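(* Consider a confounded M2DP satisfying the front-door criterion, with the standing assumptions in the context, and suppose the following. (a) Coverage: $c_1=\sup_{s,\pi}\rho^\pi(s)/\rho^{\mathcal D}(s)<\infty$ (supremum over states and stationary policies) and $c_2=\sup_{s,a}p_b^{-1}(a|s)<\infty$. (b) Mixing: the process generating the offline dataset is stationary and exponentially $\beta$-mixing, with $\beta$-mixing coefficients $\beta(\lambda)\le\kappa\rho^\lambda$, $\lambda\ge0$, for some constants $\kappa>0$, $0<\rho<1$; here $\lambda$ is set so that $\lambda\propto\ln(N)$. (c) Completeness: $\mathcal B^*Q\in\mathcal Q$ for every $Q\in\mathcal Q$. (d) Finite hypothesis classes: $|\mathcal Q|+|\mathcal P_b|+|\mathcal P_m|<\infty$. Then there is a constant $C>0$ (not depending on $N$, $K$, the function classes, the dataset or the estimators) such that, given a dataset $\mathcal D$ of size $N$, the policy $\hat\pi_K$ learned by the CAL algorithm after $K$ iterations satisfies $$\mathbb E[J(\pi^* )-J(\hat\pi_K)]\le\frac{C\sqrt{c_1}\,\gamma^KV_{\max}}{1-\gamma}+\frac{C\sqrt{c_1}}{(1-\gamma)^2}\Big[V_{\max}N^{-1/2}\ln(N)\sqrt{\ln(|\mathcal Q|^2|\mathcal P_b||\mathcal P_m|)}$$ $$\qquad+V_{\max}\Big(\sqrt{\mathbb E\,\mathbb E_{S\sim\rho^{\mathcal D}}\mathrm{KL}(p_b(\cdot|S)\|\hat p_b(\cdot|S))}+\sqrt{c_2\,\mathbb E\,\mathbb E_{S\sim\rho^{\mathcal D},A\sim p_b(\cdot|S)}\mathrm{KL}(p_m(\cdot|S,A)\|\hat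 p_m(\cdot|S,A))}\Big)\Big].$$ Outer expectations $\mathbb E$ are over the data (i.e. over $\hat\pi_K$, $\hat p_b$, $\hat p_m$); inner ones are over the state or state-action pair.
   Context: **Confounded M2DP.** The model is a tuple $(\mathcal S,\mathcal C,\mathcal A,\mathcal M,p_s,p_c,p_m,p_r,\gamma,\rho_0)$: state space $\mathcal S$ and unmeasured-confounder space $\mathcal C$ (discrete or continuous), finite action space $\mathcal A$, finite mediator space $\mathcal M$, discount factor $\gamma\in[0,1)$, initial state distribution $\rho_0$. Offline data follow: $S_0\sim\rho_0$, and at each time $t\ge 0$: $C_t\sim p_c(\cdot|S_t)$; $A_t\sim p_a(\cdot|S_t,C_t)$ (behavior policy); $M_t\sim p_m(\cdot|S_t,C_t,A_t)$; $R_t\sim p_r(\cdot|S_t,C_t,A_t,M_t)$; $S_{t+1}\sim p_s(\cdot|S_t,C_t,A_t,M_t)$; each draw is independent of the past given the displayed conditioning variables. $C_t$ is unobserved. Rewards satisfy $|R_t|\le R_{\max}<\infty$ almost surely; $V_{\max}=R_{\max}/(1-\gamma)$. Mediator probabilities are bounded below: $p_m\ge p_{m^-}$ for a fixed small threshold $p_{m^-}>0$. Write $p_b(a|s)=\mathbb P(A_t=a|S_t=s)$ for the observed-data conditional action probability. **Front-door criterion.** (i) $M_t$ intercepts every directed path from $A_t$ to $S_{t+1}$ or $R_t$; (ii) conditioning on $S_t$, no path between $A_t$ and $M_t$ has an incoming arrow into $A_t$; (iii) conditioning on $S_t$, $A_t$ blocks every path between $M_t$ and $S_{t+1}$ or $R_t$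 that has an incoming arrow into $M_t$. In this model: $A_t$ has no direct effect on $R_t$ or $S_{t+1}$ (so $p_r,p_s$ depend on $(S_t,C_t,M_t)$ only), and $p_m(m|s,c,a)=p_m(m|s,a)$. **Policies and values.** An online policy $\pi=\{\pi_t\}_{t\ge0}$ is a sequence of conditional probability mass functions on $\mathcal A$ given the observed history $H_t$ (all observed variables up to time $t$, including $S_t$); under $\pi$, trajectories are generated by $S_0\sim\rho_0$ and, at each time $t\ge0$: $C_t\sim p_c(\cdot|S_t)$; $A_t\sim\pi_t(\cdot|H_t)$, without any influence of $C_t$; $M_t\sim p_m(\cdot|S_t,A_t)$; $R_t\sim p_r(\cdot|S_t,C_t,A_t,M_t)$; $S_{t+1}\sim p_s(\cdot|S_t,C_t,A_t,M_t)$; $\mathbb E^\pi$ is the resulting expectation. A stationary policy has $\pi_t(\cdot|H_t)=\pi(\cdot|S_t)$ with the same $\pi$ for all $t$. $J(\pi)=\sum_{t\ge0}\gamma^t\mathbb E^\pi(R_t)$, and $\pi^*$ is the policy maximizing $J$. $\rho^\pi(s)=(1-\gamma)\sum_{t\ge0}\gamma^t\rho^\pi_t(s)$ is the $\gamma$-discounted visitation distribution, where $\rho_t^\pi$ is the mass/density function of $S_t$ under $\pi$; $\rho^{\mathcal D}$ is the mixture (average over trajectories) of the state distributions in the dataset. **Bellman optimality operator.** For $Q:\mathcal S\times\mathcal A\times\mathcal M\to\mathbb R$, $$\mathcal B^*Q(s,a,m)=\mathbb E\Big[R_t+\gamma\max_{a'}\sum_{\tilde a,m'}Q(S_{t+1},\tilde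 a,m')p_b(\tilde a|S_{t+1})p_m(m'|S_{t+1},a')\Big|S_t=s,A_t=a,M_t=m\Big],$$ with $\mathbb E$ under the offline distribution. **CAL algorithm.** Input: offline tuples $\mathcal D=\{(S_{(i)},A_{(i)},M_{(i)},R_{(i)},S'_{(i)}):1\le i\le N\}$ (state, action, mediator, reward, next state). Let $\mathcal Q$, $\mathcal P_b$, $\mathcal P_m$ be the function classes of the estimated mediated Q-functions, of $\hat p_b$ and of $\hat p_m$. Compute estimators $\hat p_b\in\mathcal P_b$, $\hat p_m\in\mathcal P_m$ of $p_b,p_m$ from $\mathcal D$. Set $\hat Q^{(0)}=0$; for $k=1,\dots,K$ let $$\hat Q^{(k)}=\arg\min_{Q\in\mathcal Q}\sum_{i=1}^N\Big\{R_{(i)}+\gamma\max_a\sum_{\tilde a,m}\hat p_m(m|S'_{(i)},a)\hat p_b(\tilde a|S'_{(i)})\hat Q^{(k-1)}(S'_{(i)},\tilde a,m)-Q(S_{(i)},A_{(i)},M_{(i)})\Big\}^2.$$ Output $\hat\pi_K(s)=\arg\max_a\sum_{\tilde a,m}\hat p_m(m|s,a)\hat p_b(\tilde a|s)\hat Q^{(K)}(s,\tilde a,m)$. All estimated Q-functions (elements of $\mathcal Q$) are bounded in absolute value by $V_{\max}$. **KL.** $\mathrm{KL}(p_1\|p_2)=\sum_xp_1(x)\ln(p_1(x)/p_2(x))$.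
   Formalization: The dataset size is assumed to satisfy N ≥ 2: for N = 1 the factor ln(N) vanishes and the stated bound fails (e.g. γ = 0, K = 1, exact estimators, two candidate Q-functions and noisy rewards give right side 0 but a positive expected gap). *)

theory Defs
  imports "HOL-Probability.Probability"
begin

section \<open>The confounded model\<close>

text \<open>
  The state space is the type \<^typ>\<open>'s\<close>.  The measure \<open>St\<close> is the reference measure with respect to
  which mass/density functions of states are taken: counting measure for a discrete state space,
  Lebesgue measure for a continuous one.  Of \<open>Cf\<close> only the sigma-algebra matters.  Conditional mass
  functions on the finite action and mediator spaces are pmf-valued, all other conditional
  distributions are Markov kernels.  At this level \<open>pm\<close>, \<open>pr\<close>, \<open>ps\<close> may depend on all earlier
  variables of the same time step.
\<close>

record ('s, 'c, 'a, 'm) m2dp =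
  St :: "'s measure"
  Cf :: "'c measure"
  rho0 :: "'s measure"
  pc :: "'s \<Rightarrow> 'c measure"
  pa :: "'s \<Rightarrow> 'c \<Rightarrow> 'a pmf"
  pm :: "'s \<Rightarrow> 'c \<Rightarrow> 'a \<Rightarrow> 'm pmf"
  pr :: "'s \<Rightarrow> 'c \<Rightarrow> 'a \<Rightarrow> 'm \<Rightarrow> real measure"
  ps :: "'s \<Rightarrow> 'c \<Rightarrow> 'a \<Rightarrow> 'm \<Rightarrow> 's measure"
  disc :: real
  Rmax :: real
  pmin :: real

definition Vmax :: "('s, 'c, 'a, 'm) m2dp \<Rightarrow> real" where
  "Vmax G = Rmax G / (1 - disc G)"

text \<open>Absolute continuity of \<open>rho0\<close> and \<open>ps\<close> makes every \<open>S\<^sub>t\<close> have a mass/density function.\<close>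

definition confounded_m2dp :: "('s, 'c, 'a::finite, 'm::finite) m2dp \<Rightarrow> bool" where
  "confounded_m2dp G \<longleftrightarrow>
     sigma_finite_measure (St G) \<and> space (St G) = UNIV \<and> space (Cf G) = UNIV \<and>
     prob_space (rho0 G) \<and> sets (rho0 G) = sets (St G) \<and>
     absolutely_continuous (St G) (rho0 G) \<and>
     pc G \<in> St G \<rightarrow>\<^sub>M prob_algebra (Cf G) \<and>
     (\<forall>a. (\<lambda>(s, c). pmf (pa G s c) a) \<in> borel_measurable (St G \<Otimes>\<^sub>M Cf G)) \<and>
     (\<forall>a m. (\<lambda>(s, c). pmf (pm G s c a) m) \<in> borel_measurable (St G \<Otimes>\<^sub>M Cf G)) \<and>
     (\<forall>a m. (\<lambda>(s, c). pr G s c a m) \<in> St G \<Otimes>\<^sub>M Cf G \<rightarrow>\<^sub>M prob_algebra borel) \<and>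
     (\<forall>a m. (\<lambda>(s, c). ps G s c a m) \<in> St G \<Otimes>\<^sub>M Cf G \<rightarrow>\<^sub>M prob_algebra (St G)) \<and>
     (\<forall>s c a m. absolutely_continuous (St G) (ps G s c a m)) \<and>
     0 \<le> disc G \<and> disc G < 1 \<and>
     (\<forall>s c a m. AE r in pr G s c a m. \<bar>r\<bar> \<le> Rmax G) \<and>
     0 < pmin G \<and> (\<forall>s c a m. pmin G \<le> pmf (pm G s c a) m)"

text \<open>
  The front-door criterion in terms of the kernels: the action has no direct effect on reward and
  next state, and the mediator does not depend on the confounder given state and action.
\<close>

definition front_door :: "('s, 'c, 'a, 'm) m2dp \<Rightarrow> bool" where
  "front_door G \<longleftrightarrow>
     (\<forall>s c a a' m. pr G s c a m = pr G s c a' m) \<and>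
     (\<forall>s c a a' m. ps G s c a m = ps G s c a' m) \<and>
     (\<forall>s c c' a. pm G s c a = pm G s c' a)"

section \<open>Trajectories\<close>

type_synonym ('s, 'c, 'a, 'm) full = "'s \<times> 'c \<times> 'a \<times> 'm \<times> real"
type_synonym ('s, 'a, 'm) obs = "'s \<times> 'a \<times> 'm \<times> real"
type_synonym ('s, 'a, 'm) tuple = "'s \<times> 'a \<times> 'm \<times> real \<times> 's"

definition fullM :: "('s, 'c, 'a, 'm) m2dp \<Rightarrow> ('s, 'c, 'a, 'm) full measure" where
  "fullM G = St G \<Otimes>\<^sub>M Cf G \<Otimes>\<^sub>M count_space UNIV \<Otimes>\<^sub>M count_space UNIV \<Otimes>\<^sub>M borel"

definition obsM :: "('s, 'c, 'a, 'm) m2dp \<Rightarrow> ('s, 'a, 'm) obs measure" where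
  "obsM G = St G \<Otimes>\<^sub>M count_space UNIV \<Otimes>\<^sub>M count_space UNIV \<Otimes>\<^sub>M borel"

definition tupleM :: "('s, 'c, 'a, 'm) m2dp \<Rightarrow> ('s, 'a, 'm) tuple measure" where
  "tupleM G = St G \<Otimes>\<^sub>M count_space UNIV \<Otimes>\<^sub>M count_space UNIV \<Otimes>\<^sub>M borel \<Otimes>\<^sub>M St G"

fun state_of :: "('s, 'c, 'a, 'm) full \<Rightarrow> 's" where "state_of (s, c, a, m, r) = s"
fun act_of :: "('s, 'c, 'a, 'm) full \<Rightarrow> 'a" where "act_of (s, c, a, m, r) = a"
fun med_of :: "('s, 'c, 'a, 'm) full \<Rightarrow> 'm" where "med_of (s, c, a, m, r) = m"
fun rew_of :: "('s, 'c, 'a, 'm) full \<Rightarrow> real" where "rew_of (s, c, a, m, r) = r"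
fun obs_of :: "('s, 'c, 'a, 'm) full \<Rightarrow> ('s, 'a, 'm) obs" where
  "obs_of (s, c, a, m, r) = (s, a, m, r)"

text \<open>
  Conditional law of \<open>(S\<^sub>t, C\<^sub>t, A\<^sub>t, M\<^sub>t, R\<^sub>t)\<close> given \<open>S\<^sub>t = s\<close> when the action is drawn from
  \<open>\<alpha> c\<close>, and of this vector together with \<open>S\<^sub>t\<^sub>+\<^sub>1\<close>.
\<close>

definition step_law ::
  "('s, 'c, 'a, 'm) m2dp \<Rightarrow> ('c \<Rightarrow> 'a pmf) \<Rightarrow> 's \<Rightarrow> ('s, 'c, 'a, 'm) full measure" where
  "step_law G \<alpha> s =
     pc G s \<bind> (\<lambda>c. measure_pmf (\<alpha> c) \<bind> (\<lambda>a. measure_pmf (pm G s c a) \<bind> (\<lambda>m.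
       pr G s c a m \<bind> (\<lambda>r. return (fullM G) (s, c, a, m, r)))))"

fun next_law :: "('s, 'c, 'a, 'm) m2dp \<Rightarrow> ('s, 'c, 'a, 'm) full \<Rightarrow> 's measure" where
  "next_law G (s, c, a, m, r) = ps G s c a m"

definition transition_law ::
  "('s, 'c, 'a, 'm) m2dp \<Rightarrow> ('c \<Rightarrow> 'a pmf) \<Rightarrow> 's \<Rightarrow> (('s, 'c, 'a, 'm) full \<times> 's) measure" where
  "transition_law G \<alpha> s =
     step_law G \<alpha> s \<bind> (\<lambda>x. next_law G x \<bind> (\<lambda>s'. return (fullM G \<Otimes>\<^sub>M St G) (x, s')))"

text \<open>
  An action rule maps time, observed past, current state and confounder to a distribution over
  actions.  The observed past is the family of observed variables at times \<open>0, \<dots>, t - 1\<close>.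
\<close>

type_synonym ('s, 'c, 'a, 'm) rule =
  "nat \<Rightarrow> (nat \<Rightarrow> ('s, 'a, 'm) obs) \<Rightarrow> 's \<Rightarrow> 'c \<Rightarrow> 'a pmf"

type_synonym ('s, 'a, 'm) policy = "nat \<Rightarrow> (nat \<Rightarrow> ('s, 'a, 'm) obs) \<Rightarrow> 's \<Rightarrow> 'a pmf"

definition past :: "nat \<Rightarrow> (nat \<Rightarrow> ('s, 'c, 'a, 'm) full) \<Rightarrow> nat \<Rightarrow> ('s, 'a, 'm) obs" where
  "past t w = restrict (\<lambda>i. obs_of (w i)) {0..<t}"

definition path_kernel ::
  "('s, 'c, 'a, 'm) m2dp \<Rightarrow> ('s, 'c, 'a, 'm) rule \<Rightarrow> nat \<Rightarrow> (nat \<Rightarrow> ('s, 'c, 'a, 'm) full)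
     \<Rightarrow> ('s, 'c, 'a, 'm) full measure" where
  "path_kernel G \<alpha> t w =
     (if t = 0 then rho0 G else next_law G (w (t - 1)))
       \<bind> (\<lambda>s. step_law G (\<alpha> t (past t w) s) s)"

text \<open>The Ionescu-Tulcea measure on trajectories generated by the kernels above.\<close>

definition path_law ::
  "('s, 'c, 'a, 'm) m2dp \<Rightarrow> ('s, 'c, 'a, 'm) rule \<Rightarrow> (nat \<Rightarrow> ('s, 'c, 'a, 'm) full) measure" where
  "path_law G \<alpha> =
     projective_family.lim UNIV (Ionescu_Tulcea.CI (path_kernel G \<alpha>) (\<lambda>_. fullM G)) (\<lambda>_. fullM G)"

definition offline :: "('s, 'c, 'a, 'm) m2dp \<Rightarrow> (nat \<Rightarrow> ('s, 'c, 'a, 'm) full) measure" where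
  "offline G = path_law G (\<lambda>t h. pa G)"

definition online ::
  "('s, 'c, 'a, 'm) m2dp \<Rightarrow> ('s, 'a, 'm) policy \<Rightarrow> (nat \<Rightarrow> ('s, 'c, 'a, 'm) full) measure" where
  "online G \<pi> = path_law G (\<lambda>t h s c. \<pi> t h s)"

section \<open>Policies, values and visitation\<close>

definition policies :: "('s, 'c, 'a, 'm) m2dp \<Rightarrow> ('s, 'a, 'm) policy set" where
  "policies G = {\<pi>. \<forall>t a. (\<lambda>(h, s). pmf (\<pi> t h s) a)
      \<in> borel_measurable (PiM {0..<t} (\<lambda>_. obsM G) \<Otimes>\<^sub>M St G)}"

definition stationary_rules :: "('s, 'c, 'a, 'm) m2dp \<Rightarrow> ('s \<Rightarrow> 'a pmf) set" where
  "stationary_rules G = {\<sigma>. \<forall>a. (\<lambda>s. pmf (\<sigma> s) a) \<in> borel_measurable (St G)}"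

definition stationary :: "('s \<Rightarrow> 'a pmf) \<Rightarrow> ('s, 'a, 'm) policy" where
  "stationary \<sigma> = (\<lambda>t h s. \<sigma> s)"

definition J :: "('s, 'c, 'a, 'm) m2dp \<Rightarrow> ('s, 'a, 'm) policy \<Rightarrow> real" where
  "J G \<pi> = (\<Sum>t. disc G ^ t * (LINT w|online G \<pi>. rew_of (w t)))"

definition optimal_policy :: "('s, 'c, 'a, 'm) m2dp \<Rightarrow> ('s, 'a, 'm) policy \<Rightarrow> bool" where
  "optimal_policy G \<pi> \<longleftrightarrow> is_arg_max (J G) (\<lambda>\<pi>. \<pi> \<in> policies G) \<pi>"

definition state_dens :: "('s, 'c, 'a, 'm) m2dp \<Rightarrow> ('s, 'a, 'm) policy \<Rightarrow> nat \<Rightarrow> 's \<Rightarrow> ennreal" where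
  "state_dens G \<pi> t = RN_deriv (St G) (distr (online G \<pi>) (St G) (\<lambda>w. state_of (w t)))"

definition visit_dens :: "('s, 'c, 'a, 'm) m2dp \<Rightarrow> ('s, 'a, 'm) policy \<Rightarrow> 's \<Rightarrow> ennreal" where
  "visit_dens G \<pi> s = ennreal (1 - disc G) * (\<Sum>t. ennreal (disc G ^ t) * state_dens G \<pi> t s)"

section \<open>Observed-data conditionals and the Bellman optimality operator\<close>

definition p_b :: "('s, 'c, 'a, 'm) m2dp \<Rightarrow> 's \<Rightarrow> 'a \<Rightarrow> real" where
  "p_b G s a = measure (step_law G (pa G s) s) {x \<in> space (fullM G). act_of x = a}"

text \<open>\<open>P(M\<^sub>t = m | S\<^sub>t = s, A\<^sub>t = a)\<close>; under \<^const>\<open>front_door\<close> it is \<open>pm G s c a\<close> for every \<open>c\<close>.\<close>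

definition p_m :: "('s, 'c, 'a, 'm) m2dp \<Rightarrow> 's \<Rightarrow> 'a \<Rightarrow> 'm \<Rightarrow> real" where
  "p_m G s a m =
     measure (step_law G (pa G s) s) {x \<in> space (fullM G). act_of x = a \<and> med_of x = m} / p_b G s a"

text \<open>\<open>\<Sum> Q(s, a', m) q\<^sub>b(a'|s) q\<^sub>m(m|s, a)\<close>, summed over \<open>a'\<close> and \<open>m\<close>.\<close>

definition mixQ ::
  "('s \<Rightarrow> 'a::finite \<Rightarrow> real) \<Rightarrow> ('s \<Rightarrow> 'a \<Rightarrow> 'm::finite \<Rightarrow> real) \<Rightarrow> ('s \<Rightarrow> 'a \<Rightarrow> 'm \<Rightarrow> real)
     \<Rightarrow> 's \<Rightarrow> 'a \<Rightarrow> real" where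
  "mixQ qb qm Q s a = (\<Sum>a'\<in>UNIV. \<Sum>m\<in>UNIV. Q s a' m * qb s a' * qm s a m)"

text \<open>
  The conditional expectation given \<open>S\<^sub>t = s, A\<^sub>t = a, M\<^sub>t = m\<close> is the elementary one, given the
  event \<open>A\<^sub>t = a, M\<^sub>t = m\<close>, under the offline transition law started at \<open>s\<close>.
\<close>

definition bellman_opt ::
  "('s, 'c, 'a::finite, 'm::finite) m2dp \<Rightarrow> ('s \<Rightarrow> 'a \<Rightarrow> 'm \<Rightarrow> real) \<Rightarrow> 's \<Rightarrow> 'a \<Rightarrow> 'm \<Rightarrow> real" where
  "bellman_opt G Q s a m =
     (let P = transition_law G (pa G s) s;
          E = {z \<in> space P. act_of (fst z) = a \<and> med_of (fst z) = m}
      in (LINT z|P. indicat_real E z *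
            (rew_of (fst z) + disc G * (MAX a'. mixQ (p_b G) (p_m G) Q (snd z) a'))) / measure P E)"

section \<open>Stationarity and mixing of the offline process\<close>

definition offline_stationary :: "('s, 'c, 'a, 'm) m2dp \<Rightarrow> bool" where
  "offline_stationary G \<longleftrightarrow>
     (\<forall>k. distr (offline G) (PiM UNIV (\<lambda>_. obsM G)) (\<lambda>w i. obs_of (w (i + k)))
        = distr (offline G) (PiM UNIV (\<lambda>_. obsM G)) (\<lambda>w i. obs_of (w i)))"

text \<open>
  The beta-dependence of two random elements: total variation distance between their joint law and
  the product of the marginal laws.
\<close>

definition beta_dep ::
  "'w measure \<Rightarrow> 'x measure \<Rightarrow> 'y measure \<Rightarrow> ('w \<Rightarrow> 'x) \<Rightarrow> ('w \<Rightarrow> 'y) \<Rightarrow> real" where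
  "beta_dep P MX MY X Y =
     (SUP E\<in>sets (MX \<Otimes>\<^sub>M MY).
        \<bar>measure (distr P (MX \<Otimes>\<^sub>M MY) (\<lambda>w. (X w, Y w))) E
          - measure (distr P MX X \<Otimes>\<^sub>M distr P MY Y) E\<bar>)"

definition beta_coeff :: "('s, 'c, 'a, 'm) m2dp \<Rightarrow> nat \<Rightarrow> real" where
  "beta_coeff G l =
     (SUP t. beta_dep (offline G) (PiM {..t} (\<lambda>_. obsM G)) (PiM UNIV (\<lambda>_. obsM G))
        (\<lambda>w. restrict (\<lambda>i. obs_of (w i)) {..t}) (\<lambda>w i. obs_of (w (t + l + i))))"

section \<open>Datasets\<close>

text \<open>
  A dataset consists of independent offline trajectories; trajectory number \<open>j\<close> contributes
  \<open>T ! j\<close> transition tuples, indexed by \<open>(j, t)\<close> with \<open>t < T ! j\<close>.  The dataset size is the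
  number of indices.
\<close>

definition data_idx :: "nat list \<Rightarrow> (nat \<times> nat) set" where
  "data_idx T = (SIGMA j:{..<length T}. {..<T ! j})"

fun tuple_of :: "('s, 'c, 'a, 'm) full \<Rightarrow> ('s, 'c, 'a, 'm) full \<Rightarrow> ('s, 'a, 'm) tuple" where
  "tuple_of (s, c, a, m, r) x' = (s, a, m, r, state_of x')"

type_synonym ('s, 'a, 'm) dataset = "nat \<times> nat \<Rightarrow> ('s, 'a, 'm) tuple"

definition data_law :: "('s, 'c, 'a, 'm) m2dp \<Rightarrow> nat list \<Rightarrow> ('s, 'a, 'm) dataset measure" where
  "data_law G T =
     distr (PiM {..<length T} (\<lambda>_. offline G)) (PiM (data_idx T) (\<lambda>_. tupleM G))
       (\<lambda>w. restrict (\<lambda>(j, t). tuple_of (w j t) (w j (Suc t))) (data_idx T))"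

text \<open>Mass/density function of the average over the dataset of the laws of its states.\<close>

definition rhoD_dens :: "('s, 'c, 'a, 'm) m2dp \<Rightarrow> nat list \<Rightarrow> 's \<Rightarrow> ennreal" where
  "rhoD_dens G T s =
     (\<Sum>i\<in>data_idx T. RN_deriv (St G) (distr (data_law G T) (St G) (\<lambda>d. fst (d i))) s)
       / of_nat (card (data_idx T))"

definition rhoD :: "('s, 'c, 'a, 'm) m2dp \<Rightarrow> nat list \<Rightarrow> 's measure" where
  "rhoD G T = density (St G) (rhoD_dens G T)"

text \<open>
  Densities are determined up to null sets of \<open>St\<close>, so the supremum over states is the essential
  one, which is the ordinary supremum for counting measure.  States carrying no mass under either
  distribution contribute \<open>0 / 0 = 0\<close>; \<open>x / 0 = \<infinity>\<close> for \<open>x > 0\<close>.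
\<close>

definition c1 :: "('s, 'c, 'a, 'm) m2dp \<Rightarrow> nat list \<Rightarrow> ennreal" where
  "c1 G T = (SUP \<sigma>\<in>stationary_rules G.
     esssup (St G) (\<lambda>s. visit_dens G (stationary \<sigma>) s / rhoD_dens G T s))"

definition c2 :: "('s, 'c, 'a, 'm) m2dp \<Rightarrow> ennreal" where
  "c2 G = (SUP s. SUP a. 1 / ennreal (p_b G s a))"

section \<open>The CAL algorithm\<close>

definition q_class :: "('s, 'c, 'a, 'm) m2dp \<Rightarrow> ('s \<Rightarrow> 'a \<Rightarrow> 'm \<Rightarrow> real) set \<Rightarrow> bool" where
  "q_class G \<Q> \<longleftrightarrow> (\<forall>Q\<in>\<Q>. \<forall>a m. (\<lambda>s. Q s a m) \<in> borel_measurable (St G) \<and>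
      (\<forall>s. \<bar>Q s a m\<bar> \<le> Vmax G))"

definition pb_class :: "('s, 'c, 'a, 'm) m2dp \<Rightarrow> ('s \<Rightarrow> 'a pmf) set \<Rightarrow> bool" where
  "pb_class G \<B> \<longleftrightarrow> (\<forall>q\<in>\<B>. \<forall>a. (\<lambda>s. pmf (q s) a) \<in> borel_measurable (St G))"

definition pm_class :: "('s, 'c, 'a, 'm) m2dp \<Rightarrow> ('s \<Rightarrow> 'a \<Rightarrow> 'm pmf) set \<Rightarrow> bool" where
  "pm_class G \<M> \<longleftrightarrow> (\<forall>q\<in>\<M>. \<forall>a m. (\<lambda>s. pmf (q s a) m) \<in> borel_measurable (St G))"

text \<open>
  \<open>mixQ\<close> with estimated conditional mass functions, and the least-squares objective of one
  iteration with previous iterate \<open>Q'\<close>.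
\<close>

definition mixQ_hat ::
  "('s \<Rightarrow> 'a::finite pmf) \<Rightarrow> ('s \<Rightarrow> 'a \<Rightarrow> 'm::finite pmf) \<Rightarrow> ('s \<Rightarrow> 'a \<Rightarrow> 'm \<Rightarrow> real)
     \<Rightarrow> 's \<Rightarrow> 'a \<Rightarrow> real" where
  "mixQ_hat qb qm = mixQ (\<lambda>s. pmf (qb s)) (\<lambda>s a. pmf (qm s a))"

definition cal_loss ::
  "('s, 'c, 'a::finite, 'm::finite) m2dp \<Rightarrow> nat list \<Rightarrow> ('s, 'a, 'm) dataset
     \<Rightarrow> ('s \<Rightarrow> 'a pmf) \<Rightarrow> ('s \<Rightarrow> 'a \<Rightarrow> 'm pmf) \<Rightarrow> ('s \<Rightarrow> 'a \<Rightarrow> 'm \<Rightarrow> real)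
     \<Rightarrow> ('s \<Rightarrow> 'a \<Rightarrow> 'm \<Rightarrow> real) \<Rightarrow> real" where
  "cal_loss G T d qb qm Q' Q =
     (\<Sum>i\<in>data_idx T. case d i of (s, a, m, r, s') \<Rightarrow>
        (r + disc G * (MAX a'. mixQ_hat qb qm Q' s' a') - Q s a m)\<^sup>2)"

text \<open>
  \<open>bh\<close>, \<open>mh\<close>, \<open>Qh k\<close>, \<open>ph\<close> are the estimators of \<open>p\<^sub>b\<close> and \<open>p\<^sub>m\<close>, the \<open>k\<close>-th Q-iterate and the
  learned policy, as measurable functions of the dataset.  Ties in the minimisations and
  maximisations may be broken in any measurable way.
\<close>

definition cal_run ::
  "('s, 'c, 'a::finite, 'm::finite) m2dp \<Rightarrow> nat list \<Rightarrow> nat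
     \<Rightarrow> ('s \<Rightarrow> 'a \<Rightarrow> 'm \<Rightarrow> real) set \<Rightarrow> ('s \<Rightarrow> 'a pmf) set \<Rightarrow> ('s \<Rightarrow> 'a \<Rightarrow> 'm pmf) set
     \<Rightarrow> (('s, 'a, 'm) dataset \<Rightarrow> 's \<Rightarrow> 'a pmf) \<Rightarrow> (('s, 'a, 'm) dataset \<Rightarrow> 's \<Rightarrow> 'a \<Rightarrow> 'm pmf)
     \<Rightarrow> (nat \<Rightarrow> ('s, 'a, 'm) dataset \<Rightarrow> 's \<Rightarrow> 'a \<Rightarrow> 'm \<Rightarrow> real)
     \<Rightarrow> (('s, 'a, 'm) dataset \<Rightarrow> 's \<Rightarrow> 'a) \<Rightarrow> bool" where
  "cal_run G T K \<Q> \<B> \<M> bh mh Qh ph \<longleftrightarrow>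
     bh \<in> data_law G T \<rightarrow>\<^sub>M count_space \<B> \<and>
     mh \<in> data_law G T \<rightarrow>\<^sub>M count_space \<M> \<and>
     (\<forall>d. Qh 0 d = (\<lambda>s a m. 0)) \<and>
     (\<forall>k<K. Qh (Suc k) \<in> data_law G T \<rightarrow>\<^sub>M count_space \<Q> \<and>
        (\<forall>d\<in>space (data_law G T).
           is_arg_min (cal_loss G T d (bh d) (mh d) (Qh k d)) (\<lambda>Q. Q \<in> \<Q>) (Qh (Suc k) d))) \<and>
     (\<lambda>(d, s). ph d s) \<in> data_law G T \<Otimes>\<^sub>M St G \<rightarrow>\<^sub>M count_space UNIV \<and>
     (\<forall>d\<in>space (data_law G T). \<forall>s.
        is_arg_max (mixQ_hat (bh d) (mh d) (Qh K d) s) (\<lambda>_. True) (ph d s))"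

section \<open>Error terms\<close>

text \<open>
  \<open>KL p q = \<Sum> p ln (p / q)\<close>, with \<open>0 ln (0 / x) = 0\<close> and value \<open>\<infinity>\<close> if \<open>q\<close> vanishes where \<open>p\<close> does
  not.  The sum is nonnegative for mass functions.
\<close>

definition KL :: "('x::finite \<Rightarrow> real) \<Rightarrow> ('x \<Rightarrow> real) \<Rightarrow> ennreal" where
  "KL p q = (if \<exists>x. p x \<noteq> 0 \<and> q x = 0 then \<infinity> else ennreal (\<Sum>x\<in>UNIV. p x * ln (p x / q x)))"

definition KL_b :: "('s, 'c, 'a::finite, 'm) m2dp \<Rightarrow> nat list
    \<Rightarrow> (('s, 'a, 'm) dataset \<Rightarrow> 's \<Rightarrow> 'a pmf) \<Rightarrow> ennreal" where
  "KL_b G T bh = (\<integral>\<^sup>+d. (\<integral>\<^sup>+s. KL (p_b G s) (pmf (bh d s)) \<partial>rhoD G T) \<partial>data_law G T)"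

definition KL_m :: "('s, 'c, 'a::finite, 'm::finite) m2dp \<Rightarrow> nat list
    \<Rightarrow> (('s, 'a, 'm) dataset \<Rightarrow> 's \<Rightarrow> 'a \<Rightarrow> 'm pmf) \<Rightarrow> ennreal" where
  "KL_m G T mh = (\<integral>\<^sup>+d. (\<integral>\<^sup>+s. (\<Sum>a\<in>UNIV. ennreal (p_b G s a) * KL (p_m G s a) (pmf (mh d s a)))
     \<partial>rhoD G T) \<partial>data_law G T)"

definition esqrt :: "ennreal \<Rightarrow> ennreal" where
  "esqrt x = (if x = \<infinity> then \<infinity> else ennreal (sqrt (enn2real x)))"

end

theory Submission
  imports Defs
begin

text \<open>
  Stationarity of the data identifies the state distribution of the dataset with the initial
  distribution, so that \<open>c1\<close> dominates the discounted occupancy of every policy relative to it.  The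
  front-door adjustment turns the mediated Bellman operator into the optimality operator of an ordinary
  decision process on states, and the performance gap is bounded by the discounted occupancy of the
  plug-in error and of the Bellman residuals of the iterates.  AM-GM with a parameter \<open>\<delta>\<close> chosen at the
  very end converts these first moments into root mean squares while keeping geometric weights
  \<open>\<gamma> ^ (n / 2)\<close>.

  The regression error of one fitted step has a fast rate: half the squared error minus the excess loss,
  suitably scaled and corrected for the plug-in error, has exponential moment at most 1 for each choice
  of functions in the finite classes.  Splitting the sample into \<open>l\<close> residue classes of times, with \<open>l\<close>
  of order \<open>ln N\<close>, the log-sum-exp over all these choices telescopes along each class and every
  increment is decoupled from the past at the price of a mixing coefficient.  The plug-in error is
  bounded by Kullback-Leibler divergences through the squared Hellinger distance.
\<close>

text \<open>Three obstacles shape the proof. \<open>c1\<close> sees only stationary policies and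
  compares state distributions, while the optimal policy may use the history; hence all errors are
  reduced to functions of the state alone and propagated by an upper expectation over actions, which
  a single greedy stationary policy realises. Every iterate and both estimators depend on the same
  data; a fitted step is therefore treated uniformly over quadruples (new iterate, old iterate,
  estimate of \<open>p_b\<close>, estimate of \<open>p_m\<close>), which produces the cardinality
  under the logarithm. Finally, the bound of an occupancy by \<open>c1\<close> does not improve with
  the time step, so the first moment of an error n steps ahead keeps only half of its discount; the
  start-up error is a constant function and escapes this loss, which preserves the full power of
  \<gamma>. The constant may depend on \<gamma>, \<open>pmin\<close>, \<kappa> and \<rho>:
  \<open>pmin\<close> pays for comparing the mediator law under an intervened action with the one
  under the logged action, and the powers of 1 / (1 - \<gamma>) from geometric sums are
  absorbed.\<close>

lemma measurable_pmf_kernel: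
  fixes f :: "'x \<Rightarrow> 'a::finite pmf"
  assumes "\<And>a. (\<lambda>x. pmf (f x) a) \<in> borel_measurable M"
  shows "(\<lambda>x. measure_pmf (f x)) \<in> M \<rightarrow>\<^sub>M prob_algebra (count_space UNIV)"
proof (rule measurable_prob_algebraI)
  show "prob_space (measure_pmf (f x))" for x by (rule prob_space_measure_pmf)
  show "(\<lambda>x. measure_pmf (f x)) \<in> M \<rightarrow>\<^sub>M subprob_algebra (count_space UNIV)"
  proof (rule measurable_subprob_algebra)
    fix A :: "'a set" assume "A \<in> sets (count_space UNIV)"
    have "emeasure (measure_pmf p) A = (\<Sum>a\<in>A. ennreal (pmf p a))" for p :: "'a pmf"
      by (subst emeasure_measure_pmf_finite) auto
    then show "(\<lambda>x. emeasure (measure_pmf (f x)) A) \<in> borel_measurable M"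
      using assms by simp
  qed (auto simp: measure_pmf.subprob_space_axioms)
qed

lemma nn_integral_pmf_finite_type:
  fixes p :: "'a::finite pmf"
  shows "(\<integral>\<^sup>+a. f a \<partial>measure_pmf p) = (\<Sum>a\<in>UNIV. ennreal (pmf p a) * f a)"
  by (simp add: nn_integral_measure_pmf nn_integral_count_space_finite)

section \<open>Kernels and trajectory laws\<close>

locale fd_m2dp =
  fixes G :: "('s, 'c, 'a::finite, 'm::finite) m2dp"
  assumes model: "confounded_m2dp G"
    and fd: "front_door G"
begin

lemma space_St[simp]: "space (St G) = UNIV" and space_Cf[simp]: "space (Cf G) = UNIV"
  and sets_rho0[simp, measurable_cong]: "sets (rho0 G) = sets (St G)"
  and prob_rho0: "prob_space (rho0 G)"
  and sigma_finite_St: "sigma_finite_measure (St G)"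
  and ac_rho0: "absolutely_continuous (St G) (rho0 G)"
  and ac_ps: "absolutely_continuous (St G) (ps G s c a m)"
  and disc_nonneg: "0 \<le> disc G" and disc_less: "disc G < 1"
  and reward_bound: "AE r in pr G s c a m. \<bar>r\<bar> \<le> Rmax G"
  and pmin_pos: "0 < pmin G" and pmin_le: "pmin G \<le> pmf (pm G s c a) m"
  using model by (auto simp: confounded_m2dp_def)

lemma pc_kernel[measurable]: "pc G \<in> St G \<rightarrow>\<^sub>M prob_algebra (Cf G)"
  using model by (simp add: confounded_m2dp_def)

lemma pr_kernel: "(\<lambda>(s, c). pr G s c a m) \<in> St G \<Otimes>\<^sub>M Cf G \<rightarrow>\<^sub>M prob_algebra borel"
  and ps_kernel: "(\<lambda>(s, c). ps G s c a m) \<in> St G \<Otimes>\<^sub>M Cf G \<rightarrow>\<^sub>M prob_algebra (St G)"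
  and pm_kernel: "(\<lambda>(s, c). pmf (pm G s c a) m) \<in> borel_measurable (St G \<Otimes>\<^sub>M Cf G)"
  and pa_kernel: "(\<lambda>(s, c). pmf (pa G s c) a) \<in> borel_measurable (St G \<Otimes>\<^sub>M Cf G)"
  using model by (simp_all add: confounded_m2dp_def)

text \<open>The model fixes action and mediator in its measurability assumptions. As both types are
  finite, measurable arguments can be substituted for them one after the other.\<close>

lemma pr_measurable[measurable (raw)]:
  assumes "f \<in> X \<rightarrow>\<^sub>M St G" "g \<in> X \<rightarrow>\<^sub>M Cf G" "h \<in> X \<rightarrow>\<^sub>M count_space UNIV" "k \<in> X \<rightarrow>\<^sub>M count_space UNIV"
  shows "(\<lambda>x. pr G (f x) (g x) (h x) (k x)) \<in> X \<rightarrow>\<^sub>M prob_algebra borel"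
proof -
  have "(\<lambda>x. pr G (f x) (g x) a m) \<in> X \<rightarrow>\<^sub>M prob_algebra borel" for a m
    using measurable_compose[OF measurable_Pair[OF assms(1,2)] pr_kernel[of a m]] by simp
  then have "(\<lambda>x. pr G (f x) (g x) (h x) m) \<in> X \<rightarrow>\<^sub>M prob_algebra borel" for m
    by (rule measurable_compose_countable[OF _ assms(3)])
  then show ?thesis
    by (rule measurable_compose_countable[OF _ assms(4)])
qed

lemma ps_measurable[measurable (raw)]:
  assumes "f \<in> X \<rightarrow>\<^sub>M St G" "g \<in> X \<rightarrow>\<^sub>M Cf G" "h \<in> X \<rightarrow>\<^sub>M count_space UNIV" "k \<in> X \<rightarrow>\<^sub>M count_space UNIV"
  shows "(\<lambda>x. ps G (f x) (g x) (h x) (k x)) \<in> X \<rightarrow>\<^sub>M prob_algebra (St G)"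
proof -
  have "(\<lambda>x. ps G (f x) (g x) a m) \<in> X \<rightarrow>\<^sub>M prob_algebra (St G)" for a m
    using measurable_compose[OF measurable_Pair[OF assms(1,2)] ps_kernel[of a m]] by simp
  then have "(\<lambda>x. ps G (f x) (g x) (h x) m) \<in> X \<rightarrow>\<^sub>M prob_algebra (St G)" for m
    by (rule measurable_compose_countable[OF _ assms(3)])
  then show ?thesis
    by (rule measurable_compose_countable[OF _ assms(4)])
qed

lemma pmf_pm_measurable[measurable (raw)]:
  assumes "f \<in> X \<rightarrow>\<^sub>M St G" "g \<in> X \<rightarrow>\<^sub>M Cf G" "h \<in> X \<rightarrow>\<^sub>M count_space UNIV"
  shows "(\<lambda>x. pmf (pm G (f x) (g x) (h x)) m) \<in> borel_measurable X"
proof -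
  have "(\<lambda>x. pmf (pm G (f x) (g x) a) m) \<in> borel_measurable X" for a
    using measurable_compose[OF measurable_Pair[OF assms(1,2)] pm_kernel[of a m]] by simp
  then show ?thesis
    by (rule measurable_compose_countable[OF _ assms(3)])
qed

lemma pm_measurable[measurable (raw)]:
  assumes "f \<in> X \<rightarrow>\<^sub>M St G" "g \<in> X \<rightarrow>\<^sub>M Cf G" "h \<in> X \<rightarrow>\<^sub>M count_space UNIV"
  shows "(\<lambda>x. measure_pmf (pm G (f x) (g x) (h x))) \<in> X \<rightarrow>\<^sub>M prob_algebra (count_space UNIV)"
  by (rule measurable_pmf_kernel) (use assms in measurable)

lemma pmf_pa_measurable[measurable (raw)]:
  assumes "f \<in> X \<rightarrow>\<^sub>M St G" "g \<in> X \<rightarrow>\<^sub>M Cf G"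
  shows "(\<lambda>x. pmf (pa G (f x) (g x)) a) \<in> borel_measurable X"
  using measurable_compose[OF measurable_Pair[OF assms(1,2)] pa_kernel[of a]] by simp

lemma step_law_measurable[measurable (raw)]:
  assumes [measurable]: "f \<in> X \<rightarrow>\<^sub>M St G"
    and \<alpha>: "\<And>a. (\<lambda>(x, c). pmf (\<alpha> x c) a) \<in> borel_measurable (X \<Otimes>\<^sub>M Cf G)"
  shows "(\<lambda>x. step_law G (\<alpha> x) (f x)) \<in> X \<rightarrow>\<^sub>M prob_algebra (fullM G)"
proof -
  have [measurable]: "(\<lambda>(x, c). measure_pmf (\<alpha> x c)) \<in> X \<Otimes>\<^sub>M Cf G \<rightarrow>\<^sub>M prob_algebra (count_space UNIV)"
    unfolding split_beta by (rule measurable_pmf_kernel) (use \<alpha> in \<open>simp add: split_beta\<close>)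
  show ?thesis unfolding step_law_def fullM_def by measurable
qed

end

lemma measurable_snd_arg: "f \<in> N \<rightarrow>\<^sub>M L \<Longrightarrow> (\<lambda>(x, y). f y) \<in> M \<Otimes>\<^sub>M N \<rightarrow>\<^sub>M L"
  unfolding split_beta by (rule measurable_compose[OF measurable_snd])

section \<open>Laws of one step and of one transition\<close>

context fd_m2dp begin

lemma sets_pc[measurable_cong]: "sets (pc G s) = sets (Cf G)"
  and prob_pc: "prob_space (pc G s)"
  using measurable_space[OF pc_kernel, of s] by (auto simp: space_prob_algebra)

lemma sets_pr[measurable_cong]: "sets (pr G s c a m) = sets borel"
  and prob_pr: "prob_space (pr G s c a m)"
  using measurable_space[OF pr_kernel, of "(s, c)" a m] by (auto simp: space_prob_algebra space_pair_measure)

lemma sets_ps[measurable_cong]: "sets (ps G s c a m) = sets (St G)"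
  and prob_ps: "prob_space (ps G s c a m)"
  using measurable_space[OF ps_kernel, of "(s, c)" a m] by (auto simp: space_prob_algebra space_pair_measure)

lemma space_pr[simp]: "space (pr G s c a m) = UNIV" and space_ps[simp]: "space (ps G s c a m) = UNIV"
  and space_pc[simp]: "space (pc G s) = UNIV" and space_rho0[simp]: "space (rho0 G) = UNIV"
  using sets_eq_imp_space_eq[OF sets_pr] sets_eq_imp_space_eq[OF sets_ps]
    sets_eq_imp_space_eq[OF sets_pc] sets_eq_imp_space_eq[OF sets_rho0] by auto

lemma space_fullM[simp]: "space (fullM G) = UNIV"
  by (simp add: fullM_def space_pair_measure)

lemma space_obsM[simp]: "space (obsM G) = UNIV"
  by (simp add: obsM_def space_pair_measure)

lemma state_of_eq: "state_of = fst"
  and act_of_eq: "act_of = (\<lambda>x. fst (snd (snd x)))"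
  and med_of_eq: "med_of = (\<lambda>x. fst (snd (snd (snd x))))"
  and rew_of_eq: "rew_of = (\<lambda>x. snd (snd (snd (snd x))))"
  and obs_of_eq: "obs_of = (\<lambda>x. (fst x, snd (snd x)))"
  by (auto simp: fun_eq_iff)

lemma state_of_measurable[measurable]: "state_of \<in> fullM G \<rightarrow>\<^sub>M St G"
  and act_of_measurable[measurable]: "act_of \<in> fullM G \<rightarrow>\<^sub>M count_space UNIV"
  and med_of_measurable[measurable]: "med_of \<in> fullM G \<rightarrow>\<^sub>M count_space UNIV"
  and rew_of_measurable[measurable]: "rew_of \<in> fullM G \<rightarrow>\<^sub>M borel"
  and obs_of_measurable[measurable]: "obs_of \<in> fullM G \<rightarrow>\<^sub>M obsM G"
  unfolding state_of_eq act_of_eq med_of_eq rew_of_eq obs_of_eq fullM_def obsM_def by measurable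

lemma next_law_measurable[measurable]: "next_law G \<in> fullM G \<rightarrow>\<^sub>M prob_algebra (St G)"
proof -
  have "next_law G = (\<lambda>x. ps G (fst x) (fst (snd x)) (act_of x) (med_of x))"
    by (auto simp: fun_eq_iff)
  moreover have "fst \<in> fullM G \<rightarrow>\<^sub>M St G" "(\<lambda>x. fst (snd x)) \<in> fullM G \<rightarrow>\<^sub>M Cf G"
    unfolding fullM_def by measurable
  ultimately show ?thesis by simp
qed

lemma sets_next[measurable_cong]: "sets (next_law G x) = sets (St G)"
  and prob_next: "prob_space (next_law G x)"
  using measurable_space[OF next_law_measurable, of x] by (auto simp: space_prob_algebra)

lemma space_next[simp]: "space (next_law G x) = UNIV"
  using sets_eq_imp_space_eq[OF sets_next] by simp

text \<open>Admissibility of an action rule with past and state frozen: only the dependence on the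
  confounder is left to be measurable.\<close>

definition action_kernel :: "('c \<Rightarrow> 'a pmf) \<Rightarrow> bool" where
  "action_kernel \<alpha> \<longleftrightarrow> (\<forall>a. (\<lambda>c. pmf (\<alpha> c) a) \<in> borel_measurable (Cf G))"

lemma action_kernel_const[simp]: "action_kernel (\<lambda>c. p)"
  by (simp add: action_kernel_def)

lemma action_kernel_pa[simp]: "action_kernel (pa G s)"
  unfolding action_kernel_def by simp

lemma step_law_in:
  assumes "action_kernel \<alpha>"
  shows "step_law G \<alpha> s \<in> space (prob_algebra (fullM G))"
proof -
  \<comment> \<open>A fixed state and rule form a kernel over a trivial parameter space, so the
    parametric measurability lemma also yields membership.\<close>
  have "(\<lambda>x. step_law G \<alpha> s) \<in> count_space UNIV \<rightarrow>\<^sub>M prob_algebra (fullM G)"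
    by (rule step_law_measurable) (use assms in \<open>auto simp: action_kernel_def intro!: measurable_snd_arg\<close>)
  from measurable_space[OF this, of undefined] show ?thesis by simp
qed

text \<open>Fubini for the nested binds: the draws of action and mediator become finite sums.
  Identities about a single step are checked in this form.\<close>

lemma nn_step_law:
  assumes F[measurable]: "F \<in> borel_measurable (fullM G)" and \<alpha>: "action_kernel \<alpha>"
  shows "(\<integral>\<^sup>+x. F x \<partial>step_law G \<alpha> s) =
    (\<integral>\<^sup>+c. (\<Sum>a\<in>UNIV. pmf (\<alpha> c) a * (\<Sum>m\<in>UNIV. pmf (pm G s c a) m *
       (\<integral>\<^sup>+r. F (s, c, a, m, r) \<partial>pr G s c a m))) \<partial>pc G s)"
proof -
  have [measurable]: "(\<lambda>c. measure_pmf (\<alpha> c)) \<in> Cf G \<rightarrow>\<^sub>M prob_algebra (count_space UNIV)"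
    by (rule measurable_pmf_kernel) (use \<alpha> in \<open>simp add: action_kernel_def\<close>)
  have F'[measurable]: "F \<in> borel_measurable (St G \<Otimes>\<^sub>M Cf G \<Otimes>\<^sub>M count_space UNIV \<Otimes>\<^sub>M count_space UNIV \<Otimes>\<^sub>M borel)"
    using F by (simp add: fullM_def)
  have s[measurable]: "s \<in> space (St G)" by simp
  have c[measurable]: "c \<in> space (Cf G)" for c by simp
  show ?thesis
    unfolding step_law_def fullM_def
    apply (subst nn_integral_bind[OF F'])
     apply (rule measurable_prob_algebraD, measurable)
    apply (rule nn_integral_cong)
    apply (subst nn_integral_bind[OF F'])
     apply (rule measurable_prob_algebraD, measurable)
    apply (subst nn_integral_pmf_finite_type)
    apply (intro sum.cong refl arg_cong2[where f="(*)"])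
    apply (subst nn_integral_bind[OF F'])
     apply (rule measurable_prob_algebraD, measurable)
    apply (subst nn_integral_pmf_finite_type)
    apply (intro sum.cong refl arg_cong2[where f="(*)"])
    apply (subst nn_integral_bind[OF F'])
     apply (rule measurable_prob_algebraD, measurable)
    apply (intro nn_integral_cong)
    apply (subst nn_integral_return)
      apply (auto simp: space_pair_measure)
    done
qed

lemma sum_pmf_ennreal: "(\<Sum>a\<in>UNIV. ennreal (pmf p a)) = 1" for p :: "'x::finite pmf"
  by (simp add: sum_pmf_eq_1 sum_ennreal)

text \<open>The state coordinate is copied without randomness and all other draws have total mass
  one. This allows a starting state \<open>s\<close> to be traded for \<open>state_of x\<close>
  under the integral and back.\<close>

lemma nn_step_law_state:
  assumes g[measurable]: "g \<in> borel_measurable (St G)" and \<alpha>: "action_kernel \<alpha>"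
  shows "(\<integral>\<^sup>+x. g (state_of x) \<partial>step_law G \<alpha> s) = g s"
  by (subst nn_step_law[OF _ \<alpha>])
     (simp_all add: prob_space.emeasure_space_1[OF prob_pr, simplified] prob_space.emeasure_space_1[OF prob_pc, simplified]
        sum_distrib_right[symmetric] sum_pmf_ennreal)

lemma transition_law_measurable[measurable (raw)]:
  assumes [measurable]: "f \<in> X \<rightarrow>\<^sub>M St G"
    and \<alpha>: "\<And>a. (\<lambda>(x, c). pmf (\<alpha> x c) a) \<in> borel_measurable (X \<Otimes>\<^sub>M Cf G)"
  shows "(\<lambda>x. transition_law G (\<alpha> x) (f x)) \<in> X \<rightarrow>\<^sub>M prob_algebra (fullM G \<Otimes>\<^sub>M St G)"
  unfolding transition_law_def using step_law_measurable[OF assms] by measurable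

lemma transition_law_in:
  assumes "action_kernel \<alpha>"
  shows "transition_law G \<alpha> s \<in> space (prob_algebra (fullM G \<Otimes>\<^sub>M St G))"
proof -
  have "(\<lambda>x. transition_law G \<alpha> s) \<in> count_space UNIV \<rightarrow>\<^sub>M prob_algebra (fullM G \<Otimes>\<^sub>M St G)"
    by (rule transition_law_measurable) (use assms in \<open>auto simp: action_kernel_def intro!: measurable_snd_arg\<close>)
  from measurable_space[OF this, of undefined] show ?thesis by simp
qed

lemma nn_transition_law:
  assumes F[measurable]: "F \<in> borel_measurable (fullM G \<Otimes>\<^sub>M St G)" and \<alpha>: "action_kernel \<alpha>"
  shows "(\<integral>\<^sup>+z. F z \<partial>transition_law G \<alpha> s) = (\<integral>\<^sup>+x. (\<integral>\<^sup>+s'. F (x, s') \<partial>next_law G x) \<partial>step_law G \<alpha> s)"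
proof -
  have [measurable_cong]: "sets (step_law G \<alpha> s) = sets (fullM G)"
    using step_law_in[OF \<alpha>] by (auto simp: space_prob_algebra)
  show ?thesis
    unfolding transition_law_def
    apply (subst nn_integral_bind[OF F])
     apply (rule measurable_prob_algebraD, measurable)
    apply (intro nn_integral_cong)
    apply (subst nn_integral_bind[OF F])
     apply (rule measurable_prob_algebraD, measurable)
    apply (intro nn_integral_cong)
    apply (subst nn_integral_return)
      apply (auto simp: space_pair_measure)
    done
qed

section \<open>Action rules and the trajectory measure\<close>

definition admissible :: "('s, 'c, 'a, 'm) rule \<Rightarrow> bool" where
  "admissible \<alpha> \<longleftrightarrow> (\<forall>t a. (\<lambda>((h, s), c). pmf (\<alpha> t h s c) a)
     \<in> borel_measurable ((PiM {0..<t} (\<lambda>_. obsM G) \<Otimes>\<^sub>M St G) \<Otimes>\<^sub>M Cf G))"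

lemma admissible_offline: "admissible (\<lambda>t h. pa G)"
  unfolding admissible_def split_beta by measurable

lemma admissible_online: "\<pi> \<in> policies G \<Longrightarrow> admissible (\<lambda>t h s c. \<pi> t h s)"
  unfolding admissible_def policies_def split_beta
  by (auto intro: measurable_compose[OF measurable_fst])

lemma stationary_in_policies: "\<sigma> \<in> stationary_rules G \<Longrightarrow> stationary \<sigma> \<in> policies G"
  unfolding stationary_rules_def policies_def stationary_def
  by (auto intro!: measurable_snd_arg)

lemma past_measurable[measurable]: "past t \<in> PiM {0..<t} (\<lambda>_. fullM G) \<rightarrow>\<^sub>M PiM {0..<t} (\<lambda>_. obsM G)"
  unfolding past_def by (rule measurable_restrict) measurable

lemma past_restrict: "past t (restrict w {0..<t}) = past t w"
  by (auto simp: past_def fun_eq_iff restrict_def)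

lemma action_kernel_admissible:
  assumes "admissible \<alpha>" "h \<in> space (PiM {0..<t} (\<lambda>_. obsM G))"
  shows "action_kernel (\<alpha> t h s)"
  unfolding action_kernel_def
proof
  fix a
  have "(\<lambda>((h, s), c). pmf (\<alpha> t h s c) a)
     \<in> borel_measurable ((PiM {0..<t} (\<lambda>_. obsM G) \<Otimes>\<^sub>M St G) \<Otimes>\<^sub>M Cf G)"
    using assms by (auto simp: admissible_def)
  from measurable_compose[OF _ this, of "\<lambda>c. ((h, s), c)" "Cf G"] assms(2)
  show "(\<lambda>c. pmf (\<alpha> t h s c) a) \<in> borel_measurable (Cf G)"
    by (simp add: space_pair_measure)
qed

lemma past_space: "past t (w :: nat \<Rightarrow> ('s, 'c, 'a, 'm) full) \<in> space (PiM {0..<t} (\<lambda>_. obsM G))"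
  by (auto simp: past_def space_PiM)

text \<open>Isolates the law of the current state inside \<open>path_kernel\<close>, so that time
  zero needs no separate treatment in the arguments about kernels.\<close>

definition init_or_next :: "nat \<Rightarrow> (nat \<Rightarrow> ('s, 'c, 'a, 'm) full) \<Rightarrow> 's measure" where
  "init_or_next t w = (if t = 0 then rho0 G else next_law G (w (t - 1)))"

lemma init_or_next_measurable[measurable]:
  "init_or_next t \<in> PiM {0..<t} (\<lambda>_. fullM G) \<rightarrow>\<^sub>M prob_algebra (St G)"
proof (cases t)
  case 0
  then show ?thesis
    using prob_rho0 by (simp add: init_or_next_def[abs_def] space_prob_algebra)
next
  case (Suc n)
  then have "(\<lambda>w. w n) \<in> PiM {0..<t} (\<lambda>_. fullM G) \<rightarrow>\<^sub>M fullM G"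
    by (intro measurable_component_singleton) auto
  from measurable_compose[OF this next_law_measurable] Suc show ?thesis
    by (simp add: init_or_next_def[abs_def])
qed

lemma sets_init_or_next[measurable_cong]: "sets (init_or_next t w) = sets (St G)"
  by (simp add: init_or_next_def sets_next)

lemma path_kernel_eq:
  "path_kernel G \<alpha> t w = init_or_next t w \<bind> (\<lambda>s. step_law G (\<alpha> t (past t w) s) s)"
  by (simp add: path_kernel_def init_or_next_def)

lemma admissible_step_measurable:
  assumes "admissible \<alpha>"
  shows "(\<lambda>(w, s). step_law G (\<alpha> t (past t w) s) s)
    \<in> PiM {0..<t} (\<lambda>_. fullM G) \<Otimes>\<^sub>M St G \<rightarrow>\<^sub>M prob_algebra (fullM G)"
  unfolding split_beta
proof (rule step_law_measurable)
  fix a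
  have *: "(\<lambda>((h, s), c). pmf (\<alpha> t h s c) a)
     \<in> borel_measurable ((PiM {0..<t} (\<lambda>_. obsM G) \<Otimes>\<^sub>M St G) \<Otimes>\<^sub>M Cf G)"
    using assms by (auto simp: admissible_def)
  have "(\<lambda>x. ((past t (fst (fst x)), snd (fst x)), snd x))
    \<in> (PiM {0..<t} (\<lambda>_. fullM G) \<Otimes>\<^sub>M St G) \<Otimes>\<^sub>M Cf G \<rightarrow>\<^sub>M (PiM {0..<t} (\<lambda>_. obsM G) \<Otimes>\<^sub>M St G) \<Otimes>\<^sub>M Cf G"
    by measurable
  from measurable_compose[OF this *]
  show "(\<lambda>(x, c). pmf (\<alpha> t (past t (fst x)) (snd x) c) a)
    \<in> borel_measurable ((PiM {0..<t} (\<lambda>_. fullM G) \<Otimes>\<^sub>M St G) \<Otimes>\<^sub>M Cf G)"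
    by (simp add: split_beta)
qed measurable

lemma path_kernel_measurable:
  assumes "admissible \<alpha>"
  shows "path_kernel G \<alpha> t \<in> PiM {0..<t} (\<lambda>_. fullM G) \<rightarrow>\<^sub>M prob_algebra (fullM G)"
  unfolding path_kernel_eq[abs_def]
  by (rule measurable_bind_prob_space2[OF init_or_next_measurable admissible_step_measurable[OF assms]])

lemma nn_path_kernel:
  assumes \<alpha>: "admissible \<alpha>" and F[measurable]: "F \<in> borel_measurable (fullM G)"
    and w: "w \<in> space (PiM {0..<t} (\<lambda>_. fullM G))"
  shows "(\<integral>\<^sup>+x. F x \<partial>path_kernel G \<alpha> t w) =
    (\<integral>\<^sup>+s. (\<integral>\<^sup>+x. F x \<partial>step_law G (\<alpha> t (past t w) s) s) \<partial>init_or_next t w)"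
proof -
  have "(\<lambda>s. step_law G (\<alpha> t (past t w) s) s) \<in> St G \<rightarrow>\<^sub>M prob_algebra (fullM G)"
    using measurable_compose[OF measurable_Pair1'[OF w] admissible_step_measurable[OF \<alpha>]] by simp
  then show ?thesis unfolding path_kernel_eq
    by (subst nn_integral_bind[OF F]) (auto simp: sets_init_or_next intro: measurable_prob_algebraD cong: measurable_cong_sets)
qed

definition trajM :: "(nat \<Rightarrow> ('s, 'c, 'a, 'm) full) measure" where
  "trajM = PiM UNIV (\<lambda>_. fullM G)"

lemma ionescu_tulcea:
  assumes "admissible \<alpha>"
  shows "Ionescu_Tulcea (path_kernel G \<alpha>) (\<lambda>_. fullM G)"
proof (rule Ionescu_Tulcea.intro)
  show "path_kernel G \<alpha> i \<in> PiM {0..<i} (\<lambda>_. fullM G) \<rightarrow>\<^sub>M subprob_algebra (fullM G)" for i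
    by (rule measurable_prob_algebraD, rule path_kernel_measurable[OF assms])
  show "prob_space (path_kernel G \<alpha> i x)" if "x \<in> space (PiM {0..<i} (\<lambda>_. fullM G))" for i x
    using measurable_space[OF path_kernel_measurable[OF assms] that] by (simp add: space_prob_algebra)
qed

text \<open>The third claim disintegrates the projective limit at one coordinate. Together with the
  sigma-algebra and the total mass it is all that is used of the construction of
  trajectories.\<close>

lemma
  assumes \<alpha>: "admissible \<alpha>"
  shows prob_path_law: "prob_space (path_law G \<alpha>)"
    and sets_path_law: "sets (path_law G \<alpha>) = sets trajM"
    and path_law_marginal: "\<And>g n. (\<lambda>(h, x). g h x) \<in> borel_measurable (PiM {0..<n} (\<lambda>_. fullM G) \<Otimes>\<^sub>M fullM G) \<Longrightarrow>
      (\<integral>\<^sup>+w. g (restrict w {0..<n}) (w n) \<partial>path_law G \<alpha>) =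
      (\<integral>\<^sup>+w. (\<integral>\<^sup>+x. g (restrict w {0..<n}) x \<partial>path_kernel G \<alpha> n (restrict w {0..<n})) \<partial>path_law G \<alpha>)"
proof -
  interpret IT: Ionescu_Tulcea "path_kernel G \<alpha>" "\<lambda>_. fullM G"
    by (rule ionescu_tulcea[OF \<alpha>])
  have eq: "path_law G \<alpha> = IT.PF.lim" by (simp add: path_law_def)
  have "Pi\<^sub>M UNIV (\<lambda>_. fullM G) = trajM" by (simp add: trajM_def)
  then show s: "sets (path_law G \<alpha>) = sets trajM"
    by (simp add: eq)
  \<comment> \<open>Finite marginals of the limit are the iterated kernels; on an initial segment of
    times the embedding in the definition of \<open>IT.CI\<close> is the identity.\<close>
  have lim: "distr IT.PF.lim (PiM {0..<n} (\<lambda>_. fullM G)) (\<lambda>x. restrict x {0..<n}) = IT.C 0 n (\<lambda>_. undefined)" for n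
  proof -
    have "IT.CI {0..<n} = IT.C 0 n (\<lambda>_. undefined)"
    proof (rule measure_eqI)
      show "sets (IT.CI {0..<n}) = sets (IT.C 0 n (\<lambda>_. undefined))"
        by (simp add: IT.CI_def IT.sets_C)
      fix A assume "A \<in> sets (IT.CI {0..<n})"
      then have A: "A \<in> sets (PiM {0..<n} (\<lambda>_. fullM G))" by (simp add: IT.CI_def)
      then show "emeasure (IT.CI {0..<n}) A = emeasure (IT.C 0 n (\<lambda>_. undefined)) A"
        using sets.sets_into_space[OF A] unfolding space_PiM by (subst IT.emeasure_CI[OF order_refl A]) (subst prod_emb_id, auto)
    qed
    then show ?thesis by (simp add: IT.distr_lim)
  qed
  have nn_lim: "(\<integral>\<^sup>+w. f (restrict w {0..<n}) \<partial>IT.PF.lim) = (\<integral>\<^sup>+w. f w \<partial>IT.C 0 n (\<lambda>_. undefined))"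
    if "f \<in> borel_measurable (PiM {0..<n} (\<lambda>_. fullM G))" for f n
    unfolding lim[symmetric] using that by (subst nn_integral_distr) (auto cong: measurable_cong_sets)
  show "prob_space (path_law G \<alpha>)"
  proof -
    \<comment> \<open>The marginal on the empty set of coordinates already has total mass one, and a
      push-forward preserves total mass.\<close>
    have "prob_space (distr IT.PF.lim (PiM {0..<0} (\<lambda>_. fullM G)) (\<lambda>x. restrict x {0..<0}))"
      unfolding lim by (rule IT.prob_space_C) simp
    then show ?thesis unfolding eq
      by (rule prob_space_distrD[rotated]) (auto cong: measurable_cong_sets)
  qed
  fix g :: "(nat \<Rightarrow> ('s, 'c, 'a, 'm) full) \<Rightarrow> ('s, 'c, 'a, 'm) full \<Rightarrow> ennreal" and n
  assume g: "(\<lambda>(h, x). g h x) \<in> borel_measurable (PiM {0..<n} (\<lambda>_. fullM G) \<Otimes>\<^sub>M fullM G)"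
  let ?M = "\<lambda>n. PiM {0..<n} (\<lambda>_. fullM G)"
  let ?f = "\<lambda>w. g (restrict w {0..<n}) (w n)"
  have f[measurable]: "?f \<in> borel_measurable (?M (Suc n))"
  proof -
    have "(\<lambda>w. (restrict w {0..<n}, w n)) \<in> ?M (Suc n) \<rightarrow>\<^sub>M ?M n \<Otimes>\<^sub>M fullM G"
      by (intro measurable_Pair measurable_restrict measurable_component_singleton) auto
    from measurable_compose[OF this g] show ?thesis by simp
  qed
  have K: "path_kernel G \<alpha> n \<in> ?M n \<rightarrow>\<^sub>M subprob_algebra (fullM G)" by (rule IT.P)
  have "(\<integral>\<^sup>+w. ?f w \<partial>IT.PF.lim) = (\<integral>\<^sup>+w. ?f (restrict w {0..<Suc n}) \<partial>IT.PF.lim)"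
  proof (rule nn_integral_cong)
    fix w :: "nat \<Rightarrow> ('s, 'c, 'a, 'm) full"
    have "restrict (restrict w {0..<Suc n}) {0..<n} = restrict w {0..<n}" by (auto simp: fun_eq_iff)
    then show "?f w = ?f (restrict w {0..<Suc n})" by simp
  qed
  also have "\<dots> = (\<integral>\<^sup>+w. ?f w \<partial>IT.C 0 (Suc n) (\<lambda>_. undefined))"
    by (rule nn_lim[OF f])
  also have "\<dots> = (\<integral>\<^sup>+w. (\<integral>\<^sup>+x. ?f x \<partial>IT.eP n w) \<partial>IT.C 0 n (\<lambda>_. undefined))"
    apply (simp del: IT.C.simps(1))
    apply (subst nn_integral_bind[OF f])
     apply (auto cong: measurable_cong_sets simp: IT.sets_C)
    done
  also have "\<dots> = (\<integral>\<^sup>+w. (\<integral>\<^sup>+x. g w x \<partial>path_kernel G \<alpha> n w) \<partial>IT.C 0 n (\<lambda>_. undefined))"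
  proof (rule nn_integral_cong)
    fix w assume "w \<in> space (IT.C 0 n (\<lambda>_. undefined))"
    then have w: "w \<in> space (?M n)" by (simp add: IT.space_C)
    then have "restrict (fun_upd w n x) {0..<n} = w" for x
      by (auto simp: fun_eq_iff space_PiM PiE_def extensional_def)
    then show "(\<integral>\<^sup>+x. ?f x \<partial>IT.eP n w) = (\<integral>\<^sup>+x. g w x \<partial>path_kernel G \<alpha> n w)"
      by (simp add: IT.nn_integral_eP[OF w f])
  qed
  also have "\<dots> = (\<integral>\<^sup>+w. (\<integral>\<^sup>+x. g (restrict w {0..<n}) x \<partial>path_kernel G \<alpha> n (restrict w {0..<n})) \<partial>IT.PF.lim)"
    by (rule nn_lim[symmetric]) (rule nn_integral_measurable_subprob_algebra2[OF g K])
  finally show "(\<integral>\<^sup>+w. ?f w \<partial>path_law G \<alpha>) =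
      (\<integral>\<^sup>+w. (\<integral>\<^sup>+x. g (restrict w {0..<n}) x \<partial>path_kernel G \<alpha> n (restrict w {0..<n})) \<partial>path_law G \<alpha>)"
    by (simp add: eq)
qed

lemma space_trajM[simp]: "space trajM = UNIV"
  by (auto simp: trajM_def space_PiM)

lemma space_path_law[simp]: "admissible \<alpha> \<Longrightarrow> space (path_law G \<alpha>) = UNIV"
  using sets_eq_imp_space_eq[OF sets_path_law] by simp

lemma traj_component: "(\<lambda>w. w t) \<in> trajM \<rightarrow>\<^sub>M fullM G"
  unfolding trajM_def by (rule measurable_component_singleton) simp

lemma traj_component_comp[measurable (raw)]: "f \<in> X \<rightarrow>\<^sub>M trajM \<Longrightarrow> (\<lambda>x. f x t) \<in> X \<rightarrow>\<^sub>M fullM G"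
  by (rule measurable_compose[OF _ traj_component])

lemma traj_restrict[measurable]: "(\<lambda>w. restrict w I) \<in> trajM \<rightarrow>\<^sub>M PiM I (\<lambda>_. fullM G)"
  unfolding trajM_def by (rule measurable_restrict_subset) simp

lemma past_traj[measurable]: "past t \<in> trajM \<rightarrow>\<^sub>M PiM {0..<t} (\<lambda>_. obsM G)"
  using measurable_compose[OF traj_restrict past_measurable] by (simp add: past_restrict)

text \<open>Markov property: given the past and the current state, the current step and the next
  state follow \<open>transition_law\<close>. The next state is integrated out at time
  \<open>Suc t\<close>, then the rest of the step at time \<open>t\<close>; the current state is not
  integrated out, as both the rule and the starting point of the transition depend on it.\<close>

lemma path_law_step:
  assumes \<alpha>: "admissible \<alpha>" and F[measurable]: "F \<in> borel_measurable (fullM G \<Otimes>\<^sub>M St G)"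
  shows "(\<integral>\<^sup>+w. F (w t, state_of (w (Suc t))) \<partial>path_law G \<alpha>) =
    (\<integral>\<^sup>+w. (\<integral>\<^sup>+z. F z \<partial>transition_law G (\<alpha> t (past t w) (state_of (w t))) (state_of (w t))) \<partial>path_law G \<alpha>)"
proof -
  let ?M = "\<lambda>n. PiM {0..<n} (\<lambda>_. fullM G)"
  define \<Phi> where "\<Phi> x = (\<integral>\<^sup>+s'. F (x, s') \<partial>next_law G x)" for x
  have \<Phi>[measurable]: "\<Phi> \<in> borel_measurable (fullM G)"
    unfolding \<Phi>_def by (rule nn_integral_measurable_subprob_algebra2[OF _ measurable_prob_algebraD[OF next_law_measurable]]) measurable
  define H where "H h s = (\<integral>\<^sup>+z. F z \<partial>transition_law G (\<alpha> t h s) s)" for h s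
  have ak: "action_kernel (\<alpha> t (past t w) s)" for t s and w :: "nat \<Rightarrow> ('s, 'c, 'a, 'm) full"
    by (rule action_kernel_admissible[OF \<alpha> past_space])
  have H_eq: "H (past t w) s = (\<integral>\<^sup>+x. \<Phi> x \<partial>step_law G (\<alpha> t (past t w) s) s)" for s and w :: "nat \<Rightarrow> ('s, 'c, 'a, 'm) full"
    unfolding H_def \<Phi>_def by (rule nn_transition_law[OF F ak])
  have wr: "restrict w {0..<t} \<in> space (?M t)" for t and w :: "nat \<Rightarrow> ('s, 'c, 'a, 'm) full" by (simp add: space_PiM)
  have Hm[measurable]: "(\<lambda>(h, s). H (past t h) s) \<in> borel_measurable (?M t \<Otimes>\<^sub>M St G)"
    unfolding H_eq split_beta
    by (rule nn_integral_measurable_subprob_algebra2[OF _ measurable_prob_algebraD[OF admissible_step_measurable[OF \<alpha>, of t, unfolded split_beta]]]) measurable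
  have Hm2: "(\<lambda>s. H (past t w) s) \<in> borel_measurable (St G)" for w :: "nat \<Rightarrow> ('s, 'c, 'a, 'm) full"
    using measurable_compose[OF measurable_Pair1'[OF wr[of w t]] Hm] by (simp add: past_restrict)
  have "(\<integral>\<^sup>+w. F (w t, state_of (w (Suc t))) \<partial>path_law G \<alpha>) =
    (\<integral>\<^sup>+w. F ((restrict w {0..<Suc t}) t, state_of (w (Suc t))) \<partial>path_law G \<alpha>)"
    by simp
  also have "\<dots> = (\<integral>\<^sup>+w. (\<integral>\<^sup>+x. F ((restrict w {0..<Suc t}) t, state_of x) \<partial>path_kernel G \<alpha> (Suc t) (restrict w {0..<Suc t})) \<partial>path_law G \<alpha>)"
  proof (rule path_law_marginal[OF \<alpha>])
    have "(\<lambda>w. w t) \<in> ?M (Suc t) \<rightarrow>\<^sub>M fullM G"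
      by (rule measurable_component_singleton) simp
    then show "(\<lambda>(h, x). F (h t, state_of x)) \<in> borel_measurable (?M (Suc t) \<Otimes>\<^sub>M fullM G)"
      unfolding split_beta by measurable
  qed
  also have "\<dots> = (\<integral>\<^sup>+w. \<Phi> (w t) \<partial>path_law G \<alpha>)"
  proof (rule nn_integral_cong)
    fix w :: "nat \<Rightarrow> ('s, 'c, 'a, 'm) full"
    have Fw: "(\<lambda>s. F (w t, s)) \<in> borel_measurable (St G)"
      by (rule measurable_compose[OF measurable_Pair1' F]) simp
    have "(\<integral>\<^sup>+x. F ((restrict w {0..<Suc t}) t, state_of x) \<partial>path_kernel G \<alpha> (Suc t) (restrict w {0..<Suc t}))
      = (\<integral>\<^sup>+x. F (w t, state_of x) \<partial>path_kernel G \<alpha> (Suc t) (restrict w {0..<Suc t}))" by simp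
    also have "\<dots> = (\<integral>\<^sup>+s. (\<integral>\<^sup>+x. F (w t, state_of x) \<partial>step_law G (\<alpha> (Suc t) (past (Suc t) w) s) s) \<partial>init_or_next (Suc t) (restrict w {0..<Suc t}))"
      by (subst nn_path_kernel[OF \<alpha> measurable_compose[OF state_of_measurable Fw] wr]) (simp only: past_restrict)
    also have "\<dots> = (\<integral>\<^sup>+s. F (w t, s) \<partial>init_or_next (Suc t) (restrict w {0..<Suc t}))"
      by (intro nn_integral_cong nn_step_law_state[OF Fw] ak)
    also have "\<dots> = \<Phi> (w t)"
      by (simp add: init_or_next_def \<Phi>_def)
    finally show "(\<integral>\<^sup>+x. F ((restrict w {0..<Suc t}) t, state_of x) \<partial>path_kernel G \<alpha> (Suc t) (restrict w {0..<Suc t})) = \<Phi> (w t)" .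
  qed
  also have "\<dots> = (\<integral>\<^sup>+w. (\<integral>\<^sup>+x. \<Phi> x \<partial>path_kernel G \<alpha> t (restrict w {0..<t})) \<partial>path_law G \<alpha>)"
    by (rule path_law_marginal[OF \<alpha>]) measurable
  \<comment> \<open>The conditional expectation \<open>H\<close> depends on the state drawn inside
    the kernel, so it is rewritten as a function of \<open>state_of x\<close> before the
    disintegration is reversed.\<close>
  also have "\<dots> = (\<integral>\<^sup>+w. (\<integral>\<^sup>+x. H (past t (restrict w {0..<t})) (state_of x) \<partial>path_kernel G \<alpha> t (restrict w {0..<t})) \<partial>path_law G \<alpha>)"
  proof (rule nn_integral_cong)
    fix w :: "nat \<Rightarrow> ('s, 'c, 'a, 'm) full"
    have "(\<integral>\<^sup>+x. \<Phi> x \<partial>path_kernel G \<alpha> t (restrict w {0..<t})) = (\<integral>\<^sup>+s. H (past t w) s \<partial>init_or_next t (restrict w {0..<t}))"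
      by (subst nn_path_kernel[OF \<alpha> \<Phi> wr], unfold past_restrict, intro nn_integral_cong H_eq[symmetric])
    also have "\<dots> = (\<integral>\<^sup>+s. (\<integral>\<^sup>+x. H (past t w) (state_of x) \<partial>step_law G (\<alpha> t (past t w) s) s) \<partial>init_or_next t (restrict w {0..<t}))"
      by (intro nn_integral_cong nn_step_law_state[OF Hm2, symmetric] ak)
    also have "\<dots> = (\<integral>\<^sup>+x. H (past t w) (state_of x) \<partial>path_kernel G \<alpha> t (restrict w {0..<t}))"
      by (subst nn_path_kernel[OF \<alpha> measurable_compose[OF state_of_measurable Hm2] wr]) (simp only: past_restrict)
    finally show "(\<integral>\<^sup>+x. \<Phi> x \<partial>path_kernel G \<alpha> t (restrict w {0..<t})) =
      (\<integral>\<^sup>+x. H (past t (restrict w {0..<t})) (state_of x) \<partial>path_kernel G \<alpha> t (restrict w {0..<t}))"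
      by (simp only: past_restrict)
  qed
  also have "\<dots> = (\<integral>\<^sup>+w. H (past t (restrict w {0..<t})) (state_of (w t)) \<partial>path_law G \<alpha>)"
    by (rule path_law_marginal[OF \<alpha>, symmetric]) measurable
  finally show ?thesis by (simp add: H_def past_restrict)
qed

lemma path_law_initial:
  assumes \<alpha>: "admissible \<alpha>" and g[measurable]: "g \<in> borel_measurable (St G)"
  shows "(\<integral>\<^sup>+w. g (state_of (w 0)) \<partial>path_law G \<alpha>) = (\<integral>\<^sup>+s. g s \<partial>rho0 G)"
proof -
  interpret prob_space "path_law G \<alpha>" by (rule prob_path_law[OF \<alpha>])
  have wr: "restrict w {0..<t} \<in> space (PiM {0..<t} (\<lambda>_. fullM G))" for t w by (simp add: space_PiM)
  have "(\<integral>\<^sup>+w. g (state_of (w 0)) \<partial>path_law G \<alpha>) =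
     (\<integral>\<^sup>+w. (\<integral>\<^sup>+x. g (state_of x) \<partial>path_kernel G \<alpha> 0 (restrict w {0..<0})) \<partial>path_law G \<alpha>)"
    by (rule path_law_marginal[OF \<alpha>]) measurable
  also have "\<dots> = (\<integral>\<^sup>+w. (\<integral>\<^sup>+s. g s \<partial>rho0 G) \<partial>path_law G \<alpha>)"
    apply (rule nn_integral_cong)
    apply (subst nn_path_kernel[OF \<alpha> _ wr], measurable)
    apply (subst nn_step_law_state[OF g])
    using action_kernel_admissible[OF \<alpha> past_space] apply (auto simp: init_or_next_def past_restrict)
    done
  finally show ?thesis by (simp add: emeasure_space_1[simplified space_path_law[OF \<alpha>]] \<alpha>)
qed

lemma sum_pmf_1: "(\<Sum>a\<in>UNIV. pmf p a) = 1" for p :: "'x::finite pmf"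
  by (simp add: sum_pmf_eq_1)

section \<open>Front-door identification\<close>

abbreviation "\<gamma> \<equiv> disc G"
abbreviation "V \<equiv> Vmax G"

lemma Rmax_nonneg: "0 \<le> Rmax G"
proof -
  interpret prob_space "pr G s c a m" for s c a m by (rule prob_pr)
  have "\<exists>r. \<bar>r\<bar> \<le> Rmax G"
    using eventually_happens'[OF _ reward_bound[of undefined undefined undefined undefined]]
      ae_filter_bot by blast
  then show ?thesis by auto
qed

lemma V_nonneg: "0 \<le> V"
  using Rmax_nonneg disc_less by (simp add: Vmax_def)

text \<open>\<open>V\<close> is the fixed point of adding \<open>Rmax\<close> to a discounted bound,
  which is why Bellman targets of functions bounded by \<open>V\<close> are again bounded by
  \<open>V\<close>.\<close>

lemma Rmax_V: "Rmax G + \<gamma> * V = V"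
  using disc_less by (simp add: Vmax_def field_simps)

lemma Rmax_le_V: "Rmax G \<le> V"
  using Rmax_V mult_nonneg_nonneg[OF disc_nonneg V_nonneg] by linarith

lemma pr_fd: "pr G s c a m = pr G s c a' m" and ps_fd: "ps G s c a m = ps G s c a' m"
  and pm_fd: "pm G s c a = pm G s c' a"
  using fd by (auto simp: front_door_def)

text \<open>By the front-door criterion the confounder argument is immaterial, so a placeholder is
  inserted.\<close>

definition med :: "'s \<Rightarrow> 'a \<Rightarrow> 'm pmf" where "med s a = pm G s undefined a"

lemma pm_med: "pm G s c a = med s a"
  unfolding med_def by (rule pm_fd)

lemma med_measurable[measurable]: "(\<lambda>s. pmf (med s a) m) \<in> borel_measurable (St G)"
  unfolding med_def by measurable

lemma pmin_med: "pmin G \<le> pmf (med s a) m" and med_pos: "0 < pmf (med s a) m"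
  using pmin_le[of s undefined a m] pmin_pos by (auto simp: med_def)

text \<open>Law of reward and next state under an intervention on the mediator: the confounder keeps
  its law given the state and is not reweighted by any action. The placeholder action is immaterial
  by the front-door criterion.\<close>

definition effect :: "'s \<Rightarrow> 'm \<Rightarrow> (real \<times> 's) measure" where
  "effect s m = pc G s \<bind> (\<lambda>c. pr G s c undefined m \<bind> (\<lambda>r. ps G s c undefined m \<bind>
     (\<lambda>s'. return (borel \<Otimes>\<^sub>M St G) (r, s'))))"

lemma effect_measurable[measurable]: "(\<lambda>s. effect s m) \<in> St G \<rightarrow>\<^sub>M prob_algebra (borel \<Otimes>\<^sub>M St G)"
  unfolding effect_def by measurable

lemma sets_effect[measurable_cong]: "sets (effect s m) = sets (borel \<Otimes>\<^sub>M St G)"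
  and prob_effect: "prob_space (effect s m)"
  using measurable_space[OF effect_measurable, of s m] by (auto simp: space_prob_algebra)

lemma nn_effect:
  assumes F[measurable]: "F \<in> borel_measurable (borel \<Otimes>\<^sub>M St G)"
  shows "(\<integral>\<^sup>+z. F z \<partial>effect s m) =
    (\<integral>\<^sup>+c. (\<integral>\<^sup>+r. (\<integral>\<^sup>+s'. F (r, s') \<partial>ps G s c undefined m) \<partial>pr G s c undefined m) \<partial>pc G s)"
proof -
  have s[measurable]: "s \<in> space (St G)" by simp
  have c[measurable]: "c \<in> space (Cf G)" for c by simp
  have [measurable]: "ps G s c a m \<in> space (prob_algebra (St G))" for c a m
    by (simp add: space_prob_algebra prob_ps sets_ps)
  show ?thesis
    unfolding effect_def
    apply (subst nn_integral_bind[OF F])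
     apply (rule measurable_prob_algebraD, measurable)
    apply (rule nn_integral_cong)
    apply (subst nn_integral_bind[OF F])
     apply (rule measurable_prob_algebraD, measurable)
    apply (rule nn_integral_cong)
    apply (subst nn_integral_bind[OF F])
     apply (rule measurable_prob_algebraD, measurable)
    apply (intro nn_integral_cong)
    apply (subst nn_integral_return)
      apply (auto simp: space_pair_measure)
    done
qed

lemma effect_inner_measurable:
  assumes F[measurable]: "F \<in> borel_measurable (borel \<Otimes>\<^sub>M St G)"
  shows "(\<lambda>c. \<integral>\<^sup>+r. (\<integral>\<^sup>+s'. F (r, s') \<partial>ps G s c undefined m) \<partial>pr G s c undefined m) \<in> borel_measurable (Cf G)"
proof -
  have s[measurable]: "s \<in> space (St G)" by simp
  have K: "(\<lambda>(c, r). ps G s c undefined m) \<in> Cf G \<Otimes>\<^sub>M borel \<rightarrow>\<^sub>M subprob_algebra (St G)"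
    by (rule measurable_prob_algebraD) measurable
  have 1: "(\<lambda>(c, r). \<integral>\<^sup>+s'. F (r, s') \<partial>ps G s c undefined m) \<in> borel_measurable (Cf G \<Otimes>\<^sub>M borel)"
    unfolding split_beta
    by (rule nn_integral_measurable_subprob_algebra2[OF _ K[unfolded split_beta]]) measurable
  have "(\<lambda>c. pr G s c undefined m) \<in> Cf G \<rightarrow>\<^sub>M subprob_algebra borel"
    by (rule measurable_prob_algebraD) measurable
  from nn_integral_measurable_subprob_algebra2[OF 1 this] show ?thesis .
qed

text \<open>The mediator probability factors out because it does not see the confounder. Action
  probability and outcome remain coupled through the confounder; this coupling is the confounding
  bias.\<close>

lemma nn_transition_obs:
  assumes F: "\<And>a m. F a m \<in> borel_measurable (borel \<Otimes>\<^sub>M St G)" and \<alpha>: "action_kernel \<alpha>"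
  shows "(\<integral>\<^sup>+z. F (act_of (fst z)) (med_of (fst z)) (rew_of (fst z), snd z) \<partial>transition_law G \<alpha> s) =
    (\<Sum>a\<in>UNIV. \<Sum>m\<in>UNIV. pmf (med s a) m * (\<integral>\<^sup>+c. pmf (\<alpha> c) a *
       (\<integral>\<^sup>+r. (\<integral>\<^sup>+s'. F a m (r, s') \<partial>ps G s c undefined m) \<partial>pr G s c undefined m) \<partial>pc G s))"
proof -
  have Fm[measurable]: "(\<lambda>z. F (act_of (fst z)) (med_of (fst z)) (rew_of (fst z), snd z)) \<in> borel_measurable (fullM G \<Otimes>\<^sub>M St G)"
  proof (rule measurable_compose_countable[where g="\<lambda>z. act_of (fst z)"])
    show "(\<lambda>z. F a (med_of (fst z)) (rew_of (fst z), snd z)) \<in> borel_measurable (fullM G \<Otimes>\<^sub>M St G)" for a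
    proof (rule measurable_compose_countable[where g="\<lambda>z. med_of (fst z)"])
      show "(\<lambda>z. F a m (rew_of (fst z), snd z)) \<in> borel_measurable (fullM G \<Otimes>\<^sub>M St G)" for m
        using F[of a m] by measurable
    qed measurable
  qed measurable
  have Gm: "(\<lambda>x. \<integral>\<^sup>+s'. F (act_of x) (med_of x) (rew_of x, s') \<partial>next_law G x) \<in> borel_measurable (fullM G)"
    by (rule nn_integral_measurable_subprob_algebra2[OF _ measurable_prob_algebraD[OF next_law_measurable]])
       (use Fm in \<open>simp add: split_beta\<close>)
  have [measurable]: "(\<lambda>c. pmf (\<alpha> c) a) \<in> borel_measurable (Cf G)" for a
    using \<alpha> by (simp add: action_kernel_def)
  note [measurable] = effect_inner_measurable[OF F]
  have "(\<integral>\<^sup>+z. F (act_of (fst z)) (med_of (fst z)) (rew_of (fst z), snd z) \<partial>transition_law G \<alpha> s) =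
    (\<integral>\<^sup>+c. (\<Sum>a\<in>UNIV. \<Sum>m\<in>UNIV. pmf (med s a) m * (pmf (\<alpha> c) a *
       (\<integral>\<^sup>+r. (\<integral>\<^sup>+s'. F a m (r, s') \<partial>ps G s c undefined m) \<partial>pr G s c undefined m))) \<partial>pc G s)"
  proof -
    have *: "(\<integral>\<^sup>+r. (\<integral>\<^sup>+s'. F a m (r, s') \<partial>ps G s c a m) \<partial>pr G s c a m)
      = (\<integral>\<^sup>+r. (\<integral>\<^sup>+s'. F a m (r, s') \<partial>ps G s c undefined m) \<partial>pr G s c undefined m)" for c a m
      by (simp only: pr_fd[of s c a m undefined] ps_fd[of s c a m undefined])
    show ?thesis
      unfolding nn_transition_law[OF Fm \<alpha>] fst_conv snd_conv
      unfolding nn_step_law[OF Gm \<alpha>]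
      by (simp add: * pm_med sum_distrib_left mult.left_commute)
  qed
  also have "\<dots> = (\<Sum>a\<in>UNIV. \<Sum>m\<in>UNIV. pmf (med s a) m * (\<integral>\<^sup>+c. pmf (\<alpha> c) a *
       (\<integral>\<^sup>+r. (\<integral>\<^sup>+s'. F a m (r, s') \<partial>ps G s c undefined m) \<partial>pr G s c undefined m) \<partial>pc G s))"
    apply (subst nn_integral_sum, measurable)
    apply (intro sum.cong refl)
    apply (subst nn_integral_sum, measurable)
    apply (intro sum.cong refl)
    apply (subst nn_integral_cmult, measurable)
    done
  finally show ?thesis .
qed

text \<open>Without influence of the confounder on the action the coupled integral factors, and the
  interventional law \<open>effect\<close> appears.\<close>

lemma nn_transition_online:
  assumes F: "\<And>a m. F a m \<in> borel_measurable (borel \<Otimes>\<^sub>M St G)"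
  shows "(\<integral>\<^sup>+z. F (act_of (fst z)) (med_of (fst z)) (rew_of (fst z), snd z) \<partial>transition_law G (\<lambda>c. p) s) =
    (\<Sum>a\<in>UNIV. pmf p a * (\<Sum>m\<in>UNIV. pmf (med s a) m * (\<integral>\<^sup>+z. F a m z \<partial>effect s m)))"
  apply (subst nn_transition_obs[OF F], simp_all)
  apply (subst nn_integral_cmult)
  using effect_inner_measurable[OF F] apply measurable
  apply (subst nn_effect[OF F])
  apply (simp add: sum_distrib_left mult.left_commute)
  done

lemma p_b_nn: "ennreal (p_b G s a) = (\<integral>\<^sup>+c. pmf (pa G s c) a \<partial>pc G s)"
proof -
  have S[measurable_cong]: "sets (step_law G (pa G s) s) = sets (fullM G)"
    and P: "prob_space (step_law G (pa G s) s)"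
    using step_law_in[of "pa G s" s] by (auto simp: space_prob_algebra)
  interpret prob_space "step_law G (pa G s) s" by (rule P)
  have "ennreal (p_b G s a) = (\<integral>\<^sup>+x. indicator {x \<in> space (fullM G). act_of x = a} x \<partial>step_law G (pa G s) s)"
    unfolding p_b_def emeasure_eq_measure[symmetric]
    by (rule nn_integral_indicator[symmetric], unfold S) measurable
  also have "\<dots> = (\<integral>\<^sup>+c. (\<Sum>b\<in>UNIV. ennreal (pmf (pa G s c) b) * (if b = a then 1 else 0)) \<partial>pc G s)"
    apply (subst nn_step_law)
    apply (measurable, simp)
    apply (intro nn_integral_cong sum.cong refl arg_cong2[where f="(*)"])
    apply (auto simp: indicator_def prob_space.emeasure_space_1[OF prob_pr, simplified] sum_pmf_1)
    done
  also have "\<dots> = (\<integral>\<^sup>+c. pmf (pa G s c) a \<partial>pc G s)"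
    by (simp add: if_distrib cong: if_cong)
  finally show ?thesis .
qed

lemma p_b_nonneg: "0 \<le> p_b G s a"
  by (simp add: p_b_def)

lemma p_b_measurable[measurable]: "(\<lambda>s. p_b G s a) \<in> borel_measurable (St G)"
proof -
  have "(\<lambda>s. enn2real (\<integral>\<^sup>+c. pmf (pa G s c) a \<partial>pc G s)) \<in> borel_measurable (St G)"
    using nn_integral_measurable_subprob_algebra2[OF _ measurable_prob_algebraD[OF pc_kernel], of "\<lambda>s c. pmf (pa G s c) a"]
    by measurable
  then show ?thesis by (simp add: p_b_nn[symmetric] p_b_nonneg)
qed

lemma sum_p_b: "(\<Sum>a\<in>UNIV. p_b G s a) = 1"
proof -
  have [measurable]: "s \<in> space (St G)" by simp
  have "ennreal (\<Sum>a\<in>UNIV. p_b G s a) = (\<integral>\<^sup>+c. (\<Sum>a\<in>UNIV. ennreal (pmf (pa G s c) a)) \<partial>pc G s)"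
    by (subst nn_integral_sum) (auto simp: p_b_nonneg sum_ennreal[symmetric] p_b_nn)
  also have "\<dots> = 1"
    by (simp add: sum_pmf_ennreal prob_space.emeasure_space_1[OF prob_pc, simplified])
  finally show ?thesis by simp
qed

lemma step_law_event:
  "ennreal (measure (step_law G (pa G s) s) {x \<in> space (fullM G). act_of x = a \<and> med_of x = m}) = p_b G s a * pmf (med s a) m"
proof -
  have S[measurable_cong]: "sets (step_law G (pa G s) s) = sets (fullM G)"
    and P: "prob_space (step_law G (pa G s) s)"
    using step_law_in[of "pa G s" s] by (auto simp: space_prob_algebra)
  interpret prob_space "step_law G (pa G s) s" by (rule P)
  have [measurable]: "s \<in> space (St G)" by simp
  let ?E = "{x \<in> space (fullM G). act_of x = a \<and> med_of x = m}"
  have "ennreal (measure (step_law G (pa G s) s) ?E) = (\<integral>\<^sup>+x. indicator ?E x \<partial>step_law G (pa G s) s)"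
    unfolding emeasure_eq_measure[symmetric]
    by (rule nn_integral_indicator[symmetric], unfold S) measurable
  also have "\<dots> = (\<integral>\<^sup>+c. (\<Sum>b\<in>UNIV. ennreal (pmf (pa G s c) b) * (if b = a then ennreal (pmf (med s a) m) else 0)) \<partial>pc G s)"
    apply (subst nn_step_law)
    apply (measurable, simp)
    apply (intro nn_integral_cong sum.cong refl arg_cong2[where f="(*)"])
    subgoal for c b
      apply (rule trans[where s="\<Sum>n\<in>UNIV. ennreal (pmf (med s b) n) * (if b = a \<and> n = m then 1 else 0)"])
      apply (intro sum.cong refl)
      apply (auto simp: indicator_def prob_space.emeasure_space_1[OF prob_pr, simplified] pm_med if_distrib cong: if_cong)
      done
    done
  also have "\<dots> = (\<integral>\<^sup>+c. ennreal (pmf (pa G s c) a) * ennreal (pmf (med s a) m) \<partial>pc G s)"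
    by (simp add: if_distrib cong: if_cong)
  also have "\<dots> = p_b G s a * pmf (med s a) m"
    by (subst nn_integral_multc) (auto simp: p_b_nn[symmetric] ennreal_mult p_b_nonneg)
  finally show ?thesis by simp
qed

text \<open>Positivity matters: for an action of probability zero \<open>p_m\<close> is a quotient
  by zero, hence 0, whereas \<open>med\<close> is bounded below by \<open>pmin\<close>.\<close>

lemma p_m_eq: "0 < p_b G s a \<Longrightarrow> p_m G s a m = pmf (med s a) m"
  using step_law_event[of s a m] by (simp add: p_m_def p_b_nonneg)

lemma sets_transition[measurable_cong]: "action_kernel \<alpha> \<Longrightarrow> sets (transition_law G \<alpha> s) = sets (fullM G \<Otimes>\<^sub>M St G)"
  and prob_transition: "action_kernel \<alpha> \<Longrightarrow> prob_space (transition_law G \<alpha> s)"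
  using transition_law_in[of \<alpha> s] by (auto simp: space_prob_algebra)

lemma AE_transition_reward:
  assumes \<alpha>: "action_kernel \<alpha>"
  shows "AE z in transition_law G \<alpha> s. \<bar>rew_of (fst z)\<bar> \<le> Rmax G"
proof -
  note [measurable_cong] = sets_transition[OF \<alpha>]
  have z: "(\<integral>\<^sup>+r. indicator {z. Rmax G < \<bar>fst z\<bar>} (r, s'::'s) \<partial>pr G s c a m) = 0" for s c a m s'
  proof -
    have "(\<integral>\<^sup>+r. indicator {z. Rmax G < \<bar>fst z\<bar>} (r, s') \<partial>pr G s c a m) = (\<integral>\<^sup>+r. 0 \<partial>pr G s c a m)"
      by (rule nn_integral_cong_AE) (use reward_bound[of s c a m] in \<open>auto simp: indicator_def\<close>)
    then show ?thesis by simp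
  qed
  have "(\<integral>\<^sup>+r. (\<integral>\<^sup>+s'. indicator {z. Rmax G < \<bar>fst z\<bar>} (r, s'::'s) \<partial>ps G s c a m) \<partial>pr G s c a m) = 0" for s c a m
  proof -
    have "(\<integral>\<^sup>+r. (\<integral>\<^sup>+s'. indicator {z. Rmax G < \<bar>fst z\<bar>} (r, s'::'s) \<partial>ps G s c a m) \<partial>pr G s c a m)
      = (\<integral>\<^sup>+r. indicator {z. Rmax G < \<bar>fst z\<bar>} (r, undefined::'s) \<partial>pr G s c a m)"
      by (rule nn_integral_cong) (auto simp: indicator_def prob_space.emeasure_space_1[OF prob_ps, simplified])
    then show ?thesis using z by simp
  qed
  then have "(\<integral>\<^sup>+z. indicator {z. Rmax G < \<bar>fst z\<bar>} (rew_of (fst z), snd z) \<partial>transition_law G \<alpha> s) = 0"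
    by (subst nn_transition_obs[OF _ \<alpha>]) (auto simp: indicator_def)
  then have "AE z in transition_law G \<alpha> s. indicator {z. Rmax G < \<bar>fst z\<bar>} (rew_of (fst z), snd z) = (0::ennreal)"
    by (subst (asm) nn_integral_0_iff_AE) auto
  then show ?thesis by eventually_elim (auto simp: indicator_def split: if_splits)
qed

lemma AE_effect_reward: "AE z in effect s m. \<bar>fst z\<bar> \<le> Rmax G"
proof -
  have z: "(\<integral>\<^sup>+r. (\<integral>\<^sup>+s'. indicator {z. Rmax G < \<bar>fst z\<bar>} (r, s'::'s) \<partial>ps G s c a m) \<partial>pr G s c a m) = 0" for s c a m
  proof -
    have "(\<integral>\<^sup>+r. (\<integral>\<^sup>+s'. indicator {z. Rmax G < \<bar>fst z\<bar>} (r, s'::'s) \<partial>ps G s c a m) \<partial>pr G s c a m)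
      = (\<integral>\<^sup>+r. 0 \<partial>pr G s c a m)"
      by (rule nn_integral_cong_AE) (use reward_bound[of s c a m] in \<open>auto simp: indicator_def prob_space.emeasure_space_1[OF prob_ps, simplified]\<close>)
    then show ?thesis by simp
  qed
  then have "(\<integral>\<^sup>+z. indicator {z. Rmax G < \<bar>fst z\<bar>} z \<partial>effect s m) = 0"
    by (subst nn_effect) auto
  then have "AE z in effect s m. indicator {z. Rmax G < \<bar>fst z\<bar>} z = (0::ennreal)"
    by (subst (asm) nn_integral_0_iff_AE) auto
  then show ?thesis by eventually_elim (auto simp: indicator_def split: if_splits)
qed

section \<open>Interventional backups of bounded value functions\<close>

definition bdd :: "('s \<Rightarrow> real) \<Rightarrow> bool" where
  "bdd u \<longleftrightarrow> u \<in> borel_measurable (St G) \<and> (\<forall>s. \<bar>u s\<bar> \<le> V)"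

text \<open>Backup for an intervention on the action. The action acts through the law of the
  mediator only, since \<open>effect\<close> does not see it.\<close>

definition T :: "'a \<Rightarrow> ('s \<Rightarrow> real) \<Rightarrow> 's \<Rightarrow> real" where
  "T a u s = (\<Sum>m\<in>UNIV. pmf (med s a) m * (LINT z|effect s m. fst z + \<gamma> * u (snd z)))"

lemma abs_target: "\<bar>r\<bar> \<le> Rmax G \<Longrightarrow> \<bar>x\<bar> \<le> V \<Longrightarrow> \<bar>r + \<gamma> * x\<bar> \<le> V"
proof -
  assume "\<bar>r\<bar> \<le> Rmax G" "\<bar>x\<bar> \<le> V"
  then have "\<bar>r\<bar> + \<gamma> * \<bar>x\<bar> \<le> Rmax G + \<gamma> * V"
    using disc_nonneg by (intro add_mono mult_left_mono) auto
  moreover have "\<bar>r + \<gamma> * x\<bar> \<le> \<bar>r\<bar> + \<gamma> * \<bar>x\<bar>"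
    using abs_triangle_ineq[of r "\<gamma> * x"] disc_nonneg by (simp add: abs_mult)
  ultimately show ?thesis using Rmax_V by simp
qed

lemma integrable_effect: "bdd u \<Longrightarrow> integrable (effect s m) (\<lambda>z. fst z + \<gamma> * u (snd z))"
  and abs_effect: "bdd u \<Longrightarrow> \<bar>LINT z|effect s m. fst z + \<gamma> * u (snd z)\<bar> \<le> V"
proof -
  assume u: "bdd u"
  interpret prob_space "effect s m" by (rule prob_effect)
  have [measurable]: "u \<in> borel_measurable (St G)" using u by (simp add: bdd_def)
  have b: "AE z in effect s m. \<bar>fst z + \<gamma> * u (snd z)\<bar> \<le> V"
    using AE_effect_reward by eventually_elim (use u in \<open>auto simp: bdd_def intro!: abs_target\<close>)
  show i: "integrable (effect s m) (\<lambda>z. fst z + \<gamma> * u (snd z))"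
    by (rule integrable_const_bound[of _ V]) (use b in auto)
  show "\<bar>LINT z|effect s m. fst z + \<gamma> * u (snd z)\<bar> \<le> V"
  proof -
    have "\<bar>LINT z|effect s m. fst z + \<gamma> * u (snd z)\<bar> \<le> (LINT z|effect s m. \<bar>fst z + \<gamma> * u (snd z)\<bar>)"
      by (rule integral_abs_bound)
    also have "\<dots> \<le> V"
      using integral_le_const[OF integrable_abs[OF i] b] by simp
    finally show ?thesis .
  qed
qed

lemma convex_abs_le:
  fixes p :: "'x::finite pmf"
  assumes "\<And>x. \<bar>f x\<bar> \<le> B"
  shows "\<bar>\<Sum>x\<in>UNIV. pmf p x * f x\<bar> \<le> B"
proof -
  have "\<bar>\<Sum>x\<in>UNIV. pmf p x * f x\<bar> \<le> (\<Sum>x\<in>UNIV. pmf p x * \<bar>f x\<bar>)"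
    by (rule order_trans[OF sum_abs]) (simp add: abs_mult)
  also have "\<dots> \<le> (\<Sum>x\<in>UNIV. pmf p x * B)"
    by (intro sum_mono mult_left_mono assms) auto
  finally show ?thesis by (simp add: sum_distrib_right[symmetric] sum_pmf_1)
qed

lemma abs_T: "bdd u \<Longrightarrow> \<bar>T a u s\<bar> \<le> V"
  unfolding T_def by (intro convex_abs_le abs_effect)

lemma T_measurable[measurable]: "bdd u \<Longrightarrow> T a u \<in> borel_measurable (St G)"
proof -
  assume "bdd u"
  then have [measurable]: "u \<in> borel_measurable (St G)" by (simp add: bdd_def)
  have [measurable]: "(\<lambda>s. LINT z|effect s m. fst z + \<gamma> * u (snd z)) \<in> borel_measurable (St G)" for m
    by (rule integral_measurable_subprob_algebra[THEN measurable_compose[rotated]])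
       (use measurable_prob_algebraD[OF effect_measurable] in measurable)
  show ?thesis unfolding T_def[abs_def] by measurable
qed

end

text \<open>Transfers a mixture identity from nonnegative functions to signed ones by splitting into
  positive and negative parts, both finite on every component.\<close>

lemma integral_mixture:
  fixes w :: "'i \<Rightarrow> real" and X :: "'y \<Rightarrow> real"
  assumes w: "\<And>i. i \<in> I \<Longrightarrow> 0 \<le> w i"
    and h[measurable]: "h \<in> M \<rightarrow>\<^sub>M N" and L: "\<And>i. i \<in> I \<Longrightarrow> sets (L i) = sets N"
    and mix: "\<And>F. F \<in> borel_measurable N \<Longrightarrow> (\<integral>\<^sup>+x. F (h x) \<partial>M) = (\<Sum>i\<in>I. ennreal (w i) * (\<integral>\<^sup>+y. F y \<partial>L i))"
    and X[measurable]: "X \<in> borel_measurable N" and int: "\<And>i. i \<in> I \<Longrightarrow> integrable (L i) X"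
  shows "integrable M (\<lambda>x. X (h x))"
    and "(LINT x|M. X (h x)) = (\<Sum>i\<in>I. w i * (LINT y|L i. X y))"
proof -
  have fin: "(\<integral>\<^sup>+y. ennreal (X y) \<partial>L i) \<noteq> \<infinity>" "(\<integral>\<^sup>+y. ennreal (- X y) \<partial>L i) \<noteq> \<infinity>" if "i \<in> I" for i
    using int[OF that] by (auto simp: real_integrable_def)
  have p: "(\<integral>\<^sup>+x. ennreal (X (h x)) \<partial>M) = (\<Sum>i\<in>I. ennreal (w i * enn2real (\<integral>\<^sup>+y. ennreal (X y) \<partial>L i)))"
    using fin by (subst mix) (auto intro!: sum.cong simp: ennreal_mult w less_top)
  have n: "(\<integral>\<^sup>+x. ennreal (- X (h x)) \<partial>M) = (\<Sum>i\<in>I. ennreal (w i * enn2real (\<integral>\<^sup>+y. ennreal (- X y) \<partial>L i)))"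
    using fin by (subst mix) (auto intro!: sum.cong simp: ennreal_mult w less_top)
  show i: "integrable M (\<lambda>x. X (h x))"
    unfolding real_integrable_def p n using w by (auto simp: sum_ennreal)
  show "(LINT x|M. X (h x)) = (\<Sum>i\<in>I. w i * (LINT y|L i. X y))"
    unfolding real_lebesgue_integral_def[OF i] p n
    using w by (auto simp: sum_ennreal sum_nonneg real_lebesgue_integral_def[OF int] right_diff_distrib sum_subtractf)
qed

lemma sum_UNIV_prod:
  fixes f :: "'x::finite \<times> 'y::finite \<Rightarrow> 'z::comm_monoid_add"
  shows "(\<Sum>i\<in>UNIV. f i) = (\<Sum>x\<in>UNIV. \<Sum>y\<in>UNIV. f (x, y))"
  by (simp add: sum.cartesian_product)

context fd_m2dp begin

lemma transition_online_integral:
  assumes u: "bdd u"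
  shows "(LINT z|transition_law G (\<lambda>c. p) s. rew_of (fst z) + \<gamma> * u (snd z)) = (\<Sum>a\<in>UNIV. pmf p a * T a u s)"
proof -
  have [measurable]: "u \<in> borel_measurable (St G)" using u by (simp add: bdd_def)
  note [measurable_cong] = sets_transition[OF action_kernel_const]
  have "(LINT z|transition_law G (\<lambda>c. p) s. (\<lambda>z. fst z + \<gamma> * u (snd z)) (rew_of (fst z), snd z))
    = (\<Sum>i\<in>UNIV. (case i of (a, m) \<Rightarrow> pmf p a * pmf (med s a) m) * (LINT z|(case i of (a, m) \<Rightarrow> effect s m). fst z + \<gamma> * u (snd z)))"
  proof (rule integral_mixture(2)[where N="borel \<Otimes>\<^sub>M St G"])
    fix F :: "real \<times> 's \<Rightarrow> ennreal" assume F: "F \<in> borel_measurable (borel \<Otimes>\<^sub>M St G)"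
    show "(\<integral>\<^sup>+z. F (rew_of (fst z), snd z) \<partial>transition_law G (\<lambda>c. p) s) =
      (\<Sum>i\<in>UNIV. ennreal (case i of (a, m) \<Rightarrow> pmf p a * pmf (med s a) m) * (\<integral>\<^sup>+ y. F y \<partial>(case i of (a, m) \<Rightarrow> effect s m)))"
      using nn_transition_online[of "\<lambda>a m. F", OF F, of p s]
      by (simp add: sum_UNIV_prod sum_distrib_left ennreal_mult mult.assoc)
  qed (auto simp: sets_effect integrable_effect[OF u] split: prod.split)
  then show ?thesis
    by (simp add: sum_UNIV_prod T_def sum_distrib_left mult.assoc)
qed

definition cell :: "'a \<Rightarrow> 'm \<Rightarrow> (('s, 'c, 'a, 'm) full \<times> 's) set" where
  "cell a m = {z. act_of (fst z) = a \<and> med_of (fst z) = m}"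

lemma nn_cell:
  assumes F[measurable]: "F \<in> borel_measurable (borel \<Otimes>\<^sub>M St G)"
  shows "(\<integral>\<^sup>+z. indicator (cell a m) z * F (rew_of (fst z), snd z) \<partial>transition_law G (pa G s) s) =
    ennreal (pmf (med s a) m) * (\<integral>\<^sup>+c. ennreal (pmf (pa G s c) a) *
       (\<integral>\<^sup>+r. (\<integral>\<^sup>+s'. F (r, s') \<partial>ps G s c undefined m) \<partial>pr G s c undefined m) \<partial>pc G s)"
proof -
  let ?F = "\<lambda>a' m' z. if a' = a \<and> m' = m then F z else 0"
  have [measurable]: "?F a' m' \<in> borel_measurable (borel \<Otimes>\<^sub>M St G)" for a' m'
    by (cases "a' = a \<and> m' = m") auto
  have "(\<integral>\<^sup>+z. indicator (cell a m) z * F (rew_of (fst z), snd z) \<partial>transition_law G (pa G s) s) =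
    (\<integral>\<^sup>+z. ?F (act_of (fst z)) (med_of (fst z)) (rew_of (fst z), snd z) \<partial>transition_law G (pa G s) s)"
    by (intro nn_integral_cong) (auto simp: cell_def indicator_def)
  also have "\<dots> = (\<Sum>a'\<in>UNIV. \<Sum>m'\<in>UNIV. pmf (med s a') m' * (\<integral>\<^sup>+c. pmf (pa G s c) a' *
       (\<integral>\<^sup>+r. (\<integral>\<^sup>+s'. ?F a' m' (r, s') \<partial>ps G s c undefined m') \<partial>pr G s c undefined m') \<partial>pc G s))"
    by (rule nn_transition_obs) auto
  also have "\<dots> = (\<Sum>a'\<in>UNIV. \<Sum>m'\<in>UNIV. if a' = a \<and> m' = m then pmf (med s a) m * (\<integral>\<^sup>+c. pmf (pa G s c) a *
       (\<integral>\<^sup>+r. (\<integral>\<^sup>+s'. F (r, s') \<partial>ps G s c undefined m) \<partial>pr G s c undefined m) \<partial>pc G s) else 0)"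
    by (intro sum.cong refl) auto
  also have "\<dots> = (\<Sum>a'\<in>UNIV. if a' = a then (\<Sum>m'\<in>UNIV. if m' = m then pmf (med s a) m * (\<integral>\<^sup>+c. pmf (pa G s c) a *
       (\<integral>\<^sup>+r. (\<integral>\<^sup>+s'. F (r, s') \<partial>ps G s c undefined m) \<partial>pr G s c undefined m) \<partial>pc G s) else 0) else 0)"
    by (intro sum.cong refl) auto
  finally show ?thesis by simp
qed

lemma cell_sets[measurable]: "cell a m \<in> sets (fullM G \<Otimes>\<^sub>M St G)"
proof -
  have "Measurable.pred (fullM G \<Otimes>\<^sub>M St G) (\<lambda>z. act_of (fst z) = a \<and> med_of (fst z) = m)" by measurable
  then show ?thesis by (simp add: cell_def pred_def space_pair_measure)
qed

lemma measure_cell: "measure (transition_law G (pa G s) s) (cell a m) = p_b G s a * pmf (med s a) m"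
proof -
  note S[measurable_cong] = sets_transition[OF action_kernel_pa, of s]
  interpret prob_space "transition_law G (pa G s) s" by (rule prob_transition) simp
  have "ennreal (measure (transition_law G (pa G s) s) (cell a m))
    = (\<integral>\<^sup>+z. indicator (cell a m) z * 1 \<partial>transition_law G (pa G s) s)"
    by (simp add: emeasure_eq_measure[symmetric] nn_integral_indicator S cell_sets)
  also have "\<dots> = ennreal (p_b G s a * pmf (med s a) m)"
    by (subst nn_cell) (auto simp: prob_space.emeasure_space_1[OF prob_pr, simplified]
      prob_space.emeasure_space_1[OF prob_ps, simplified] p_b_nn[symmetric] ennreal_mult p_b_nonneg mult.commute)
  finally show ?thesis by (simp add: p_b_nonneg)
qed

lemma integrable_transition:
  assumes u: "bdd u" and \<alpha>: "action_kernel \<alpha>"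
  shows "integrable (transition_law G \<alpha> s) (\<lambda>z. rew_of (fst z) + \<gamma> * u (snd z))"
    and "AE z in transition_law G \<alpha> s. \<bar>rew_of (fst z) + \<gamma> * u (snd z)\<bar> \<le> V"
proof -
  interpret prob_space "transition_law G \<alpha> s" by (rule prob_transition[OF \<alpha>])
  have [measurable]: "u \<in> borel_measurable (St G)" using u by (simp add: bdd_def)
  note [measurable_cong] = sets_transition[OF \<alpha>]
  show b: "AE z in transition_law G \<alpha> s. \<bar>rew_of (fst z) + \<gamma> * u (snd z)\<bar> \<le> V"
    using AE_transition_reward[OF \<alpha>] by eventually_elim (use u in \<open>auto simp: bdd_def intro!: abs_target\<close>)
  show "integrable (transition_law G \<alpha> s) (\<lambda>z. rew_of (fst z) + \<gamma> * u (snd z))"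
    by (rule integrable_const_bound[of _ V]) (use b in auto)
qed

text \<open>On the cell of action \<open>a\<close> the law of the confounder is tilted by
  \<open>pmf (pa G s c) a\<close>. Division by the mediator probability leaves exactly this tilt,
  and the tilts of all actions sum to one, which restores the untilted law in
  \<open>effect\<close>.\<close>

lemma front_door_adjustment:
  assumes u: "bdd u"
  shows "(\<Sum>a\<in>UNIV. (LINT z|transition_law G (pa G s) s. indicat_real (cell a m) z * (rew_of (fst z) + \<gamma> * u (snd z))) / pmf (med s a) m)
    = (LINT z|effect s m. fst z + \<gamma> * u (snd z))"
proof -
  let ?P = "transition_law G (pa G s) s"
  have [measurable]: "u \<in> borel_measurable (St G)" using u by (simp add: bdd_def)
  note S[measurable_cong] = sets_transition[OF action_kernel_pa, of s]
  let ?h = "\<lambda>z. (rew_of (fst z), snd z)"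
  let ?X = "\<lambda>z. fst z + \<gamma> * u (snd z)"
  \<comment> \<open>The unnormalised law of reward and next state on the cell.\<close>
  let ?L = "\<lambda>a. distr (density ?P (\<lambda>z. ennreal (indicat_real (cell a m) z))) (borel \<Otimes>\<^sub>M St G) ?h"
  have i: "integrable ?P (\<lambda>z. indicat_real (cell a m) z * (rew_of (fst z) + \<gamma> * u (snd z)))" for a
    using integrable_mult_indicator[OF _ integrable_transition(1)[OF u action_kernel_pa, of s s], of "cell a m"]
    by (simp add: S)
  have Li: "integrable (?L a) ?X" for a
    using i[of a] by (subst integrable_distr_eq) (auto simp: integrable_density)
  have Leq: "(LINT z|?L a. ?X z) = (LINT z|?P. indicat_real (cell a m) z * (rew_of (fst z) + \<gamma> * u (snd z)))" for a
    by (subst integral_distr) (auto simp: integral_density)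
  have "(LINT z|effect s m. ?X z) = (\<Sum>a\<in>UNIV. (1 / pmf (med s a) m) * (LINT z|?L a. ?X z))"
  proof (rule integral_mixture(2)[where h="\<lambda>x. x" and N="borel \<Otimes>\<^sub>M St G"])
    fix F :: "real \<times> 's \<Rightarrow> ennreal" assume F[measurable]: "F \<in> borel_measurable (borel \<Otimes>\<^sub>M St G)"
    have [measurable]: "(\<lambda>c. pmf (pa G s c) a) \<in> borel_measurable (Cf G)" for a
      using action_kernel_pa[of s] by (simp add: action_kernel_def)
    note [measurable] = effect_inner_measurable[OF F]
    have "(\<Sum>a\<in>UNIV. ennreal (1 / pmf (med s a) m) * (\<integral>\<^sup>+y. F y \<partial>?L a)) =
      (\<Sum>a\<in>UNIV. \<integral>\<^sup>+c. ennreal (pmf (pa G s c) a) *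
       (\<integral>\<^sup>+r. (\<integral>\<^sup>+s'. F (r, s') \<partial>ps G s c undefined m) \<partial>pr G s c undefined m) \<partial>pc G s)"
    proof (intro sum.cong refl)
      fix a
      have "(\<integral>\<^sup>+y. F y \<partial>?L a) = (\<integral>\<^sup>+z. indicator (cell a m) z * F (?h z) \<partial>?P)"
        by (subst nn_integral_distr) (auto simp: nn_integral_density ennreal_indicator)
      then show "ennreal (1 / pmf (med s a) m) * (\<integral>\<^sup>+y. F y \<partial>?L a) = (\<integral>\<^sup>+c. ennreal (pmf (pa G s c) a) *
       (\<integral>\<^sup>+r. (\<integral>\<^sup>+s'. F (r, s') \<partial>ps G s c undefined m) \<partial>pr G s c undefined m) \<partial>pc G s)"
        using med_pos[of s a m]
        by (simp add: nn_cell mult.assoc[symmetric] ennreal_mult[symmetric])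
    qed
    \<comment> \<open>Summation over actions under the integral turns the tilts into total
      probability one.\<close>
    also have "\<dots> = (\<integral>\<^sup>+c. (\<Sum>a\<in>UNIV. ennreal (pmf (pa G s c) a)) *
       (\<integral>\<^sup>+r. (\<integral>\<^sup>+s'. F (r, s') \<partial>ps G s c undefined m) \<partial>pr G s c undefined m) \<partial>pc G s)"
      by (subst nn_integral_sum[symmetric], measurable) (simp only: sum_distrib_right)
    finally show "(\<integral>\<^sup>+x. F x \<partial>effect s m) = (\<Sum>a\<in>UNIV. ennreal (1 / pmf (med s a) m) * (\<integral>\<^sup>+y. F y \<partial>?L a))"
      by (simp only: nn_effect[OF F] sum_pmf_ennreal mult_1)
  qed (auto simp: sets_effect Li)
  then show ?thesis by (simp add: Leq)
qed

lemma path_kernel_transition_measurable: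
  assumes \<alpha>: "admissible \<alpha>"
  shows "(\<lambda>w. transition_law G (\<alpha> t (past t w) (state_of (w t))) (state_of (w t))) \<in> trajM \<rightarrow>\<^sub>M prob_algebra (fullM G \<Otimes>\<^sub>M St G)"
proof (rule transition_law_measurable)
  fix a
  have *: "(\<lambda>((h, s), c). pmf (\<alpha> t h s c) a)
     \<in> borel_measurable ((PiM {0..<t} (\<lambda>_. obsM G) \<Otimes>\<^sub>M St G) \<Otimes>\<^sub>M Cf G)"
    using assms by (auto simp: admissible_def)
  have "(\<lambda>x. ((past t (fst x), state_of (fst x t)), snd x))
    \<in> trajM \<Otimes>\<^sub>M Cf G \<rightarrow>\<^sub>M (PiM {0..<t} (\<lambda>_. obsM G) \<Otimes>\<^sub>M St G) \<Otimes>\<^sub>M Cf G"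
    by measurable
  from measurable_compose[OF this *]
  show "(\<lambda>(x, c). pmf (\<alpha> t (past t x) (state_of (x t)) c) a) \<in> borel_measurable (trajM \<Otimes>\<^sub>M Cf G)"
    by (simp add: split_beta)
qed measurable

text \<open>The bound on \<open>X\<close> is required only almost surely under each one-step law,
  because rewards are bounded only almost surely.\<close>

lemma path_law_step_integral_nonneg:
  fixes X :: "('s, 'c, 'a, 'm) full \<times> 's \<Rightarrow> real"
  assumes \<alpha>: "admissible \<alpha>" and X[measurable]: "X \<in> borel_measurable (fullM G \<Otimes>\<^sub>M St G)"
    and X0: "\<And>z. 0 \<le> X z"
    and B: "\<And>\<beta> s. action_kernel \<beta> \<Longrightarrow> AE z in transition_law G \<beta> s. X z \<le> B"
  shows "integrable (path_law G \<alpha>) (\<lambda>w. X (w t, state_of (w (Suc t))))"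
    and "integrable (path_law G \<alpha>) (\<lambda>w. LINT z|transition_law G (\<alpha> t (past t w) (state_of (w t))) (state_of (w t)). X z)"
    and "(LINT w|path_law G \<alpha>. X (w t, state_of (w (Suc t)))) =
      (LINT w|path_law G \<alpha>. LINT z|transition_law G (\<alpha> t (past t w) (state_of (w t))) (state_of (w t)). X z)"
proof -
  let ?\<Omega> = "path_law G \<alpha>"
  let ?K = "\<lambda>w :: nat \<Rightarrow> ('s, 'c, 'a, 'm) full. transition_law G (\<alpha> t (past t w) (state_of (w t))) (state_of (w t))"
  interpret prob_space ?\<Omega> by (rule prob_path_law[OF \<alpha>])
  note S[measurable_cong] = sets_path_law[OF \<alpha>]
  have ak: "action_kernel (\<alpha> t (past t w) s)" for s and w :: "nat \<Rightarrow> ('s, 'c, 'a, 'm) full"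
    by (rule action_kernel_admissible[OF \<alpha> past_space])
  have Km: "?K \<in> ?\<Omega> \<rightarrow>\<^sub>M subprob_algebra (fullM G \<Otimes>\<^sub>M St G)"
    by (subst measurable_cong_sets[OF S refl], rule measurable_prob_algebraD, rule path_kernel_transition_measurable[OF \<alpha>])
  have i: "integrable (?K w) X" for w
  proof -
    interpret P: prob_space "?K w" by (rule prob_transition[OF ak])
    show ?thesis
      by (rule P.integrable_const_bound[of _ B]) (use B[OF ak] X0 in \<open>auto cong: measurable_cong_sets simp: sets_transition[OF ak]\<close>)
  qed
  have le: "(LINT z|?K w. X z) \<le> B" and ge: "0 \<le> (LINT z|?K w. X z)" for w
  proof -
    interpret P: prob_space "?K w" by (rule prob_transition[OF ak])
    show "(LINT z|?K w. X z) \<le> B" by (rule P.integral_le_const[OF i B[OF ak]])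
    show "0 \<le> (LINT z|?K w. X z)" using X0 by simp
  qed
  have m[measurable]: "(\<lambda>w. LINT z|?K w. X z) \<in> borel_measurable ?\<Omega>"
    by (rule integral_measurable_subprob_algebra[THEN measurable_compose[rotated]]) (use Km in auto)
  show i2: "integrable ?\<Omega> (\<lambda>w. LINT z|?K w. X z)"
    by (rule integrable_const_bound[of _ B]) (use le ge in auto)
  have eq: "(\<integral>\<^sup>+w. ennreal (X (w t, state_of (w (Suc t)))) \<partial>?\<Omega>) = ennreal (LINT w|?\<Omega>. LINT z|?K w. X z)"
    using path_law_step[OF \<alpha>, of "\<lambda>z. ennreal (X z)" t] X0
    by (simp add: nn_integral_eq_integral[OF i] nn_integral_eq_integral[OF i2] ge)
  have Xm[measurable]: "(\<lambda>w. X (w t, state_of (w (Suc t)))) \<in> borel_measurable ?\<Omega>" by measurable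
  show i3: "integrable ?\<Omega> (\<lambda>w. X (w t, state_of (w (Suc t))))"
    by (rule integrableI_nonneg) (use X0 eq in auto)
  have "ennreal (LINT w|?\<Omega>. X (w t, state_of (w (Suc t)))) = ennreal (LINT w|?\<Omega>. LINT z|?K w. X z)"
    using eq X0 by (simp add: nn_integral_eq_integral[OF i3])
  then show "(LINT w|?\<Omega>. X (w t, state_of (w (Suc t)))) = (LINT w|?\<Omega>. LINT z|?K w. X z)"
    using X0 ge by (subst (asm) ennreal_inj) (auto intro!: Bochner_Integration.integral_nonneg)
qed

lemma path_law_step_integral:
  fixes X :: "('s, 'c, 'a, 'm) full \<times> 's \<Rightarrow> real"
  assumes \<alpha>: "admissible \<alpha>" and X[measurable]: "X \<in> borel_measurable (fullM G \<Otimes>\<^sub>M St G)"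
    and B: "\<And>\<beta> s. action_kernel \<beta> \<Longrightarrow> AE z in transition_law G \<beta> s. \<bar>X z\<bar> \<le> B"
  shows "integrable (path_law G \<alpha>) (\<lambda>w. X (w t, state_of (w (Suc t))))"
    and "integrable (path_law G \<alpha>) (\<lambda>w. LINT z|transition_law G (\<alpha> t (past t w) (state_of (w t))) (state_of (w t)). X z)"
    and "(LINT w|path_law G \<alpha>. X (w t, state_of (w (Suc t)))) =
      (LINT w|path_law G \<alpha>. LINT z|transition_law G (\<alpha> t (past t w) (state_of (w t))) (state_of (w t)). X z)"
proof -
  let ?\<Omega> = "path_law G \<alpha>"
  let ?K = "\<lambda>w :: nat \<Rightarrow> ('s, 'c, 'a, 'm) full. transition_law G (\<alpha> t (past t w) (state_of (w t))) (state_of (w t))"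
  let ?p = "\<lambda>z. max 0 (X z)" and ?n = "\<lambda>z. max 0 (- X z)"
  have ak: "action_kernel (\<alpha> t (past t w) s)" for s and w :: "nat \<Rightarrow> ('s, 'c, 'a, 'm) full"
    by (rule action_kernel_admissible[OF \<alpha> past_space])
  have Bp: "AE z in transition_law G \<beta> s. ?p z \<le> B" "AE z in transition_law G \<beta> s. ?n z \<le> B" if "action_kernel \<beta>" for \<beta> s
  proof -
    have b: "\<bar>x\<bar> \<le> B \<Longrightarrow> max 0 x \<le> B" "\<bar>x\<bar> \<le> B \<Longrightarrow> max 0 (- x) \<le> B" for x by auto
    show "AE z in transition_law G \<beta> s. ?p z \<le> B"
      using B[OF that, of s] by eventually_elim (erule b)
    show "AE z in transition_law G \<beta> s. ?n z \<le> B"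
      using B[OF that, of s] by eventually_elim (erule b)
  qed
  have i: "integrable (?K w) ?p" "integrable (?K w) ?n" for w
  proof -
    interpret P: prob_space "?K w" by (rule prob_transition[OF ak])
    show "integrable (?K w) ?p"
      by (rule P.integrable_const_bound[of _ B]) (use Bp[OF ak] in \<open>auto cong: measurable_cong_sets simp: sets_transition[OF ak]\<close>)
    show "integrable (?K w) ?n"
      by (rule P.integrable_const_bound[of _ B]) (use Bp[OF ak] in \<open>auto cong: measurable_cong_sets simp: sets_transition[OF ak]\<close>)
  qed
  have Xd: "X = (\<lambda>z. ?p z - ?n z)" by auto
  note p = path_law_step_integral_nonneg[OF \<alpha>, of ?p B t, OF _ _ Bp(1), simplified]
  note n = path_law_step_integral_nonneg[OF \<alpha>, of ?n B t, OF _ _ Bp(2), simplified]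
  have d: "(LINT z|?K w. X z) = (LINT z|?K w. ?p z) - (LINT z|?K w. ?n z)" for w
    by (subst Xd) (rule Bochner_Integration.integral_diff[OF i])
  show "integrable ?\<Omega> (\<lambda>w. X (w t, state_of (w (Suc t))))"
    by (subst Xd) (intro Bochner_Integration.integrable_diff p n)
  show "integrable ?\<Omega> (\<lambda>w. LINT z|?K w. X z)"
    unfolding d by (intro Bochner_Integration.integrable_diff p n)
  show "(LINT w|?\<Omega>. X (w t, state_of (w (Suc t)))) = (LINT w|?\<Omega>. LINT z|?K w. X z)"
    unfolding d
    by (subst Xd, subst Bochner_Integration.integral_diff[OF p(1) n(1)], subst Bochner_Integration.integral_diff[OF p(2) n(2)])
       (simp only: p(3) n(3))
qed

section \<open>Optimal control of discounted occupancies\<close>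

text \<open>Upper expectation of the next state over interventions on the action. Values in
  \<open>ennreal\<close> make it total and monotone without integrability; as a supremum it is
  subadditive rather than additive.\<close>

definition Tb :: "('s \<Rightarrow> ennreal) \<Rightarrow> 's \<Rightarrow> ennreal" where
  "Tb g s = (SUP a. \<Sum>m\<in>UNIV. ennreal (pmf (med s a) m) * (\<integral>\<^sup>+z. g (snd z) \<partial>effect s m))"

lemma nn_effect_measurable:
  assumes [measurable]: "g \<in> borel_measurable (St G)"
  shows "(\<lambda>s. \<integral>\<^sup>+z. g (snd z) \<partial>effect s m) \<in> borel_measurable (St G)"
  by (rule nn_integral_measurable_subprob_algebra[THEN measurable_compose[rotated]])
     (use measurable_prob_algebraD[OF effect_measurable] in measurable)

lemma Tb_measurable[measurable]:
  assumes g[measurable]: "g \<in> borel_measurable (St G)"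
  shows "Tb g \<in> borel_measurable (St G)"
  using nn_effect_measurable[OF g] unfolding Tb_def[abs_def]
  by (intro borel_measurable_SUP) auto

lemma Tb_mono: "(\<And>s. g s \<le> h s) \<Longrightarrow> Tb g s \<le> Tb h s"
  unfolding Tb_def by (intro SUP_mono' sum_mono mult_left_mono nn_integral_mono) auto

lemma Tb_upper: "(\<Sum>m\<in>UNIV. ennreal (pmf (med s a) m) * (\<integral>\<^sup>+z. g (snd z) \<partial>effect s m)) \<le> Tb g s"
  unfolding Tb_def by (rule SUP_upper) simp

lemma Tb_attained:
  obtains a where "Tb g s = (\<Sum>m\<in>UNIV. ennreal (pmf (med s a) m) * (\<integral>\<^sup>+z. g (snd z) \<partial>effect s m))"
proof -
  let ?f = "\<lambda>a. \<Sum>m\<in>UNIV. ennreal (pmf (med s a) m) * (\<integral>\<^sup>+z. g (snd z) \<partial>effect s m)"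
  have "Tb g s = Max (range ?f)"
    unfolding Tb_def by (rule Max_Sup[symmetric]) auto
  moreover have "Max (range ?f) \<in> range ?f" by (rule Max_in) auto
  then obtain a where "Max (range ?f) = ?f a" by (rule rangeE)
  ultimately have "Tb g s = ?f a" by simp
  then show ?thesis by (rule that)
qed

lemma Tb_add:
  assumes [measurable]: "g \<in> borel_measurable (St G)" "h \<in> borel_measurable (St G)"
  shows "Tb (\<lambda>s. g s + h s) s \<le> Tb g s + Tb h s"
proof -
  obtain a where "Tb (\<lambda>s. g s + h s) s = (\<Sum>m\<in>UNIV. ennreal (pmf (med s a) m) * (\<integral>\<^sup>+z. g (snd z) + h (snd z) \<partial>effect s m))"
    by (rule Tb_attained)
  also have "\<dots> = (\<Sum>m\<in>UNIV. ennreal (pmf (med s a) m) * (\<integral>\<^sup>+z. g (snd z) \<partial>effect s m))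
     + (\<Sum>m\<in>UNIV. ennreal (pmf (med s a) m) * (\<integral>\<^sup>+z. h (snd z) \<partial>effect s m))"
    by (subst nn_integral_add) (auto simp: distrib_left sum.distrib)
  also have "\<dots> \<le> Tb g s + Tb h s"
    by (intro add_mono Tb_upper)
  finally show ?thesis .
qed

lemma Tb_cmult:
  assumes [measurable]: "g \<in> borel_measurable (St G)"
  shows "Tb (\<lambda>s. c * g s) s \<le> c * Tb g s"
proof -
  obtain a where "Tb (\<lambda>s. c * g s) s = (\<Sum>m\<in>UNIV. ennreal (pmf (med s a) m) * (\<integral>\<^sup>+z. c * g (snd z) \<partial>effect s m))"
    by (rule Tb_attained)
  also have "\<dots> = c * (\<Sum>m\<in>UNIV. ennreal (pmf (med s a) m) * (\<integral>\<^sup>+z. g (snd z) \<partial>effect s m))"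
    by (subst nn_integral_cmult) (auto simp: sum_distrib_left mult.left_commute)
  also have "\<dots> \<le> c * Tb g s"
    by (intro mult_left_mono Tb_upper) auto
  finally show ?thesis .
qed

lemma Tb_const: "Tb (\<lambda>s. c) s = c"
  unfolding Tb_def
  by (simp add: prob_space.emeasure_space_1[OF prob_effect] sum_distrib_right[symmetric] sum_pmf_1)

text \<open>Equals \<gamma> ^ n times the optimal expectation of \<open>g\<close> after n
  transitions, with one discount factor applied per step so that powers compose.\<close>

definition Tpow :: "nat \<Rightarrow> ('s \<Rightarrow> ennreal) \<Rightarrow> 's \<Rightarrow> ennreal" where
  "Tpow n g = ((\<lambda>h s. ennreal \<gamma> * Tb h s) ^^ n) g"

lemma Tpow_0[simp]: "Tpow 0 g = g" and Tpow_Suc: "Tpow (Suc n) g = (\<lambda>s. ennreal \<gamma> * Tb (Tpow n g) s)"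
  by (auto simp: Tpow_def)

lemma Tpow_Suc2: "Tpow (Suc n) g = Tpow n (\<lambda>s. ennreal \<gamma> * Tb g s)"
  by (simp only: Tpow_def funpow_Suc_right o_apply)

lemma Tpow_add: "Tpow (i + j) g = Tpow i (Tpow j g)"
  by (simp add: Tpow_def funpow_add)

lemma Tpow_measurable[measurable]: "g \<in> borel_measurable (St G) \<Longrightarrow> Tpow n g \<in> borel_measurable (St G)"
  by (induction n) (auto simp: Tpow_Suc)

lemma Tpow_mono: "(\<And>s. g s \<le> h s) \<Longrightarrow> Tpow n g s \<le> Tpow n h s"
  by (induction n arbitrary: s) (auto simp: Tpow_Suc intro!: mult_left_mono Tb_mono)

lemma Tpow_plus:
  assumes [measurable]: "g \<in> borel_measurable (St G)" "h \<in> borel_measurable (St G)"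
  shows "Tpow n (\<lambda>s. g s + h s) s \<le> Tpow n g s + Tpow n h s"
proof (induction n arbitrary: s)
  case (Suc n)
  have "Tpow (Suc n) (\<lambda>s. g s + h s) s \<le> ennreal \<gamma> * Tb (\<lambda>s. Tpow n g s + Tpow n h s) s"
    unfolding Tpow_Suc by (intro mult_left_mono Tb_mono Suc) auto
  also have "\<dots> \<le> ennreal \<gamma> * (Tb (Tpow n g) s + Tb (Tpow n h) s)"
    by (intro mult_left_mono Tb_add) auto
  finally show ?case by (simp add: Tpow_Suc distrib_left)
qed simp

lemma Tpow_cmult:
  assumes [measurable]: "g \<in> borel_measurable (St G)"
  shows "Tpow n (\<lambda>s. c * g s) s \<le> c * Tpow n g s"
proof (induction n arbitrary: s)
  case (Suc n)
  have "Tpow (Suc n) (\<lambda>s. c * g s) s \<le> ennreal \<gamma> * Tb (\<lambda>s. c * Tpow n g s) s"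
    unfolding Tpow_Suc by (intro mult_left_mono Tb_mono Suc) auto
  also have "\<dots> \<le> ennreal \<gamma> * (c * Tb (Tpow n g) s)"
    by (intro mult_left_mono Tb_cmult) auto
  finally show ?case by (simp add: Tpow_Suc mult.left_commute)
qed simp

lemma Tpow_const: "Tpow n (\<lambda>s. c) s = ennreal (\<gamma> ^ n) * c"
proof -
  have "Tpow n (\<lambda>s. c) = (\<lambda>s. ennreal (\<gamma> ^ n) * c)"
    by (induction n) (simp_all add: Tpow_Suc Tb_const ennreal_mult disc_nonneg mult.assoc)
  then show ?thesis by simp
qed

text \<open>A policy, even one using the history, chooses a distribution over actions, and an
  average of action-wise expectations is at most their supremum.\<close>

lemma online_step_le:
  assumes \<pi>: "\<pi> \<in> policies G" and g[measurable]: "g \<in> borel_measurable (St G)"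
  shows "(\<integral>\<^sup>+w. g (state_of (w (Suc t))) \<partial>online G \<pi>) \<le> (\<integral>\<^sup>+w. Tb g (state_of (w t)) \<partial>online G \<pi>)"
proof -
  note \<alpha> = admissible_online[OF \<pi>]
  have "(\<integral>\<^sup>+w. g (state_of (w (Suc t))) \<partial>online G \<pi>) =
    (\<integral>\<^sup>+w. (\<integral>\<^sup>+z. g (snd z) \<partial>transition_law G (\<lambda>c. \<pi> t (past t w) (state_of (w t))) (state_of (w t))) \<partial>online G \<pi>)"
    unfolding online_def using path_law_step[OF \<alpha>, of "\<lambda>z. g (snd z)" t] by simp
  also have "\<dots> \<le> (\<integral>\<^sup>+w. Tb g (state_of (w t)) \<partial>online G \<pi>)"
  proof (rule nn_integral_mono)
    fix w :: "nat \<Rightarrow> ('s, 'c, 'a, 'm) full"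
    let ?p = "\<pi> t (past t w) (state_of (w t))" and ?s = "state_of (w t)"
    have "(\<integral>\<^sup>+z. g (snd z) \<partial>transition_law G (\<lambda>c. ?p) ?s) =
      (\<Sum>a\<in>UNIV. pmf ?p a * (\<Sum>m\<in>UNIV. pmf (med ?s a) m * (\<integral>\<^sup>+z. g (snd z) \<partial>effect ?s m)))"
      using nn_transition_online[of "\<lambda>a m z. g (snd z)" ?p ?s] by simp
    also have "\<dots> \<le> (\<Sum>a\<in>UNIV. ennreal (pmf ?p a) * Tb g ?s)"
      by (intro sum_mono mult_left_mono Tb_upper) auto
    also have "\<dots> = Tb g ?s" by (simp add: sum_distrib_right[symmetric] sum_pmf_1)
    finally show "(\<integral>\<^sup>+z. g (snd z) \<partial>transition_law G (\<lambda>c. ?p) ?s) \<le> Tb g ?s" .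
  qed
  finally show ?thesis .
qed

lemma online_initial:
  assumes \<pi>: "\<pi> \<in> policies G" and g[measurable]: "g \<in> borel_measurable (St G)"
  shows "(\<integral>\<^sup>+w. g (state_of (w 0)) \<partial>online G \<pi>) = (\<integral>\<^sup>+s. g s \<partial>rho0 G)"
  unfolding online_def by (rule path_law_initial[OF admissible_online[OF \<pi>] g])

text \<open>The induction peels off the last transition, so the operator is applied innermost; hence
  the unfolding \<open>Tpow_Suc2\<close>.\<close>

lemma online_le_Tpow:
  assumes \<pi>: "\<pi> \<in> policies G" and g: "g \<in> borel_measurable (St G)"
  shows "ennreal (\<gamma> ^ t) * (\<integral>\<^sup>+w. g (state_of (w t)) \<partial>online G \<pi>) \<le> (\<integral>\<^sup>+s. Tpow t g s \<partial>rho0 G)"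
  using g
proof (induction t arbitrary: g)
  case 0
  then show ?case by (simp add: online_initial[OF \<pi>])
next
  case (Suc t)
  note [measurable] = Suc.prems
  note S[measurable_cong] = sets_path_law[OF admissible_online[OF \<pi>], folded online_def]
  have "ennreal (\<gamma> ^ Suc t) * (\<integral>\<^sup>+w. g (state_of (w (Suc t))) \<partial>online G \<pi>)
    \<le> ennreal (\<gamma> ^ Suc t) * (\<integral>\<^sup>+w. Tb g (state_of (w t)) \<partial>online G \<pi>)"
    by (intro mult_left_mono online_step_le[OF \<pi>]) auto
  also have "\<dots> = ennreal (\<gamma> ^ t) * (\<integral>\<^sup>+w. ennreal \<gamma> * Tb g (state_of (w t)) \<partial>online G \<pi>)"
    by (subst nn_integral_cmult) (auto simp: ennreal_mult disc_nonneg mult_ac)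
  also have "\<dots> \<le> (\<integral>\<^sup>+s. Tpow t (\<lambda>s. ennreal \<gamma> * Tb g s) s \<partial>rho0 G)"
    by (rule Suc.IH) simp
  finally show ?case by (simp only: Tpow_Suc2)
qed

text \<open>Expected one-step Bellman error of the baseline \<open>u\<close> at time
  \<open>t\<close> along the policy.\<close>

definition adv :: "('s, 'a, 'm) policy \<Rightarrow> ('s \<Rightarrow> real) \<Rightarrow> nat \<Rightarrow> real" where
  "adv \<pi> u t = (LINT w|online G \<pi>. (\<Sum>a\<in>UNIV. pmf (\<pi> t (past t w) (state_of (w t))) a * T a u (state_of (w t))) - u (state_of (w t)))"

lemma bdd_const_0: "bdd (\<lambda>s. 0)"
  by (simp add: bdd_def V_nonneg)

lemma
  assumes \<pi>: "\<pi> \<in> policies G" and u: "bdd u"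
  shows adv_step: "(LINT w|online G \<pi>. rew_of (w t)) + \<gamma> * (LINT w|online G \<pi>. u (state_of (w (Suc t)))) =
      (LINT w|online G \<pi>. u (state_of (w t))) + adv \<pi> u t"
    and integrable_state: "integrable (online G \<pi>) (\<lambda>w. u (state_of (w t)))"
    and integrable_mix: "integrable (online G \<pi>) (\<lambda>w. \<Sum>a\<in>UNIV. pmf (\<pi> t (past t w) (state_of (w t))) a * T a u (state_of (w t)))"
    and abs_state: "\<bar>LINT w|online G \<pi>. u (state_of (w t))\<bar> \<le> V"
    and abs_reward: "\<bar>LINT w|online G \<pi>. rew_of (w t)\<bar> \<le> V"
    and abs_adv: "\<bar>adv \<pi> u t\<bar> \<le> 2 * V"
proof -
  let ?\<Omega> = "online G \<pi>"
  note \<alpha> = admissible_online[OF \<pi>]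
  interpret prob_space ?\<Omega> unfolding online_def by (rule prob_path_law[OF \<alpha>])
  note S[measurable_cong] = sets_path_law[OF \<alpha>, folded online_def]
  have [measurable]: "u \<in> borel_measurable (St G)" using u by (simp add: bdd_def)
  have um: "(\<lambda>w. u (state_of (w t))) \<in> borel_measurable ?\<Omega>" for t by measurable
  have ub: "\<bar>u (state_of (w t))\<bar> \<le> V" for w :: "nat \<Rightarrow> ('s, 'c, 'a, 'm) full" and t
    using u by (simp add: bdd_def)
  show iu: "integrable ?\<Omega> (\<lambda>w. u (state_of (w t)))" for t
    by (rule integrable_const_bound[of _ V]) (use ub um in auto)
  have abs_le: "\<bar>LINT w|?\<Omega>. f w\<bar> \<le> B" if "integrable ?\<Omega> f" "AE w in ?\<Omega>. \<bar>f w\<bar> \<le> B" for f :: "_ \<Rightarrow> real" and B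
    using integral_abs_bound[of ?\<Omega> f] integral_le_const[OF integrable_abs[OF that(1)] that(2)] by linarith
  show "\<bar>LINT w|?\<Omega>. u (state_of (w t))\<bar> \<le> V"
    by (rule abs_le[OF iu]) (use ub in auto)
  note step = path_law_step_integral[OF \<alpha>, of _ V, folded online_def]
  have r: "(\<lambda>w. rew_of (w t) + \<gamma> * u (state_of (w (Suc t)))) = (\<lambda>w. (\<lambda>z. rew_of (fst z) + \<gamma> * u (snd z)) (w t, state_of (w (Suc t))))"
    by simp
  note st = step[of "\<lambda>z. rew_of (fst z) + \<gamma> * u (snd z)" t, OF _ integrable_transition(2)[OF u], simplified]
  have i1: "integrable ?\<Omega> (\<lambda>w. rew_of (w t) + \<gamma> * u (state_of (w (Suc t))))"
    using st(1) by simp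
  have ir: "integrable ?\<Omega> (\<lambda>w. rew_of (w t))"
    using Bochner_Integration.integrable_diff[OF i1 integrable_mult_right[OF iu[of "Suc t"], of \<gamma>]] by simp
  show im: "integrable ?\<Omega> (\<lambda>w. \<Sum>a\<in>UNIV. pmf (\<pi> t (past t w) (state_of (w t))) a * T a u (state_of (w t)))"
    using st(2) by (simp add: transition_online_integral[OF u])
  have "(LINT w|?\<Omega>. rew_of (w t) + \<gamma> * u (state_of (w (Suc t)))) =
    (LINT w|?\<Omega>. (\<Sum>a\<in>UNIV. pmf (\<pi> t (past t w) (state_of (w t))) a * T a u (state_of (w t))))"
    using st(3) by (simp add: transition_online_integral[OF u])
  then show "(LINT w|?\<Omega>. rew_of (w t)) + \<gamma> * (LINT w|?\<Omega>. u (state_of (w (Suc t)))) =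
      (LINT w|?\<Omega>. u (state_of (w t))) + adv \<pi> u t"
    unfolding adv_def
    by (subst Bochner_Integration.integral_diff[OF im iu]) (simp add: Bochner_Integration.integral_add[OF ir integrable_mult_right[OF iu]])
  have "\<bar>(\<Sum>a\<in>UNIV. pmf (\<pi> t (past t w) (state_of (w t))) a * T a u (state_of (w t))) - u (state_of (w t))\<bar> \<le> 2 * V" for w :: "nat \<Rightarrow> ('s, 'c, 'a, 'm) full"
    using convex_abs_le[where f="\<lambda>a. T a u (state_of (w t))" and B=V and p="\<pi> t (past t w) (state_of (w t))", OF abs_T[OF u]] ub[of w t]
    unfolding abs_le_iff by linarith
  then show "\<bar>adv \<pi> u t\<bar> \<le> 2 * V"
    unfolding adv_def by (intro abs_le Bochner_Integration.integrable_diff im iu) auto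
  have rm: "(\<lambda>z. rew_of (fst z)) \<in> borel_measurable (fullM G \<Otimes>\<^sub>M St G)" by measurable
  have rb: "AE z in transition_law G \<beta> s. \<bar>rew_of (fst z)\<bar> \<le> V" if "action_kernel \<beta>" for \<beta> s
    using AE_transition_reward[OF that] by eventually_elim (use Rmax_le_V in linarith)
  have "abs (LINT z|transition_law G (\<lambda>c. \<pi> t (past t w) (state_of (w t))) (state_of (w t)). rew_of (fst z)) \<le> V" for w :: "nat \<Rightarrow> ('s, 'c, 'a, 'm) full"
  proof -
    have "(LINT z|transition_law G (\<lambda>c. \<pi> t (past t w) (state_of (w t))) (state_of (w t)). rew_of (fst z) + \<gamma> * (\<lambda>s. 0) (snd z))
      = (\<Sum>a\<in>UNIV. pmf (\<pi> t (past t w) (state_of (w t))) a * T a (\<lambda>s. 0) (state_of (w t)))"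
      by (rule transition_online_integral[OF bdd_const_0])
    then show ?thesis
      using convex_abs_le[OF abs_T[OF bdd_const_0]] by simp
  qed
  then show "\<bar>LINT w|?\<Omega>. rew_of (w t)\<bar> \<le> V"
    using abs_le[OF step(2)[OF rm rb]] step(3)[OF rm rb, of t] by simp
qed

text \<open>Performance difference identity with an arbitrary bounded baseline: the discounted
  expectations of \<open>u\<close> telescope, and boundedness removes the contribution at
  infinity.\<close>

lemma J_adv:
  assumes \<pi>: "\<pi> \<in> policies G" and u: "bdd u"
  shows "(\<lambda>t. \<gamma> ^ t * adv \<pi> u t) sums (J G \<pi> - (LINT s|rho0 G. u s))"
proof -
  let ?e = "\<lambda>t. LINT w|online G \<pi>. u (state_of (w t))"
  let ?r = "\<lambda>t. LINT w|online G \<pi>. rew_of (w t)"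
  have [measurable]: "u \<in> borel_measurable (St G)" using u by (simp add: bdd_def)
  note S[measurable_cong] = sets_path_law[OF admissible_online[OF \<pi>], folded online_def]
  have geo: "summable (\<lambda>t. V * \<gamma> ^ t)"
    using disc_nonneg disc_less by (intro summable_mult summable_geometric) auto
  have "summable (\<lambda>t. \<gamma> ^ t * ?r t)"
  proof (rule summable_comparison_test'[OF geo])
    show "norm (\<gamma> ^ t * ?r t) \<le> V * \<gamma> ^ t" for t
      using mult_left_mono[OF abs_reward[OF \<pi> u, of t], of "\<gamma> ^ t"] disc_nonneg
      by (simp add: abs_mult mult.commute)
  qed
  then have 1: "(\<lambda>t. \<gamma> ^ t * ?r t) sums J G \<pi>" by (simp add: J_def summable_sums)
  have "(\<lambda>t. \<gamma> ^ t * ?e t) \<longlonglongrightarrow> 0"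
  proof (rule Lim_null_comparison)
    show "\<forall>\<^sub>F t in sequentially. norm (\<gamma> ^ t * ?e t) \<le> V * \<gamma> ^ t"
      using mult_left_mono[OF abs_state[OF \<pi> u], of "\<gamma> ^ _"] disc_nonneg
      by (intro always_eventually allI) (simp add: abs_mult mult.commute)
    show "(\<lambda>t. V * \<gamma> ^ t) \<longlonglongrightarrow> 0"
      using geo by (rule summable_LIMSEQ_zero)
  qed
  from telescope_sums[OF this] have 2: "(\<lambda>t. \<gamma> ^ Suc t * ?e (Suc t) - \<gamma> ^ t * ?e t) sums (- ?e 0)"
    by simp
  have "\<gamma> ^ t * ?r t + (\<gamma> ^ Suc t * ?e (Suc t) - \<gamma> ^ t * ?e t) = \<gamma> ^ t * adv \<pi> u t" for t
    using arg_cong[OF adv_step[OF \<pi> u, of t], of "\<lambda>x. \<gamma> ^ t * x"] by (simp add: algebra_simps)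
  with sums_add[OF 1 2] have 3: "(\<lambda>t. \<gamma> ^ t * adv \<pi> u t) sums (J G \<pi> - ?e 0)"
    by simp
  have d: "distr (online G \<pi>) (St G) (\<lambda>w. state_of (w 0)) = rho0 G"
  proof (rule measure_eqI)
    fix A assume "A \<in> sets (distr (online G \<pi>) (St G) (\<lambda>w. state_of (w 0)))"
    then have [measurable]: "A \<in> sets (St G)" by simp
    have "emeasure (distr (online G \<pi>) (St G) (\<lambda>w. state_of (w 0))) A =
      (\<integral>\<^sup>+s. indicator A s \<partial>distr (online G \<pi>) (St G) (\<lambda>w. state_of (w 0)))" by simp
    also have "\<dots> = (\<integral>\<^sup>+w. indicator A (state_of (w 0)) \<partial>online G \<pi>)"
      by (rule nn_integral_distr) auto
    also have "\<dots> = emeasure (rho0 G) A" by (simp add: online_initial[OF \<pi>, where g="indicator A"])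
    finally show "emeasure (distr (online G \<pi>) (St G) (\<lambda>w. state_of (w 0))) A = emeasure (rho0 G) A" .
  qed simp
  have "?e 0 = (LINT s|rho0 G. u s)"
    unfolding d[symmetric] by (rule integral_distr[symmetric]) auto
  with 3 show ?thesis by simp
qed

lemma ac_next: "absolutely_continuous (St G) (next_law G x)"
  by (cases x) (simp add: ac_ps)

lemma sets_online: "\<pi> \<in> policies G \<Longrightarrow> sets (online G \<pi>) = sets trajM"
  unfolding online_def by (rule sets_path_law[OF admissible_online])

text \<open>Time zero uses absolute continuity of \<open>rho0\<close>, later times that of the
  transition kernels. It makes \<open>state_dens\<close> a genuine density, so that integrals
  against it are expectations.\<close>

lemma ac_state:
  assumes \<alpha>: "admissible \<alpha>"
  shows "absolutely_continuous (St G) (distr (path_law G \<alpha>) (St G) (\<lambda>w. state_of (w t)))"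
  unfolding absolutely_continuous_def
proof
  fix A assume A: "A \<in> null_sets (St G)"
  then have [measurable]: "A \<in> sets (St G)" by auto
  note S[measurable_cong] = sets_path_law[OF \<alpha>]
  have "emeasure (distr (path_law G \<alpha>) (St G) (\<lambda>w. state_of (w t))) A
    = (\<integral>\<^sup>+s. indicator A s \<partial>distr (path_law G \<alpha>) (St G) (\<lambda>w. state_of (w t)))" by simp
  also have "\<dots> = (\<integral>\<^sup>+w. indicator A (state_of (w t)) \<partial>path_law G \<alpha>)"
    by (rule nn_integral_distr) auto
  also have "\<dots> = 0"
  proof (cases t)
    case 0
    then show ?thesis
      using path_law_initial[OF \<alpha>, of "indicator A"] ac_rho0 A
      by (auto simp: absolutely_continuous_def)
  next
    case (Suc n)
    have "(\<integral>\<^sup>+w. indicator A (state_of (w t)) \<partial>path_law G \<alpha>) =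
      (\<integral>\<^sup>+w. (\<integral>\<^sup>+z. indicator A (snd z) \<partial>transition_law G (\<alpha> n (past n w) (state_of (w n))) (state_of (w n))) \<partial>path_law G \<alpha>)"
      using path_law_step[OF \<alpha>, of "\<lambda>z. indicator A (snd z)" n] Suc by simp
    also have "\<dots> = (\<integral>\<^sup>+w. 0 \<partial>path_law G \<alpha>)"
    proof (rule nn_integral_cong)
      fix w :: "nat \<Rightarrow> ('s, 'c, 'a, 'm) full"
      have z: "(\<integral>\<^sup>+s'. indicator A s' \<partial>next_law G x) = 0" for x
        using ac_next[of x] A by (subst nn_integral_indicator) (auto simp: absolutely_continuous_def sets_next)
      show "(\<integral>\<^sup>+z. indicator A (snd z) \<partial>transition_law G (\<alpha> n (past n w) (state_of (w n))) (state_of (w n))) = 0"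
        by (subst nn_transition_law[OF _ action_kernel_admissible[OF \<alpha> past_space]]) (auto simp: z)
    qed
    finally show ?thesis by simp
  qed
  finally show "A \<in> null_sets (distr (path_law G \<alpha>) (St G) (\<lambda>w. state_of (w t)))"
    by (intro null_setsI) auto
qed

lemma nn_visit_dens:
  assumes \<pi>: "\<pi> \<in> policies G" and g[measurable]: "g \<in> borel_measurable (St G)"
  shows "(\<integral>\<^sup>+s. visit_dens G \<pi> s * g s \<partial>St G) =
    ennreal (1 - \<gamma>) * (\<Sum>t. ennreal (\<gamma> ^ t) * (\<integral>\<^sup>+w. g (state_of (w t)) \<partial>online G \<pi>))"
proof -
  interpret sigma_finite_measure "St G" by (rule sigma_finite_St)
  note S[measurable_cong] = sets_online[OF \<pi>]
  have sd: "(\<integral>\<^sup>+s. state_dens G \<pi> t s * g s \<partial>St G) = (\<integral>\<^sup>+w. g (state_of (w t)) \<partial>online G \<pi>)" for t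
  proof -
    have "(\<integral>\<^sup>+s. state_dens G \<pi> t s * g s \<partial>St G) = (\<integral>\<^sup>+s. g s \<partial>distr (online G \<pi>) (St G) (\<lambda>w. state_of (w t)))"
      unfolding state_dens_def
      by (rule RN_deriv_nn_integral[symmetric]) (auto simp: online_def intro!: ac_state admissible_online[OF \<pi>])
    also have "\<dots> = (\<integral>\<^sup>+w. g (state_of (w t)) \<partial>online G \<pi>)"
      by (rule nn_integral_distr) auto
    finally show ?thesis .
  qed
  have [measurable]: "state_dens G \<pi> t \<in> borel_measurable (St G)" for t
    unfolding state_dens_def by measurable
  have "(\<integral>\<^sup>+s. visit_dens G \<pi> s * g s \<partial>St G) =
     (\<integral>\<^sup>+s. ennreal (1 - \<gamma>) * (\<Sum>t. ennreal (\<gamma> ^ t) * (state_dens G \<pi> t s * g s)) \<partial>St G)"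
    by (intro nn_integral_cong) (simp add: visit_dens_def mult.assoc ennreal_suminf_multc[symmetric])
  also have "\<dots> = ennreal (1 - \<gamma>) * (\<Sum>t. ennreal (\<gamma> ^ t) * (\<integral>\<^sup>+s. state_dens G \<pi> t s * g s \<partial>St G))"
    by (subst nn_integral_cmult, measurable, subst nn_integral_suminf, measurable, subst nn_integral_cmult, measurable)
  finally show ?thesis by (simp add: sd)
qed

section \<open>The stationary dataset\<close>

lemma tuple_of_eq: "tuple_of x x' = (state_of x, act_of x, med_of x, rew_of x, state_of x')"
  by (cases x) simp

lemma tuple_of_measurable[measurable (raw)]:
  assumes [measurable]: "f \<in> X \<rightarrow>\<^sub>M fullM G" "g \<in> X \<rightarrow>\<^sub>M fullM G"
  shows "(\<lambda>x. tuple_of (f x) (g x)) \<in> X \<rightarrow>\<^sub>M tupleM G"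
  unfolding tuple_of_eq tupleM_def by measurable

lemma sets_offline[measurable_cong]: "sets (offline G) = sets trajM"
  and prob_offline: "prob_space (offline G)"
  unfolding offline_def by (rule sets_path_law[OF admissible_offline], rule prob_path_law[OF admissible_offline])

lemma space_offline[simp]: "space (offline G) = UNIV"
  using sets_eq_imp_space_eq[OF sets_offline] by simp

lemma obs_traj_measurable[measurable]: "(\<lambda>w i. obs_of (w (i + k))) \<in> trajM \<rightarrow>\<^sub>M PiM UNIV (\<lambda>_. obsM G)"
  by (rule measurable_PiM_single') (auto simp: PiE_def Pi_def)

text \<open>Stationarity concerns the observed process, and a tuple is a function of two consecutive
  observations.\<close>

lemma offline_shift:
  assumes "offline_stationary G" and F[measurable]: "F \<in> borel_measurable (tupleM G)"
  shows "(\<integral>\<^sup>+w. F (tuple_of (w t) (w (Suc t))) \<partial>offline G) = (\<integral>\<^sup>+w. F (tuple_of (w 0) (w (Suc 0))) \<partial>offline G)"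
proof -
  define H where "H h = (case h (0::nat) of (s, a, m, r) \<Rightarrow> F (s, a, m, r, fst (h (1::nat))))" for h :: "nat \<Rightarrow> ('s, 'a, 'm) obs"
  have H_obs: "H (\<lambda>i. obs_of (w (i + k))) = F (tuple_of (w k) (w (Suc k)))" for w :: "nat \<Rightarrow> ('s, 'c, 'a, 'm) full" and k
    by (simp add: H_def tuple_of_eq obs_of_eq state_of_eq act_of_eq med_of_eq rew_of_eq split_beta)
  have [measurable]: "(\<lambda>h. h i) \<in> PiM UNIV (\<lambda>_. obsM G) \<rightarrow>\<^sub>M St G \<Otimes>\<^sub>M count_space UNIV \<Otimes>\<^sub>M count_space UNIV \<Otimes>\<^sub>M borel" for i :: nat
    unfolding obsM_def[symmetric] by measurable
  have [measurable]: "F \<in> borel_measurable (St G \<Otimes>\<^sub>M count_space UNIV \<Otimes>\<^sub>M count_space UNIV \<Otimes>\<^sub>M borel \<Otimes>\<^sub>M St G)"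
    using F by (simp add: tupleM_def)
  have Hm: "H \<in> borel_measurable (PiM UNIV (\<lambda>_. obsM G))"
    unfolding H_def split_beta by measurable
  have "(\<integral>\<^sup>+w. F (tuple_of (w k) (w (Suc k))) \<partial>offline G) =
     (\<integral>\<^sup>+h. H h \<partial>distr (offline G) (PiM UNIV (\<lambda>_. obsM G)) (\<lambda>w i. obs_of (w (i + k))))" for k
    by (subst nn_integral_distr) (use Hm in \<open>auto simp: H_obs cong: measurable_cong_sets\<close>)
  from this[of t] this[of 0] show ?thesis
    using assms(1) by (simp add: offline_stationary_def)
qed

lemma offline_state:
  assumes st: "offline_stationary G" and g[measurable]: "g \<in> borel_measurable (St G)"
  shows "(\<integral>\<^sup>+w. g (state_of (w t)) \<partial>offline G) = (\<integral>\<^sup>+s. g s \<partial>rho0 G)"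
proof -
  have F: "(\<lambda>x. g (fst x)) \<in> borel_measurable (tupleM G)" unfolding tupleM_def by measurable
  have "(\<integral>\<^sup>+w. g (state_of (w t)) \<partial>offline G) = (\<integral>\<^sup>+w. g (state_of (w 0)) \<partial>offline G)"
    using offline_shift[OF st F, of t] by (simp add: tuple_of_eq)
  then show ?thesis
    unfolding offline_def using path_law_initial[OF admissible_offline g] by simp
qed

lemma offline_state_distr:
  assumes st: "offline_stationary G"
  shows "distr (offline G) (St G) (\<lambda>w. state_of (w t)) = rho0 G"
proof (rule measure_eqI)
  fix A assume "A \<in> sets (distr (offline G) (St G) (\<lambda>w. state_of (w t)))"
  then have [measurable]: "A \<in> sets (St G)" by simp
  have "emeasure (distr (offline G) (St G) (\<lambda>w. state_of (w t))) A =
    (\<integral>\<^sup>+s. indicator A s \<partial>distr (offline G) (St G) (\<lambda>w. state_of (w t)))" by simp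
  also have "\<dots> = (\<integral>\<^sup>+w. indicator A (state_of (w t)) \<partial>offline G)"
    by (rule nn_integral_distr) auto
  also have "\<dots> = emeasure (rho0 G) A" by (simp add: offline_state[OF st, where g="indicator A"])
  finally show "emeasure (distr (offline G) (St G) (\<lambda>w. state_of (w t))) A = emeasure (rho0 G) A" .
qed simp

definition dataM :: "nat list \<Rightarrow> (nat \<Rightarrow> nat \<Rightarrow> ('s, 'c, 'a, 'm) full) measure" where
  "dataM L = PiM {..<length L} (\<lambda>_. offline G)"

definition tuples :: "nat list \<Rightarrow> (nat \<Rightarrow> nat \<Rightarrow> ('s, 'c, 'a, 'm) full) \<Rightarrow> ('s, 'a, 'm) dataset" where
  "tuples L w = restrict (\<lambda>(j, t). tuple_of (w j t) (w j (Suc t))) (data_idx L)"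

lemma data_law_eq: "data_law G L = distr (dataM L) (PiM (data_idx L) (\<lambda>_. tupleM G)) (tuples L)"
  by (simp add: data_law_def dataM_def tuples_def[abs_def])

lemma finite_data_idx[simp]: "finite (data_idx L)"
  by (simp add: data_idx_def)

lemma dataM_traj: "j < length L \<Longrightarrow> (\<lambda>w. w j) \<in> dataM L \<rightarrow>\<^sub>M trajM"
  unfolding dataM_def by (subst measurable_cong_sets[OF refl sets_offline[symmetric]]) (rule measurable_component_singleton, simp)

lemma dataM_offline: "j < length L \<Longrightarrow> (\<lambda>w. w j) \<in> dataM L \<rightarrow>\<^sub>M offline G"
  unfolding measurable_cong_sets[OF refl sets_offline] by (rule dataM_traj)

lemma dataM_component: "j < length L \<Longrightarrow> (\<lambda>w. w j t) \<in> dataM L \<rightarrow>\<^sub>M fullM G"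
  using measurable_compose[OF dataM_traj traj_component] by simp

lemma tuples_measurable[measurable]: "tuples L \<in> dataM L \<rightarrow>\<^sub>M PiM (data_idx L) (\<lambda>_. tupleM G)"
  unfolding tuples_def[abs_def]
proof (rule measurable_restrict)
  fix i assume i: "i \<in> data_idx L"
  obtain j t where "i = (j, t)" by (cases i)
  with i have ij: "i = (j, t)" and j: "j < length L" by (auto simp: data_idx_def)
  show "(\<lambda>w. case i of (j, t) \<Rightarrow> tuple_of (w j t) (w j (Suc t))) \<in> dataM L \<rightarrow>\<^sub>M tupleM G"
    unfolding ij prod.case by (intro tuple_of_measurable dataM_component j)
qed

lemma prob_dataM: "prob_space (dataM L)"
  unfolding dataM_def by (intro prob_space_PiM prob_offline)

lemma dataM_marginal: "j < length L \<Longrightarrow> distr (dataM L) (offline G) (\<lambda>w. w j) = offline G"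
  unfolding dataM_def by (rule distr_PiM_component) (auto intro: prob_offline)

text \<open>Every state of a stationary dataset has law \<open>rho0 G\<close>, so identical
  derivatives are averaged. The equality is pointwise, not merely almost everywhere, because
  \<open>RN_deriv\<close> is a function of the two measures.\<close>

lemma rhoD_dens_eq:
  assumes st: "offline_stationary G" and N: "0 < card (data_idx L)"
  shows "rhoD_dens G L = RN_deriv (St G) (rho0 G)"
proof
  fix s
  have fst_tm: "fst \<in> tupleM G \<rightarrow>\<^sub>M St G" unfolding tupleM_def by measurable
  have "distr (data_law G L) (St G) (\<lambda>d. fst (d i)) = rho0 G" if i: "i \<in> data_idx L" for i
  proof -
    obtain j t where jt: "i = (j, t)" by (cases i)
    then have j: "j < length L" using i by (auto simp: data_idx_def)
    have "(\<lambda>d. fst (d i)) \<in> PiM (data_idx L) (\<lambda>_. tupleM G) \<rightarrow>\<^sub>M St G"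
      using measurable_compose[OF measurable_component_singleton[OF i] fst_tm] .
    then have "distr (data_law G L) (St G) (\<lambda>d. fst (d i)) = distr (dataM L) (St G) (\<lambda>w. state_of (w j t))"
      unfolding data_law_eq using i jt
      by (subst distr_distr) (auto simp: comp_def tuples_def tuple_of_eq)
    also have "\<dots> = distr (distr (dataM L) (offline G) (\<lambda>w. w j)) (St G) (\<lambda>w. state_of (w t))"
      by (subst distr_distr[OF _ dataM_offline[OF j]]) (measurable, simp add: comp_def)
    finally show ?thesis by (simp add: dataM_marginal[OF j] offline_state_distr[OF st])
  qed
  then have "rhoD_dens G L s = (of_nat (card (data_idx L)) * RN_deriv (St G) (rho0 G) s) / of_nat (card (data_idx L))"
    unfolding rhoD_dens_def by simp
  also have "\<dots> = RN_deriv (St G) (rho0 G) s"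
  proof -
    have "of_nat (card (data_idx L)) \<noteq> (0::ennreal)" "of_nat (card (data_idx L)) \<noteq> (top::ennreal)"
      using N by (auto simp del: card_0_eq)
    then show ?thesis by (subst mult.commute) (rule ennreal_mult_divide_eq)
  qed
  finally show "rhoD_dens G L s = RN_deriv (St G) (rho0 G) s" .
qed

lemma rhoD_eq:
  assumes "offline_stationary G" "0 < card (data_idx L)"
  shows "rhoD G L = rho0 G"
  unfolding rhoD_def rhoD_dens_eq[OF assms]
  by (rule sigma_finite_measure.density_RN_deriv[OF sigma_finite_St ac_rho0]) simp

text \<open>The essential bound on the ratio is multiplied by the dataset density, which is finite
  almost everywhere since \<open>rho0\<close> has mass one. Where this density vanishes, finiteness
  of \<open>c1\<close> forces the visitation density to vanish as well.\<close>

lemma visit_le_c1: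
  assumes st: "offline_stationary G" and N: "0 < card (data_idx L)" and c: "c1 G L < \<infinity>"
    and \<sigma>: "\<sigma> \<in> stationary_rules G" and g[measurable]: "g \<in> borel_measurable (St G)"
  shows "(\<integral>\<^sup>+s. visit_dens G (stationary \<sigma>) s * g s \<partial>St G) \<le> c1 G L * (\<integral>\<^sup>+s. g s \<partial>rho0 G)"
proof -
  interpret sigma_finite_measure "St G" by (rule sigma_finite_St)
  interpret rho0: prob_space "rho0 G" by (rule prob_rho0)
  let ?f = "RN_deriv (St G) (rho0 G)"
  have rn: "(\<integral>\<^sup>+s. h s \<partial>rho0 G) = (\<integral>\<^sup>+s. ?f s * h s \<partial>St G)" if "h \<in> borel_measurable (St G)" for h
    by (rule RN_deriv_nn_integral[OF ac_rho0 _ that]) simp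
  have "(\<integral>\<^sup>+s. ?f s \<partial>St G) = 1"
    using rn[of "\<lambda>s. 1"] rho0.emeasure_space_1 by simp
  then have fin: "AE s in St G. ?f s \<noteq> \<infinity>"
    by (intro nn_integral_PInf_AE) auto
  have "esssup (St G) (\<lambda>s. visit_dens G (stationary \<sigma>) s / rhoD_dens G L s) \<le> c1 G L"
    unfolding c1_def by (rule SUP_upper[OF \<sigma>])
  then have "AE s in St G. visit_dens G (stationary \<sigma>) s / ?f s \<le> c1 G L"
    using esssup_AE[of "\<lambda>s. visit_dens G (stationary \<sigma>) s / rhoD_dens G L s" "St G"]
    unfolding rhoD_dens_eq[OF st N] by (auto elim: eventually_mono intro: order_trans)
  with fin have "AE s in St G. visit_dens G (stationary \<sigma>) s \<le> c1 G L * ?f s"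
  proof eventually_elim
    case (elim s)
    show ?case
    proof (cases "?f s = 0")
      case True
      then show ?thesis using elim c by (auto split: if_splits)
    next
      case False
      then have "visit_dens G (stationary \<sigma>) s = visit_dens G (stationary \<sigma>) s / ?f s * ?f s"
        using elim by (simp add: ennreal_divide_times top.not_eq_extremum)
      also have "\<dots> \<le> c1 G L * ?f s" by (intro mult_right_mono elim) auto
      finally show ?thesis .
    qed
  qed
  then have "(\<integral>\<^sup>+s. visit_dens G (stationary \<sigma>) s * g s \<partial>St G) \<le> (\<integral>\<^sup>+s. c1 G L * (?f s * g s) \<partial>St G)"
    by (intro nn_integral_mono_AE) (auto elim!: eventually_mono simp: mult.assoc[symmetric] intro: mult_right_mono)
  also have "\<dots> = c1 G L * (\<integral>\<^sup>+s. g s \<partial>rho0 G)"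
    by (simp add: nn_integral_cmult rn)
  finally show ?thesis .
qed

lemma geometric_suminf: "(\<Sum>t. ennreal (\<gamma> ^ t)) = ennreal (1 / (1 - \<gamma>))"
  using disc_nonneg disc_less by (simp add: suminf_ennreal2 suminf_geometric)

lemma prob_online: "\<pi> \<in> policies G \<Longrightarrow> prob_space (online G \<pi>)"
  unfolding online_def by (rule prob_path_law[OF admissible_online])

text \<open>Both densities integrate to one, as the case of a constant integrand shows. It allows
  the factor \<open>esqrt (c1 G L)\<close> to be inserted into terms that are bounded without
  it.\<close>

lemma c1_ge_1:
  assumes st: "offline_stationary G" and N: "0 < card (data_idx L)" and c: "c1 G L < \<infinity>"
  shows "1 \<le> c1 G L"
proof -
  let ?\<sigma> = "\<lambda>s. undefined :: 'a pmf"
  have \<sigma>: "?\<sigma> \<in> stationary_rules G" by (simp add: stationary_rules_def)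
  note \<pi> = stationary_in_policies[OF \<sigma>]
  interpret prob_space "online G (stationary ?\<sigma>)" by (rule prob_online[OF \<pi>])
  interpret rho0: prob_space "rho0 G" by (rule prob_rho0)
  have "(\<integral>\<^sup>+s. visit_dens G (stationary ?\<sigma>) s * 1 \<partial>St G) = ennreal (1 - \<gamma>) * (\<Sum>t. ennreal (\<gamma> ^ t))"
    using nn_visit_dens[OF \<pi>, of "\<lambda>s. 1"] by (simp add: emeasure_space_1)
  also have "\<dots> = 1"
    using disc_less by (simp add: geometric_suminf ennreal_mult[symmetric])
  finally show ?thesis
    using visit_le_c1[OF st N c \<sigma>, of "\<lambda>s. 1"] rho0.emeasure_space_1 by simp
qed

text \<open>The uniform distribution on all maximising actions avoids a measurable selection: its
  point masses are explicit functions of finitely many measurable comparisons.\<close>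

lemma greedy_rule:
  assumes g[measurable]: "g \<in> borel_measurable (St G)"
  shows "\<exists>\<sigma>\<in>stationary_rules G. \<forall>s. (\<Sum>a\<in>UNIV. ennreal (pmf (\<sigma> s) a) * (\<Sum>m\<in>UNIV. ennreal (pmf (med s a) m) * (\<integral>\<^sup>+z. g (snd z) \<partial>effect s m))) = Tb g s"
proof -
  let ?f = "\<lambda>a s. \<Sum>m\<in>UNIV. ennreal (pmf (med s a) m) * (\<integral>\<^sup>+z. g (snd z) \<partial>effect s m)"
  let ?A = "\<lambda>s. {a. ?f a s = Tb g s}"
  have ne: "?A s \<noteq> {}" for s
  proof -
    obtain a where "Tb g s = ?f a s" by (rule Tb_attained)
    then have "a \<in> ?A s" by simp
    then show ?thesis by (rule ex_in_conv[THEN iffD1, OF exI])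
  qed
  define \<sigma> where "\<sigma> s = pmf_of_set (?A s)" for s
  have [measurable]: "?f a \<in> borel_measurable (St G)" for a
    using nn_effect_measurable[OF g] by measurable
  have pm: "pmf (\<sigma> s) a = (if ?f a s = Tb g s then 1 else 0) / (\<Sum>b\<in>UNIV. if ?f b s = Tb g s then 1 else 0)" for s a
  proof -
    have "real (card (?A s)) = (\<Sum>b\<in>UNIV. if ?f b s = Tb g s then 1 else 0)"
      by (simp add: sum.If_cases)
    then show ?thesis by (simp add: \<sigma>_def pmf_of_set[OF ne] indicator_def)
  qed
  show ?thesis
  proof (intro bexI[of _ \<sigma>] allI)
    have "(\<lambda>s. pmf (\<sigma> s) a) \<in> borel_measurable (St G)" for a
      unfolding pm by measurable
    then show "\<sigma> \<in> stationary_rules G"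
      by (simp add: stationary_rules_def)
    fix s
    have "(\<Sum>a\<in>UNIV. ennreal (pmf (\<sigma> s) a) * ?f a s) = (\<Sum>a\<in>UNIV. ennreal (pmf (\<sigma> s) a) * Tb g s)"
      by (intro sum.cong refl) (simp add: pm)
    then show "(\<Sum>a\<in>UNIV. ennreal (pmf (\<sigma> s) a) * ?f a s) = Tb g s"
      by (simp add: sum_distrib_right[symmetric] sum_pmf_1)
  qed
qed

text \<open>
  The value iteration for the running reward \<open>g\<close> is almost attained by a greedy stationary policy, so
  \<open>c1\<close>, a supremum over stationary policies, also controls history-dependent ones.
\<close>

lemma Tpow_le_c1:
  assumes st: "offline_stationary G" and N: "0 < card (data_idx L)" and c: "c1 G L < \<infinity>"
    and g[measurable]: "g \<in> borel_measurable (St G)" and B: "\<And>s. g s \<le> ennreal B" and B0: "0 \<le> B"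
  shows "ennreal (1 - \<gamma>) * (\<integral>\<^sup>+s. Tpow n g s \<partial>rho0 G) \<le> c1 G L * (\<integral>\<^sup>+s. g s \<partial>rho0 G)"
proof -
  interpret rho0: prob_space "rho0 G" by (rule prob_rho0)
  \<comment> \<open>Value iteration from zero with running reward \<open>g\<close>; the supremum
    \<open>W\<close> of the iterates stands for the optimal discounted total of
    \<open>g\<close>.\<close>
  define U where "U n = ((\<lambda>h s. g s + ennreal \<gamma> * Tb h s) ^^ n) (\<lambda>s. 0)" for n :: nat
  have U0: "U 0 = (\<lambda>s. 0)" and US: "U (Suc n) = (\<lambda>s. g s + ennreal \<gamma> * Tb (U n) s)" for n
    by (auto simp: U_def)
  have Um[measurable]: "U n \<in> borel_measurable (St G)" for n
    by (induction n) (auto simp: U0 US)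
  define C where "C = ennreal (B / (1 - \<gamma>))"
  have C: "ennreal B + ennreal \<gamma> * C = C"
    using B0 disc_nonneg disc_less by (simp add: C_def ennreal_mult[symmetric] ennreal_plus[symmetric] field_simps del: ennreal_plus)
  have UC: "U n s \<le> C" for n s
  proof (induction n arbitrary: s)
    case (Suc n)
    have "U (Suc n) s \<le> ennreal B + ennreal \<gamma> * Tb (\<lambda>s. C) s"
      unfolding US by (intro add_mono B mult_left_mono Tb_mono Suc) auto
    then show ?case by (simp add: Tb_const C)
  qed (simp add: U0)
  define W where "W s = (SUP n. U n s)" for s
  have Wm[measurable]: "W \<in> borel_measurable (St G)" unfolding W_def by measurable
  have WC: "W s \<le> C" for s unfolding W_def by (intro SUP_least UC)
  have UW: "U n s \<le> W s" for n s unfolding W_def by (rule SUP_upper) simp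
  \<comment> \<open>This half of the optimality equation allows \<open>W\<close> to be unrolled
    along a policy that is greedy for it.\<close>
  have W_le: "W s \<le> g s + ennreal \<gamma> * Tb W s" for s
    unfolding W_def[of s]
  proof (rule SUP_least)
    fix n show "U n s \<le> g s + ennreal \<gamma> * Tb W s"
      by (cases n) (auto simp: U0 US intro!: add_left_mono mult_left_mono Tb_mono UW)
  qed
  have "Tpow n g s \<le> U (Suc n) s" for n s
  proof (induction n arbitrary: s)
    case (Suc n)
    have "Tpow (Suc n) g s \<le> ennreal \<gamma> * Tb (U (Suc n)) s"
      unfolding Tpow_Suc by (intro mult_left_mono Tb_mono Suc) auto
    also have "\<dots> \<le> U (Suc (Suc n)) s" unfolding US[of "Suc n"] by simp
    finally show ?case .
  qed (simp add: US)
  then have TW: "Tpow n g s \<le> W s" for s using UW order_trans by blast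
  obtain \<sigma> where \<sigma>: "\<sigma> \<in> stationary_rules G"
    and gr: "\<And>s. (\<Sum>a\<in>UNIV. ennreal (pmf (\<sigma> s) a) * (\<Sum>m\<in>UNIV. ennreal (pmf (med s a) m) * (\<integral>\<^sup>+z. W (snd z) \<partial>effect s m))) = Tb W s"
    using greedy_rule[OF Wm] by blast
  note \<pi> = stationary_in_policies[OF \<sigma>]
  note \<alpha> = admissible_online[OF \<pi>]
  let ?\<Omega> = "online G (stationary \<sigma>)"
  interpret O: prob_space ?\<Omega> by (rule prob_online[OF \<pi>])
  note S[measurable_cong] = sets_online[OF \<pi>]
  have step: "(\<integral>\<^sup>+w. Tb W (state_of (w t)) \<partial>?\<Omega>) = (\<integral>\<^sup>+w. W (state_of (w (Suc t))) \<partial>?\<Omega>)" for t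
    using path_law_step[OF \<alpha>, of "\<lambda>z. W (snd z)" t, folded online_def]
      nn_transition_online[of "\<lambda>a m z. W (snd z)"]
    by (simp add: gr stationary_def)
  have one: "(\<integral>\<^sup>+w. W (state_of (w t)) \<partial>?\<Omega>) \<le> (\<integral>\<^sup>+w. g (state_of (w t)) \<partial>?\<Omega>) + ennreal \<gamma> * (\<integral>\<^sup>+w. W (state_of (w (Suc t))) \<partial>?\<Omega>)" for t
  proof -
    have "(\<integral>\<^sup>+w. W (state_of (w t)) \<partial>?\<Omega>) \<le> (\<integral>\<^sup>+w. g (state_of (w t)) + ennreal \<gamma> * Tb W (state_of (w t)) \<partial>?\<Omega>)"
      by (intro nn_integral_mono W_le)
    also have "\<dots> = (\<integral>\<^sup>+w. g (state_of (w t)) \<partial>?\<Omega>) + ennreal \<gamma> * (\<integral>\<^sup>+w. Tb W (state_of (w t)) \<partial>?\<Omega>)"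
      by (subst nn_integral_add) (auto simp: nn_integral_cmult)
    finally show ?thesis by (simp add: step)
  qed
  \<comment> \<open>Unrolling k times leaves a remainder of at most \<gamma> ^ k times the uniform
    bound \<open>C\<close> on \<open>W\<close>, which vanishes as k grows.\<close>
  have many: "(\<integral>\<^sup>+s. W s \<partial>rho0 G) \<le> (\<Sum>t<k. ennreal (\<gamma> ^ t) * (\<integral>\<^sup>+w. g (state_of (w t)) \<partial>?\<Omega>)) + ennreal (\<gamma> ^ k) * (\<integral>\<^sup>+w. W (state_of (w k)) \<partial>?\<Omega>)" for k
  proof (induction k)
    case 0
    then show ?case by (simp add: online_initial[OF \<pi>])
  next
    case (Suc k)
    have "ennreal (\<gamma> ^ k) * (\<integral>\<^sup>+w. W (state_of (w k)) \<partial>?\<Omega>) \<le>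
      ennreal (\<gamma> ^ k) * ((\<integral>\<^sup>+w. g (state_of (w k)) \<partial>?\<Omega>) + ennreal \<gamma> * (\<integral>\<^sup>+w. W (state_of (w (Suc k))) \<partial>?\<Omega>))"
      by (intro mult_left_mono one) auto
    also have "\<dots> = ennreal (\<gamma> ^ k) * (\<integral>\<^sup>+w. g (state_of (w k)) \<partial>?\<Omega>) + ennreal (\<gamma> ^ Suc k) * (\<integral>\<^sup>+w. W (state_of (w (Suc k))) \<partial>?\<Omega>)"
      using disc_nonneg by (simp add: distrib_left ennreal_mult mult_ac)
    finally show ?case
      using Suc by (auto simp: add.assoc intro: order_trans add_left_mono)
  qed
  let ?s = "\<Sum>t. ennreal (\<gamma> ^ t) * (\<integral>\<^sup>+w. g (state_of (w t)) \<partial>?\<Omega>)"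
  have le: "(\<integral>\<^sup>+s. W s \<partial>rho0 G) \<le> ?s + ennreal (\<gamma> ^ k * (B / (1 - \<gamma>)))" for k
  proof -
    have "(\<integral>\<^sup>+w. W (state_of (w k)) \<partial>?\<Omega>) \<le> (\<integral>\<^sup>+w. C \<partial>?\<Omega>)"
      by (intro nn_integral_mono WC)
    also have "\<dots> = C" by (simp add: O.emeasure_space_1)
    finally have "ennreal (\<gamma> ^ k) * (\<integral>\<^sup>+w. W (state_of (w k)) \<partial>?\<Omega>) \<le> ennreal (\<gamma> ^ k) * C"
      by (intro mult_left_mono) auto
    also have "\<dots> = ennreal (\<gamma> ^ k * (B / (1 - \<gamma>)))"
      using disc_nonneg B0 disc_less by (simp add: C_def ennreal_mult[symmetric])
    finally show ?thesis
      using many[of k] by (elim order_trans) (intro add_mono sum_le_suminf, auto)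
  qed
  have "(\<integral>\<^sup>+s. W s \<partial>rho0 G) \<le> ?s"
  proof (rule ennreal_le_epsilon)
    fix e :: real assume e: "0 < e"
    have "(\<lambda>k. \<gamma> ^ k * (B / (1 - \<gamma>))) \<longlonglongrightarrow> 0 * (B / (1 - \<gamma>))"
      using disc_nonneg disc_less by (intro tendsto_mult LIMSEQ_realpow_zero) auto
    then have "\<forall>\<^sub>F k in sequentially. \<gamma> ^ k * (B / (1 - \<gamma>)) < e"
      using e by (auto dest: order_tendstoD(2))
    then obtain k where "\<gamma> ^ k * (B / (1 - \<gamma>)) < e"
      using eventually_happens sequentially_bot by blast
    then show "(\<integral>\<^sup>+s. W s \<partial>rho0 G) \<le> ?s + ennreal e"
      using le[of k] by (elim order_trans) (auto intro!: add_left_mono ennreal_leI)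
  qed
  then have "ennreal (1 - \<gamma>) * (\<integral>\<^sup>+s. Tpow n g s \<partial>rho0 G) \<le> ennreal (1 - \<gamma>) * ?s"
    by (intro mult_left_mono order_trans[OF nn_integral_mono[OF TW]]) auto
  also have "\<dots> \<le> c1 G L * (\<integral>\<^sup>+s. g s \<partial>rho0 G)"
    using visit_le_c1[OF st N c \<sigma> g] nn_visit_dens[OF \<pi> g] by simp
  finally show ?thesis .
qed

end

section \<open>Exponential weights under beta-mixing\<close>

text \<open>\<open>g\<close> is approximated from above by a step function with n levels of equal
  height B / n at most e. Each level set costs \<beta> times this height, so the total cost is B
  \<beta> for every n.\<close>

lemma tv_nn_integral_le:
  fixes g :: "'z \<Rightarrow> real"
  assumes P: "prob_space P" and Q: "prob_space Q" and S: "sets P = sets M" "sets Q = sets M"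
    and g[measurable]: "g \<in> borel_measurable M" and g0: "\<And>z. 0 \<le> g z" and gB: "\<And>z. g z \<le> B"
    and \<beta>: "\<And>A. A \<in> sets M \<Longrightarrow> measure P A \<le> measure Q A + \<beta>"
  shows "(\<integral>\<^sup>+z. g z \<partial>P) \<le> (\<integral>\<^sup>+z. g z \<partial>Q) + ennreal (B * \<beta>)"
proof (rule ennreal_le_epsilon)
  fix e :: real assume e: "0 < e"
  interpret P: prob_space P by fact
  interpret Q: prob_space Q by fact
  note [measurable_cong] = S
  have B0: "0 \<le> B" using g0 gB order_trans by blast
  have \<beta>0: "0 \<le> \<beta>" using \<beta>[of "{}"] by simp
  obtain n :: nat where n: "B / e < real n" using reals_Archimedean2 by blast
  then have n0: "0 < n" using B0 e by (metis divide_nonneg_pos not_gr_zero of_nat_0 not_le)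
  define b where "b = B / real n"
  have b0: "0 \<le> b" using B0 by (simp add: b_def)
  have be: "b \<le> e" using n n0 e by (simp add: b_def field_simps)
  have bn: "b * real n = B" using n0 by (simp add: b_def)
  define h where "h z = (\<Sum>i<n. b * indicator {z \<in> space M. b * real i < g z} z)" for z
  \<comment> \<open>Adding b for each level strictly below x overshoots x by at most b; the
    induction runs over the number of levels.\<close>
  have count: "(\<Sum>i<n. if b * real i < x then b else 0) \<ge> x \<and> (\<Sum>i<n. if b * real i < x then b else 0) \<le> x + b"
    if x: "0 \<le> x" "x \<le> b * real n" for x
    using x
  proof (induction n)
    case (Suc n)
    show ?case
    proof (cases "x \<le> b * real n")
      case True
      then show ?thesis using Suc by auto
    next
      case False
      have "(\<Sum>i<n. if b * real i < x then b else 0) = (\<Sum>i<n. b)"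
      proof (rule sum.cong)
        fix i assume "i \<in> {..<n}"
        then have "b * real i \<le> b * real n" using b0 by (intro mult_left_mono) auto
        then show "(if b * real i < x then b else 0) = b" using False by auto
      qed simp
      then show ?thesis using Suc.prems False by (simp add: algebra_simps)
    qed
  qed (use b0 in auto)
  have h_eq: "h z = (\<Sum>i<n. if b * real i < g z then b else 0)" if "z \<in> space M" for z
    unfolding h_def using that by (intro sum.cong) auto
  have sp: "space P = space M" "space Q = space M" using S[THEN sets_eq_imp_space_eq] by auto
  have hge: "g z \<le> h z" and hle: "h z \<le> g z + b" if "z \<in> space M" for z
    using count[OF g0[of z]] gB[of z] bn h_eq[OF that] by auto
  have h0: "0 \<le> h z" for z unfolding h_def using b0 by (intro sum_nonneg) auto
  have int: "(\<integral>\<^sup>+z. h z \<partial>R) = ennreal (\<Sum>i<n. b * measure R {z \<in> space M. b * real i < g z})"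
    if R: "prob_space R" "sets R = sets M" for R
  proof -
    interpret R: prob_space R by fact
    note [measurable_cong] = R(2)
    have "(\<integral>\<^sup>+z. h z \<partial>R) = (\<integral>\<^sup>+z. (\<Sum>i<n. ennreal b * indicator {z \<in> space M. b * real i < g z} z) \<partial>R)"
      unfolding h_def using b0
      by (intro nn_integral_cong) (auto simp: sum_ennreal[symmetric] ennreal_mult indicator_def ennreal_of_nat_eq_real_of_nat intro!: sum.cong)
    also have "\<dots> = (\<Sum>i<n. ennreal b * emeasure R {z \<in> space M. b * real i < g z})"
      by (subst nn_integral_sum) (auto simp: nn_integral_cmult)
    also have "\<dots> = ennreal (\<Sum>i<n. b * measure R {z \<in> space M. b * real i < g z})"
      using b0 by (subst sum_ennreal[symmetric]) (auto simp: R.emeasure_eq_measure ennreal_mult)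
    finally show ?thesis .
  qed
  have "(\<integral>\<^sup>+z. g z \<partial>P) \<le> (\<integral>\<^sup>+z. h z \<partial>P)"
    by (intro nn_integral_mono ennreal_leI hge) (simp add: sp)
  also have "\<dots> \<le> ennreal (\<Sum>i<n. b * (measure Q {z \<in> space M. b * real i < g z} + \<beta>))"
    unfolding int[OF P S(1)] using b0 by (intro ennreal_leI sum_mono mult_left_mono \<beta>) auto
  also have "\<dots> = (\<integral>\<^sup>+z. h z \<partial>Q) + ennreal (B * \<beta>)"
    using b0 \<beta>0 B0 bn unfolding int[OF Q S(2)]
    by (subst ennreal_plus[symmetric]) (auto intro!: sum_nonneg simp: algebra_simps sum.distrib simp del: ennreal_plus)
  also have "(\<integral>\<^sup>+z. h z \<partial>Q) \<le> (\<integral>\<^sup>+z. ennreal (g z) + ennreal b \<partial>Q)"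
    using g0 b0 by (intro nn_integral_mono) (subst ennreal_plus[symmetric], auto simp: sp simp del: ennreal_plus intro!: ennreal_leI hle)
  also have "\<dots> = (\<integral>\<^sup>+z. g z \<partial>Q) + ennreal b"
    by (subst nn_integral_add) (auto simp: Q.emeasure_space_1)
  also have "ennreal b \<le> ennreal e" using be by (rule ennreal_leI)
  finally show "(\<integral>\<^sup>+z. g z \<partial>P) \<le> (\<integral>\<^sup>+z. g z \<partial>Q) + ennreal (B * \<beta>) + ennreal e"
    by (simp add: add_mono ac_simps)
qed

text \<open>
  The log-sum-exp of the cumulative scores telescopes into logarithms of posterior averages, and
  \<open>ln y \<le> y - 1\<close>.
\<close>

lemma log_sum_exp_le:
  fixes W :: "'f \<Rightarrow> 'i \<Rightarrow> real" and key :: "'i \<Rightarrow> nat"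
  assumes F: "finite F" "F \<noteq> {}" and I: "finite I" and key: "inj_on key I"
  shows "ln (\<Sum>f\<in>F. exp (\<Sum>i\<in>I. W f i)) \<le> ln (real (card F)) +
    (\<Sum>i\<in>I. (\<Sum>f\<in>F. exp (\<Sum>j | j \<in> I \<and> key j < key i. W f j) * exp (W f i)) /
       (\<Sum>f\<in>F. exp (\<Sum>j | j \<in> I \<and> key j < key i. W f j)) - 1)"
  using I key
proof (induction I rule: finite_ranking_induct[where f=key])
  case empty
  then show ?case using F by simp
next
  case (insert x S)
  show ?case
  proof (cases "x \<in> S")
    case True
    then show ?thesis using insert by (simp add: insert_absorb)
  next
    case False
    \<comment> \<open>The element inserted last has the largest key, so the sets of predecessors of
      all other elements are unchanged.\<close>
    have lt: "key y < key x" if "y \<in> S" for y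
      using insert.hyps(2)[OF that] insert.prems False that by (metis inj_onD insertI1 insertI2 le_neq_implies_less)
    have S1: "{j. j \<in> insert x S \<and> key j < key x} = S" using lt by auto
    have S2: "{j. j \<in> insert x S \<and> key j < key i} = {j. j \<in> S \<and> key j < key i}" if "i \<in> S" for i
      using lt[OF that] by auto
    let ?Z = "\<Sum>f\<in>F. exp (\<Sum>j\<in>S. W f j)"
    let ?Y = "\<Sum>f\<in>F. exp (\<Sum>j\<in>S. W f j) * exp (W f x)"
    have pos: "0 < ?Z" "0 < ?Y" using F by (auto intro!: sum_pos)
    have "ln (\<Sum>f\<in>F. exp (\<Sum>i\<in>insert x S. W f i)) = ln ?Y"
      using False insert.hyps(1) by (simp add: exp_add mult.commute)
    also have "\<dots> = ln ?Z + ln (?Y / ?Z)" using pos by (simp add: ln_div)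
    also have "ln (?Y / ?Z) \<le> ?Y / ?Z - 1" using pos by (intro ln_le_minus_one) auto
    also have "ln ?Z \<le> ln (real (card F)) +
      (\<Sum>i\<in>S. (\<Sum>f\<in>F. exp (\<Sum>j | j \<in> S \<and> key j < key i. W f j) * exp (W f i)) /
       (\<Sum>f\<in>F. exp (\<Sum>j | j \<in> S \<and> key j < key i. W f j)) - 1)"
      using insert.prems by (intro insert.IH) (auto simp: inj_on_def)
    finally have "ln (\<Sum>f\<in>F. exp (\<Sum>i\<in>insert x S. W f i)) \<le> ln (real (card F)) +
      (\<Sum>i\<in>S. (\<Sum>f\<in>F. exp (\<Sum>j | j \<in> S \<and> key j < key i. W f j) * exp (W f i)) /
       (\<Sum>f\<in>F. exp (\<Sum>j | j \<in> S \<and> key j < key i. W f j)) - 1) + (?Y / ?Z - 1)"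
      by simp
    also have "\<dots> = ln (real (card F)) +
      (\<Sum>i\<in>insert x S. (\<Sum>f\<in>F. exp (\<Sum>j | j \<in> insert x S \<and> key j < key i. W f j) * exp (W f i)) /
       (\<Sum>f\<in>F. exp (\<Sum>j | j \<in> insert x S \<and> key j < key i. W f j)) - 1)"
    proof -
      have "(\<Sum>i\<in>S. (\<Sum>f\<in>F. exp (\<Sum>j | j \<in> insert x S \<and> key j < key i. W f j) * exp (W f i)) /
         (\<Sum>f\<in>F. exp (\<Sum>j | j \<in> insert x S \<and> key j < key i. W f j)) - 1) =
        (\<Sum>i\<in>S. (\<Sum>f\<in>F. exp (\<Sum>j | j \<in> S \<and> key j < key i. W f j) * exp (W f i)) /
         (\<Sum>f\<in>F. exp (\<Sum>j | j \<in> S \<and> key j < key i. W f j)) - 1)"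
        by (rule sum.cong[OF refl]) (simp only: S2)
      then show ?thesis
        unfolding sum.insert[OF insert.hyps(1) False] S1 by simp
    qed
    finally show ?thesis .
  qed
qed

text \<open>Reduces an exponential moment to the first two moments. For negative arguments x = - y
  it follows from 1 + y \<le> exp y and (1 + y)(1 - y + y^2) = 1 + y^3.\<close>

lemma exp_le_quadratic:
  fixes x :: real
  assumes "\<bar>x\<bar> \<le> 1"
  shows "exp x \<le> 1 + x + x\<^sup>2"
proof (cases "0 \<le> x")
  case True
  then show ?thesis using exp_bound[of x] assms by simp
next
  case False
  define y where "y = - x"
  have y: "0 < y" "y \<le> 1" using False assms by (auto simp: y_def)
  have "1 + y \<le> exp y" by (rule exp_ge_add_one_self)
  moreover have "1 \<le> (1 + y) * (1 - y + y\<^sup>2)"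
  proof -
    have "(1 + y) * (1 - y + y\<^sup>2) = 1 + y ^ 3" by (simp add: algebra_simps power2_eq_square power3_eq_cube)
    then show ?thesis using y by simp
  qed
  moreover have "0 \<le> 1 - y + y\<^sup>2" using y by (simp add: add_nonneg_nonneg)
  ultimately have "1 \<le> exp y * (1 - y + y\<^sup>2)"
    by (meson mult_right_mono order_trans)
  then have "exp (- y) * 1 \<le> exp (- y) * (exp y * (1 - y + y\<^sup>2))"
    by (intro mult_left_mono) auto
  also have "\<dots> = 1 - y + y\<^sup>2" by (simp add: mult.assoc[symmetric] exp_minus)
  finally show ?thesis by (simp add: y_def)
qed

text \<open>ln x \<le> x - 1 at x = sqrt (q / p), multiplied by 2 p and summed; the left side
  expands to 2 minus twice the sum of sqrt (p q).\<close>

lemma hellinger_le_KL: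
  fixes p q :: "'x::finite \<Rightarrow> real"
  assumes p: "\<And>x. 0 \<le> p x" "(\<Sum>x\<in>UNIV. p x) = 1" and q: "\<And>x. 0 \<le> q x" "(\<Sum>x\<in>UNIV. q x) = 1"
    and ac: "\<And>x. q x = 0 \<Longrightarrow> p x = 0"
  shows "(\<Sum>x\<in>UNIV. (sqrt (p x) - sqrt (q x))\<^sup>2) \<le> (\<Sum>x\<in>UNIV. p x * ln (p x / q x))"
proof -
  have "2 * (p x - sqrt (p x) * sqrt (q x)) \<le> p x * ln (p x / q x)" for x
  proof (cases "p x = 0")
    case False
    then have px: "0 < p x" and qx: "0 < q x" using p(1)[of x] q(1)[of x] ac[of x] by (auto simp: less_le)
    have "ln (sqrt (q x / p x)) \<le> sqrt (q x / p x) - 1" using px qx by (intro ln_le_minus_one) auto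
    then have "ln (q x / p x) \<le> 2 * (sqrt (q x / p x) - 1)" using px qx by (simp add: ln_sqrt)
    then have "2 * (1 - sqrt (q x / p x)) \<le> ln (p x / q x)" using px qx by (simp add: ln_div)
    then have "p x * (2 * (1 - sqrt (q x / p x))) \<le> p x * ln (p x / q x)" using px by (intro mult_left_mono) auto
    moreover have "p x * sqrt (q x / p x) = sqrt (p x) * sqrt (q x)"
      using px by (simp add: real_sqrt_divide real_div_sqrt field_simps)
    ultimately show ?thesis by (simp add: algebra_simps)
  qed simp
  then have "(\<Sum>x\<in>UNIV. 2 * (p x - sqrt (p x) * sqrt (q x))) \<le> (\<Sum>x\<in>UNIV. p x * ln (p x / q x))"
    by (intro sum_mono) auto
  moreover have "(\<Sum>x\<in>UNIV. (sqrt (p x) - sqrt (q x))\<^sup>2) = (\<Sum>x\<in>UNIV. 2 * (p x - sqrt (p x) * sqrt (q x)))"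
  proof -
    have "(\<Sum>x\<in>UNIV. (sqrt (p x) - sqrt (q x))\<^sup>2) = (\<Sum>x\<in>UNIV. p x + q x - 2 * (sqrt (p x) * sqrt (q x)))"
      by (intro sum.cong) (auto simp: power2_diff p q)
    also have "\<dots> = (\<Sum>x\<in>UNIV. 2 * (p x - sqrt (p x) * sqrt (q x)))"
      by (simp add: sum.distrib sum_subtractf sum_distrib_left[symmetric] right_diff_distrib p(2) q(2))
    finally show ?thesis .
  qed
  ultimately show ?thesis by simp
qed

text \<open>A Pinsker-type bound: |p - q| = |sqrt p - sqrt q| (sqrt p + sqrt q), and in
  Cauchy-Schwarz the squares of the second factors sum to at most 4. An infinite divergence makes
  the claim trivial.\<close>

lemma KL_bound:
  fixes p q :: "'x::finite \<Rightarrow> real"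
  assumes p: "\<And>x. 0 \<le> p x" "(\<Sum>x\<in>UNIV. p x) = 1" and q: "\<And>x. 0 \<le> q x" "(\<Sum>x\<in>UNIV. q x) = 1"
  shows "ennreal ((\<Sum>x\<in>UNIV. \<bar>p x - q x\<bar>)\<^sup>2) \<le> 4 * KL p q"
proof (cases "\<exists>x. p x \<noteq> 0 \<and> q x = 0")
  case False
  let ?d = "\<lambda>x. \<bar>sqrt (p x) - sqrt (q x)\<bar>" and ?s = "\<lambda>x. sqrt (p x) + sqrt (q x)"
  have eq: "\<bar>p x - q x\<bar> = ?d x * ?s x" for x
  proof -
    have "p x - q x = (sqrt (p x) - sqrt (q x)) * ?s x" using p(1)[of x] q(1)[of x] by (simp add: algebra_simps)
    then show ?thesis using p(1)[of x] q(1)[of x] by (simp add: abs_mult)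
  qed
  have "(\<Sum>x\<in>UNIV. \<bar>p x - q x\<bar>)\<^sup>2 \<le> (\<Sum>x\<in>UNIV. (?d x)\<^sup>2) * (\<Sum>x\<in>UNIV. (?s x)\<^sup>2)"
    unfolding eq by (rule Cauchy_Schwarz_ineq_sum)
  also have "\<dots> \<le> (\<Sum>x\<in>UNIV. (?d x)\<^sup>2) * 4"
  proof (intro mult_left_mono sum_nonneg)
    have "(?s x)\<^sup>2 \<le> 2 * p x + 2 * q x" for x
    proof -
      have "(?s x)\<^sup>2 \<le> 2 * (sqrt (p x))\<^sup>2 + 2 * (sqrt (q x))\<^sup>2"
        using sum_squares_bound[of "sqrt (p x)" "sqrt (q x)"] by (simp add: power2_sum)
      then show ?thesis using p q by simp
    qed
    then have "(\<Sum>x\<in>UNIV. (?s x)\<^sup>2) \<le> (\<Sum>x\<in>UNIV. 2 * p x + 2 * q x)" by (intro sum_mono) auto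
    then show "(\<Sum>x\<in>UNIV. (?s x)\<^sup>2) \<le> 4" by (simp add: sum.distrib sum_distrib_left[symmetric] p q)
  qed auto
  also have "\<dots> \<le> 4 * (\<Sum>x\<in>UNIV. p x * ln (p x / q x))"
    using hellinger_le_KL[OF p q] False by auto
  finally have "ennreal ((\<Sum>x\<in>UNIV. \<bar>p x - q x\<bar>)\<^sup>2) \<le> ennreal (4 * (\<Sum>x\<in>UNIV. p x * ln (p x / q x)))"
    by (rule ennreal_leI)
  also have "\<dots> = 4 * KL p q"
  proof -
    have "0 \<le> (\<Sum>x\<in>UNIV. (sqrt (p x) - sqrt (q x))\<^sup>2)" by (intro sum_nonneg) auto
    then have "0 \<le> (\<Sum>x\<in>UNIV. p x * ln (p x / q x))"
      using hellinger_le_KL[OF p q] False by (meson order_trans)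
    then show ?thesis using False by (auto simp: KL_def ennreal_mult)
  qed
  finally show ?thesis .
qed (auto simp: KL_def ennreal_mult_top)

section \<open>Decoupling along the observed trajectories\<close>

definition obs_tuple :: "('s, 'a, 'm) obs \<Rightarrow> ('s, 'a, 'm) obs \<Rightarrow> ('s, 'a, 'm) tuple" where
  "obs_tuple x y = (fst x, fst (snd x), fst (snd (snd x)), snd (snd (snd x)), fst y)"

lemma obs_tuple_obs_of: "obs_tuple (obs_of x) (obs_of x') = tuple_of x x'"
  by (cases x; cases x') (simp add: obs_tuple_def)

context fd_m2dp begin

lemma obs_tuple_measurable[measurable (raw)]:
  assumes "f \<in> X \<rightarrow>\<^sub>M obsM G" "g \<in> X \<rightarrow>\<^sub>M obsM G"
  shows "(\<lambda>x. obs_tuple (f x) (g x)) \<in> X \<rightarrow>\<^sub>M tupleM G"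
proof -
  have [measurable]: "f \<in> X \<rightarrow>\<^sub>M St G \<Otimes>\<^sub>M count_space UNIV \<Otimes>\<^sub>M count_space UNIV \<Otimes>\<^sub>M borel"
    "g \<in> X \<rightarrow>\<^sub>M St G \<Otimes>\<^sub>M count_space UNIV \<Otimes>\<^sub>M count_space UNIV \<Otimes>\<^sub>M borel"
    using assms by (simp_all add: obsM_def)
  show ?thesis unfolding obs_tuple_def tupleM_def by measurable
qed

text \<open>The total variation terms are at most one, so the real suprema in
  \<open>beta_dep\<close> and \<open>beta_coeff\<close> range over bounded sets and are true upper
  bounds.\<close>

lemma beta_dep_le:
  assumes "prob_space P" "X \<in> P \<rightarrow>\<^sub>M MX" "Y \<in> P \<rightarrow>\<^sub>M MY" "E \<in> sets (MX \<Otimes>\<^sub>M MY)"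
  shows "\<bar>measure (distr P (MX \<Otimes>\<^sub>M MY) (\<lambda>w. (X w, Y w))) E
          - measure (distr P MX X \<Otimes>\<^sub>M distr P MY Y) E\<bar> \<le> beta_dep P MX MY X Y"
    and "beta_dep P MX MY X Y \<le> 1"
proof -
  interpret P: prob_space P by fact
  note [measurable] = assms(2,3)
  interpret j: prob_space "distr P (MX \<Otimes>\<^sub>M MY) (\<lambda>w. (X w, Y w))"
    by (rule P.prob_space_distr) simp
  interpret x: prob_space "distr P MX X" by (rule P.prob_space_distr) simp
  interpret y: prob_space "distr P MY Y" by (rule P.prob_space_distr) simp
  interpret p: pair_prob_space "distr P MX X" "distr P MY Y" ..
  let ?d = "\<lambda>E. \<bar>measure (distr P (MX \<Otimes>\<^sub>M MY) (\<lambda>w. (X w, Y w))) E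
          - measure (distr P MX X \<Otimes>\<^sub>M distr P MY Y) E\<bar>"
  have d: "?d E \<le> 1" for E
    using j.prob_le_1[of E] p.prob_le_1[of E]
      measure_nonneg[of "distr P (MX \<Otimes>\<^sub>M MY) (\<lambda>w. (X w, Y w))" E]
      measure_nonneg[of "distr P MX X \<Otimes>\<^sub>M distr P MY Y" E] by linarith
  show "?d E \<le> beta_dep P MX MY X Y"
    unfolding beta_dep_def using d by (intro cSUP_upper assms(4) bdd_aboveI[of _ 1]) auto
  show "beta_dep P MX MY X Y \<le> 1"
    unfolding beta_dep_def using d by (intro cSUP_least) auto
qed

lemma past_obs_measurable: "(\<lambda>w. restrict (\<lambda>i. obs_of (w i)) I) \<in> trajM \<rightarrow>\<^sub>M PiM I (\<lambda>_. obsM G)"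
  by (rule measurable_restrict) measurable

lemma future_obs_measurable: "(\<lambda>w i. obs_of (w (k + i))) \<in> trajM \<rightarrow>\<^sub>M PiM UNIV (\<lambda>_. obsM G)"
  using obs_traj_measurable[of k] by (simp add: add.commute)

lemma beta_coeff_ge:
  "beta_dep (offline G) (PiM {..t} (\<lambda>_. obsM G)) (PiM UNIV (\<lambda>_. obsM G))
        (\<lambda>w. restrict (\<lambda>i. obs_of (w i)) {..t}) (\<lambda>w i. obs_of (w (t + l + i))) \<le> beta_coeff G l"
proof -
  have "beta_dep (offline G) (PiM {..t} (\<lambda>_. obsM G)) (PiM UNIV (\<lambda>_. obsM G))
        (\<lambda>w. restrict (\<lambda>i. obs_of (w i)) {..t}) (\<lambda>w i. obs_of (w (t + l + i))) \<le> 1" for t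
    by (rule beta_dep_le(2)[where E="{}"])
       (auto simp: prob_offline measurable_cong_sets[OF sets_offline refl] past_obs_measurable future_obs_measurable)
  then show ?thesis
    unfolding beta_coeff_def by (intro cSUP_upper bdd_aboveI[of _ 1]) auto
qed

lemma beta_coeff_nonneg: "0 \<le> beta_coeff G l"
proof -
  have "0 \<le> beta_dep (offline G) (PiM {..0} (\<lambda>_. obsM G)) (PiM UNIV (\<lambda>_. obsM G))
        (\<lambda>w. restrict (\<lambda>i. obs_of (w i)) {..0}) (\<lambda>w i. obs_of (w (0 + l + i)))"
    by (rule order_trans[OF _ beta_dep_le(1)[where E="{}"]])
       (auto simp: prob_offline measurable_cong_sets[OF sets_offline refl] past_obs_measurable future_obs_measurable[of l])
  then show ?thesis using beta_coeff_ge[of 0 l] by (rule order_trans)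
qed

text \<open>The weights depend on observations up to time \<open>u\<close>, the tuple starts at
  \<open>u + l\<close>. Under the product of the two laws each moment is at most one by
  stationarity, and convex weights preserve this; passing from the joint law to the product costs B
  times the mixing coefficient.\<close>

lemma beta_mixing_decoupling:
  fixes p :: "'f \<Rightarrow> (nat \<Rightarrow> ('s, 'a, 'm) obs) \<Rightarrow> real" and E :: "'f \<Rightarrow> ('s, 'a, 'm) tuple \<Rightarrow> real"
  assumes st: "offline_stationary G" and F: "finite F"
    and p[measurable]: "\<And>f. f \<in> F \<Longrightarrow> p f \<in> borel_measurable (PiM {..u} (\<lambda>_. obsM G))"
    and p0: "\<And>f h. f \<in> F \<Longrightarrow> 0 \<le> p f h" and p1: "\<And>h. (\<Sum>f\<in>F. p f h) = 1"
    and E[measurable]: "\<And>f. f \<in> F \<Longrightarrow> E f \<in> borel_measurable (tupleM G)"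
    and E0: "\<And>f x. f \<in> F \<Longrightarrow> 0 \<le> E f x" and EB: "\<And>f x. f \<in> F \<Longrightarrow> E f x \<le> B"
    and Enu: "\<And>f. f \<in> F \<Longrightarrow> (\<integral>\<^sup>+w. E f (tuple_of (w 0) (w (Suc 0))) \<partial>offline G) \<le> 1"
  shows "(\<integral>\<^sup>+w. ennreal (\<Sum>f\<in>F. p f (restrict (\<lambda>i. obs_of (w i)) {..u}) * E f (tuple_of (w (u + l)) (w (Suc (u + l))))) \<partial>offline G)
    \<le> 1 + ennreal (B * beta_coeff G l)"
proof -
  let ?MX = "PiM {..u} (\<lambda>_. obsM G)" and ?MY = "PiM (UNIV :: nat set) (\<lambda>_. obsM G)"
  let ?X = "\<lambda>w :: nat \<Rightarrow> ('s, 'c, 'a, 'm) full. restrict (\<lambda>i. obs_of (w i)) {..u}"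
  let ?Y = "\<lambda>(w :: nat \<Rightarrow> ('s, 'c, 'a, 'm) full) i. obs_of (w (u + l + i))"
  have X[measurable]: "?X \<in> offline G \<rightarrow>\<^sub>M ?MX" and Y[measurable]: "?Y \<in> offline G \<rightarrow>\<^sub>M ?MY"
    by (simp_all add: measurable_cong_sets[OF sets_offline refl] past_obs_measurable future_obs_measurable)
  let ?P = "distr (offline G) (?MX \<Otimes>\<^sub>M ?MY) (\<lambda>w. (?X w, ?Y w))"
  let ?QX = "distr (offline G) ?MX ?X" and ?QY = "distr (offline G) ?MY ?Y"
  interpret O: prob_space "offline G" by (rule prob_offline)
  interpret QX: prob_space ?QX by (rule O.prob_space_distr) simp
  interpret QY: prob_space ?QY by (rule O.prob_space_distr) simp
  interpret Q: pair_prob_space ?QX ?QY ..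
  have P: "prob_space ?P" by (rule O.prob_space_distr) simp
  have Em[measurable]: "(\<lambda>y. E f (obs_tuple (y 0) (y 1))) \<in> borel_measurable ?MY" if "f \<in> F" for f
    by (rule measurable_compose[OF _ E[OF that]]) measurable
  let ?g = "\<lambda>z. \<Sum>f\<in>F. p f (fst z) * E f (obs_tuple (snd z 0) (snd z 1))"
  have gm[measurable]: "?g \<in> borel_measurable (?MX \<Otimes>\<^sub>M ?MY)"
  proof (rule borel_measurable_sum)
    fix f assume f: "f \<in> F"
    show "(\<lambda>z. p f (fst z) * E f (obs_tuple (snd z 0) (snd z 1))) \<in> borel_measurable (?MX \<Otimes>\<^sub>M ?MY)"
      using measurable_compose[OF measurable_fst p[OF f]] measurable_compose[OF measurable_snd Em[OF f]]
      by (intro borel_measurable_times) auto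
  qed
  have "(\<integral>\<^sup>+w. ennreal (\<Sum>f\<in>F. p f (?X w) * E f (tuple_of (w (u + l)) (w (Suc (u + l))))) \<partial>offline G)
    = (\<integral>\<^sup>+z. ?g z \<partial>?P)"
    by (subst nn_integral_distr) (auto simp: obs_tuple_obs_of)
  also have "\<dots> \<le> (\<integral>\<^sup>+z. ?g z \<partial>(?QX \<Otimes>\<^sub>M ?QY)) + ennreal (B * beta_coeff G l)"
  proof (rule tv_nn_integral_le[OF P Q.prob_space_axioms _ _ gm])
    show "0 \<le> ?g z" for z by (intro sum_nonneg mult_nonneg_nonneg p0 E0)
    \<comment> \<open>The weights sum to one, so the bound does not grow with the number of
      functions.\<close>
    show "?g z \<le> B" for z
    proof -
      have "?g z \<le> (\<Sum>f\<in>F. p f (fst z) * B)" by (intro sum_mono mult_left_mono p0 EB)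
      then show ?thesis by (simp add: sum_distrib_right[symmetric] p1)
    qed
    fix A assume A: "A \<in> sets (?MX \<Otimes>\<^sub>M ?MY)"
    have "\<bar>measure ?P A - measure (?QX \<Otimes>\<^sub>M ?QY) A\<bar> \<le> beta_coeff G l"
      using beta_dep_le(1)[OF prob_offline X Y A] beta_coeff_ge[of u l] by linarith
    then show "measure ?P A \<le> measure (?QX \<Otimes>\<^sub>M ?QY) A + beta_coeff G l" by linarith
  qed (auto intro!: sets_pair_measure_cong)
  finally have fin: "(\<integral>\<^sup>+w. ennreal (\<Sum>f\<in>F. p f (?X w) * E f (tuple_of (w (u + l)) (w (Suc (u + l))))) \<partial>offline G)
    \<le> (\<integral>\<^sup>+z. ?g z \<partial>(?QX \<Otimes>\<^sub>M ?QY)) + ennreal (B * beta_coeff G l)" .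
  have "(\<integral>\<^sup>+z. ?g z \<partial>(?QX \<Otimes>\<^sub>M ?QY)) = (\<integral>\<^sup>+x. (\<integral>\<^sup>+y. ?g (x, y) \<partial>?QY) \<partial>?QX)"
    by (rule QY.nn_integral_fst[symmetric]) measurable
  also have "\<dots> \<le> (\<integral>\<^sup>+x. 1 \<partial>?QX)"
  proof (rule nn_integral_mono)
    fix x
    have "(\<integral>\<^sup>+y. ?g (x, y) \<partial>?QY) = (\<integral>\<^sup>+y. (\<Sum>f\<in>F. ennreal (p f x) * ennreal (E f (obs_tuple (y 0) (y 1)))) \<partial>?QY)"
      by (intro nn_integral_cong) (simp add: p0 E0 sum_ennreal[symmetric] ennreal_mult)
    also have "\<dots> = (\<Sum>f\<in>F. ennreal (p f x) * (\<integral>\<^sup>+y. ennreal (E f (obs_tuple (y 0) (y 1))) \<partial>?QY))"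
      by (subst nn_integral_sum) (auto intro!: sum.cong nn_integral_cmult)
    also have "\<dots> \<le> (\<Sum>f\<in>F. ennreal (p f x) * 1)"
    proof (intro sum_mono mult_left_mono)
      fix f assume f: "f \<in> F"
      have "(\<integral>\<^sup>+y. ennreal (E f (obs_tuple (y 0) (y 1))) \<partial>?QY) = (\<integral>\<^sup>+w. ennreal (E f (tuple_of (w (u + l)) (w (Suc (u + l))))) \<partial>offline G)"
        using Em[OF f] by (subst nn_integral_distr) (auto simp: obs_tuple_obs_of)
      also have "\<dots> \<le> 1"
        using offline_shift[OF st, of "\<lambda>x. ennreal (E f x)" "u + l"] E[OF f] Enu[OF f] by simp
      finally show "(\<integral>\<^sup>+y. ennreal (E f (obs_tuple (y 0) (y 1))) \<partial>?QY) \<le> 1" .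
    qed auto
    also have "\<dots> = 1" by (simp add: p0 p1)
    finally show "(\<integral>\<^sup>+y. ?g (x, y) \<partial>?QY) \<le> 1" .
  qed
  also have "\<dots> = 1" by (simp add: QX.emeasure_space_1[simplified])
  finally show ?thesis by (intro order_trans[OF fin] add_right_mono)
qed

lemma tuples_idx: "(j, t) \<in> data_idx L \<Longrightarrow> tuples L w (j, t) = tuple_of (w j t) (w j (Suc t))"
  by (simp add: tuples_def)

text \<open>\<Gamma> adds up the posterior averages from \<open>log_sum_exp_le\<close> over all
  residue classes. The coefficient is taken at l - 1 because a tuple also contains the state one
  time later, and 3 bounds exp 1. The one subtracted for each sample stays on the left side, where
  it later cancels the main part of the bound on \<Gamma>.\<close>

lemma exponential_weights_bound:
  fixes W :: "'f \<Rightarrow> ('s, 'a, 'm) tuple \<Rightarrow> real"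
  assumes st: "offline_stationary G" and l: "1 \<le> l" and F: "finite F" "F \<noteq> {}"
    and W[measurable]: "\<And>f. f \<in> F \<Longrightarrow> W f \<in> borel_measurable (tupleM G)"
    and W1: "\<And>f x. f \<in> F \<Longrightarrow> W f x \<le> 1"
    and Wnu: "\<And>f. f \<in> F \<Longrightarrow> (\<integral>\<^sup>+w. exp (W f (tuple_of (w 0) (w (Suc 0)))) \<partial>offline G) \<le> 1"
  shows "\<exists>\<Gamma>. \<Gamma> \<in> borel_measurable (PiM (data_idx L) (\<lambda>_. tupleM G)) \<and> (\<forall>d. 0 \<le> \<Gamma> d) \<and>
    (\<forall>d. \<forall>f\<in>F. (\<Sum>i\<in>data_idx L. W f (d i)) + real (card (data_idx L)) \<le> real l * ln (real (card F)) + \<Gamma> d) \<and>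
    (\<integral>\<^sup>+d. ennreal (\<Gamma> d) \<partial>data_law G L) \<le> ennreal (real (card (data_idx L)) * (1 + 3 * beta_coeff G (l - 1)))"
proof -
  \<comment> \<open>\<open>M\<close> exceeds every time index, so \<open>key\<close> encodes the
    lexicographic order of trajectory and time.\<close>
  define M where "M = Suc (Max (insert 0 (set L)))"
  define key where "key i = fst i * M + snd i" for i :: "nat \<times> nat"
  have tM: "t < M" if "(j, t) \<in> data_idx L" for j t
  proof -
    have "t < L ! j" "j < length L" using that by (auto simp: data_idx_def)
    then have "t < L ! j" "L ! j \<le> Max (insert 0 (set L))" by (auto intro!: Max_ge)
    then show ?thesis by (simp add: M_def)
  qed
  have key_less: "key (j', t') < key (j, t) \<longleftrightarrow> j' < j \<or> j' = j \<and> t' < t"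
    if "(j', t') \<in> data_idx L" "(j, t) \<in> data_idx L" for j j' t t'
  proof -
    have a: "t < M" "t' < M" using tM that by auto
    have 1: "key (j', t') < key (j, t)" if "j' < j"
    proof -
      have "j' * M + t' < Suc j' * M" using a by simp
      also have "\<dots> \<le> j * M" using that by (intro mult_le_mono1) simp
      finally show ?thesis by (simp add: key_def)
    qed
    have 2: "key (j, t) < key (j', t')" if "j < j'"
    proof -
      have "j * M + t < Suc j * M" using a by simp
      also have "\<dots> \<le> j' * M" using that by (intro mult_le_mono1) simp
      finally show ?thesis by (simp add: key_def)
    qed
    show ?thesis
      by (cases j j' rule: linorder_cases) (use 1 2 in \<open>auto simp: key_def\<close>)
  qed
  have inj: "inj_on key (data_idx L)"
  proof (rule inj_onI)
    fix x y assume xy: "x \<in> data_idx L" "y \<in> data_idx L" "key x = key y"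
    obtain j t j' t' where "x = (j, t)" "y = (j', t')" by (cases x; cases y)
    then show "x = y"
      using key_less[of j t j' t'] key_less[of j' t' j t] xy by (cases j j' rule: linorder_cases) auto
  qed
  \<comment> \<open>Predecessors in the same residue class are taken over all trajectories. Pooling
    keeps the number of log-sum-exp terms at l, independently of the number of trajectories.\<close>
  define before where "before i = {k \<in> data_idx L. snd k mod l = snd i mod l \<and> key k < key i}" for i
  have bsub: "before i \<subseteq> data_idx L" and finb: "finite (before i)" for i
    by (auto simp: before_def)
  define num where "num f i d = exp (\<Sum>k\<in>before i. W f (d k))" for f i and d :: "nat \<times> nat \<Rightarrow> ('s, 'a, 'm) tuple"
  \<comment> \<open>Posterior average of the exponential score at sample i, with weights built from
    the earlier scores of its class.\<close>
  define \<Gamma>i where "\<Gamma>i i d = (\<Sum>f\<in>F. num f i d * exp (W f (d i))) / (\<Sum>f\<in>F. num f i d)" for i d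
  define \<Gamma> where "\<Gamma> d = (\<Sum>i\<in>data_idx L. \<Gamma>i i d)" for d
  have Dpos: "0 < (\<Sum>f\<in>F. num f i d)" for i d
    using F by (intro sum_pos) (auto simp: num_def)
  have \<Gamma>i0: "0 \<le> \<Gamma>i i d" for i d
    unfolding \<Gamma>i_def by (intro divide_nonneg_pos Dpos sum_nonneg) (auto simp: num_def)
  have Wd: "(\<lambda>d. W f (d k)) \<in> borel_measurable (PiM (data_idx L) (\<lambda>_. tupleM G))" if "f \<in> F" "k \<in> data_idx L" for f k
    by (rule measurable_compose[OF measurable_component_singleton[OF that(2)] W[OF that(1)]])
  have numm: "(\<lambda>d. num f i d) \<in> borel_measurable (PiM (data_idx L) (\<lambda>_. tupleM G))" if "f \<in> F" for f i
    unfolding num_def by (intro measurable_compose[OF _ borel_measurable_exp] borel_measurable_sum Wd[OF that subsetD[OF bsub]])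
  have \<Gamma>im: "\<Gamma>i i \<in> borel_measurable (PiM (data_idx L) (\<lambda>_. tupleM G))" if "i \<in> data_idx L" for i
    unfolding \<Gamma>i_def[abs_def]
    by (intro borel_measurable_divide borel_measurable_sum borel_measurable_times numm measurable_compose[OF Wd[OF _ that] borel_measurable_exp])
  have pathwise: "(\<Sum>i\<in>data_idx L. W f (d i)) + real (card (data_idx L)) \<le> real l * ln (real (card F)) + \<Gamma> d"
    if f: "f \<in> F" for d f
  proof -
    have r: "(\<Sum>i | i \<in> data_idx L \<and> snd i mod l = r. W f (d i)) \<le> ln (real (card F)) + (\<Sum>i | i \<in> data_idx L \<and> snd i mod l = r. \<Gamma>i i d - 1)" for r
    proof -
      let ?I = "{i \<in> data_idx L. snd i mod l = r}"
      have "(\<Sum>i\<in>?I. W f (d i)) = ln (exp (\<Sum>i\<in>?I. W f (d i)))" by simp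
      also have "\<dots> \<le> ln (\<Sum>f\<in>F. exp (\<Sum>i\<in>?I. W f (d i)))"
        using F f by (subst ln_le_cancel_iff) (auto intro!: member_le_sum sum_pos)
      also have "\<dots> \<le> ln (real (card F)) +
        (\<Sum>i\<in>?I. (\<Sum>f\<in>F. exp (\<Sum>j | j \<in> ?I \<and> key j < key i. W f (d j)) * exp (W f (d i))) /
         (\<Sum>f\<in>F. exp (\<Sum>j | j \<in> ?I \<and> key j < key i. W f (d j))) - 1)"
        by (rule log_sum_exp_le[OF F, of ?I key "\<lambda>f i. W f (d i)"]) (auto intro: inj_on_subset[OF inj])
      also have "\<dots> = ln (real (card F)) + (\<Sum>i\<in>?I. \<Gamma>i i d - 1)"
      proof -
        have "{j. j \<in> ?I \<and> key j < key i} = before i" if "i \<in> ?I" for i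
          using that by (auto simp: before_def)
        then show ?thesis
          unfolding \<Gamma>i_def num_def by (intro arg_cong2[where f="(+)"] refl sum.cong) (simp only:)
      qed
      finally show ?thesis .
    qed
    \<comment> \<open>The residue classes partition the index set; each contributes one ln (card
      F).\<close>
    have grp: "(\<Sum>r<l. \<Sum>i | i \<in> data_idx L \<and> snd i mod l = r. h i) = (\<Sum>i\<in>data_idx L. h i)" for h :: "nat \<times> nat \<Rightarrow> real"
      by (rule sum.group) (use l in auto)
    have "(\<Sum>i\<in>data_idx L. W f (d i)) \<le> (\<Sum>r<l. ln (real (card F)) + (\<Sum>i | i \<in> data_idx L \<and> snd i mod l = r. \<Gamma>i i d - 1))"
      unfolding grp[symmetric] by (intro sum_mono r)
    also have "\<dots> = real l * ln (real (card F)) + (\<Sum>i\<in>data_idx L. \<Gamma>i i d - 1)"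
      by (simp add: sum.distrib grp del: sum_subtractf)
    finally show ?thesis by (simp add: \<Gamma>_def sum_subtractf)
  qed
  let ?\<beta> = "1 + ennreal (3 * beta_coeff G (l - 1))"
  have one: "(\<integral>\<^sup>+w. ennreal (\<Gamma>i i (tuples L w)) \<partial>dataM L) \<le> ?\<beta>" if i: "i \<in> data_idx L" for i
  proof -
    obtain j t where ijt: "i = (j, t)" by (cases i)
    have j: "j < length L" using i ijt by (auto simp: data_idx_def)
    \<comment> \<open>Trajectories are independent: all but trajectory j are frozen, and mixing is
      applied along that one only.\<close>
    interpret ps: product_prob_space "\<lambda>_::nat. offline G" UNIV
      by (rule product_prob_spaceI) (rule prob_offline)
    let ?R = "{..<length L} - {j}"
    have ins: "{..<length L} = insert j ?R" using j by auto
    have fm: "(\<lambda>w. ennreal (\<Gamma>i i (tuples L w))) \<in> borel_measurable (dataM L)"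
      using measurable_compose[OF tuples_measurable \<Gamma>im[OF i]] by simp
    have "(\<integral>\<^sup>+w. ennreal (\<Gamma>i i (tuples L w)) \<partial>dataM L) =
      (\<integral>\<^sup>+u. (\<integral>\<^sup>+y. ennreal (\<Gamma>i i (tuples L (u(j := y)))) \<partial>offline G) \<partial>PiM ?R (\<lambda>_. offline G))"
      using fm unfolding dataM_def by (subst (asm) ins, subst ins) (rule ps.product_nn_integral_insert, auto)
    also have "\<dots> \<le> (\<integral>\<^sup>+u. ?\<beta> \<partial>PiM ?R (\<lambda>_. offline G))"
    proof (rule nn_integral_mono)
      fix u :: "nat \<Rightarrow> nat \<Rightarrow> ('s, 'c, 'a, 'm) full"
      \<comment> \<open>The dataset as a function of the observations of trajectory j, with frozen
        values elsewhere; the mixing assumption speaks of observations, not of full steps.\<close>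
      define val where "val h k = (if fst k = j then obs_tuple (h (snd k)) (h (Suc (snd k)))
        else tuple_of (u (fst k) (snd k)) (u (fst k) (Suc (snd k))))" for h :: "nat \<Rightarrow> ('s, 'a, 'm) obs" and k :: "nat \<times> nat"
      define p where "p f h = num f i (val h) / (\<Sum>f\<in>F. num f i (val h))" for f h
      have p0: "0 \<le> p f h" for f h
        unfolding p_def by (intro divide_nonneg_pos Dpos) (simp add: num_def)
      have p1: "(\<Sum>f\<in>F. p f h) = 1" for h
        using Dpos[of i "val h"] by (simp add: p_def sum_divide_distrib[symmetric])
      have tval: "tuples L (u(j := y)) k = val (\<lambda>t. obs_of (y t)) k" if "k \<in> data_idx L" for y k
        using that by (cases k) (auto simp: tuples_idx val_def obs_tuple_obs_of)
      have ti: "tuples L (u(j := y)) i = tuple_of (y t) (y (Suc t))" for y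
        using i by (simp add: ijt tuples_idx)
      have num_tv: "num f i (tuples L (u(j := y))) = num f i (val (\<lambda>t. obs_of (y t)))" for f y
        unfolding num_def
        by (intro arg_cong[where f=exp] sum.cong refl arg_cong[where f="W f"] tval) (rule subsetD[OF bsub])
      have G: "\<Gamma>i i (tuples L (u(j := y))) = (\<Sum>f\<in>F. p f (\<lambda>t. obs_of (y t)) * exp (W f (tuple_of (y t) (y (Suc t)))))" for y
        unfolding \<Gamma>i_def num_tv ti p_def by (simp add: sum_divide_distrib)
      have gap: "fst k = j \<Longrightarrow> snd k + l \<le> t" if "k \<in> before i" for k
      proof -
        assume kj: "fst k = j"
        obtain t' where k: "k = (j, t')" using kj by (cases k) auto
        have "t' mod l = t mod l" "t' < t"
          using that key_less[of j t' j t] i by (auto simp: before_def k ijt)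
        then have "l dvd t - t'" by (metis mod_eq_dvd_iff_nat less_imp_le)
        then have "l \<le> t - t'" by (rule dvd_imp_le) (use \<open>t' < t\<close> in simp)
        then show ?thesis using k \<open>t' < t\<close> by simp
      qed
      show "(\<integral>\<^sup>+y. ennreal (\<Gamma>i i (tuples L (u(j := y)))) \<partial>offline G) \<le> ?\<beta>"
      proof (cases "l \<le> t")
        case True
        \<comment> \<open>Earlier samples of the class on this trajectory start at time t - l or
          before, so the last observation they use is at t - l + 1.\<close>
        let ?u = "t - (l - 1)"
        have tu: "t = ?u + (l - 1)" using True l by simp
        have veq: "val h k = val (restrict h {..?u}) k" if "k \<in> before i" for h k
          using gap[OF that] l by (auto simp: val_def)
        have neq: "num f i (val h) = num f i (val (restrict h {..?u}))" for f h
          unfolding num_def by (intro arg_cong[where f=exp] sum.cong refl arg_cong[where f="W f"] veq)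
        have pr: "p f h = p f (restrict h {..?u})" for f h
          unfolding p_def by (intro arg_cong2[where f="(/)"] sum.cong refl neq)
        have vm: "(\<lambda>h. W f (val h k)) \<in> borel_measurable (PiM {..?u} (\<lambda>_. obsM G))" if "f \<in> F" "k \<in> before i" for f k
        proof (cases "fst k = j")
          case True
          then have "snd k \<in> {..?u}" "Suc (snd k) \<in> {..?u}" using gap[OF that(2)] l by auto
          then have "(\<lambda>h. obs_tuple (h (snd k)) (h (Suc (snd k)))) \<in> PiM {..?u} (\<lambda>_. obsM G) \<rightarrow>\<^sub>M tupleM G"
            by (intro obs_tuple_measurable measurable_component_singleton)
          from measurable_compose[OF this W[OF that(1)]] True show ?thesis by (simp add: val_def)
        next
          case False
          then show ?thesis by (simp add: val_def)
        qed
        have nm: "(\<lambda>h. num f i (val h)) \<in> borel_measurable (PiM {..?u} (\<lambda>_. obsM G))" if "f \<in> F" for f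
          unfolding num_def by (intro measurable_compose[OF _ borel_measurable_exp] borel_measurable_sum vm that)
        have pm: "p f \<in> borel_measurable (PiM {..?u} (\<lambda>_. obsM G))" if "f \<in> F" for f
          unfolding p_def[abs_def] by (intro borel_measurable_divide borel_measurable_sum nm that)
        have Em: "(\<lambda>x. exp (W f x)) \<in> borel_measurable (tupleM G)" if "f \<in> F" for f
          by (rule measurable_compose[OF W[OF that] borel_measurable_exp])
        have E3: "exp (W f x) \<le> 3" if "f \<in> F" for f x
          using W1[OF that, of x] exp_le by (meson exp_le_cancel_iff order_trans)
        have E0: "0 \<le> exp (W f x)" for f x by simp
        from beta_mixing_decoupling[OF st F(1) pm p0 p1 Em E0 E3 Wnu, where l="l - 1"]
        have "(\<integral>\<^sup>+w. ennreal (\<Sum>f\<in>F. p f (restrict (\<lambda>i. obs_of (w i)) {..?u}) * exp (W f (tuple_of (w t) (w (Suc t))))) \<partial>offline G) \<le> ?\<beta>"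
          unfolding tu[symmetric] by simp
        then show ?thesis unfolding G pr[symmetric] .
      next
        \<comment> \<open>No earlier sample of the class lies on this trajectory, so the weights are
          constant in y and stationarity alone gives the bound one.\<close>
        case False
        then have veq: "val h k = val h' k" if "k \<in> before i" for h h' k
          using gap[OF that] by (auto simp: val_def)
        have neq: "num f i (val h) = num f i (val h')" for f h h'
          unfolding num_def by (intro arg_cong[where f=exp] sum.cong refl arg_cong[where f="W f"] veq)
        have pc: "p f h = p f undefined" for f h
          unfolding p_def by (intro arg_cong2[where f="(/)"] sum.cong refl neq)
        have Em: "(\<lambda>y. ennreal (exp (W f (tuple_of (y t) (y (Suc t)))))) \<in> borel_measurable (offline G)" if "f \<in> F" for f
          using W[OF that] by measurable
        have "(\<integral>\<^sup>+y. ennreal (\<Gamma>i i (tuples L (u(j := y)))) \<partial>offline G) =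
          (\<integral>\<^sup>+y. (\<Sum>f\<in>F. ennreal (p f undefined) * ennreal (exp (W f (tuple_of (y t) (y (Suc t)))))) \<partial>offline G)"
          unfolding G by (subst pc) (simp add: p0 sum_ennreal[symmetric] ennreal_mult)
        also have "\<dots> = (\<Sum>f\<in>F. ennreal (p f undefined) * (\<integral>\<^sup>+y. ennreal (exp (W f (tuple_of (y t) (y (Suc t))))) \<partial>offline G))"
          using Em by (subst nn_integral_sum) (auto intro!: sum.cong nn_integral_cmult)
        also have "\<dots> \<le> (\<Sum>f\<in>F. ennreal (p f undefined) * 1)"
        proof (intro sum_mono mult_left_mono)
          fix f assume f: "f \<in> F"
          have "(\<lambda>x. ennreal (exp (W f x))) \<in> borel_measurable (tupleM G)" using W[OF f] by measurable
          from offline_shift[OF st this, of t] Wnu[OF f]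
          show "(\<integral>\<^sup>+y. ennreal (exp (W f (tuple_of (y t) (y (Suc t))))) \<partial>offline G) \<le> 1" by simp
        qed auto
        also have "\<dots> = 1" by (simp add: p0 p1)
        also have "\<dots> \<le> ?\<beta>" by simp
        finally show ?thesis .
      qed
    qed
    also have "\<dots> = ?\<beta>"
      using prob_space.emeasure_space_1[OF prob_space_PiM[of ?R "\<lambda>_. offline G"]] prob_offline by simp
    finally show ?thesis .
  qed
  have "(\<integral>\<^sup>+d. ennreal (\<Gamma> d) \<partial>data_law G L) = (\<integral>\<^sup>+w. (\<Sum>i\<in>data_idx L. ennreal (\<Gamma>i i (tuples L w))) \<partial>dataM L)"
    unfolding data_law_eq \<Gamma>_def using \<Gamma>im
    by (subst nn_integral_distr) (auto simp: \<Gamma>i0 sum_ennreal)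
  also have "\<dots> = (\<Sum>i\<in>data_idx L. (\<integral>\<^sup>+w. ennreal (\<Gamma>i i (tuples L w)) \<partial>dataM L))"
    by (rule nn_integral_sum) (use measurable_compose[OF tuples_measurable \<Gamma>im] in simp)
  also have "\<dots> \<le> (\<Sum>i\<in>data_idx L. ?\<beta>)" by (intro sum_mono one)
  also have "\<dots> = ennreal (real (card (data_idx L)) * (1 + 3 * beta_coeff G (l - 1)))"
  proof -
    have "?\<beta> = ennreal (1 + 3 * beta_coeff G (l - 1))"
      using beta_coeff_nonneg[of "l - 1"] by (subst ennreal_plus) auto
    then show ?thesis
      using beta_coeff_nonneg[of "l - 1"] by (simp add: ennreal_mult ennreal_of_nat_eq_real_of_nat del: ennreal_plus)
  qed
  finally have "(\<integral>\<^sup>+d. ennreal (\<Gamma> d) \<partial>data_law G L) \<le> ennreal (real (card (data_idx L)) * (1 + 3 * beta_coeff G (l - 1)))" .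
  moreover have "\<Gamma> \<in> borel_measurable (PiM (data_idx L) (\<lambda>_. tupleM G))"
    unfolding \<Gamma>_def[abs_def] using \<Gamma>im by (intro borel_measurable_sum) auto
  moreover have "0 \<le> \<Gamma> d" for d unfolding \<Gamma>_def by (intro sum_nonneg \<Gamma>i0)
  ultimately show ?thesis using pathwise by blast
qed

end

section \<open>Value functions of mediated Q-functions\<close>

lemma abs_Max_diff_le:
  fixes f g :: "'x::finite \<Rightarrow> real"
  assumes "\<And>x. \<bar>f x - g x\<bar> \<le> B"
  shows "\<bar>(MAX x. f x) - (MAX x. g x)\<bar> \<le> B"
proof -
  have "(MAX x. f x) \<le> (MAX x. g x) + B" if "\<And>x. f x \<le> g x + B" for f g :: "'x \<Rightarrow> real"
  proof (rule Max.boundedI)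
    fix y assume "y \<in> range f"
    then obtain x where "y = f x" by auto
    moreover have "g x \<le> (MAX x. g x)" by (rule Max_ge) auto
    ultimately show "y \<le> (MAX x. g x) + B" using that[of x] by linarith
  qed auto
  from this[of f g] this[of g f] show ?thesis using assms by (smt (verit))
qed

lemma abs_Max_le:
  fixes f :: "'x::finite \<Rightarrow> real"
  assumes "\<And>x. \<bar>f x\<bar> \<le> B"
  shows "\<bar>MAX x. f x\<bar> \<le> B"
proof -
  have "(MAX x. f x) \<in> range f" by (rule Max_in) auto
  then obtain x where "(MAX x. f x) = f x" by (rule rangeE)
  then show ?thesis using assms[of x] by simp
qed

lemma borel_measurable_MAX:
  fixes f :: "'x::finite \<Rightarrow> 'y \<Rightarrow> real"
  assumes "\<And>x. f x \<in> borel_measurable M"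
  shows "(\<lambda>y. MAX x. f x y) \<in> borel_measurable M"
  using borel_measurable_Max[of UNIV f M] assms by simp

context fd_m2dp begin

definition qfun :: "('s \<Rightarrow> 'a \<Rightarrow> 'm \<Rightarrow> real) \<Rightarrow> bool" where
  "qfun Q \<longleftrightarrow> (\<forall>a m. (\<lambda>s. Q s a m) \<in> borel_measurable (St G) \<and> (\<forall>s. \<bar>Q s a m\<bar> \<le> V))"

definition VQ :: "('s \<Rightarrow> 'a \<Rightarrow> 'm \<Rightarrow> real) \<Rightarrow> 's \<Rightarrow> real" where
  "VQ Q s = (MAX a. mixQ (p_b G) (p_m G) Q s a)"

definition Vhat :: "('s \<Rightarrow> 'a pmf) \<Rightarrow> ('s \<Rightarrow> 'a \<Rightarrow> 'm pmf) \<Rightarrow> ('s \<Rightarrow> 'a \<Rightarrow> 'm \<Rightarrow> real) \<Rightarrow> 's \<Rightarrow> real" where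
  "Vhat qb qm Q s = (MAX a. mixQ_hat qb qm Q s a)"

lemma mixQ_abs_le:
  assumes qb: "\<And>a. 0 \<le> qb s a" "(\<Sum>a\<in>UNIV. qb s a) = 1"
    and qm: "\<And>m. 0 \<le> qm s a m" "(\<Sum>m\<in>UNIV. qm s a m) = 1"
    and Q: "\<And>a m. \<bar>Q s a m\<bar> \<le> B"
  shows "\<bar>mixQ qb qm Q s (a::'a)\<bar> \<le> B"
proof -
  have "\<bar>mixQ qb qm Q s a\<bar> \<le> (\<Sum>a'\<in>UNIV. \<Sum>m\<in>UNIV. \<bar>Q s a' m * qb s a' * qm s a m\<bar>)"
    unfolding mixQ_def by (intro order_trans[OF sum_abs] sum_mono sum_abs)
  also have "\<dots> \<le> (\<Sum>a'\<in>UNIV. \<Sum>m\<in>UNIV. B * qb s a' * qm s a m)"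
    by (intro sum_mono) (auto simp: abs_mult qb qm intro!: mult_right_mono Q)
  also have "\<dots> = B"
    by (simp add: sum_distrib_left[symmetric] qm qb)
  finally show ?thesis .
qed

end

text \<open>Finiteness of \<open>c2\<close> forces this positivity at every state. It gives
  \<open>p_m\<close> and \<open>bellman_opt\<close>, which divide by \<open>p_b\<close>, their
  intended meaning everywhere.\<close>

locale fd_m2dp_pos = fd_m2dp G for G :: "('s, 'c, 'a::finite, 'm::finite) m2dp" +
  assumes p_b_pos: "0 < p_b G s a"
begin

lemma p_m_med[simp]: "p_m G s a m = pmf (med s a) m"
  by (rule p_m_eq[OF p_b_pos])

lemma mixQ_bound: "qfun Q \<Longrightarrow> \<bar>mixQ (p_b G) (p_m G) Q s a\<bar> \<le> V"
  by (rule mixQ_abs_le) (auto simp: p_b_nonneg sum_p_b sum_pmf_1 qfun_def)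

lemma mixQ_hat_bound: "qfun Q \<Longrightarrow> \<bar>mixQ_hat qb qm Q s a\<bar> \<le> V"
  unfolding mixQ_hat_def by (rule mixQ_abs_le) (auto simp: sum_pmf_1 qfun_def)

lemma mixQ_measurable: "qfun Q \<Longrightarrow> (\<lambda>s. mixQ (p_b G) (p_m G) Q s a) \<in> borel_measurable (St G)"
proof -
  assume "qfun Q"
  then have [measurable]: "(\<lambda>s. Q s a m) \<in> borel_measurable (St G)" for a m by (simp add: qfun_def)
  show ?thesis unfolding mixQ_def p_m_med by measurable
qed

lemma mixQ_hat_measurable:
  assumes "qfun Q" "pb_class G {qb}" "pm_class G {qm}"
  shows "(\<lambda>s. mixQ_hat qb qm Q s a) \<in> borel_measurable (St G)"
proof -
  have [measurable]: "(\<lambda>s. Q s a m) \<in> borel_measurable (St G)" "(\<lambda>s. pmf (qb s) a) \<in> borel_measurable (St G)"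
    "(\<lambda>s. pmf (qm s a) m) \<in> borel_measurable (St G)" for a m
    using assms by (auto simp: qfun_def pb_class_def pm_class_def)
  show ?thesis unfolding mixQ_hat_def mixQ_def by measurable
qed

lemma bdd_VQ: "qfun Q \<Longrightarrow> bdd (VQ Q)"
  unfolding bdd_def VQ_def by (intro conjI borel_measurable_MAX allI abs_Max_le mixQ_bound mixQ_measurable)

lemma bdd_Vhat: "qfun Q \<Longrightarrow> pb_class G {qb} \<Longrightarrow> pm_class G {qm} \<Longrightarrow> bdd (Vhat qb qm Q)"
  unfolding bdd_def Vhat_def by (intro conjI borel_measurable_MAX allI abs_Max_le mixQ_hat_bound mixQ_hat_measurable)

lemma space_transition: "action_kernel \<alpha> \<Longrightarrow> space (transition_law G \<alpha> s) = UNIV"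
  using sets_eq_imp_space_eq[OF sets_transition] by (simp add: space_pair_measure)

lemma bellman_eq:
  "bellman_opt G Q s a m = (LINT z|transition_law G (pa G s) s. indicat_real (cell a m) z *
     (rew_of (fst z) + \<gamma> * VQ Q (snd z))) / (p_b G s a * pmf (med s a) m)"
proof -
  have "{z \<in> space (transition_law G (pa G s) s). act_of (fst z) = a \<and> med_of (fst z) = m} = cell a m"
    by (simp add: space_transition cell_def)
  then show ?thesis by (simp add: bellman_opt_def Let_def VQ_def measure_cell)
qed

text \<open>Averaging over the logged action multiplies each conditional expectation by
  \<open>p_b\<close>, which cancels against the mass of its cell; the left side of
  \<open>front_door_adjustment\<close> remains. Thus the confounded mediated backup becomes the
  interventional backup of a function of the state.\<close>

lemma mix_bellman:
  assumes Q: "qfun Q"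
  shows "mixQ (p_b G) (p_m G) (bellman_opt G Q) s a = T a (VQ Q) s"
proof -
  have "mixQ (p_b G) (p_m G) (bellman_opt G Q) s a =
    (\<Sum>a'\<in>UNIV. \<Sum>m\<in>UNIV. pmf (med s a) m * ((LINT z|transition_law G (pa G s) s. indicat_real (cell a' m) z *
     (rew_of (fst z) + \<gamma> * VQ Q (snd z))) / pmf (med s a') m))"
    unfolding mixQ_def
  proof (intro sum.cong refl)
    fix a' m
    show "bellman_opt G Q s a' m * p_b G s a' * p_m G s a m = pmf (med s a) m * ((LINT z|transition_law G (pa G s) s. indicat_real (cell a' m) z *
     (rew_of (fst z) + \<gamma> * VQ Q (snd z))) / pmf (med s a') m)"
      using p_b_pos[of s a'] by (simp add: bellman_eq)
  qed
  also have "\<dots> = (\<Sum>m\<in>UNIV. pmf (med s a) m * (LINT z|effect s m. fst z + \<gamma> * VQ Q (snd z)))"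
    by (subst sum.swap) (simp only: sum_distrib_left[symmetric] front_door_adjustment[OF bdd_VQ[OF Q]])
  finally show ?thesis by (simp add: T_def)
qed

section \<open>The law of a transition tuple\<close>

text \<open>The transition law from \<open>s\<close> has first state \<open>s\<close>, so the
  parameter can replace the coordinate. This fits functions of the state to
  \<open>path_law_step\<close>, whose integrand sees coordinates only.\<close>

lemma nn_transition_state:
  assumes H[measurable]: "H \<in> borel_measurable (St G \<Otimes>\<^sub>M (fullM G \<Otimes>\<^sub>M St G))" and \<alpha>: "action_kernel \<alpha>"
  shows "(\<integral>\<^sup>+z. H (state_of (fst z), z) \<partial>transition_law G \<alpha> s) = (\<integral>\<^sup>+z. H (s, z) \<partial>transition_law G \<alpha> s)"
proof -
  have s[measurable]: "s \<in> space (St G)" by simp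
  have 1: "(\<lambda>z. H (state_of (fst z), z)) \<in> borel_measurable (fullM G \<Otimes>\<^sub>M St G)"
    and 2: "(\<lambda>z. H (s, z)) \<in> borel_measurable (fullM G \<Otimes>\<^sub>M St G)" by measurable
  have K: "next_law G \<in> fullM G \<rightarrow>\<^sub>M subprob_algebra (St G)" by (rule measurable_prob_algebraD) measurable
  have 3: "(\<lambda>x. \<integral>\<^sup>+s'. H (state_of x, (x, s')) \<partial>next_law G x) \<in> borel_measurable (fullM G)"
    by (rule nn_integral_measurable_subprob_algebra2[OF _ K]) measurable
  have 4: "(\<lambda>x. \<integral>\<^sup>+s'. H (s, (x, s')) \<partial>next_law G x) \<in> borel_measurable (fullM G)"
    by (rule nn_integral_measurable_subprob_algebra2[OF _ K]) measurable
  show ?thesis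
    unfolding nn_transition_law[OF 1 \<alpha>] nn_transition_law[OF 2 \<alpha>] fst_conv
    unfolding nn_step_law[OF 3 \<alpha>] nn_step_law[OF 4 \<alpha>] by simp
qed

text \<open>For signed integrands the nonnegative version is applied to indicators, which identifies
  the two push-forward measures.\<close>

lemma integral_transition_state:
  fixes H :: "'s \<times> (('s, 'c, 'a, 'm) full \<times> 's) \<Rightarrow> real"
  assumes H[measurable]: "H \<in> borel_measurable (St G \<Otimes>\<^sub>M (fullM G \<Otimes>\<^sub>M St G))" and \<alpha>: "action_kernel \<alpha>"
  shows "(LINT z|transition_law G \<alpha> s. H (state_of (fst z), z)) = (LINT z|transition_law G \<alpha> s. H (s, z))"
proof -
  have s[measurable]: "s \<in> space (St G)" by simp
  note [measurable_cong] = sets_transition[OF \<alpha>]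
  let ?M = "St G \<Otimes>\<^sub>M (fullM G \<Otimes>\<^sub>M St G)"
  have "distr (transition_law G \<alpha> s) ?M (\<lambda>z. (state_of (fst z), z)) = distr (transition_law G \<alpha> s) ?M (\<lambda>z. (s, z))"
  proof (rule measure_eqI)
    fix A assume "A \<in> sets (distr (transition_law G \<alpha> s) ?M (\<lambda>z. (state_of (fst z), z)))"
    then have A[measurable]: "A \<in> sets ?M" by simp
    have "(\<integral>\<^sup>+x. indicator A x \<partial>distr (transition_law G \<alpha> s) ?M (\<lambda>z. (state_of (fst z), z))) =
      (\<integral>\<^sup>+x. indicator A x \<partial>distr (transition_law G \<alpha> s) ?M (\<lambda>z. (s, z)))"
      by (subst (1 2) nn_integral_distr) (auto intro: nn_transition_state[OF _ \<alpha>])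
    then show "emeasure (distr (transition_law G \<alpha> s) ?M (\<lambda>z. (state_of (fst z), z))) A = emeasure (distr (transition_law G \<alpha> s) ?M (\<lambda>z. (s, z))) A"
      by simp
  qed simp
  then have "(LINT x|distr (transition_law G \<alpha> s) ?M (\<lambda>z. (state_of (fst z), z)). H x) = (LINT x|distr (transition_law G \<alpha> s) ?M (\<lambda>z. (s, z)). H x)"
    by simp
  then show ?thesis by (subst (asm) (1 2) integral_distr) auto
qed

lemma offline_sections: "(\<lambda>s. transition_law G (pa G s) s) \<in> St G \<rightarrow>\<^sub>M subprob_algebra (fullM G \<Otimes>\<^sub>M St G)"
  by (rule measurable_prob_algebraD, rule transition_law_measurable) (simp_all add: pa_kernel[unfolded split_beta'])

lemma sum_cells:
  fixes f :: "'a \<Rightarrow> 'm \<Rightarrow> 'z::semiring_1"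
  shows "f (act_of (fst z)) (med_of (fst z)) = (\<Sum>a\<in>UNIV. \<Sum>m\<in>UNIV. indicator (cell a m) z * f a m)"
proof -
  have "(\<Sum>a\<in>UNIV. \<Sum>m\<in>UNIV. indicator (cell a m) z * f a m) =
    (\<Sum>a\<in>UNIV. if a = act_of (fst z) then (\<Sum>m\<in>UNIV. if m = med_of (fst z) then f a m else 0) else 0)"
    by (intro sum.cong refl) (auto simp: cell_def indicator_def intro!: sum.cong sum.neutral)
  then show ?thesis by simp
qed

text \<open>Each cell has mass \<open>p_b\<close> times \<open>med\<close> under the transition law,
  and the initial state has law \<open>rho0\<close>; the confounder is integrated out.\<close>

lemma nn_tuple_am:
  assumes \<phi>: "\<And>a m. (\<lambda>s. \<phi> s a m) \<in> borel_measurable (St G)"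
  shows "(\<integral>\<^sup>+w. \<phi> (state_of (w 0)) (act_of (w 0)) (med_of (w 0)) \<partial>offline G) =
    (\<integral>\<^sup>+s. (\<Sum>a\<in>UNIV. \<Sum>m\<in>UNIV. ennreal (p_b G s a * pmf (med s a) m) * \<phi> s a m) \<partial>rho0 G)"
proof -
  let ?F = "\<lambda>(s, z). \<Sum>a\<in>UNIV. \<Sum>m\<in>UNIV. indicator (cell a m) z * \<phi> s a m"
  note [measurable] = \<phi>
  have Fm[measurable]: "?F \<in> borel_measurable (St G \<Otimes>\<^sub>M (fullM G \<Otimes>\<^sub>M St G))"
    unfolding split_beta by measurable
  have in_eq: "(\<integral>\<^sup>+z. ?F (s, z) \<partial>transition_law G (pa G s) s) =
     (\<Sum>a\<in>UNIV. \<Sum>m\<in>UNIV. ennreal (p_b G s a * pmf (med s a) m) * \<phi> s a m)" for s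
  proof -
    interpret prob_space "transition_law G (pa G s) s" by (rule prob_transition) simp
    note S[measurable_cong] = sets_transition[OF action_kernel_pa, of s]
    have c: "(\<integral>\<^sup>+z. indicator (cell a m) z * \<phi> s a m \<partial>transition_law G (pa G s) s) = ennreal (p_b G s a * pmf (med s a) m) * \<phi> s a m" for a m
      by (subst nn_integral_multc) (auto simp: measure_cell[symmetric] emeasure_eq_measure)
    show ?thesis
      unfolding prod.case
      by (subst nn_integral_sum, measurable, intro sum.cong refl, subst nn_integral_sum, measurable, simp only: c)
  qed
  have "(\<integral>\<^sup>+w. \<phi> (state_of (w 0)) (act_of (w 0)) (med_of (w 0)) \<partial>offline G) =
    (\<integral>\<^sup>+w. (\<lambda>z. ?F (state_of (fst z), z)) (w 0, state_of (w (Suc 0))) \<partial>offline G)"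
  proof (rule nn_integral_cong)
    fix w :: "nat \<Rightarrow> ('s, 'c, 'a, 'm) full"
    show "\<phi> (state_of (w 0)) (act_of (w 0)) (med_of (w 0)) = (\<lambda>z. ?F (state_of (fst z), z)) (w 0, state_of (w (Suc 0)))"
      using sum_cells[of "\<phi> (state_of (w 0))" "(w 0, state_of (w (Suc 0)))"] by (simp only: prod.case fst_conv)
  qed
  also have "\<dots> = (\<integral>\<^sup>+w. (\<integral>\<^sup>+z. ?F (state_of (fst z), z) \<partial>transition_law G (pa G (state_of (w 0))) (state_of (w 0))) \<partial>offline G)"
    unfolding offline_def by (rule path_law_step[OF admissible_offline]) measurable
  also have "\<dots> = (\<integral>\<^sup>+w. (\<integral>\<^sup>+z. ?F (state_of (w 0), z) \<partial>transition_law G (pa G (state_of (w 0))) (state_of (w 0))) \<partial>offline G)"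
    by (intro nn_integral_cong nn_transition_state Fm) simp
  also have "\<dots> = (\<integral>\<^sup>+s. (\<integral>\<^sup>+z. ?F (s, z) \<partial>transition_law G (pa G s) s) \<partial>rho0 G)"
    unfolding offline_def
    by (rule path_law_initial[OF admissible_offline], rule nn_integral_measurable_subprob_algebra2[OF _ offline_sections]) (simp only: case_prod_eta Fm)
  finally show ?thesis by (simp only: in_eq)
qed

text \<open>On each cell \<open>bellman_opt\<close> is the elementary conditional mean of the
  target, so the residual integrates to zero against any weight that depends on state, action and
  mediator only.\<close>

lemma orthogonality:
  assumes Q: "qfun Q" and \<phi>: "\<And>a m. (\<lambda>s. \<phi> s a m) \<in> borel_measurable (St G)" "\<And>s a m. \<bar>\<phi> s a m\<bar> \<le> 2 * V"
    and B: "qfun (bellman_opt G Q)"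
  shows "(LINT w|offline G. \<phi> (state_of (w 0)) (act_of (w 0)) (med_of (w 0)) *
      (rew_of (w 0) + \<gamma> * VQ Q (state_of (w (Suc 0))) - bellman_opt G Q (state_of (w 0)) (act_of (w 0)) (med_of (w 0)))) = 0"
    and "integrable (offline G) (\<lambda>w. \<phi> (state_of (w 0)) (act_of (w 0)) (med_of (w 0)) *
      (rew_of (w 0) + \<gamma> * VQ Q (state_of (w (Suc 0))) - bellman_opt G Q (state_of (w 0)) (act_of (w 0)) (med_of (w 0))))"
proof -
  let ?f = "bellman_opt G Q"
  let ?H = "\<lambda>(s, z). \<Sum>a\<in>UNIV. \<Sum>m\<in>UNIV. indicat_real (cell a m) z * (\<phi> s a m * (rew_of (fst z) + \<gamma> * VQ Q (snd z) - ?f s a m))"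
  note [measurable] = \<phi>(1)
  have [measurable]: "(\<lambda>s. ?f s a m) \<in> borel_measurable (St G)" for a m using B by (simp add: qfun_def)
  have u: "bdd (VQ Q)" by (rule bdd_VQ[OF Q])
  have [measurable]: "VQ Q \<in> borel_measurable (St G)" using u by (simp add: bdd_def)
  have Hm[measurable]: "?H \<in> borel_measurable (St G \<Otimes>\<^sub>M (fullM G \<Otimes>\<^sub>M St G))"
    unfolding split_beta by measurable
  have H_eq: "?H (s, z) = \<phi> s (act_of (fst z)) (med_of (fst z)) * (rew_of (fst z) + \<gamma> * VQ Q (snd z) - ?f s (act_of (fst z)) (med_of (fst z)))" for s z
    unfolding prod.case
    by (rule sum_cells[symmetric, where f="\<lambda>a m. \<phi> s a m * (rew_of (fst z) + \<gamma> * VQ Q (snd z) - ?f s a m)"])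
  have zero: "(LINT z|transition_law G (pa G s) s. ?H (s, z)) = 0" for s
  proof -
    interpret prob_space "transition_law G (pa G s) s" by (rule prob_transition) simp
    note S[measurable_cong] = sets_transition[OF action_kernel_pa, of s]
    have i1: "integrable (transition_law G (pa G s) s) (\<lambda>z. indicat_real (cell a m) z * (rew_of (fst z) + \<gamma> * VQ Q (snd z)))" for a m
      using integrable_mult_indicator[OF _ integrable_transition(1)[OF u action_kernel_pa, of s s], of "cell a m"] by (simp add: S)
    have i2: "integrable (transition_law G (pa G s) s) (\<lambda>z. indicat_real (cell a m) z)" for a m
      by (rule integrable_real_indicator) (auto simp: S emeasure_eq_measure)
    have 0: "(LINT z|transition_law G (pa G s) s. \<phi> s a m * (indicat_real (cell a m) z * (rew_of (fst z) + \<gamma> * VQ Q (snd z))) - \<phi> s a m * ?f s a m * indicat_real (cell a m) z) = 0" for a m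
    proof -
      have "(LINT z|transition_law G (pa G s) s. \<phi> s a m * (indicat_real (cell a m) z * (rew_of (fst z) + \<gamma> * VQ Q (snd z))) - \<phi> s a m * ?f s a m * indicat_real (cell a m) z)
        = \<phi> s a m * (LINT z|transition_law G (pa G s) s. indicat_real (cell a m) z * (rew_of (fst z) + \<gamma> * VQ Q (snd z))) - \<phi> s a m * ?f s a m * measure (transition_law G (pa G s) s) (cell a m)"
        using i1 i2 by (subst Bochner_Integration.integral_diff) (auto simp: S)
      also have "\<dots> = 0"
        using p_b_pos[of s a] med_pos[of s a m] by (simp add: measure_cell bellman_eq)
      finally show ?thesis .
    qed
    have "?H (s, z) = (\<Sum>a\<in>UNIV. \<Sum>m\<in>UNIV. \<phi> s a m * (indicat_real (cell a m) z * (rew_of (fst z) + \<gamma> * VQ Q (snd z))) - \<phi> s a m * ?f s a m * indicat_real (cell a m) z)" for z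
      unfolding prod.case by (intro sum.cong refl) (simp add: algebra_simps)
    then have "(LINT z|transition_law G (pa G s) s. ?H (s, z)) = (\<Sum>a\<in>UNIV. \<Sum>m\<in>UNIV. LINT z|transition_law G (pa G s) s. \<phi> s a m * (indicat_real (cell a m) z * (rew_of (fst z) + \<gamma> * VQ Q (snd z))) - \<phi> s a m * ?f s a m * indicat_real (cell a m) z)"
      using i1 i2 by (simp only:) (subst Bochner_Integration.integral_sum, auto intro!: Bochner_Integration.integrable_sum Bochner_Integration.integrable_diff integrable_mult_right sum.cong Bochner_Integration.integral_sum)
    then show ?thesis by (simp only: 0 sum.neutral_const)
  qed
  have bound: "AE z in transition_law G \<beta> s. \<bar>?H (state_of (fst z), z)\<bar> \<le> 2 * V * (2 * V)" if "action_kernel \<beta>" for \<beta> s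
    using integrable_transition(2)[OF u that]
  proof eventually_elim
    case (elim z)
    have "\<bar>rew_of (fst z) + \<gamma> * VQ Q (snd z) - ?f (state_of (fst z)) (act_of (fst z)) (med_of (fst z))\<bar> \<le> 2 * V"
    proof -
      have "\<bar>?f (state_of (fst z)) (act_of (fst z)) (med_of (fst z))\<bar> \<le> V" using B by (simp add: qfun_def)
      then show ?thesis using elim by linarith
    qed
    then show ?case
      unfolding H_eq abs_mult using V_nonneg by (intro mult_mono \<phi>(2)) auto
  qed
  have m: "(\<lambda>z. ?H (state_of (fst z), z)) \<in> borel_measurable (fullM G \<Otimes>\<^sub>M St G)" by measurable
  note st = path_law_step_integral[OF admissible_offline m bound, where t=0, folded offline_def]
  show "integrable (offline G) (\<lambda>w. \<phi> (state_of (w 0)) (act_of (w 0)) (med_of (w 0)) *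
      (rew_of (w 0) + \<gamma> * VQ Q (state_of (w (Suc 0))) - ?f (state_of (w 0)) (act_of (w 0)) (med_of (w 0))))"
    using st(1) unfolding H_eq by simp
  have "(LINT w|offline G. ?H (state_of (w 0), (w 0, state_of (w (Suc 0))))) = 0"
    using st(3) by (simp only: fst_conv integral_transition_state[OF Hm action_kernel_pa] zero) simp
  then show "(LINT w|offline G. \<phi> (state_of (w 0)) (act_of (w 0)) (med_of (w 0)) *
      (rew_of (w 0) + \<gamma> * VQ Q (state_of (w (Suc 0))) - ?f (state_of (w 0)) (act_of (w 0)) (med_of (w 0)))) = 0"
    unfolding H_eq by simp
qed

end

section \<open>Regression error\<close>

text \<open>Besides the noise term the difference equals (Q - F)^2 + 2 g e (F - Q). A quarter of the
  square absorbs the cross term at the price 4 g^2 e^2, leaving 3/4; the slack is a perfect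
  square.\<close>

lemma excess_square_ge:
  fixes F Q Y g e :: real
  shows "2 * ((F - Q) * (Y - F)) + 3 / 4 * (Q - F)\<^sup>2 - 4 * g\<^sup>2 * e\<^sup>2 \<le> (Y + g * e - Q)\<^sup>2 - (Y + g * e - F)\<^sup>2"
proof -
  have "(Y + g * e - Q)\<^sup>2 - (Y + g * e - F)\<^sup>2 - (2 * ((F - Q) * (Y - F)) + 3 / 4 * (Q - F)\<^sup>2 - 4 * g\<^sup>2 * e\<^sup>2) =
    ((F - Q) / 2 + 2 * (g * e))\<^sup>2"
    by (simp add: power2_eq_square field_simps)
  also have "\<dots> \<ge> 0" by simp
  finally show ?thesis by linarith
qed

context fd_m2dp_pos begin

text \<open>Rewards are bounded only almost surely; clamping makes the scores bounded everywhere.\<close>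

definition clampR :: "real \<Rightarrow> real" where
  "clampR r = max (- Rmax G) (min (Rmax G) r)"

lemma clampR: "\<bar>clampR r\<bar> \<le> Rmax G" "\<bar>r\<bar> \<le> Rmax G \<Longrightarrow> clampR r = r"
  using Rmax_nonneg by (auto simp: clampR_def)

lemma clampR_measurable[measurable]: "clampR \<in> borel_measurable borel"
  unfolding clampR_def by measurable

text \<open>Loss of \<open>Q\<close> minus loss of the Bellman image of \<open>Q'\<close>, both
  against the plug-in target. \<open>Q'\<close> and the estimates are fixed functions here; their
  dependence on the data is recovered by uniformity over the finite classes.\<close>

definition excess :: "('s \<Rightarrow> 'a \<Rightarrow> 'm \<Rightarrow> real) \<Rightarrow> ('s \<Rightarrow> 'a \<Rightarrow> 'm \<Rightarrow> real) \<Rightarrow> ('s \<Rightarrow> 'a pmf) \<Rightarrow> ('s \<Rightarrow> 'a \<Rightarrow> 'm pmf)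
    \<Rightarrow> ('s, 'a, 'm) tuple \<Rightarrow> real" where
  "excess Q Q' qb qm x = (case x of (s, a, m, r, s') \<Rightarrow>
     (clampR r + \<gamma> * Vhat qb qm Q' s' - Q s a m)\<^sup>2 - (clampR r + \<gamma> * Vhat qb qm Q' s' - bellman_opt G Q' s a m)\<^sup>2)"

definition dist2 :: "('s \<Rightarrow> 'a \<Rightarrow> 'm \<Rightarrow> real) \<Rightarrow> ('s \<Rightarrow> 'a \<Rightarrow> 'm \<Rightarrow> real) \<Rightarrow> real" where
  "dist2 Q f = (LINT w|offline G. (Q (state_of (w 0)) (act_of (w 0)) (med_of (w 0)) - f (state_of (w 0)) (act_of (w 0)) (med_of (w 0)))\<^sup>2)"

text \<open>Taken at the next state, where the regression target evaluates the plug-in value; by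
  stationarity its law is that of the initial state.\<close>

definition plug2 :: "('s \<Rightarrow> 'a pmf) \<Rightarrow> ('s \<Rightarrow> 'a \<Rightarrow> 'm pmf) \<Rightarrow> ('s \<Rightarrow> 'a \<Rightarrow> 'm \<Rightarrow> real) \<Rightarrow> real" where
  "plug2 qb qm Q = (LINT w|offline G. (Vhat qb qm Q (state_of (w (Suc 0))) - VQ Q (state_of (w (Suc 0))))\<^sup>2)"

lemma qfun_am_measurable:
  assumes Q: "qfun Q" and [measurable]: "f \<in> X \<rightarrow>\<^sub>M St G" "g \<in> X \<rightarrow>\<^sub>M count_space UNIV" "h \<in> X \<rightarrow>\<^sub>M count_space UNIV"
  shows "(\<lambda>x. Q (f x) (g x) (h x)) \<in> borel_measurable X"
proof -
  have [measurable]: "(\<lambda>s. Q s a m) \<in> borel_measurable (St G)" for a m using Q by (simp add: qfun_def)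
  have "(\<lambda>x. Q (f x) a m) \<in> borel_measurable X" for a m by measurable
  then have "(\<lambda>x. Q (f x) (g x) m) \<in> borel_measurable X" for m
    by (rule measurable_compose_countable) measurable
  then show ?thesis by (rule measurable_compose_countable) measurable
qed

lemma dist2_nonneg: "0 \<le> dist2 Q f"
  unfolding dist2_def by (intro Bochner_Integration.integral_nonneg) auto

lemma plug2_nonneg: "0 \<le> plug2 qb qm Q"
  unfolding plug2_def by (intro Bochner_Integration.integral_nonneg) auto

lemma qfun_abs: "qfun Q \<Longrightarrow> \<bar>Q s a m\<bar> \<le> V"
  by (simp add: qfun_def)

lemma offline_integrable_bounded:
  fixes f :: "(nat \<Rightarrow> ('s, 'c, 'a, 'm) full) \<Rightarrow> real"
  assumes "f \<in> borel_measurable trajM" "\<And>w. \<bar>f w\<bar> \<le> B"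
  shows "integrable (offline G) f"
proof -
  interpret prob_space "offline G" by (rule prob_offline)
  show ?thesis
    by (rule integrable_const_bound[of _ B]) (use assms in \<open>auto simp: measurable_cong_sets[OF sets_offline refl]\<close>)
qed

lemma dist2_le:
  assumes "qfun Q" "qfun f" shows "dist2 Q f \<le> 4 * V\<^sup>2"
proof -
  interpret prob_space "offline G" by (rule prob_offline)
  have b: "(Q s a m - f s a m)\<^sup>2 \<le> 4 * V\<^sup>2" for s a m
  proof -
    have "\<bar>Q s a m - f s a m\<bar> \<le> 2 * V" using qfun_abs[OF assms(1), of s a m] qfun_abs[OF assms(2), of s a m] by linarith
    then have "\<bar>Q s a m - f s a m\<bar>\<^sup>2 \<le> (2 * V)\<^sup>2" by (intro power_mono) auto
    then show ?thesis by (simp add: power_mult_distrib)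
  qed
  have "integrable (offline G) (\<lambda>w. (Q (state_of (w 0)) (act_of (w 0)) (med_of (w 0)) - f (state_of (w 0)) (act_of (w 0)) (med_of (w 0)))\<^sup>2)"
    by (rule offline_integrable_bounded[where B="4 * V\<^sup>2"])
       (use b in \<open>auto intro!: borel_measurable_power borel_measurable_diff qfun_am_measurable assms\<close>)
  then show ?thesis unfolding dist2_def by (intro integral_le_const AE_I2 b)
qed

lemma AE_offline_reward: "AE w in offline G. \<bar>rew_of (w t)\<bar> \<le> Rmax G"
proof -
  let ?F = "\<lambda>z :: ('s, 'c, 'a, 'm) full \<times> 's. indicator {z. Rmax G < \<bar>rew_of (fst z)\<bar>} z :: ennreal"
  have m[measurable]: "{z. Rmax G < \<bar>rew_of (fst z)\<bar>} \<in> sets (fullM G \<Otimes>\<^sub>M St G)"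
  proof -
    have "Measurable.pred (fullM G \<Otimes>\<^sub>M St G) (\<lambda>z. Rmax G < \<bar>rew_of (fst z)\<bar>)" by measurable
    then show ?thesis by (simp add: pred_def space_pair_measure)
  qed
  have ak: "action_kernel (pa G s)" for s by simp
  have "(\<integral>\<^sup>+w. ?F (w t, state_of (w (Suc t))) \<partial>offline G) =
    (\<integral>\<^sup>+w. (\<integral>\<^sup>+z. ?F z \<partial>transition_law G (pa G (state_of (w t))) (state_of (w t))) \<partial>offline G)"
    unfolding offline_def by (rule path_law_step[OF admissible_offline]) measurable
  also have "\<dots> = (\<integral>\<^sup>+w. 0 \<partial>offline G)"
  proof (rule nn_integral_cong)
    fix w :: "nat \<Rightarrow> ('s, 'c, 'a, 'm) full"
    have "(\<integral>\<^sup>+z. ?F z \<partial>transition_law G (pa G (state_of (w t))) (state_of (w t))) =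
      (\<integral>\<^sup>+z. 0 \<partial>transition_law G (pa G (state_of (w t))) (state_of (w t)))"
      by (rule nn_integral_cong_AE, rule eventually_mono[OF AE_transition_reward[OF ak]]) (simp add: indicator_def)
    then show "(\<integral>\<^sup>+z. ?F z \<partial>transition_law G (pa G (state_of (w t))) (state_of (w t))) = 0" by simp
  qed
  finally have "(\<integral>\<^sup>+w. indicator {w. Rmax G < \<bar>rew_of (w t)\<bar>} w \<partial>offline G) = 0" by (simp add: indicator_def)
  then have "AE w in offline G. indicator {w. Rmax G < \<bar>rew_of (w t)\<bar>} w = (0::ennreal)"
  proof (subst (asm) nn_integral_0_iff_AE)
    have "Measurable.pred trajM (\<lambda>w. Rmax G < \<bar>rew_of (w t)\<bar>)" by measurable
    then have "{w. Rmax G < \<bar>rew_of (w t)\<bar>} \<in> sets (offline G)" by (simp add: pred_def sets_offline)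
    then show "(\<lambda>w. indicator {w. Rmax G < \<bar>rew_of (w t)\<bar>} w :: ennreal) \<in> borel_measurable (offline G)" by simp
  qed
  then show ?thesis by eventually_elim (auto simp: indicator_def split: if_splits)
qed

lemma excess_measurable:
  assumes Q: "qfun Q" "qfun Q'" "qfun (bellman_opt G Q')" and c: "pb_class G {qb}" "pm_class G {qm}"
  shows "excess Q Q' qb qm \<in> borel_measurable (tupleM G)"
proof -
  have [measurable]: "Vhat qb qm Q' \<in> borel_measurable (St G)" using bdd_Vhat[OF Q(2) c] by (simp add: bdd_def)
  have 1: "(\<lambda>x. Q (fst x) (fst (snd x)) (fst (snd (snd x)))) \<in> borel_measurable (tupleM G)"
    "(\<lambda>x. bellman_opt G Q' (fst x) (fst (snd x)) (fst (snd (snd x)))) \<in> borel_measurable (tupleM G)"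
    unfolding tupleM_def by (rule qfun_am_measurable[OF Q(1)] qfun_am_measurable[OF Q(3)], measurable)+
  have 2: "(\<lambda>x. clampR (fst (snd (snd (snd x)))) + \<gamma> * Vhat qb qm Q' (snd (snd (snd (snd x))))) \<in> borel_measurable (tupleM G)"
    unfolding tupleM_def by measurable
  show ?thesis unfolding excess_def split_beta
    by (intro borel_measurable_diff borel_measurable_power 1 2)
qed

text \<open>The difference of squares factors as (2 y - Q - f)(f - Q), with factors at most 4 V and
  2 V. Keeping the second factor makes the second moment proportional to the squared error, which is
  the source of the fast rate.\<close>

lemma excess_bound:
  assumes Q: "qfun Q" "qfun Q'" "qfun (bellman_opt G Q')" and c: "pb_class G {qb}" "pm_class G {qm}"
  shows "(excess Q Q' qb qm (s, a, m, r, s'))\<^sup>2 \<le> 16 * V\<^sup>2 * (Q s a m - bellman_opt G Q' s a m)\<^sup>2"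
    and "\<bar>excess Q Q' qb qm x\<bar> \<le> 8 * V\<^sup>2"
proof -
  have main: "(excess Q Q' qb qm (s, a, m, r, s'))\<^sup>2 \<le> 16 * V\<^sup>2 * (Q s a m - bellman_opt G Q' s a m)\<^sup>2
      \<and> \<bar>excess Q Q' qb qm (s, a, m, r, s')\<bar> \<le> 8 * V\<^sup>2" for s a m r s'
  proof -
    let ?y = "clampR r + \<gamma> * Vhat qb qm Q' s'" and ?Q = "Q s a m" and ?f = "bellman_opt G Q' s a m"
    have y: "\<bar>?y\<bar> \<le> V" using bdd_Vhat[OF Q(2) c] by (intro abs_target clampR) (simp add: bdd_def)
    have q: "\<bar>?Q\<bar> \<le> V" "\<bar>?f\<bar> \<le> V" using Q by (auto simp: qfun_def)
    have e: "excess Q Q' qb qm (s, a, m, r, s') = (2 * ?y - ?Q - ?f) * (?f - ?Q)"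
      by (simp add: excess_def power2_eq_square algebra_simps)
    have aux: "\<bar>2 * y - p - f\<bar> \<le> 4 * V \<and> \<bar>f - p\<bar> \<le> 2 * V"
      if "\<bar>y\<bar> \<le> V" "\<bar>p\<bar> \<le> V" "\<bar>f\<bar> \<le> V" for y p f :: real
      using that by linarith
    have a1: "\<bar>2 * ?y - ?Q - ?f\<bar> \<le> 4 * V" and a2: "\<bar>?f - ?Q\<bar> \<le> 2 * V"
      using aux[OF y q] by blast+
    have "\<bar>2 * ?y - ?Q - ?f\<bar> * \<bar>?f - ?Q\<bar> \<le> (4 * V) * (2 * V)"
      using a1 a2 V_nonneg by (intro mult_mono) auto
    moreover have "\<bar>2 * ?y - ?Q - ?f\<bar>\<^sup>2 \<le> (4 * V)\<^sup>2" using a1 by (intro power_mono) auto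
    then have "(2 * ?y - ?Q - ?f)\<^sup>2 * (?f - ?Q)\<^sup>2 \<le> (16 * V\<^sup>2) * (?f - ?Q)\<^sup>2"
      by (intro mult_right_mono) (auto simp: power_mult_distrib)
    ultimately show ?thesis
      unfolding e by (simp add: abs_mult power_mult_distrib power2_commute[of ?f ?Q] power2_eq_square[of V])
  qed
  show "(excess Q Q' qb qm (s, a, m, r, s'))\<^sup>2 \<le> 16 * V\<^sup>2 * (Q s a m - bellman_opt G Q' s a m)\<^sup>2"
    using main by blast
  show "\<bar>excess Q Q' qb qm x\<bar> \<le> 8 * V\<^sup>2"
    by (cases x) (use main in blast)
qed

text \<open>The product with the noise has mean zero by \<open>orthogonality\<close>, as the other
  factor depends on state, action and mediator only; the plug-in bias enters through
  \<open>excess_square_ge\<close>.\<close>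

lemma excess_mean:
  assumes Q: "qfun Q" "qfun Q'" "qfun (bellman_opt G Q')" and c: "pb_class G {qb}" "pm_class G {qm}"
  shows "3 / 4 * dist2 Q (bellman_opt G Q') - 4 * \<gamma>\<^sup>2 * plug2 qb qm Q' \<le> (LINT w|offline G. excess Q Q' qb qm (tuple_of (w 0) (w (Suc 0))))"
    and "(LINT w|offline G. (excess Q Q' qb qm (tuple_of (w 0) (w (Suc 0))))\<^sup>2) \<le> 16 * V\<^sup>2 * dist2 Q (bellman_opt G Q')"
    and "integrable (offline G) (\<lambda>w. excess Q Q' qb qm (tuple_of (w 0) (w (Suc 0))))"
    and "integrable (offline G) (\<lambda>w. (excess Q Q' qb qm (tuple_of (w 0) (w (Suc 0))))\<^sup>2)"
proof -
  let ?f = "bellman_opt G Q'"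
  let ?Q = "\<lambda>w :: nat \<Rightarrow> ('s, 'c, 'a, 'm) full. Q (state_of (w 0)) (act_of (w 0)) (med_of (w 0))"
  let ?F = "\<lambda>w :: nat \<Rightarrow> ('s, 'c, 'a, 'm) full. ?f (state_of (w 0)) (act_of (w 0)) (med_of (w 0))"
  let ?e = "\<lambda>w :: nat \<Rightarrow> ('s, 'c, 'a, 'm) full. Vhat qb qm Q' (state_of (w (Suc 0))) - VQ Q' (state_of (w (Suc 0)))"
  let ?Y = "\<lambda>w :: nat \<Rightarrow> ('s, 'c, 'a, 'm) full. rew_of (w 0) + \<gamma> * VQ Q' (state_of (w (Suc 0)))"
  let ?Z = "\<lambda>w. excess Q Q' qb qm (tuple_of (w 0) (w (Suc 0)))"
  note [measurable] = excess_measurable[OF Q c]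
  show iZ: "integrable (offline G) ?Z"
    by (rule offline_integrable_bounded[OF _ excess_bound(2)[OF Q c]]) measurable
  have Zb2: "(excess Q Q' qb qm x)\<^sup>2 \<le> (8 * V\<^sup>2)\<^sup>2" for x
    using power_mono[OF excess_bound(2)[OF Q c, of x], of 2] by simp
  show iZ2: "integrable (offline G) (\<lambda>w. (?Z w)\<^sup>2)"
    by (rule offline_integrable_bounded[where B="(8 * V\<^sup>2)\<^sup>2"]) (use Zb2 in auto)
  have mQ: "?Q \<in> borel_measurable trajM" "?F \<in> borel_measurable trajM"
    by (rule qfun_am_measurable[OF Q(1)] qfun_am_measurable[OF Q(3)], measurable)+
  have eb: "\<bar>?e w\<bar> \<le> 2 * V" for w
  proof -
    have "\<bar>Vhat qb qm Q' (state_of (w (Suc 0)))\<bar> \<le> V" "\<bar>VQ Q' (state_of (w (Suc 0)))\<bar> \<le> V"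
      using bdd_Vhat[OF Q(2) c] bdd_VQ[OF Q(2)] by (auto simp: bdd_def)
    then show ?thesis by linarith
  qed
  have [measurable]: "Vhat qb qm Q' \<in> borel_measurable (St G)" "VQ Q' \<in> borel_measurable (St G)"
    using bdd_Vhat[OF Q(2) c] bdd_VQ[OF Q(2)] by (auto simp: bdd_def)
  have me: "?e \<in> borel_measurable trajM" by measurable
  have sq: "\<bar>x\<bar> \<le> 2 * V \<Longrightarrow> \<bar>x\<^sup>2\<bar> \<le> (2 * V)\<^sup>2" for x :: real
    using power_mono[of "\<bar>x\<bar>" "2 * V" 2] by simp
  have QF: "\<bar>?Q w - ?F w\<bar> \<le> 2 * V" for w
    using qfun_abs[OF Q(1), of "state_of (w 0)" "act_of (w 0)" "med_of (w 0)"] qfun_abs[OF Q(3), of "state_of (w 0)" "act_of (w 0)" "med_of (w 0)"] by linarith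
  have iD: "integrable (offline G) (\<lambda>w. (?Q w - ?F w)\<^sup>2)"
    by (rule offline_integrable_bounded[OF _ sq[OF QF]]) (intro borel_measurable_power borel_measurable_diff mQ)
  have ie: "integrable (offline G) (\<lambda>w. (?e w)\<^sup>2)"
    by (rule offline_integrable_bounded[OF _ sq[OF eb]]) (intro borel_measurable_power me)
  have o: "(LINT w|offline G. (?F w - ?Q w) * (?Y w - ?F w)) = 0" "integrable (offline G) (\<lambda>w. (?F w - ?Q w) * (?Y w - ?F w))"
  proof -
    have "(\<lambda>s. ?f s a m - Q s a m) \<in> borel_measurable (St G)" for a m
      by (intro borel_measurable_diff) (use Q in \<open>simp_all add: qfun_def\<close>)
    moreover have "\<bar>?f s a m - Q s a m\<bar> \<le> 2 * V" for s a m
      using qfun_abs[OF Q(1), of s a m] qfun_abs[OF Q(3), of s a m] by linarith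
    ultimately show "(LINT w|offline G. (?F w - ?Q w) * (?Y w - ?F w)) = 0" "integrable (offline G) (\<lambda>w. (?F w - ?Q w) * (?Y w - ?F w))"
      using orthogonality[OF Q(2) _ _ Q(3), of "\<lambda>s a m. ?f s a m - Q s a m"] by auto
  qed
  have pt: "AE w in offline G. 2 * ((?F w - ?Q w) * (?Y w - ?F w)) + 3 / 4 * (?Q w - ?F w)\<^sup>2 - 4 * \<gamma>\<^sup>2 * (?e w)\<^sup>2 \<le> ?Z w"
    using AE_offline_reward[of 0]
  proof eventually_elim
    case (elim w)
    have y: "clampR (rew_of (w 0)) + \<gamma> * Vhat qb qm Q' (state_of (w (Suc 0))) = ?Y w + \<gamma> * ?e w"
      by (simp add: clampR(2)[OF elim] algebra_simps)
    have Z: "?Z w = (?Y w + \<gamma> * ?e w - ?Q w)\<^sup>2 - (?Y w + \<gamma> * ?e w - ?F w)\<^sup>2"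
      unfolding tuple_of_eq excess_def prod.case y ..
    show ?case
      unfolding Z by (rule excess_square_ge)
  qed
  have "(LINT w|offline G. 2 * ((?F w - ?Q w) * (?Y w - ?F w)) + 3 / 4 * (?Q w - ?F w)\<^sup>2 - 4 * \<gamma>\<^sup>2 * (?e w)\<^sup>2) \<le> (LINT w|offline G. ?Z w)"
    by (rule integral_mono_AE[OF _ iZ pt])
       (intro Bochner_Integration.integrable_diff Bochner_Integration.integrable_add integrable_mult_right o iD ie)
  moreover have "(LINT w|offline G. 2 * ((?F w - ?Q w) * (?Y w - ?F w)) + 3 / 4 * (?Q w - ?F w)\<^sup>2 - 4 * \<gamma>\<^sup>2 * (?e w)\<^sup>2)
    = 2 * (LINT w|offline G. (?F w - ?Q w) * (?Y w - ?F w)) + 3 / 4 * dist2 Q ?f - 4 * \<gamma>\<^sup>2 * plug2 qb qm Q'"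
    unfolding dist2_def plug2_def
    by (subst Bochner_Integration.integral_diff, (intro Bochner_Integration.integrable_add integrable_mult_right o iD ie)+,
        subst Bochner_Integration.integral_add, (intro integrable_mult_right o iD ie)+) (simp only: integral_mult_right_zero)
  ultimately show "3 / 4 * dist2 Q ?f - 4 * \<gamma>\<^sup>2 * plug2 qb qm Q' \<le> (LINT w|offline G. ?Z w)"
    by (simp add: o(1))
  have "(LINT w|offline G. (?Z w)\<^sup>2) \<le> (LINT w|offline G. 16 * V\<^sup>2 * (?Q w - ?F w)\<^sup>2)"
  proof (rule integral_mono[OF iZ2])
    show "(?Z w)\<^sup>2 \<le> 16 * V\<^sup>2 * (?Q w - ?F w)\<^sup>2" for w
      unfolding tuple_of_eq by (rule excess_bound(1)[OF Q c])
  qed (intro integrable_mult_right iD)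
  then show "(LINT w|offline G. (?Z w)\<^sup>2) \<le> 16 * V\<^sup>2 * dist2 Q ?f"
    by (simp add: dist2_def)
qed

text \<open>The scale 64 V^2 is chosen so that two quarters match: the mean excess contains 3/4 of
  \<open>dist2\<close>, only 1/2 is used here, and the remaining 1/4 pays for the second moment,
  since 16 V^2 / (64 V^2) = 1/4.\<close>

definition score :: "('s \<Rightarrow> 'a \<Rightarrow> 'm \<Rightarrow> real) \<Rightarrow> ('s \<Rightarrow> 'a \<Rightarrow> 'm \<Rightarrow> real) \<Rightarrow> ('s \<Rightarrow> 'a pmf) \<Rightarrow> ('s \<Rightarrow> 'a \<Rightarrow> 'm pmf)
    \<Rightarrow> ('s, 'a, 'm) tuple \<Rightarrow> real" where
  "score Q Q' qb qm x = (dist2 Q (bellman_opt G Q') / 2 - 4 * \<gamma>\<^sup>2 * plug2 qb qm Q' - excess Q Q' qb qm x) / (64 * V\<^sup>2)"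

text \<open>The exponential is bounded by \<open>exp_le_quadratic\<close>, integrated, and returned
  to an exponent by 1 + x \<le> exp x; the two moments in \<open>excess_mean\<close> make that
  exponent nonpositive.\<close>

lemma score:
  assumes V0: "0 < V" and Q: "qfun Q" "qfun Q'" "qfun (bellman_opt G Q')" and c: "pb_class G {qb}" "pm_class G {qm}"
  shows "score Q Q' qb qm \<in> borel_measurable (tupleM G)"
    and "score Q Q' qb qm x \<le> 1"
    and "(\<integral>\<^sup>+w. exp (score Q Q' qb qm (tuple_of (w 0) (w (Suc 0)))) \<partial>offline G) \<le> 1"
proof -
  interpret prob_space "offline G" by (rule prob_offline)
  note [measurable] = excess_measurable[OF Q c]
  show [measurable]: "score Q Q' qb qm \<in> borel_measurable (tupleM G)"
    unfolding score_def[abs_def] by measurable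
  let ?D = "dist2 Q (bellman_opt G Q')" and ?p = "4 * \<gamma>\<^sup>2 * plug2 qb qm Q'"
  have p0: "0 \<le> ?p" by (simp add: plug2_nonneg)
  have "?D / 2 - ?p - excess Q Q' qb qm x \<le> 64 * V\<^sup>2"
    using dist2_le[OF Q(1,3)] p0 excess_bound(2)[OF Q c, of x] zero_le_power2[of V] by linarith
  then show "score Q Q' qb qm x \<le> 1" using V0 by (simp add: score_def)
  define \<theta> where "\<theta> = 1 / (64 * V\<^sup>2)"
  have \<theta>0: "0 < \<theta>" using V0 by (simp add: \<theta>_def)
  let ?Z = "\<lambda>w. excess Q Q' qb qm (tuple_of (w 0) (w (Suc 0)))"
  note mean = excess_mean[OF Q c]
  have sc: "score Q Q' qb qm (tuple_of (w 0) (w (Suc 0))) = \<theta> * (?D / 2 - ?p) - \<theta> * ?Z w" for w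
    by (simp add: score_def \<theta>_def diff_divide_distrib right_diff_distrib)
  have tz: "\<bar>- (\<theta> * excess Q Q' qb qm x)\<bar> \<le> 1" for x
  proof -
    have "\<theta> * \<bar>excess Q Q' qb qm x\<bar> \<le> \<theta> * (8 * V\<^sup>2)"
      using \<theta>0 excess_bound(2)[OF Q c] by (intro mult_left_mono) auto
    also have "\<dots> \<le> 1" using V0 by (simp add: \<theta>_def)
    finally show ?thesis using \<theta>0 by (simp add: abs_mult)
  qed
  let ?A = "exp (\<theta> * (?D / 2 - ?p))"
  have "(\<integral>\<^sup>+w. exp (score Q Q' qb qm (tuple_of (w 0) (w (Suc 0)))) \<partial>offline G)
    \<le> (\<integral>\<^sup>+w. ennreal (?A * (1 - \<theta> * ?Z w + \<theta>\<^sup>2 * (?Z w)\<^sup>2)) \<partial>offline G)"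
  proof (intro nn_integral_mono ennreal_leI)
    fix w :: "nat \<Rightarrow> ('s, 'c, 'a, 'm) full"
    have "exp (score Q Q' qb qm (tuple_of (w 0) (w (Suc 0)))) = ?A * exp (- (\<theta> * ?Z w))"
      unfolding sc exp_add[symmetric] by (simp only: diff_conv_add_uminus)
    also have "\<dots> \<le> ?A * (1 + - (\<theta> * ?Z w) + (- (\<theta> * ?Z w))\<^sup>2)"
      by (intro mult_left_mono exp_le_quadratic tz) (rule exp_ge_zero)
    also have "\<dots> = ?A * (1 - \<theta> * ?Z w + \<theta>\<^sup>2 * (?Z w)\<^sup>2)"
      by (simp only: power2_minus power_mult_distrib diff_conv_add_uminus)
    finally show "exp (score Q Q' qb qm (tuple_of (w 0) (w (Suc 0)))) \<le> ?A * (1 - \<theta> * ?Z w + \<theta>\<^sup>2 * (?Z w)\<^sup>2)" .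
  qed
  also have "\<dots> = ennreal (LINT w|offline G. ?A * (1 - \<theta> * ?Z w + \<theta>\<^sup>2 * (?Z w)\<^sup>2))"
  proof (rule nn_integral_eq_integral)
    show "integrable (offline G) (\<lambda>w. ?A * (1 - \<theta> * ?Z w + \<theta>\<^sup>2 * (?Z w)\<^sup>2))"
      by (intro integrable_mult_right Bochner_Integration.integrable_add Bochner_Integration.integrable_diff mean) simp
    have "0 \<le> 1 - \<theta> * ?Z w + \<theta>\<^sup>2 * (?Z w)\<^sup>2" for w
      using order_trans[OF exp_ge_zero exp_le_quadratic[OF tz, of "tuple_of (w 0) (w (Suc 0))"]]
      by (simp add: power_mult_distrib)
    then have "0 \<le> ?A * (1 - \<theta> * ?Z w + \<theta>\<^sup>2 * (?Z w)\<^sup>2)" for w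
      by (intro mult_nonneg_nonneg) (rule exp_ge_zero)
    then show "AE w in offline G. 0 \<le> ?A * (1 - \<theta> * ?Z w + \<theta>\<^sup>2 * (?Z w)\<^sup>2)" by (rule AE_I2)
  qed
  finally have fin: "(\<integral>\<^sup>+w. exp (score Q Q' qb qm (tuple_of (w 0) (w (Suc 0)))) \<partial>offline G)
    \<le> ennreal (LINT w|offline G. ?A * (1 - \<theta> * ?Z w + \<theta>\<^sup>2 * (?Z w)\<^sup>2))" .
  have "(LINT w|offline G. ?A * (1 - \<theta> * ?Z w + \<theta>\<^sup>2 * (?Z w)\<^sup>2)) =
    ?A * (1 - \<theta> * (LINT w|offline G. ?Z w) + \<theta>\<^sup>2 * (LINT w|offline G. (?Z w)\<^sup>2))"
    using mean by (simp add: prob_space[simplified])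
  also have "\<dots> \<le> ?A * exp (- (\<theta> * (LINT w|offline G. ?Z w)) + \<theta>\<^sup>2 * (LINT w|offline G. (?Z w)\<^sup>2))"
    using exp_ge_add_one_self[of "- (\<theta> * (LINT w|offline G. ?Z w)) + \<theta>\<^sup>2 * (LINT w|offline G. (?Z w)\<^sup>2)"]
    by (intro mult_left_mono) (linarith, rule exp_ge_zero)
  also have "\<dots> = exp (\<theta> * (?D / 2 - ?p) - \<theta> * (LINT w|offline G. ?Z w) + \<theta>\<^sup>2 * (LINT w|offline G. (?Z w)\<^sup>2))"
    by (simp add: exp_add[symmetric])
  also have "\<dots> \<le> exp 0"
  proof (subst exp_le_cancel_iff)
    have "\<theta>\<^sup>2 * (LINT w|offline G. (?Z w)\<^sup>2) \<le> \<theta>\<^sup>2 * (16 * V\<^sup>2 * ?D)" by (intro mult_left_mono mean) auto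
    also have "\<dots> = \<theta> * (?D / 4)" using V0 by (simp add: \<theta>_def power2_eq_square field_simps)
    finally have 1: "\<theta>\<^sup>2 * (LINT w|offline G. (?Z w)\<^sup>2) \<le> \<theta> * (?D / 4)" .
    have 2: "\<theta> * (3 / 4 * ?D - ?p) \<le> \<theta> * (LINT w|offline G. ?Z w)"
      using mean(1) \<theta>0 by (intro mult_left_mono) auto
    show "\<theta> * (?D / 2 - ?p) - \<theta> * (LINT w|offline G. ?Z w) + \<theta>\<^sup>2 * (LINT w|offline G. (?Z w)\<^sup>2) \<le> 0"
      using 1 2 by (simp add: algebra_simps)
  qed
  finally have "(LINT w|offline G. ?A * (1 - \<theta> * ?Z w + \<theta>\<^sup>2 * (?Z w)\<^sup>2)) \<le> 1" by simp
  from order_trans[OF fin ennreal_leI[OF this]] show "(\<integral>\<^sup>+w. exp (score Q Q' qb qm (tuple_of (w 0) (w (Suc 0)))) \<partial>offline G) \<le> 1"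
    by (simp only: ennreal_1)
qed

end

text \<open>Jensen's inequality for the square, in the form that a variance is nonnegative.\<close>

lemma weighted_square_le:
  fixes w x :: "'i \<Rightarrow> real"
  assumes w: "\<And>i. i \<in> I \<Longrightarrow> 0 \<le> w i" and w1: "(\<Sum>i\<in>I. w i) = 1"
  shows "(\<Sum>i\<in>I. w i * x i)\<^sup>2 \<le> (\<Sum>i\<in>I. w i * (x i)\<^sup>2)"
proof -
  define \<mu> where "\<mu> = (\<Sum>i\<in>I. w i * x i)"
  have "0 \<le> (\<Sum>i\<in>I. w i * (x i - \<mu>)\<^sup>2)" by (intro sum_nonneg mult_nonneg_nonneg w) auto
  also have "\<dots> = (\<Sum>i\<in>I. w i * (x i)\<^sup>2 - 2 * \<mu> * (w i * x i) + \<mu>\<^sup>2 * w i)"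
    by (intro sum.cong refl) (simp add: power2_eq_square algebra_simps)
  also have "\<dots> = (\<Sum>i\<in>I. w i * (x i)\<^sup>2) - 2 * \<mu> * \<mu> + \<mu>\<^sup>2"
    by (simp add: sum.distrib sum_subtractf sum_distrib_left[symmetric] w1 \<mu>_def)
  finally show ?thesis by (simp add: \<mu>_def power2_eq_square)
qed

context fd_m2dp_pos begin

section \<open>Kullback-Leibler bound on the plug-in error\<close>

text \<open>The maximum over interventions turns an error of mediated Q-functions into a function of
  the state alone, to which state occupancies apply.\<close>

definition err :: "('s \<Rightarrow> 'a \<Rightarrow> 'm \<Rightarrow> real) \<Rightarrow> ('s \<Rightarrow> 'a \<Rightarrow> 'm \<Rightarrow> real) \<Rightarrow> 's \<Rightarrow> real" where
  "err Q f s = (MAX a. \<bar>mixQ (p_b G) (p_m G) Q s a - mixQ (p_b G) (p_m G) f s a\<bar>)"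

definition plug :: "('s \<Rightarrow> 'a pmf) \<Rightarrow> ('s \<Rightarrow> 'a \<Rightarrow> 'm pmf) \<Rightarrow> ('s \<Rightarrow> 'a \<Rightarrow> 'm \<Rightarrow> real) \<Rightarrow> 's \<Rightarrow> real" where
  "plug qb qm Q s = (MAX a. \<bar>mixQ_hat qb qm Q s a - mixQ (p_b G) (p_m G) Q s a\<bar>)"

lemma MAX_ge: "f a \<le> (MAX a. f a)" for f :: "'x::finite \<Rightarrow> real"
  by (rule Max_ge) auto

lemma err_measurable: "qfun Q \<Longrightarrow> qfun f \<Longrightarrow> err Q f \<in> borel_measurable (St G)"
  unfolding err_def[abs_def] by (intro borel_measurable_MAX borel_measurable_abs borel_measurable_diff mixQ_measurable)

lemma plug_measurable: "qfun Q \<Longrightarrow> pb_class G {qb} \<Longrightarrow> pm_class G {qm} \<Longrightarrow> plug qb qm Q \<in> borel_measurable (St G)"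
  unfolding plug_def[abs_def] by (intro borel_measurable_MAX borel_measurable_abs borel_measurable_diff mixQ_measurable mixQ_hat_measurable)

lemma err_ge: "\<bar>mixQ (p_b G) (p_m G) Q s a - mixQ (p_b G) (p_m G) f s a\<bar> \<le> err Q f s"
  unfolding err_def by (rule MAX_ge)

lemma plug_ge: "\<bar>mixQ_hat qb qm Q s a - mixQ (p_b G) (p_m G) Q s a\<bar> \<le> plug qb qm Q s"
  unfolding plug_def by (rule MAX_ge)

lemma err_nonneg: "0 \<le> err Q f s" using err_ge[of Q s undefined f] by linarith
lemma plug_nonneg: "0 \<le> plug qb qm Q s" using plug_ge[of qb qm Q s undefined] by linarith

lemma err_le: "qfun Q \<Longrightarrow> qfun f \<Longrightarrow> err Q f s \<le> 2 * V"
  unfolding err_def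
proof (rule Max.boundedI)
  fix x assume Q: "qfun Q" "qfun f" and "x \<in> range (\<lambda>a. \<bar>mixQ (p_b G) (p_m G) Q s a - mixQ (p_b G) (p_m G) f s a\<bar>)"
  then obtain a where "x = \<bar>mixQ (p_b G) (p_m G) Q s a - mixQ (p_b G) (p_m G) f s a\<bar>" by auto
  then show "x \<le> 2 * V" using mixQ_bound[OF Q(1), of s a] mixQ_bound[OF Q(2), of s a] by linarith
qed auto

lemma plug_le: "qfun Q \<Longrightarrow> plug qb qm Q s \<le> 2 * V"
  unfolding plug_def
proof (rule Max.boundedI)
  fix x assume Q: "qfun Q" and "x \<in> range (\<lambda>a. \<bar>mixQ_hat qb qm Q s a - mixQ (p_b G) (p_m G) Q s a\<bar>)"
  then obtain a where "x = \<bar>mixQ_hat qb qm Q s a - mixQ (p_b G) (p_m G) Q s a\<bar>" by auto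
  then show "x \<le> 2 * V" using mixQ_hat_bound[OF Q, of qb qm s a] mixQ_bound[OF Q, of s a] by linarith
qed auto

lemma Vhat_VQ: "\<bar>Vhat qb qm Q s - VQ Q s\<bar> \<le> plug qb qm Q s"
  unfolding Vhat_def VQ_def by (rule abs_Max_diff_le) (rule plug_ge)

lemma pmin_le_1: "pmin G \<le> 1"
  using pmin_le[of undefined undefined undefined undefined] pmf_le_1[of "pm G undefined undefined undefined"] by (meson order_trans)

text \<open>Jensen for the mixture at the maximising action \<open>a\<close>. In the data the
  mediator is drawn under the logged action instead; since mediator probabilities lie between
  \<open>pmin\<close> and one, exchanging the two laws costs 1 / \<open>pmin\<close>.\<close>

lemma err_square:
  "(err Q f s)\<^sup>2 \<le> (1 / pmin G) * (\<Sum>a\<in>UNIV. \<Sum>m\<in>UNIV. p_b G s a * pmf (med s a) m * (Q s a m - f s a m)\<^sup>2)"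
proof -
  have "err Q f s \<in> range (\<lambda>a. \<bar>mixQ (p_b G) (p_m G) Q s a - mixQ (p_b G) (p_m G) f s a\<bar>)"
    unfolding err_def by (rule Max_in) auto
  then obtain a where a: "err Q f s = \<bar>mixQ (p_b G) (p_m G) Q s a - mixQ (p_b G) (p_m G) f s a\<bar>" by auto
  have "mixQ (p_b G) (p_m G) Q s a - mixQ (p_b G) (p_m G) f s a =
    (\<Sum>i\<in>UNIV. (p_b G s (fst i) * pmf (med s a) (snd i)) * (Q s (fst i) (snd i) - f s (fst i) (snd i)))"
    by (simp add: mixQ_def sum_UNIV_prod sum_subtractf[symmetric] algebra_simps)
  then have "(err Q f s)\<^sup>2 \<le> (\<Sum>i\<in>UNIV. (p_b G s (fst i) * pmf (med s a) (snd i)) * (Q s (fst i) (snd i) - f s (fst i) (snd i))\<^sup>2)"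
    unfolding a power2_abs
    using weighted_square_le[of UNIV "\<lambda>i. p_b G s (fst i) * pmf (med s a) (snd i)" "\<lambda>i. Q s (fst i) (snd i) - f s (fst i) (snd i)"]
    by (simp add: p_b_nonneg sum_UNIV_prod sum_distrib_left[symmetric] sum_pmf_1 sum_p_b)
  also have "\<dots> = (\<Sum>a'\<in>UNIV. \<Sum>m\<in>UNIV. p_b G s a' * pmf (med s a) m * (Q s a' m - f s a' m)\<^sup>2)"
    by (simp add: sum_UNIV_prod)
  also have "\<dots> \<le> (\<Sum>a'\<in>UNIV. \<Sum>m\<in>UNIV. (1 / pmin G) * (p_b G s a' * pmf (med s a') m * (Q s a' m - f s a' m)\<^sup>2))"
  proof (intro sum_mono)
    fix a' m
    have "pmf (med s a) m * pmin G \<le> 1 * pmf (med s a') m"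
      using pmin_med[of s a' m] pmin_pos pmf_le_1[of "med s a" m] by (intro mult_mono) auto
    then have "pmf (med s a) m \<le> (1 / pmin G) * pmf (med s a') m" using pmin_pos by (simp add: field_simps)
    then have "p_b G s a' * pmf (med s a) m * (Q s a' m - f s a' m)\<^sup>2 \<le> p_b G s a' * ((1 / pmin G) * pmf (med s a') m) * (Q s a' m - f s a' m)\<^sup>2"
      by (intro mult_right_mono mult_left_mono p_b_nonneg) auto
    then show "p_b G s a' * pmf (med s a) m * (Q s a' m - f s a' m)\<^sup>2 \<le> (1 / pmin G) * (p_b G s a' * pmf (med s a') m * (Q s a' m - f s a' m)\<^sup>2)"
      by (simp add: mult_ac)
  qed
  finally show ?thesis by (simp add: sum_distrib_left)
qed

lemma nn_err:
  assumes Q: "qfun Q" "qfun f"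
  shows "(\<integral>\<^sup>+s. ennreal ((err Q f s)\<^sup>2) \<partial>rho0 G) \<le> ennreal (1 / pmin G) * ennreal (dist2 Q f)"
proof -
  have [measurable]: "(\<lambda>s. Q s a m) \<in> borel_measurable (St G)" "(\<lambda>s. f s a m) \<in> borel_measurable (St G)" for a m
    using Q by (auto simp: qfun_def)
  let ?D = "\<lambda>s. \<Sum>a\<in>UNIV. \<Sum>m\<in>UNIV. p_b G s a * pmf (med s a) m * (Q s a m - f s a m)\<^sup>2"
  have "(\<integral>\<^sup>+s. ennreal ((err Q f s)\<^sup>2) \<partial>rho0 G) \<le> (\<integral>\<^sup>+s. ennreal (1 / pmin G) * ennreal (?D s) \<partial>rho0 G)"
    using err_square pmin_pos by (intro nn_integral_mono) (subst ennreal_mult[symmetric], auto intro!: ennreal_leI sum_nonneg mult_nonneg_nonneg p_b_nonneg)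
  also have "\<dots> = ennreal (1 / pmin G) * (\<integral>\<^sup>+s. ennreal (?D s) \<partial>rho0 G)"
    by (rule nn_integral_cmult) measurable
  also have "(\<integral>\<^sup>+s. ennreal (?D s) \<partial>rho0 G) = (\<integral>\<^sup>+s. (\<Sum>a\<in>UNIV. \<Sum>m\<in>UNIV. ennreal (p_b G s a * pmf (med s a) m) * ennreal ((Q s a m - f s a m)\<^sup>2)) \<partial>rho0 G)"
    by (intro nn_integral_cong) (simp add: sum_ennreal[symmetric] sum_nonneg p_b_nonneg ennreal_mult)
  also have "\<dots> = (\<integral>\<^sup>+w. ennreal ((Q (state_of (w 0)) (act_of (w 0)) (med_of (w 0)) - f (state_of (w 0)) (act_of (w 0)) (med_of (w 0)))\<^sup>2) \<partial>offline G)"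
    by (rule nn_tuple_am[symmetric, where \<phi>="\<lambda>s a m. ennreal ((Q s a m - f s a m)\<^sup>2)"]) measurable
  also have "\<dots> = ennreal (dist2 Q f)"
    unfolding dist2_def
  proof (rule nn_integral_eq_integral)
    have "(Q s a m - f s a m)\<^sup>2 \<le> (2 * V)\<^sup>2" for s a m
      using power_mono[of "\<bar>Q s a m - f s a m\<bar>" "2 * V" 2] qfun_abs[OF Q(1), of s a m] qfun_abs[OF Q(2), of s a m] by simp
    then show "integrable (offline G) (\<lambda>w. (Q (state_of (w 0)) (act_of (w 0)) (med_of (w 0)) - f (state_of (w 0)) (act_of (w 0)) (med_of (w 0)))\<^sup>2)"
      by (intro offline_integrable_bounded[where B="(2 * V)\<^sup>2"] borel_measurable_power borel_measurable_diff
           qfun_am_measurable[OF Q(1)] qfun_am_measurable[OF Q(2)]) auto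
  qed simp
  finally show ?thesis .
qed

definition KLs :: "ennreal \<Rightarrow> ('s \<Rightarrow> 'a pmf) \<Rightarrow> ('s \<Rightarrow> 'a \<Rightarrow> 'm pmf) \<Rightarrow> 's \<Rightarrow> ennreal" where
  "KLs c qb qm s = KL (p_b G s) (pmf (qb s)) + c * (\<Sum>a\<in>UNIV. ennreal (p_b G s a) * KL (p_m G s a) (pmf (qm s a)))"

text \<open>The two estimated factors are replaced one at a time, and the factor that stays sums to
  one.\<close>

lemma mixQ_diff:
  assumes Q: "qfun Q"
  shows "\<bar>mixQ_hat qb qm Q s a - mixQ (p_b G) (p_m G) Q s a\<bar> \<le>
    V * ((\<Sum>a'\<in>UNIV. \<bar>p_b G s a' - pmf (qb s) a'\<bar>) + (\<Sum>m\<in>UNIV. \<bar>p_m G s a m - pmf (qm s a) m\<bar>))"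
proof -
  let ?b = "\<lambda>a'. \<bar>p_b G s a' - pmf (qb s) a'\<bar>" and ?m = "\<lambda>m. \<bar>p_m G s a m - pmf (qm s a) m\<bar>"
  have "mixQ_hat qb qm Q s a - mixQ (p_b G) (p_m G) Q s a =
    (\<Sum>a'\<in>UNIV. \<Sum>m\<in>UNIV. Q s a' m * ((pmf (qb s) a' - p_b G s a') * pmf (qm s a) m + p_b G s a' * (pmf (qm s a) m - p_m G s a m)))"
    unfolding mixQ_hat_def mixQ_def sum_subtractf[symmetric] by (intro sum.cong refl) (simp add: algebra_simps)
  also have "\<bar>\<dots>\<bar> \<le> (\<Sum>a'\<in>UNIV. \<Sum>m\<in>UNIV. V * (?b a' * pmf (qm s a) m + p_b G s a' * ?m m))"
  proof (intro order_trans[OF sum_abs] sum_mono)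
    fix a' m
    have "\<bar>(pmf (qb s) a' - p_b G s a') * pmf (qm s a) m + p_b G s a' * (pmf (qm s a) m - p_m G s a m)\<bar>
      \<le> \<bar>(pmf (qb s) a' - p_b G s a') * pmf (qm s a) m\<bar> + \<bar>p_b G s a' * (pmf (qm s a) m - p_m G s a m)\<bar>"
      by (rule abs_triangle_ineq)
    also have "\<dots> = ?b a' * pmf (qm s a) m + p_b G s a' * ?m m"
      by (simp add: abs_mult p_b_nonneg abs_minus_commute)
    finally have "\<bar>(pmf (qb s) a' - p_b G s a') * pmf (qm s a) m + p_b G s a' * (pmf (qm s a) m - p_m G s a m)\<bar>
      \<le> ?b a' * pmf (qm s a) m + p_b G s a' * ?m m" .
    then show "\<bar>Q s a' m * ((pmf (qb s) a' - p_b G s a') * pmf (qm s a) m + p_b G s a' * (pmf (qm s a) m - p_m G s a m))\<bar>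
      \<le> V * (?b a' * pmf (qm s a) m + p_b G s a' * ?m m)"
      unfolding abs_mult[of "Q s a' m"] using qfun_abs[OF Q] V_nonneg by (intro mult_mono) auto
  qed
  also have "\<dots> = V * ((\<Sum>a'\<in>UNIV. ?b a') + (\<Sum>m\<in>UNIV. ?m m))"
    by (simp add: sum_distrib_left[symmetric] sum.distrib sum_distrib_right[symmetric] sum_pmf_1 sum_p_b)
  finally show ?thesis .
qed

lemma c2_mult: "1 \<le> c2 G * ennreal (p_b G s a)"
proof -
  have "1 / ennreal (p_b G s a) \<le> c2 G"
    unfolding c2_def by (meson SUP_upper2 UNIV_I order_refl)
  then have "1 / ennreal (p_b G s a) * ennreal (p_b G s a) \<le> c2 G * ennreal (p_b G s a)"
    by (rule mult_right_mono) auto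
  moreover have "1 / ennreal (p_b G s a) * ennreal (p_b G s a) = 1"
    using p_b_pos[of s a] by (simp add: ennreal_divide_times)
  ultimately show ?thesis by simp
qed

text \<open>The maximising action depends on the state, whereas the mediator divergence is averaged
  under \<open>p_b\<close>; \<open>c2\<close> extracts the summand of a single action. The 8 is a 2
  from splitting the square times the 4 of \<open>KL_bound\<close>.\<close>

lemma plug_square:
  assumes Q: "qfun Q"
  shows "ennreal ((plug qb qm Q s)\<^sup>2) \<le> ennreal (8 * V\<^sup>2) * KLs (c2 G) qb qm s"
proof -
  have "plug qb qm Q s \<in> range (\<lambda>a. \<bar>mixQ_hat qb qm Q s a - mixQ (p_b G) (p_m G) Q s a\<bar>)"
    unfolding plug_def by (rule Max_in) auto
  then obtain a where a: "plug qb qm Q s = \<bar>mixQ_hat qb qm Q s a - mixQ (p_b G) (p_m G) Q s a\<bar>" by auto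
  let ?b = "\<Sum>a'\<in>UNIV. \<bar>p_b G s a' - pmf (qb s) a'\<bar>" and ?m = "\<Sum>m\<in>UNIV. \<bar>p_m G s a m - pmf (qm s a) m\<bar>"
  have "(plug qb qm Q s)\<^sup>2 \<le> (V * (?b + ?m))\<^sup>2"
    unfolding a by (intro power_mono mixQ_diff Q) auto
  also have "\<dots> = V\<^sup>2 * (?b + ?m)\<^sup>2" by (rule power_mult_distrib)
  also have "\<dots> \<le> V\<^sup>2 * (2 * ?b\<^sup>2 + 2 * ?m\<^sup>2)"
    using sum_squares_bound[of ?b ?m] by (intro mult_left_mono) (auto simp: power2_sum)
  finally have "ennreal ((plug qb qm Q s)\<^sup>2) \<le> ennreal (V\<^sup>2 * (2 * ?b\<^sup>2 + 2 * ?m\<^sup>2))" by (rule ennreal_leI)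
  also have "\<dots> = ennreal (2 * V\<^sup>2) * (ennreal (?b\<^sup>2) + ennreal (?m\<^sup>2))"
    by (simp add: ennreal_mult[symmetric] ennreal_plus[symmetric] algebra_simps del: ennreal_plus)
  also have "\<dots> \<le> ennreal (2 * V\<^sup>2) * (4 * KL (p_b G s) (pmf (qb s)) + 4 * KL (p_m G s a) (pmf (qm s a)))"
    by (intro mult_left_mono add_mono KL_bound) (auto simp: p_b_nonneg sum_p_b sum_pmf_1)
  also have "\<dots> \<le> ennreal (2 * V\<^sup>2) * (4 * KLs (c2 G) qb qm s)"
  proof (rule mult_left_mono)
    have "1 * KL (p_m G s a) (pmf (qm s a)) \<le> (c2 G * ennreal (p_b G s a)) * KL (p_m G s a) (pmf (qm s a))"
      by (intro mult_right_mono c2_mult) auto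
    also have "\<dots> = c2 G * (ennreal (p_b G s a) * KL (p_m G s a) (pmf (qm s a)))"
      by (rule mult.assoc)
    also have "\<dots> \<le> c2 G * (\<Sum>a\<in>UNIV. ennreal (p_b G s a) * KL (p_m G s a) (pmf (qm s a)))"
      by (intro mult_left_mono member_le_sum) auto
    finally show "4 * KL (p_b G s) (pmf (qb s)) + 4 * KL (p_m G s a) (pmf (qm s a)) \<le> 4 * KLs (c2 G) qb qm s"
      unfolding KLs_def distrib_left by (intro add_left_mono mult_left_mono) auto
  qed auto
  also have "\<dots> = ennreal (8 * V\<^sup>2) * KLs (c2 G) qb qm s"
  proof -
    have "ennreal (8 * V\<^sup>2) = ennreal (2 * V\<^sup>2) * 4"
      using ennreal_mult[of "2 * V\<^sup>2" 4] by (simp add: mult.commute)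
    then show ?thesis by (simp add: mult.assoc)
  qed
  finally show ?thesis .
qed

lemma KL_measurable:
  fixes p q :: "'y \<Rightarrow> 'x::finite \<Rightarrow> real"
  assumes [measurable]: "\<And>x. (\<lambda>y. p y x) \<in> borel_measurable M" "\<And>x. (\<lambda>y. q y x) \<in> borel_measurable M"
  shows "(\<lambda>y. KL (p y) (q y)) \<in> borel_measurable M"
  unfolding KL_def by measurable

text \<open>\<open>KL_b\<close> for one fixed estimate, with the dataset distribution already
  replaced by \<open>rho0\<close>.\<close>

definition klb :: "('s \<Rightarrow> 'a pmf) \<Rightarrow> ennreal" where
  "klb qb = (\<integral>\<^sup>+s. KL (p_b G s) (pmf (qb s)) \<partial>rho0 G)"

definition klm :: "('s \<Rightarrow> 'a \<Rightarrow> 'm pmf) \<Rightarrow> ennreal" where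
  "klm qm = (\<integral>\<^sup>+s. (\<Sum>a\<in>UNIV. ennreal (p_b G s a) * KL (p_m G s a) (pmf (qm s a))) \<partial>rho0 G)"

lemma nn_plug:
  assumes Q: "qfun Q" and c: "pb_class G {qb}" "pm_class G {qm}"
  shows "(\<integral>\<^sup>+s. ennreal ((plug qb qm Q s)\<^sup>2) \<partial>rho0 G) \<le> ennreal (8 * V\<^sup>2) * (klb qb + c2 G * klm qm)"
proof -
  have [measurable]: "(\<lambda>s. pmf (qb s) a) \<in> borel_measurable (St G)" "(\<lambda>s. pmf (qm s a) m) \<in> borel_measurable (St G)" for a m
    using c by (auto simp: pb_class_def pm_class_def)
  have [measurable]: "(\<lambda>s. KL (p_b G s) (pmf (qb s))) \<in> borel_measurable (St G)"
    by (rule KL_measurable) measurable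
  have [measurable]: "(\<lambda>s. KL (p_m G s a) (pmf (qm s a))) \<in> borel_measurable (St G)" for a
    by (rule KL_measurable) (simp_all, measurable)
  have "(\<integral>\<^sup>+s. ennreal ((plug qb qm Q s)\<^sup>2) \<partial>rho0 G) \<le> (\<integral>\<^sup>+s. ennreal (8 * V\<^sup>2) * KLs (c2 G) qb qm s \<partial>rho0 G)"
    by (intro nn_integral_mono plug_square Q)
  also have "\<dots> = ennreal (8 * V\<^sup>2) * (klb qb + c2 G * klm qm)"
    unfolding KLs_def klb_def klm_def
    by (subst nn_integral_cmult, measurable, subst nn_integral_add, measurable, subst nn_integral_cmult, measurable)
  finally show ?thesis .
qed

lemma nn_plug2:
  assumes st: "offline_stationary G" and Q: "qfun Q" and c: "pb_class G {qb}" "pm_class G {qm}"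
  shows "ennreal (plug2 qb qm Q) \<le> ennreal (8 * V\<^sup>2) * (klb qb + c2 G * klm qm)"
proof -
  have [measurable]: "Vhat qb qm Q \<in> borel_measurable (St G)" "VQ Q \<in> borel_measurable (St G)"
    using bdd_Vhat[OF Q c] bdd_VQ[OF Q] by (auto simp: bdd_def)
  have sq: "(Vhat qb qm Q s - VQ Q s)\<^sup>2 \<le> (plug qb qm Q s)\<^sup>2" for s
    using power_mono[OF Vhat_VQ[of qb qm Q s], of 2] by simp
  have sq2: "(Vhat qb qm Q s - VQ Q s)\<^sup>2 \<le> (2 * V)\<^sup>2" for s
    using sq[of s] power_mono[OF plug_le[OF Q, of qb qm s] plug_nonneg, of 2] by linarith
  have "ennreal (plug2 qb qm Q) = (\<integral>\<^sup>+w. ennreal ((Vhat qb qm Q (state_of (w (Suc 0))) - VQ Q (state_of (w (Suc 0))))\<^sup>2) \<partial>offline G)"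
    unfolding plug2_def
    by (rule nn_integral_eq_integral[symmetric], rule offline_integrable_bounded[where B="(2 * V)\<^sup>2"]) (use sq2 in auto)
  also have "\<dots> = (\<integral>\<^sup>+s. ennreal ((Vhat qb qm Q s - VQ Q s)\<^sup>2) \<partial>rho0 G)"
    by (rule offline_state[OF st]) measurable
  also have "\<dots> \<le> (\<integral>\<^sup>+s. ennreal ((plug qb qm Q s)\<^sup>2) \<partial>rho0 G)"
    by (intro nn_integral_mono ennreal_leI sq)
  also have "\<dots> \<le> ennreal (8 * V\<^sup>2) * (klb qb + c2 G * klm qm)" by (rule nn_plug[OF Q c])
  finally show ?thesis .
qed

section \<open>One fitted step on the data\<close>

lemma AE_data_reward: "AE d in data_law G L. \<forall>i\<in>data_idx L. \<bar>fst (snd (snd (snd (d i))))\<bar> \<le> Rmax G"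
proof -
  have m: "(\<lambda>d. fst (snd (snd (snd (d i))))) \<in> borel_measurable (PiM (data_idx L) (\<lambda>_. tupleM G))" if "i \<in> data_idx L" for i
  proof -
    have "(\<lambda>x. fst (snd (snd (snd x)))) \<in> borel_measurable (tupleM G)" unfolding tupleM_def by measurable
    from measurable_compose[OF measurable_component_singleton[OF that] this] show ?thesis .
  qed
  have "AE d in data_law G L. \<bar>fst (snd (snd (snd (d i))))\<bar> \<le> Rmax G" if i: "i \<in> data_idx L" for i
  proof -
    obtain j t where ijt: "i = (j, t)" by (cases i)
    have j: "j < length L" using i ijt by (auto simp: data_idx_def)
    have "AE w in dataM L. \<bar>rew_of (w j t)\<bar> \<le> Rmax G"
      unfolding dataM_def by (rule AE_PiM_component[OF prob_offline _ AE_offline_reward]) (use j in auto)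
    then have "AE w in dataM L. \<bar>fst (snd (snd (snd (tuples L w i))))\<bar> \<le> Rmax G"
      using i by (auto simp: ijt tuples_idx tuple_of_eq)
    then show ?thesis
      unfolding data_law_eq using m[OF i] by (subst AE_distr_iff) auto
  qed
  then show ?thesis by (intro AE_finite_allI) auto
qed

lemma sets_data_law[measurable_cong]: "sets (data_law G L) = sets (PiM (data_idx L) (\<lambda>_. tupleM G))"
  by (simp add: data_law_eq)

lemma prob_data_law: "prob_space (data_law G L)"
  unfolding data_law_eq by (rule prob_space.prob_space_distr[OF prob_dataM tuples_measurable])

text \<open>The summed score of the functions chosen by the algorithm is bounded below because the
  fit is a minimiser and above by \<open>exponential_weights_bound\<close>. Comparing the two
  pathwise and integrating isolates the squared error.\<close>

lemma regression_error:
  assumes st: "offline_stationary G" and V0: "0 < V" and N: "0 < card (data_idx L)" and l: "1 \<le> l"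
    and cls: "finite \<Q>" "finite \<B>" "finite \<M>" "q_class G \<Q>" "pb_class G \<B>" "pm_class G \<M>"
    and complete: "\<And>Q. Q \<in> \<Q> \<Longrightarrow> bellman_opt G Q \<in> \<Q>"
    and m: "Qn \<in> data_law G L \<rightarrow>\<^sub>M count_space \<Q>" "Qo \<in> data_law G L \<rightarrow>\<^sub>M count_space \<Q>"
      "bh \<in> data_law G L \<rightarrow>\<^sub>M count_space \<B>" "mh \<in> data_law G L \<rightarrow>\<^sub>M count_space \<M>"
    and argmin: "\<And>d. d \<in> space (data_law G L) \<Longrightarrow> is_arg_min (cal_loss G L d (bh d) (mh d) (Qo d)) (\<lambda>Q. Q \<in> \<Q>) (Qn d)"
  shows "(\<integral>\<^sup>+d. ennreal (dist2 (Qn d) (bellman_opt G (Qo d))) \<partial>data_law G L) \<le>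
      8 * (\<integral>\<^sup>+d. ennreal (plug2 (bh d) (mh d) (Qo d)) \<partial>data_law G L) +
      ennreal (128 * V\<^sup>2 * (real l * ln (real ((card \<Q>)\<^sup>2 * card \<B> * card \<M>)) / real (card (data_idx L)) + 3 * beta_coeff G (l - 1)))"
proof -
  let ?P = "data_law G L"
  let ?N = "real (card (data_idx L))"
  interpret P: prob_space ?P by (rule prob_data_law)
  have q: "qfun Q" if "Q \<in> \<Q>" for Q using cls(4) that by (auto simp: q_class_def qfun_def)
  have pb: "pb_class G {b}" if "b \<in> \<B>" for b using cls(5) that by (auto simp: pb_class_def)
  have pm: "pm_class G {b}" if "b \<in> \<M>" for b using cls(6) that by (auto simp: pm_class_def)
  \<comment> \<open>New iterate, previous iterate and both estimates all depend on the data, so the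
    bound has to be uniform over their quadruples.\<close>
  define F where "F = \<Q> \<times> \<Q> \<times> \<B> \<times> \<M>"
  define W where "W = (\<lambda>(Q, Q', b, c). score Q Q' b c)"
  have mem: "Qn d \<in> \<Q>" "Qo d \<in> \<Q>" "bh d \<in> \<B>" "mh d \<in> \<M>" if "d \<in> space ?P" for d
    using m[THEN measurable_space, OF that] by auto
  obtain d0 where "d0 \<in> space ?P" using P.not_empty by blast
  then have Fne: "F \<noteq> {}" using mem[of d0] by (auto simp: F_def)
  have Ffin: "finite F" using cls by (simp add: F_def)
  have cF: "card F = (card \<Q>)\<^sup>2 * card \<B> * card \<M>"
    by (simp add: F_def card_cartesian_product power2_eq_square mult_ac)
  have Wf: "W f \<in> borel_measurable (tupleM G)" "W f x \<le> 1"
    "(\<integral>\<^sup>+w. exp (W f (tuple_of (w 0) (w (Suc 0)))) \<partial>offline G) \<le> 1" if "f \<in> F" for f x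
  proof -
    obtain Q Q' b c where f: "f = (Q, Q', b, c)" by (cases f)
    then have in_cls: "Q \<in> \<Q>" "Q' \<in> \<Q>" "b \<in> \<B>" "c \<in> \<M>" using that by (auto simp: F_def)
    show "W f \<in> borel_measurable (tupleM G)" "W f x \<le> 1"
      "(\<integral>\<^sup>+w. exp (W f (tuple_of (w 0) (w (Suc 0)))) \<partial>offline G) \<le> 1"
      using score[OF V0 q[OF in_cls(1)] q[OF in_cls(2)] q[OF complete[OF in_cls(2)]] pb[OF in_cls(3)] pm[OF in_cls(4)]]
      by (auto simp: f W_def)
  qed
  obtain \<Gamma> where \<Gamma>: "\<Gamma> \<in> borel_measurable (PiM (data_idx L) (\<lambda>_. tupleM G))" "\<And>d. 0 \<le> \<Gamma> d"
    "\<And>d f. f \<in> F \<Longrightarrow> (\<Sum>i\<in>data_idx L. W f (d i)) + ?N \<le> real l * ln (real (card F)) + \<Gamma> d"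
    "(\<integral>\<^sup>+d. ennreal (\<Gamma> d) \<partial>?P) \<le> ennreal (?N * (1 + 3 * beta_coeff G (l - 1)))"
    using exponential_weights_bound[where F=F and W=W and L=L, OF st l Ffin Fne Wf] by blast
  have \<Gamma>m[measurable]: "\<Gamma> \<in> borel_measurable ?P" using \<Gamma>(1) by (simp cong: measurable_cong_sets add: sets_data_law)
  let ?D = "\<lambda>d. dist2 (Qn d) (bellman_opt G (Qo d))" and ?p = "\<lambda>d. plug2 (bh d) (mh d) (Qo d)"
  have Dm[measurable]: "?D \<in> borel_measurable ?P"
    by (rule measurable_compose_countable'[OF _ m(1)], rule measurable_compose_countable'[OF _ m(2)]) (auto simp: cls countable_finite)
  have pmm[measurable]: "?p \<in> borel_measurable ?P"
    by (rule measurable_compose_countable'[OF _ m(3)], rule measurable_compose_countable'[OF _ m(4)], rule measurable_compose_countable'[OF _ m(2)])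
       (auto simp: cls countable_finite)
  have lnF: "0 \<le> ln (real (card F))" using Ffin Fne by (simp add: Suc_le_eq card_gt_0_iff)
  have path: "AE d in ?P. ?N * ?D d + 128 * V\<^sup>2 * ?N \<le> 8 * ?N * ?p d + 128 * V\<^sup>2 * (real l * ln (real (card F)) + \<Gamma> d)"
    using AE_data_reward[of L] AE_space
  proof eventually_elim
    case (elim d)
    let ?f = "(Qn d, Qo d, bh d, mh d)"
    have fF: "?f \<in> F" using mem[OF elim(2)] by (simp add: F_def)
    \<comment> \<open>Completeness makes the Bellman image of the previous iterate a competitor of
      the minimiser, so the summed excess is nonpositive.\<close>
    have le: "cal_loss G L d (bh d) (mh d) (Qo d) (Qn d) \<le> cal_loss G L d (bh d) (mh d) (Qo d) (bellman_opt G (Qo d))"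
      using argmin[OF elim(2)] complete[OF mem(2)[OF elim(2)]] by (auto simp: is_arg_min_def not_less)
    have ex: "(\<Sum>i\<in>data_idx L. excess (Qn d) (Qo d) (bh d) (mh d) (d i)) =
      cal_loss G L d (bh d) (mh d) (Qo d) (Qn d) - cal_loss G L d (bh d) (mh d) (Qo d) (bellman_opt G (Qo d))"
      unfolding cal_loss_def sum_subtractf[symmetric]
    proof (intro sum.cong refl)
      fix i assume "i \<in> data_idx L"
      then have "clampR (fst (snd (snd (snd (d i))))) = fst (snd (snd (snd (d i))))" using elim(1) clampR(2) by blast
      then show "excess (Qn d) (Qo d) (bh d) (mh d) (d i) =
        (case d i of (s, a, m, r, s') \<Rightarrow> (r + \<gamma> * (MAX a'. mixQ_hat (bh d) (mh d) (Qo d) s' a') - Qn d s a m)\<^sup>2) -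
        (case d i of (s, a, m, r, s') \<Rightarrow> (r + \<gamma> * (MAX a'. mixQ_hat (bh d) (mh d) (Qo d) s' a') - bellman_opt G (Qo d) s a m)\<^sup>2)"
        by (cases "d i") (simp add: excess_def Vhat_def)
    qed
    have "(\<Sum>i\<in>data_idx L. W ?f (d i)) =
      (?N * (?D d / 2 - 4 * \<gamma>\<^sup>2 * ?p d) - (\<Sum>i\<in>data_idx L. excess (Qn d) (Qo d) (bh d) (mh d) (d i))) / (64 * V\<^sup>2)"
      unfolding W_def prod.case score_def sum_divide_distrib[symmetric] sum_subtractf by (simp add: right_diff_distrib)
    also have "\<dots> \<ge> (?N * (?D d / 2 - 4 * ?p d)) / (64 * V\<^sup>2)"
    proof (rule divide_right_mono)
      have "\<gamma>\<^sup>2 \<le> 1" using disc_nonneg disc_less by (simp add: power_le_one)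
      then have "\<gamma>\<^sup>2 * ?p d \<le> 1 * ?p d" by (intro mult_right_mono plug2_nonneg)
      then have "?N * (?D d / 2 - 4 * ?p d) \<le> ?N * (?D d / 2 - 4 * \<gamma>\<^sup>2 * ?p d)" by (intro mult_left_mono) auto
      then show "?N * (?D d / 2 - 4 * ?p d) \<le> ?N * (?D d / 2 - 4 * \<gamma>\<^sup>2 * ?p d) - (\<Sum>i\<in>data_idx L. excess (Qn d) (Qo d) (bh d) (mh d) (d i))"
        using le ex by linarith
    qed simp
    finally have "(?N * (?D d / 2 - 4 * ?p d)) / (64 * V\<^sup>2) + ?N \<le> real l * ln (real (card F)) + \<Gamma> d"
      using \<Gamma>(3)[OF fF, of d] by linarith
    \<comment> \<open>Twice the scale of the scores, which leaves \<open>dist2\<close> with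
      coefficient N; this produces the 128 and, from 2 times 4, the 8.\<close>
    then have "128 * V\<^sup>2 * ((?N * (?D d / 2 - 4 * ?p d)) / (64 * V\<^sup>2) + ?N) \<le> 128 * V\<^sup>2 * (real l * ln (real (card F)) + \<Gamma> d)"
      by (intro mult_left_mono) auto
    moreover have "128 * V\<^sup>2 * ((?N * (?D d / 2 - 4 * ?p d)) / (64 * V\<^sup>2) + ?N) = ?N * ?D d - 8 * ?N * ?p d + 128 * V\<^sup>2 * ?N"
      using V0 by (simp add: field_simps)
    ultimately show ?case by linarith
  qed
  let ?K = "128 * V\<^sup>2"
  have "ennreal ?N * (\<integral>\<^sup>+d. ennreal (?D d) \<partial>?P) + ennreal (?K * ?N) = (\<integral>\<^sup>+d. ennreal (?N * ?D d + ?K * ?N) \<partial>?P)"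
    by (subst nn_integral_cmult[symmetric], measurable)
       (simp add: ennreal_mult dist2_nonneg nn_integral_add P.emeasure_space_1)
  also have "\<dots> \<le> (\<integral>\<^sup>+d. ennreal (8 * ?N * ?p d + ?K * (real l * ln (real (card F)) + \<Gamma> d)) \<partial>?P)"
    using path by (intro nn_integral_mono_AE) (auto elim!: eventually_mono intro: ennreal_leI)
  also have "\<dots> = (\<integral>\<^sup>+d. ennreal (8 * ?N) * ennreal (?p d) + (ennreal (?K * (real l * ln (real (card F)))) + ennreal ?K * ennreal (\<Gamma> d)) \<partial>?P)"
    by (intro nn_integral_cong) (simp add: distrib_left ennreal_mult plug2_nonneg \<Gamma>(2) lnF)
  also have "\<dots> = ennreal (8 * ?N) * (\<integral>\<^sup>+d. ennreal (?p d) \<partial>?P) + (ennreal (?K * (real l * ln (real (card F)))) + ennreal ?K * (\<integral>\<^sup>+d. ennreal (\<Gamma> d) \<partial>?P))"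
    by (subst nn_integral_add, measurable, subst nn_integral_add, measurable) (simp add: nn_integral_cmult P.emeasure_space_1)
  also have "\<dots> \<le> ennreal (8 * ?N) * (\<integral>\<^sup>+d. ennreal (?p d) \<partial>?P) + (ennreal (?K * (real l * ln (real (card F)))) + ennreal ?K * ennreal (?N * (1 + 3 * beta_coeff G (l - 1))))"
    by (intro add_left_mono mult_left_mono \<Gamma>(4)) auto
  also have "\<dots> = (ennreal (8 * ?N) * (\<integral>\<^sup>+d. ennreal (?p d) \<partial>?P) + ennreal (?K * (real l * ln (real (card F)) + 3 * ?N * beta_coeff G (l - 1)))) + ennreal (?K * ?N)"
  proof -
    have "ennreal (?K * (real l * ln (real (card F)))) + ennreal ?K * ennreal (?N * (1 + 3 * beta_coeff G (l - 1))) =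
      ennreal (?K * (real l * ln (real (card F)) + 3 * ?N * beta_coeff G (l - 1))) + ennreal (?K * ?N)"
      using lnF beta_coeff_nonneg[of "l - 1"]
      by (simp add: ennreal_mult[symmetric] ennreal_plus[symmetric] algebra_simps del: ennreal_plus)
    then show ?thesis by (simp add: add.assoc)
  qed
  \<comment> \<open>The finite term \<open>?K * ?N\<close> cancels: the unit gained per sample
    equals the unit moment bound per sample. Only the complexity and the mixing terms
    survive.\<close>
  finally have "ennreal ?N * (\<integral>\<^sup>+d. ennreal (?D d) \<partial>?P) \<le>
     ennreal (8 * ?N) * (\<integral>\<^sup>+d. ennreal (?p d) \<partial>?P) + ennreal (?K * (real l * ln (real (card F)) + 3 * ?N * beta_coeff G (l - 1)))"
    by (subst (asm) (1 2) add.commute) (simp only: ennreal_add_left_cancel_le, simp)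
  then have "ennreal (1 / ?N) * (ennreal ?N * (\<integral>\<^sup>+d. ennreal (?D d) \<partial>?P)) \<le>
     ennreal (1 / ?N) * (ennreal (8 * ?N) * (\<integral>\<^sup>+d. ennreal (?p d) \<partial>?P) + ennreal (?K * (real l * ln (real (card F)) + 3 * ?N * beta_coeff G (l - 1))))"
    by (rule mult_left_mono) auto
  moreover have "ennreal (1 / ?N) * (ennreal ?N * (\<integral>\<^sup>+d. ennreal (?D d) \<partial>?P)) = (\<integral>\<^sup>+d. ennreal (?D d) \<partial>?P)"
    using N by (simp add: mult.assoc[symmetric] ennreal_mult[symmetric] del: card_0_eq)
  moreover have "ennreal (1 / ?N) * (ennreal (8 * ?N) * (\<integral>\<^sup>+d. ennreal (?p d) \<partial>?P) + ennreal (?K * (real l * ln (real (card F)) + 3 * ?N * beta_coeff G (l - 1))))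
    = 8 * (\<integral>\<^sup>+d. ennreal (?p d) \<partial>?P) + ennreal (?K * (real l * ln (real (card F)) / ?N + 3 * beta_coeff G (l - 1)))"
  proof -
    have "ennreal (1 / ?N) * ennreal (8 * ?N) = 8" using N by (simp add: ennreal_mult[symmetric] del: card_0_eq)
    moreover have "ennreal (1 / ?N) * ennreal (?K * (real l * ln (real (card F)) + 3 * ?N * beta_coeff G (l - 1))) = ennreal (?K * (real l * ln (real (card F)) / ?N + 3 * beta_coeff G (l - 1)))"
      using N lnF beta_coeff_nonneg[of "l - 1"] by (subst ennreal_mult[symmetric]) (auto simp: field_simps simp del: card_0_eq)
    ultimately show ?thesis by (simp add: distrib_left mult.assoc[symmetric])
  qed
  ultimately show ?thesis by (simp add: cF)
qed

end

section \<open>Error propagation\<close>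

lemma abs_Max_diff_attained:
  fixes f g :: "'x::finite \<Rightarrow> real"
  shows "\<exists>x. \<bar>(MAX x. f x) - (MAX x. g x)\<bar> \<le> \<bar>f x - g x\<bar>"
proof -
  have "(MAX x. f x) \<in> range f" by (rule Max_in) auto
  then obtain x where x: "(MAX x. f x) = f x" by (rule rangeE)
  have "(MAX x. g x) \<in> range g" by (rule Max_in) auto
  then obtain y where y: "(MAX x. g x) = g y" by (rule rangeE)
  have "g x \<le> (MAX x. g x)" "f y \<le> (MAX x. f x)" by (rule Max_ge, auto)+
  then show ?thesis using x y by (cases "(MAX x. g x) \<le> (MAX x. f x)") (auto intro: exI[of _ x] exI[of _ y])
qed

text \<open>\<open>ennreal\<close> truncates negative numbers at zero, so it is subadditive on all
  reals; the next two lemmas extend this to integrals and series, so signed gaps can be bounded term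
  by term.\<close>

lemma ennreal_plus_le: "ennreal (a + b) \<le> ennreal a + ennreal b"
proof -
  have "ennreal (a + b) \<le> ennreal (max 0 a + max 0 b)" by (rule ennreal_leI) auto
  also have "\<dots> = ennreal (max 0 a) + ennreal (max 0 b)" by (rule ennreal_plus) auto
  finally show ?thesis by (simp add: ennreal_max_0)
qed

lemma ennreal_integral_le:
  fixes f :: "'y \<Rightarrow> real"
  assumes f: "integrable M f"
  shows "ennreal (LINT x|M. f x) \<le> (\<integral>\<^sup>+x. ennreal (f x) \<partial>M)"
proof -
  have i: "integrable M (\<lambda>x. max 0 (f x))" using f by (intro integrable_max) auto
  have "(LINT x|M. f x) \<le> (LINT x|M. max 0 (f x))" by (rule integral_mono[OF f i]) auto
  then have "ennreal (LINT x|M. f x) \<le> ennreal (LINT x|M. max 0 (f x))" by (rule ennreal_leI)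
  also have "\<dots> = (\<integral>\<^sup>+x. ennreal (max 0 (f x)) \<partial>M)"
    by (rule nn_integral_eq_integral[OF i, symmetric]) simp
  finally show ?thesis by (simp add: ennreal_max_0)
qed

lemma ennreal_sums_le:
  fixes f :: "nat \<Rightarrow> real"
  assumes s: "f sums x" and a: "summable (\<lambda>t. \<bar>f t\<bar>)"
  shows "ennreal x \<le> (\<Sum>t. ennreal (f t))"
proof -
  have sm: "summable (\<lambda>t. max 0 (f t))"
    by (rule summable_comparison_test'[OF a, of 0]) auto
  have "x \<le> (\<Sum>t. max 0 (f t))"
    using s sm by (auto simp: sums_iff intro!: suminf_le)
  then have "ennreal x \<le> ennreal (\<Sum>t. max 0 (f t))" by (rule ennreal_leI)
  also have "\<dots> = (\<Sum>t. ennreal (max 0 (f t)))"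
    by (rule suminf_ennreal2[symmetric]) (use sm in auto)
  finally show ?thesis by (simp add: ennreal_max_0)
qed

context fd_m2dp begin

text \<open>The difference is kept as a discounted one-step expectation rather than a supremum norm,
  so that it can be measured by occupancies and hence by mean squares.\<close>

lemma T_diff:
  assumes u: "bdd u" and v: "bdd v"
  shows "ennreal \<bar>T a u s - T a v s\<bar> \<le> Tpow 1 (\<lambda>s. ennreal \<bar>u s - v s\<bar>) s"
proof -
  have [measurable]: "u \<in> borel_measurable (St G)" "v \<in> borel_measurable (St G)" using u v by (auto simp: bdd_def)
  have uv: "\<bar>u s - v s\<bar> \<le> 2 * V" for s
  proof -
    have "\<bar>u s\<bar> \<le> V" "\<bar>v s\<bar> \<le> V" using u v by (auto simp: bdd_def)
    then show ?thesis by linarith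
  qed
  have i: "integrable (effect s m) (\<lambda>z. \<bar>u (snd z) - v (snd z)\<bar>)" for m
  proof -
    interpret prob_space "effect s m" by (rule prob_effect)
    show ?thesis by (rule integrable_const_bound[of _ "2 * V"]) (use uv in auto)
  qed
  have d: "\<bar>(LINT z|effect s m. fst z + \<gamma> * u (snd z)) - (LINT z|effect s m. fst z + \<gamma> * v (snd z))\<bar>
    \<le> \<gamma> * (LINT z|effect s m. \<bar>u (snd z) - v (snd z)\<bar>)" for m
  proof -
    have "(LINT z|effect s m. fst z + \<gamma> * u (snd z)) - (LINT z|effect s m. fst z + \<gamma> * v (snd z)) =
      (LINT z|effect s m. (fst z + \<gamma> * u (snd z)) - (fst z + \<gamma> * v (snd z)))"
      by (rule Bochner_Integration.integral_diff[symmetric]) (intro integrable_effect u v)+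
    also have "\<dots> = (LINT z|effect s m. \<gamma> * (u (snd z) - v (snd z)))"
      by (intro Bochner_Integration.integral_cong refl) (simp add: algebra_simps)
    finally have "\<bar>(LINT z|effect s m. fst z + \<gamma> * u (snd z)) - (LINT z|effect s m. fst z + \<gamma> * v (snd z))\<bar> =
      \<gamma> * \<bar>LINT z|effect s m. u (snd z) - v (snd z)\<bar>"
      using disc_nonneg by (simp add: abs_mult)
    also have "\<dots> \<le> \<gamma> * (LINT z|effect s m. \<bar>u (snd z) - v (snd z)\<bar>)"
      using disc_nonneg by (intro mult_left_mono integral_abs_bound)
    finally show ?thesis .
  qed
  have "\<bar>T a u s - T a v s\<bar> = \<bar>\<Sum>m\<in>UNIV. pmf (med s a) m * ((LINT z|effect s m. fst z + \<gamma> * u (snd z)) - (LINT z|effect s m. fst z + \<gamma> * v (snd z)))\<bar>"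
    by (simp add: T_def sum_subtractf[symmetric] right_diff_distrib)
  also have "\<dots> \<le> (\<Sum>m\<in>UNIV. pmf (med s a) m * (\<gamma> * (LINT z|effect s m. \<bar>u (snd z) - v (snd z)\<bar>)))"
    by (rule order_trans[OF sum_abs]) (auto simp: abs_mult intro!: sum_mono mult_left_mono d)
  finally have "ennreal \<bar>T a u s - T a v s\<bar> \<le> ennreal (\<Sum>m\<in>UNIV. pmf (med s a) m * (\<gamma> * (LINT z|effect s m. \<bar>u (snd z) - v (snd z)\<bar>)))"
    by (rule ennreal_leI)
  also have "\<dots> = (\<Sum>m\<in>UNIV. ennreal (pmf (med s a) m * (\<gamma> * (LINT z|effect s m. \<bar>u (snd z) - v (snd z)\<bar>))))"
    using disc_nonneg by (intro sum_ennreal[symmetric] mult_nonneg_nonneg) auto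
  also have "\<dots> = (\<Sum>m\<in>UNIV. ennreal \<gamma> * (ennreal (pmf (med s a) m) * (\<integral>\<^sup>+z. ennreal \<bar>u (snd z) - v (snd z)\<bar> \<partial>effect s m)))"
    using disc_nonneg by (intro sum.cong refl) (simp add: nn_integral_eq_integral[OF i] ennreal_mult mult_ac)
  also have "\<dots> = ennreal \<gamma> * (\<Sum>m\<in>UNIV. ennreal (pmf (med s a) m) * (\<integral>\<^sup>+z. ennreal \<bar>u (snd z) - v (snd z)\<bar> \<partial>effect s m))"
    by (simp only: sum_distrib_left)
  also have "\<dots> \<le> ennreal \<gamma> * Tb (\<lambda>s. ennreal \<bar>u s - v s\<bar>) s"
    by (intro mult_left_mono Tb_upper) auto
  finally show ?thesis by (simp add: Tpow_Suc)
qed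

definition Tstar :: "('s \<Rightarrow> real) \<Rightarrow> 's \<Rightarrow> real" where
  "Tstar u s = (MAX a. T a u s)"

lemma Tstar_ge: "T a u s \<le> Tstar u s"
  unfolding Tstar_def by (rule Max_ge) auto

lemma Tstar_diff:
  assumes u: "bdd u" and v: "bdd v"
  shows "ennreal \<bar>Tstar u s - Tstar v s\<bar> \<le> Tpow 1 (\<lambda>s. ennreal \<bar>u s - v s\<bar>) s"
proof -
  obtain a where "\<bar>Tstar u s - Tstar v s\<bar> \<le> \<bar>T a u s - T a v s\<bar>"
    unfolding Tstar_def using abs_Max_diff_attained[of "\<lambda>a. T a u s" "\<lambda>a. T a v s"] by blast
  then show ?thesis using T_diff[OF u v, of a s] by (meson ennreal_leI order_trans)
qed

lemma bdd_Tstar: "bdd u \<Longrightarrow> bdd (Tstar u)"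
  unfolding bdd_def[of "Tstar u"] Tstar_def by (intro conjI borel_measurable_MAX allI abs_Max_le abs_T T_measurable)

text \<open>The factor \<epsilon> serves both signs: 1 for the competitor and -1 for the learned
  policy. The hypothesis ranges over every action distribution the policy may use at a state, at any
  time and after any past.\<close>

lemma adv_le:
  assumes \<pi>: "\<pi> \<in> policies G" and u: "bdd u" and h: "h \<in> borel_measurable (St G)"
    and le: "\<And>s p. p \<in> range (\<lambda>(t, hs). \<pi> t hs s) \<Longrightarrow> ennreal (\<epsilon> * ((\<Sum>a\<in>UNIV. pmf p a * T a u s) - u s)) \<le> h s"
  shows "ennreal (\<gamma> ^ t * (\<epsilon> * adv \<pi> u t)) \<le> (\<integral>\<^sup>+s. Tpow t h s \<partial>rho0 G)"
proof -
  have i: "integrable (online G \<pi>) (\<lambda>w. (\<Sum>a\<in>UNIV. pmf (\<pi> t (past t w) (state_of (w t))) a * T a u (state_of (w t))) - u (state_of (w t)))"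
    by (intro Bochner_Integration.integrable_diff integrable_mix integrable_state \<pi> u)
  have "ennreal (\<epsilon> * adv \<pi> u t) = ennreal (LINT w|online G \<pi>. \<epsilon> * ((\<Sum>a\<in>UNIV. pmf (\<pi> t (past t w) (state_of (w t))) a * T a u (state_of (w t))) - u (state_of (w t))))"
    unfolding adv_def by simp
  also have "\<dots> \<le> (\<integral>\<^sup>+w. ennreal (\<epsilon> * ((\<Sum>a\<in>UNIV. pmf (\<pi> t (past t w) (state_of (w t))) a * T a u (state_of (w t))) - u (state_of (w t)))) \<partial>online G \<pi>)"
    by (rule ennreal_integral_le) (rule integrable_mult_right[OF i])
  also have "\<dots> \<le> (\<integral>\<^sup>+w. h (state_of (w t)) \<partial>online G \<pi>)"
    by (intro nn_integral_mono le) auto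
  finally have "ennreal (\<gamma> ^ t) * ennreal (\<epsilon> * adv \<pi> u t) \<le> ennreal (\<gamma> ^ t) * (\<integral>\<^sup>+w. h (state_of (w t)) \<partial>online G \<pi>)"
    by (rule mult_left_mono) auto
  also have "\<dots> \<le> (\<integral>\<^sup>+s. Tpow t h s \<partial>rho0 G)" by (rule online_le_Tpow[OF \<pi> h])
  finally show ?thesis using disc_nonneg by (simp add: ennreal_mult')
qed

lemma summable_adv:
  assumes "\<pi> \<in> policies G" "bdd u"
  shows "summable (\<lambda>t. \<bar>\<gamma> ^ t * (\<epsilon> * adv \<pi> u t)\<bar>)"
proof (rule summable_comparison_test')
  show "summable (\<lambda>t. \<bar>\<epsilon>\<bar> * (2 * V) * \<gamma> ^ t)"
    using disc_nonneg disc_less by (intro summable_mult summable_geometric) auto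
  show "norm \<bar>\<gamma> ^ t * (\<epsilon> * adv \<pi> u t)\<bar> \<le> \<bar>\<epsilon>\<bar> * (2 * V) * \<gamma> ^ t" for t
  proof -
    have "\<gamma> ^ t * (\<bar>\<epsilon>\<bar> * \<bar>adv \<pi> u t\<bar>) \<le> \<gamma> ^ t * (\<bar>\<epsilon>\<bar> * (2 * V))"
      using abs_adv[OF assms, of t] disc_nonneg by (intro mult_left_mono) auto
    then show ?thesis using disc_nonneg by (simp add: abs_mult mult_ac)
  qed
qed

lemma greedy_policy:
  assumes a: "a \<in> St G \<rightarrow>\<^sub>M count_space UNIV"
  shows "stationary (\<lambda>s. return_pmf (a s)) \<in> policies G"
proof (rule stationary_in_policies)
  have [measurable]: "a \<in> St G \<rightarrow>\<^sub>M count_space UNIV" by fact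
  have "(\<lambda>s. pmf (return_pmf (a s)) b) \<in> borel_measurable (St G)" for b
    unfolding pmf_return indicator_def by measurable
  then show "(\<lambda>s. return_pmf (a s)) \<in> stationary_rules G" by (simp add: stationary_rules_def)
qed

text \<open>\<open>J_adv\<close> is applied to both policies with the same baseline, whose initial
  expectation cancels. Advantages of any policy are at most those of \<open>Tstar\<close>; those of
  the deterministic policy are explicit.\<close>

lemma J_gap:
  assumes \<pi>: "\<pi> \<in> policies G" and a: "a \<in> St G \<rightarrow>\<^sub>M count_space UNIV" and u: "bdd u"
    and h[measurable]: "h1 \<in> borel_measurable (St G)" "h2 \<in> borel_measurable (St G)"
    and h1: "\<And>s. ennreal \<bar>u s - Tstar u s\<bar> \<le> h1 s"
    and h2: "\<And>s. ennreal (u s - T (a s) u s) \<le> h2 s"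
  shows "ennreal (J G \<pi> - J G (stationary (\<lambda>s. return_pmf (a s)))) \<le>
    (\<Sum>t. \<integral>\<^sup>+s. Tpow t h1 s \<partial>rho0 G) + (\<Sum>t. \<integral>\<^sup>+s. Tpow t h2 s \<partial>rho0 G)"
proof -
  let ?\<sigma> = "stationary (\<lambda>s. return_pmf (a s))"
  note \<sigma> = greedy_policy[OF a]
  have le1: "ennreal (1 * ((\<Sum>b\<in>UNIV. pmf p b * T b u s) - u s)) \<le> h1 s" for p s
  proof -
    have "(\<Sum>b\<in>UNIV. pmf p b * T b u s) \<le> (\<Sum>b\<in>UNIV. pmf p b * Tstar u s)"
      by (intro sum_mono mult_left_mono Tstar_ge) auto
    also have "\<dots> = Tstar u s" by (simp add: sum_distrib_right[symmetric] sum_pmf_1)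
    finally have "(\<Sum>b\<in>UNIV. pmf p b * T b u s) - u s \<le> \<bar>u s - Tstar u s\<bar>" by linarith
    then show ?thesis using h1[of s] unfolding mult_1 by (meson ennreal_leI order_trans)
  qed
  have le2: "ennreal (- 1 * ((\<Sum>b\<in>UNIV. pmf p b * T b u s) - u s)) \<le> h2 s" if "p \<in> range (\<lambda>(t, hs). ?\<sigma> t hs s)" for p s
  proof -
    have p: "p = return_pmf (a s)" using that by (auto simp: stationary_def)
    have "(\<Sum>b\<in>UNIV. pmf p b * T b u s) = (\<Sum>b\<in>UNIV. if b = a s then T b u s else 0)"
      unfolding p pmf_return by (intro sum.cong) (auto simp: indicator_def)
    then show ?thesis using h2[of s] by simp
  qed
  have s1: "(\<lambda>t. \<gamma> ^ t * (1 * adv \<pi> u t)) sums (J G \<pi> - (LINT s|rho0 G. u s))"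
    using J_adv[OF \<pi> u] by simp
  have s2: "(\<lambda>t. \<gamma> ^ t * (- 1 * adv ?\<sigma> u t)) sums - (J G ?\<sigma> - (LINT s|rho0 G. u s))"
    using sums_minus[OF J_adv[OF \<sigma> u]] by simp
  have "ennreal (J G \<pi> - J G ?\<sigma>) = ennreal ((J G \<pi> - (LINT s|rho0 G. u s)) + - (J G ?\<sigma> - (LINT s|rho0 G. u s)))"
    by simp
  also have "\<dots> \<le> ennreal (J G \<pi> - (LINT s|rho0 G. u s)) + ennreal (- (J G ?\<sigma> - (LINT s|rho0 G. u s)))"
    by (rule ennreal_plus_le)
  also have "\<dots> \<le> (\<Sum>t. ennreal (\<gamma> ^ t * (1 * adv \<pi> u t))) + (\<Sum>t. ennreal (\<gamma> ^ t * (- 1 * adv ?\<sigma> u t)))"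
    by (intro add_mono ennreal_sums_le[OF s1 summable_adv[OF \<pi> u]] ennreal_sums_le[OF s2 summable_adv[OF \<sigma> u]])
  also have "\<dots> \<le> (\<Sum>t. \<integral>\<^sup>+s. Tpow t h1 s \<partial>rho0 G) + (\<Sum>t. \<integral>\<^sup>+s. Tpow t h2 s \<partial>rho0 G)"
    by (intro add_mono suminf_le adv_le[OF \<pi> u h(1) le1] adv_le[OF \<sigma> u h(2) le2] summableI)
  finally show ?thesis .
qed

text \<open>The zero baseline in \<open>J_adv\<close>; it supplies the trivial bound on the gap for
  short runs.\<close>

lemma J_bound:
  assumes \<pi>: "\<pi> \<in> policies G"
  shows "\<bar>J G \<pi>\<bar> \<le> 2 * V / (1 - \<gamma>)"
proof -
  have s: "(\<lambda>t. \<gamma> ^ t * adv \<pi> (\<lambda>s. 0) t) sums J G \<pi>"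
    using J_adv[OF \<pi> bdd_const_0] by simp
  have sa: "summable (\<lambda>t. \<bar>\<gamma> ^ t * adv \<pi> (\<lambda>s. 0) t\<bar>)"
    using summable_adv[OF \<pi> bdd_const_0, of 1] by simp
  have g: "(\<lambda>t. 2 * V * \<gamma> ^ t) sums (2 * V * (1 / (1 - \<gamma>)))"
    using disc_nonneg disc_less by (intro sums_mult geometric_sums) auto
  have "\<bar>J G \<pi>\<bar> \<le> (\<Sum>t. \<bar>\<gamma> ^ t * adv \<pi> (\<lambda>s. 0) t\<bar>)"
    using summable_rabs[OF sa] s by (simp add: sums_iff)
  also have "\<dots> \<le> (\<Sum>t. 2 * V * \<gamma> ^ t)"
  proof (rule suminf_le[OF _ sa sums_summable[OF g]])
    show "\<bar>\<gamma> ^ t * adv \<pi> (\<lambda>s. 0) t\<bar> \<le> 2 * V * \<gamma> ^ t" for t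
      using mult_left_mono[OF abs_adv[OF \<pi> bdd_const_0, of t], of "\<gamma> ^ t"] disc_nonneg
      by (simp add: abs_mult mult_ac)
  qed
  also have "\<dots> = 2 * V / (1 - \<gamma>)" using g by (simp add: sums_iff)
  finally show ?thesis .
qed

text \<open>With t = sqrt \<gamma> ^ n, pointwise e \<le> \<delta> / (2 t) + t e^2 / (2 \<delta>).
  The constant is discounted by \<gamma> ^ n = t^2 and the square is bounded by
  \<open>Tpow_le_c1\<close> uniformly in n, so both parts keep the factor t. Leaving \<delta> free
  makes the bound affine in the second moment, hence compatible with expectations over the
  data.\<close>

lemma Tpow_am_gm:
  assumes st: "offline_stationary G" and N: "0 < card (data_idx L)" and c: "c1 G L < \<infinity>"
    and e[measurable]: "e \<in> borel_measurable (St G)" and e0: "\<And>s. 0 \<le> e s" and eB: "\<And>s. e s \<le> B" and \<delta>: "0 < \<delta>"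
  shows "(\<integral>\<^sup>+s. Tpow n (\<lambda>s. ennreal (e s)) s \<partial>rho0 G) \<le>
    ennreal (sqrt \<gamma> ^ n) * (ennreal (\<delta> / 2) + ennreal (1 / (2 * \<delta> * (1 - \<gamma>))) * c1 G L * (\<integral>\<^sup>+s. ennreal ((e s)\<^sup>2) \<partial>rho0 G))"
proof (cases "sqrt \<gamma> ^ n = 0")
  \<comment> \<open>Here \<gamma> = 0 and n > 0, where the weight 1 / t would be undefined, but
    \<open>Tpow n\<close> vanishes.\<close>
  case True
  then have "0 < n" "\<gamma> = 0" by (auto simp: power_eq_0_iff)
  then obtain k where "n = Suc k" by (cases n) auto
  then have z: "Tpow n (\<lambda>s. ennreal (e s)) s = 0" for s using \<open>\<gamma> = 0\<close> by (simp add: Tpow_Suc)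
  show ?thesis unfolding z nn_integral_const mult_zero_left by (rule zero_le)
next
  case False
  define t where "t = sqrt \<gamma> ^ n"
  have t0: "0 < t" using False disc_nonneg unfolding t_def by (metis less_le real_sqrt_ge_zero zero_le_power)
  have tt: "\<gamma> ^ n = t * t" using disc_nonneg unfolding t_def power_mult_distrib[symmetric] by simp
  interpret rho0: prob_space "rho0 G" by (rule prob_rho0)
  have pt: "ennreal (e s) \<le> ennreal (\<delta> / (2 * t)) + ennreal (t / (2 * \<delta>)) * ennreal ((e s)\<^sup>2)" for s
  proof -
    have "0 \<le> (t * e s - \<delta>)\<^sup>2" by simp
    then have "e s \<le> \<delta> / (2 * t) + t / (2 * \<delta>) * (e s)\<^sup>2"
      using t0 \<delta> by (simp add: power2_eq_square field_simps)
    then show ?thesis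
      using t0 \<delta> by (simp add: ennreal_mult[symmetric] ennreal_plus[symmetric] ennreal_leI del: ennreal_plus)
  qed
  have "Tpow n (\<lambda>s. ennreal (e s)) s \<le> ennreal (t * \<delta> / 2) + ennreal (t / (2 * \<delta>)) * Tpow n (\<lambda>s. ennreal ((e s)\<^sup>2)) s" for s
  proof -
    have "Tpow n (\<lambda>s. ennreal (e s)) s \<le> Tpow n (\<lambda>s. ennreal (\<delta> / (2 * t)) + ennreal (t / (2 * \<delta>)) * ennreal ((e s)\<^sup>2)) s"
      by (rule Tpow_mono[OF pt])
    also have "\<dots> \<le> Tpow n (\<lambda>s. ennreal (\<delta> / (2 * t))) s + Tpow n (\<lambda>s. ennreal (t / (2 * \<delta>)) * ennreal ((e s)\<^sup>2)) s"
      by (rule Tpow_plus) measurable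
    also have "\<dots> \<le> ennreal (\<gamma> ^ n) * ennreal (\<delta> / (2 * t)) + ennreal (t / (2 * \<delta>)) * Tpow n (\<lambda>s. ennreal ((e s)\<^sup>2)) s"
      by (intro add_mono Tpow_cmult) (auto simp: Tpow_const)
    also have "ennreal (\<gamma> ^ n) * ennreal (\<delta> / (2 * t)) = ennreal (t * \<delta> / 2)"
      using t0 \<delta> unfolding tt by (simp add: ennreal_mult[symmetric])
    finally show ?thesis .
  qed
  then have "(\<integral>\<^sup>+s. Tpow n (\<lambda>s. ennreal (e s)) s \<partial>rho0 G) \<le> (\<integral>\<^sup>+s. ennreal (t * \<delta> / 2) + ennreal (t / (2 * \<delta>)) * Tpow n (\<lambda>s. ennreal ((e s)\<^sup>2)) s \<partial>rho0 G)"
    by (rule nn_integral_mono)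
  also have "\<dots> = ennreal (t * \<delta> / 2) + ennreal (t / (2 * \<delta>)) * (\<integral>\<^sup>+s. Tpow n (\<lambda>s. ennreal ((e s)\<^sup>2)) s \<partial>rho0 G)"
    by (subst nn_integral_add, measurable) (simp add: nn_integral_cmult rho0.emeasure_space_1[simplified])
  also have "\<dots> = ennreal (t * \<delta> / 2) + ennreal (t / (2 * \<delta> * (1 - \<gamma>))) * (ennreal (1 - \<gamma>) * (\<integral>\<^sup>+s. Tpow n (\<lambda>s. ennreal ((e s)\<^sup>2)) s \<partial>rho0 G))"
    using t0 \<delta> disc_less by (simp add: mult.assoc[symmetric] ennreal_mult[symmetric])
  also have "\<dots> \<le> ennreal (t * \<delta> / 2) + ennreal (t / (2 * \<delta> * (1 - \<gamma>))) * (c1 G L * (\<integral>\<^sup>+s. ennreal ((e s)\<^sup>2) \<partial>rho0 G))"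
  proof (intro add_left_mono mult_left_mono Tpow_le_c1[OF st N c, where B="B\<^sup>2"])
    show "ennreal ((e s)\<^sup>2) \<le> ennreal (B\<^sup>2)" for s
      by (intro ennreal_leI power_mono eB e0)
  qed auto
  also have "\<dots> = ennreal t * (ennreal (\<delta> / 2) + ennreal (1 / (2 * \<delta> * (1 - \<gamma>))) * c1 G L * (\<integral>\<^sup>+s. ennreal ((e s)\<^sup>2) \<partial>rho0 G))"
  proof -
    have "ennreal (t * \<delta> / 2) = ennreal t * ennreal (\<delta> / 2)" using t0 \<delta> by (simp add: ennreal_mult[symmetric])
    moreover have "ennreal (t / (2 * \<delta> * (1 - \<gamma>))) = ennreal t * ennreal (1 / (2 * \<delta> * (1 - \<gamma>)))"
      using t0 \<delta> disc_less by (simp add: ennreal_mult[symmetric])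
    ultimately show ?thesis by (simp add: distrib_left mult.assoc)
  qed
  finally show ?thesis by (simp add: t_def)
qed

end

context fd_m2dp_pos begin

text \<open>
  Unrolls \<open>b\<^sub>k = \<epsilon>\<^sub>k + \<gamma> B \<epsilon>\<^sub>k + \<gamma> B b\<^sub>k\<^sub>-\<^sub>1\<close>, which bounds the residual of the value function of
  the \<open>k\<close>-th iterate when \<open>\<epsilon>\<^sub>k\<close> is its regression error and \<open>B\<close> the operator \<open>Tb\<close>.
\<close>

fun resid :: "(nat \<Rightarrow> 's \<Rightarrow> ennreal) \<Rightarrow> nat \<Rightarrow> 's \<Rightarrow> ennreal" where
  "resid E 0 = (\<lambda>s. ennreal (2 * V))"
| "resid E (Suc k) = (\<lambda>s. E k s + Tpow 1 (E k) s + Tpow 1 (resid E k) s)"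

lemma resid_measurable: "(\<And>k. E k \<in> borel_measurable (St G)) \<Longrightarrow> resid E k \<in> borel_measurable (St G)"
  by (induction k) auto

text \<open>Scalar counterpart of \<open>resid\<close> after integration: each fit is added twice,
  and the past is discounted by sqrt \<gamma>, the rate that survives
  \<open>Tpow_am_gm\<close>.\<close>

fun accum :: "(nat \<Rightarrow> ennreal) \<Rightarrow> nat \<Rightarrow> ennreal" where
  "accum y 0 = 0"
| "accum y (Suc k) = 2 * y k + ennreal (sqrt \<gamma>) * accum y k"

text \<open>The initial residual is constant and is discounted exactly, hence at rate \<gamma>;
  errors of the fits decay only at rate sqrt \<gamma>. A fit counts twice because the bound for its
  one-step shift is no larger than the bound for the fit itself.\<close>

lemma nn_resid:
  assumes E[measurable]: "\<And>k. E k \<in> borel_measurable (St G)"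
    and y: "\<And>k n. (\<integral>\<^sup>+s. Tpow n (E k) s \<partial>rho0 G) \<le> ennreal (sqrt \<gamma> ^ n) * y k"
  shows "(\<integral>\<^sup>+s. Tpow n (resid E k) s \<partial>rho0 G) \<le> ennreal (sqrt \<gamma> ^ n) * accum y k + ennreal (\<gamma> ^ n) * ennreal (2 * V * \<gamma> ^ k)"
proof (induction k arbitrary: n)
  case 0
  interpret rho0: prob_space "rho0 G" by (rule prob_rho0)
  show ?case by (simp add: Tpow_const rho0.emeasure_space_1[simplified])
next
  case (Suc k)
  note [measurable] = resid_measurable[of E k, OF E]
  have "Tpow n (resid E (Suc k)) s \<le> Tpow n (E k) s + Tpow (Suc n) (E k) s + Tpow (Suc n) (resid E k) s" for s
  proof -
    have "Tpow n (resid E (Suc k)) s \<le> Tpow n (\<lambda>s. E k s + Tpow 1 (E k) s) s + Tpow n (Tpow 1 (resid E k)) s"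
      by (simp del: One_nat_def) (rule Tpow_plus, measurable)
    also have "\<dots> \<le> (Tpow n (E k) s + Tpow n (Tpow 1 (E k)) s) + Tpow n (Tpow 1 (resid E k)) s"
      by (intro add_right_mono Tpow_plus) measurable
    finally show ?thesis unfolding Tpow_add[symmetric] by simp
  qed
  then have "(\<integral>\<^sup>+s. Tpow n (resid E (Suc k)) s \<partial>rho0 G) \<le> (\<integral>\<^sup>+s. Tpow n (E k) s + Tpow (Suc n) (E k) s + Tpow (Suc n) (resid E k) s \<partial>rho0 G)"
    by (rule nn_integral_mono)
  also have "\<dots> = (\<integral>\<^sup>+s. Tpow n (E k) s \<partial>rho0 G) + (\<integral>\<^sup>+s. Tpow (Suc n) (E k) s \<partial>rho0 G) + (\<integral>\<^sup>+s. Tpow (Suc n) (resid E k) s \<partial>rho0 G)"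
    by (subst nn_integral_add, measurable, subst nn_integral_add, measurable)
  also have "\<dots> \<le> ennreal (sqrt \<gamma> ^ n) * y k + ennreal (sqrt \<gamma> ^ n) * y k + (ennreal (sqrt \<gamma> ^ Suc n) * accum y k + ennreal (\<gamma> ^ Suc n) * ennreal (2 * V * \<gamma> ^ k))"
  proof (intro add_mono y Suc.IH)
    have "ennreal (sqrt \<gamma> ^ Suc n) * y k \<le> ennreal (sqrt \<gamma> ^ n) * y k"
      using disc_nonneg disc_less by (intro mult_right_mono ennreal_leI power_decreasing) auto
    then show "(\<integral>\<^sup>+s. Tpow (Suc n) (E k) s \<partial>rho0 G) \<le> ennreal (sqrt \<gamma> ^ n) * y k"
      using y[of "Suc n" k] by (rule order_trans[rotated])
  qed
  also have "\<dots> = ennreal (sqrt \<gamma> ^ n) * accum y (Suc k) + ennreal (\<gamma> ^ n) * ennreal (2 * V * \<gamma> ^ Suc k)"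
  proof -
    have 1: "ennreal (sqrt \<gamma> ^ Suc n) = ennreal (sqrt \<gamma> ^ n) * ennreal (sqrt \<gamma>)"
      using disc_nonneg by (simp add: ennreal_mult[symmetric] mult.commute)
    have 2: "ennreal (\<gamma> ^ Suc n) * ennreal (2 * V * \<gamma> ^ k) = ennreal (\<gamma> ^ n) * ennreal (2 * V * \<gamma> ^ Suc k)"
      using disc_nonneg V_nonneg by (simp add: ennreal_mult[symmetric] mult_ac)
    have 3: "ennreal (sqrt \<gamma> ^ n) * accum y (Suc k) =
      ennreal (sqrt \<gamma> ^ n) * y k + ennreal (sqrt \<gamma> ^ n) * y k + ennreal (sqrt \<gamma> ^ n) * ennreal (sqrt \<gamma>) * accum y k"
      unfolding accum.simps mult_2 distrib_left mult.assoc ..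
    show ?thesis unfolding 1 2 3 by (simp only: add.assoc)
  qed
  finally show ?case .
qed

text \<open>\<open>mix_bellman\<close> turns the mixture of the Bellman image of an iterate into
  \<open>T\<close> applied to its value, so the value of the next iterate is \<open>Tstar\<close> of
  the present one up to \<open>err\<close>. The second claim covers a fixed action, as required for
  the learned policy.\<close>

lemma residual_bound:
  assumes Q: "\<And>k. qfun (Q k)" and B: "\<And>k. qfun (bellman_opt G (Q k))"
    and E: "\<And>k s. E k s = ennreal (err (Q (Suc k)) (bellman_opt G (Q k)) s)"
  shows "ennreal \<bar>VQ (Q k) s - Tstar (VQ (Q k)) s\<bar> \<le> resid E k s"
    and "ennreal (err (Q (Suc k)) (bellman_opt G (Q k)) s) + Tpow 1 (\<lambda>s. ennreal \<bar>VQ (Q k) s - VQ (Q (Suc k)) s\<bar>) s \<le> resid E (Suc k) s"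
proof -
  have v: "bdd (VQ (Q k))" for k by (rule bdd_VQ[OF Q])
  have [measurable]: "VQ (Q k) \<in> borel_measurable (St G)" "Tstar (VQ (Q k)) \<in> borel_measurable (St G)" for k
    using v[of k] bdd_Tstar[OF v[of k]] by (auto simp: bdd_def)
  have Em[measurable]: "E k \<in> borel_measurable (St G)" for k
    unfolding E[abs_def] using err_measurable[OF Q B] by measurable
  \<comment> \<open>Maxima over actions differ by at most the maximal difference, and this maximum
    is \<open>err\<close>.\<close>
  have a: "\<bar>VQ (Q (Suc k)) s - Tstar (VQ (Q k)) s\<bar> \<le> err (Q (Suc k)) (bellman_opt G (Q k)) s" for k s
    unfolding VQ_def Tstar_def
    by (rule abs_Max_diff_le) (use err_ge[of "Q (Suc k)" s _ "bellman_opt G (Q k)"] in \<open>simp add: mix_bellman[OF Q] VQ_def[abs_def]\<close>)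
  have step: "ennreal (err (Q (Suc k)) (bellman_opt G (Q k)) s) + Tpow 1 (\<lambda>s. ennreal \<bar>VQ (Q k) s - VQ (Q (Suc k)) s\<bar>) s \<le> resid E (Suc k) s"
    if IH: "\<And>s. ennreal \<bar>VQ (Q k) s - Tstar (VQ (Q k)) s\<bar> \<le> resid E k s" for k s
  proof -
    have "ennreal \<bar>VQ (Q k) s - VQ (Q (Suc k)) s\<bar> \<le> E k s + resid E k s" for s
    proof -
      have "\<bar>VQ (Q k) s - VQ (Q (Suc k)) s\<bar> \<le> err (Q (Suc k)) (bellman_opt G (Q k)) s + \<bar>VQ (Q k) s - Tstar (VQ (Q k)) s\<bar>"
        using a[where k=k and s=s] by linarith
      then have "ennreal \<bar>VQ (Q k) s - VQ (Q (Suc k)) s\<bar> \<le> ennreal (err (Q (Suc k)) (bellman_opt G (Q k)) s) + ennreal \<bar>VQ (Q k) s - Tstar (VQ (Q k)) s\<bar>"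
        using ennreal_plus_le ennreal_leI order_trans by blast
      also have "\<dots> \<le> E k s + resid E k s" unfolding E[of k s, symmetric] by (intro add_left_mono IH)
      finally show ?thesis .
    qed
    then have "Tpow 1 (\<lambda>s. ennreal \<bar>VQ (Q k) s - VQ (Q (Suc k)) s\<bar>) s \<le> Tpow 1 (\<lambda>s. E k s + resid E k s) s"
      by (rule Tpow_mono)
    also have "\<dots> \<le> Tpow 1 (E k) s + Tpow 1 (resid E k) s"
      by (rule Tpow_plus[OF Em resid_measurable[OF Em]])
    finally show ?thesis by (simp add: E add.assoc add_left_mono del: One_nat_def)
  qed
  have res: "ennreal \<bar>VQ (Q k) s - Tstar (VQ (Q k)) s\<bar> \<le> resid E k s" for k s
  proof (induction k arbitrary: s)
    case 0
    have "\<bar>VQ (Q 0) s\<bar> \<le> V" "\<bar>Tstar (VQ (Q 0)) s\<bar> \<le> V" using v[of 0] bdd_Tstar[OF v[of 0]] by (auto simp: bdd_def)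
    then have "\<bar>VQ (Q 0) s - Tstar (VQ (Q 0)) s\<bar> \<le> 2 * V" by linarith
    then show ?case by (simp add: ennreal_leI)
  next
    case (Suc k)
    have "\<bar>VQ (Q (Suc k)) s - Tstar (VQ (Q (Suc k))) s\<bar> \<le> err (Q (Suc k)) (bellman_opt G (Q k)) s + \<bar>Tstar (VQ (Q k)) s - Tstar (VQ (Q (Suc k))) s\<bar>"
      using a[where k=k and s=s] by linarith
    then have "ennreal \<bar>VQ (Q (Suc k)) s - Tstar (VQ (Q (Suc k))) s\<bar> \<le> ennreal (err (Q (Suc k)) (bellman_opt G (Q k)) s) + ennreal \<bar>Tstar (VQ (Q k)) s - Tstar (VQ (Q (Suc k))) s\<bar>"
      using ennreal_plus_le ennreal_leI order_trans by blast
    also have "\<dots> \<le> ennreal (err (Q (Suc k)) (bellman_opt G (Q k)) s) + Tpow 1 (\<lambda>s. ennreal \<bar>VQ (Q k) s - VQ (Q (Suc k)) s\<bar>) s"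
      by (intro add_left_mono Tstar_diff v)
    also have "\<dots> \<le> resid E (Suc k) s" by (rule step[OF Suc.IH])
    finally show ?case .
  qed
  show "ennreal \<bar>VQ (Q k) s - Tstar (VQ (Q k)) s\<bar> \<le> resid E k s" by (rule res)
  show "ennreal (err (Q (Suc k)) (bellman_opt G (Q k)) s) + Tpow 1 (\<lambda>s. ennreal \<bar>VQ (Q k) s - VQ (Q (Suc k)) s\<bar>) s \<le> resid E (Suc k) s"
    by (rule step[OF res])
qed

text \<open>The baseline is the value of the last iterate under the true mixture. Its residual is
  paid once for the competitor and once for the learned policy, and the latter also pays twice for
  the plug-in mixture; hence the factors 2, and 4 V from two initial residuals 2 V.\<close>

lemma propagation:
  assumes st: "offline_stationary G" and N: "0 < card (data_idx L)" and c: "c1 G L < \<infinity>"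
    and \<pi>: "\<pi> \<in> policies G" and a: "a \<in> St G \<rightarrow>\<^sub>M count_space UNIV"
    and Q: "\<And>k. qfun (Q k)" and B: "\<And>k. qfun (bellman_opt G (Q k))"
    and cls: "pb_class G {qb}" "pm_class G {qm}"
    and greedy: "\<And>s. is_arg_max (mixQ_hat qb qm (Q (Suc k)) s) (\<lambda>_. True) (a s)"
    and \<delta>: "0 < \<delta>"
  defines "y \<equiv> \<lambda>z. ennreal (\<delta> / 2) + ennreal (1 / (2 * \<delta> * (1 - \<gamma>))) * c1 G L * z"
  shows "ennreal (J G \<pi> - J G (stationary (\<lambda>s. return_pmf (a s)))) \<le>
    2 * (\<Sum>n. ennreal (sqrt \<gamma> ^ n)) * (y (\<integral>\<^sup>+s. ennreal ((plug qb qm (Q (Suc k)) s)\<^sup>2) \<partial>rho0 G) +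
      accum (\<lambda>j. y (\<integral>\<^sup>+s. ennreal ((err (Q (Suc j)) (bellman_opt G (Q j)) s)\<^sup>2) \<partial>rho0 G)) (Suc k))
    + ennreal (4 * V * \<gamma> ^ Suc k / (1 - \<gamma>))"
proof -
  define E where "E j = (\<lambda>s. ennreal (err (Q (Suc j)) (bellman_opt G (Q j)) s))" for j
  define H where "H = (\<lambda>s. ennreal (plug qb qm (Q (Suc k)) s))"
  let ?K = "Suc k"
  let ?R = "resid E ?K"
  let ?u = "VQ (Q ?K)"
  have v: "bdd (VQ (Q k))" for k by (rule bdd_VQ[OF Q])
  have Em[measurable]: "E j \<in> borel_measurable (St G)" for j
    unfolding E_def using err_measurable[OF Q B] by measurable
  have Hm[measurable]: "H \<in> borel_measurable (St G)"
    unfolding H_def using plug_measurable[OF Q cls] by measurable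
  have Rm[measurable]: "?R \<in> borel_measurable (St G)" by (rule resid_measurable[OF Em])
  note rb = residual_bound[where Q=Q and E=E, OF Q B, OF E_def[THEN fun_cong]]
  have h2: "ennreal (?u s - T (a s) ?u s) \<le> (\<lambda>s. (H s + H s) + ?R s) s" for s
  proof -
    let ?p = "plug qb qm (Q ?K) s" and ?e = "err (Q ?K) (bellman_opt G (Q k)) s"
    have g: "mixQ_hat qb qm (Q ?K) s b \<le> mixQ_hat qb qm (Q ?K) s (a s)" for b
      using greedy[of s] by (auto simp: is_arg_max_def not_less)
    have "?u s \<in> range (mixQ (p_b G) (p_m G) (Q ?K) s)" unfolding VQ_def by (rule Max_in) auto
    then obtain b where b: "?u s = mixQ (p_b G) (p_m G) (Q ?K) s b" by auto
    \<comment> \<open>The chosen action maximises the plug-in mixture; comparing with the true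
      mixture at \<open>b\<close> and at \<open>a s\<close> costs one plug-in error each.\<close>
    have "?u s \<le> mixQ (p_b G) (p_m G) (Q ?K) s (a s) + 2 * ?p"
      using plug_ge[of qb qm "Q ?K" s b] plug_ge[of qb qm "Q ?K" s "a s"] g[of b] unfolding b by linarith
    moreover have "mixQ (p_b G) (p_m G) (Q ?K) s (a s) \<le> T (a s) (VQ (Q k)) s + ?e"
      using err_ge[of "Q ?K" s "a s" "bellman_opt G (Q k)"] by (simp add: mix_bellman[OF Q])
    ultimately have "?u s - T (a s) ?u s \<le> (?p + ?p) + (?e + \<bar>T (a s) (VQ (Q k)) s - T (a s) ?u s\<bar>)" by linarith
    then have "ennreal (?u s - T (a s) ?u s) \<le> ennreal ((?p + ?p) + (?e + \<bar>T (a s) (VQ (Q k)) s - T (a s) ?u s\<bar>))" by (rule ennreal_leI)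
    also have "\<dots> = (H s + H s) + (ennreal ?e + ennreal \<bar>T (a s) (VQ (Q k)) s - T (a s) ?u s\<bar>)"
      by (simp only: ennreal_plus plug_nonneg err_nonneg add_nonneg_nonneg abs_ge_zero H_def)
    also have "\<dots> \<le> (H s + H s) + (ennreal ?e + Tpow 1 (\<lambda>s. ennreal \<bar>VQ (Q k) s - ?u s\<bar>) s)"
      by (intro add_left_mono T_diff v)
    also have "\<dots> \<le> (H s + H s) + ?R s"
      by (intro add_left_mono rb(2))
    finally show ?thesis .
  qed
  let ?y = "\<lambda>j. y (\<integral>\<^sup>+s. ennreal ((err (Q (Suc j)) (bellman_opt G (Q j)) s)\<^sup>2) \<partial>rho0 G)"
  let ?yH = "y (\<integral>\<^sup>+s. ennreal ((plug qb qm (Q ?K) s)\<^sup>2) \<partial>rho0 G)"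
  have yE: "(\<integral>\<^sup>+s. Tpow n (E j) s \<partial>rho0 G) \<le> ennreal (sqrt \<gamma> ^ n) * ?y j" for n j
    unfolding E_def y_def
    by (rule Tpow_am_gm[OF st N c err_measurable[OF Q B] err_nonneg err_le[OF Q B] \<delta>])
  have yHn: "(\<integral>\<^sup>+s. Tpow n H s \<partial>rho0 G) \<le> ennreal (sqrt \<gamma> ^ n) * ?yH" for n
    unfolding H_def y_def
    by (rule Tpow_am_gm[OF st N c plug_measurable[OF Q cls] plug_nonneg plug_le[OF Q] \<delta>])
  let ?A = "accum ?y ?K" and ?s = "\<Sum>n. ennreal (sqrt \<gamma> ^ n)"
  have R: "(\<integral>\<^sup>+s. Tpow n ?R s \<partial>rho0 G) \<le> ennreal (sqrt \<gamma> ^ n) * ?A + ennreal (\<gamma> ^ n) * ennreal (2 * V * \<gamma> ^ ?K)" for n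
    by (rule nn_resid[OF Em yE])
  have sumR: "(\<Sum>n. \<integral>\<^sup>+s. Tpow n ?R s \<partial>rho0 G) \<le> ?s * ?A + ennreal (2 * V * \<gamma> ^ ?K / (1 - \<gamma>))"
  proof -
    have "(\<Sum>n. \<integral>\<^sup>+s. Tpow n ?R s \<partial>rho0 G) \<le> (\<Sum>n. ennreal (sqrt \<gamma> ^ n) * ?A + ennreal (\<gamma> ^ n) * ennreal (2 * V * \<gamma> ^ ?K))"
      by (intro suminf_le R summableI)
    also have "\<dots> = ?s * ?A + (\<Sum>n. ennreal (\<gamma> ^ n)) * ennreal (2 * V * \<gamma> ^ ?K)"
      by (simp only: suminf_add[symmetric, OF summableI summableI] ennreal_suminf_multc)
    also have "(\<Sum>n. ennreal (\<gamma> ^ n)) * ennreal (2 * V * \<gamma> ^ ?K) = ennreal (2 * V * \<gamma> ^ ?K / (1 - \<gamma>))"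
      using disc_nonneg disc_less V_nonneg by (simp add: geometric_suminf ennreal_mult[symmetric] del: power_Suc)
    finally show ?thesis .
  qed
  have sumH: "(\<Sum>n. \<integral>\<^sup>+s. Tpow n (\<lambda>s. (H s + H s) + ?R s) s \<partial>rho0 G) \<le> 2 * ?s * ?yH + (\<Sum>n. \<integral>\<^sup>+s. Tpow n ?R s \<partial>rho0 G)"
  proof -
    have "(\<integral>\<^sup>+s. Tpow n (\<lambda>s. (H s + H s) + ?R s) s \<partial>rho0 G) \<le> 2 * (ennreal (sqrt \<gamma> ^ n) * ?yH) + (\<integral>\<^sup>+s. Tpow n ?R s \<partial>rho0 G)" for n
    proof -
      have "Tpow n (\<lambda>s. (H s + H s) + ?R s) s \<le> (Tpow n H s + Tpow n H s) + Tpow n ?R s" for s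
        by (rule order_trans[OF Tpow_plus], measurable) (intro add_right_mono Tpow_plus Hm)
      then have "(\<integral>\<^sup>+s. Tpow n (\<lambda>s. (H s + H s) + ?R s) s \<partial>rho0 G) \<le> (\<integral>\<^sup>+s. (Tpow n H s + Tpow n H s) + Tpow n ?R s \<partial>rho0 G)"
        by (rule nn_integral_mono)
      also have "\<dots> = (\<integral>\<^sup>+s. Tpow n H s \<partial>rho0 G) + (\<integral>\<^sup>+s. Tpow n H s \<partial>rho0 G) + (\<integral>\<^sup>+s. Tpow n ?R s \<partial>rho0 G)"
        by (subst nn_integral_add, measurable, subst nn_integral_add, measurable)
      also have "\<dots> \<le> 2 * (ennreal (sqrt \<gamma> ^ n) * ?yH) + (\<integral>\<^sup>+s. Tpow n ?R s \<partial>rho0 G)"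
        unfolding mult_2 by (intro add_mono yHn order_refl)
      finally show ?thesis .
    qed
    then have "(\<Sum>n. \<integral>\<^sup>+s. Tpow n (\<lambda>s. (H s + H s) + ?R s) s \<partial>rho0 G) \<le> (\<Sum>n. 2 * (ennreal (sqrt \<gamma> ^ n) * ?yH) + (\<integral>\<^sup>+s. Tpow n ?R s \<partial>rho0 G))"
      by (intro suminf_le summableI)
    also have "\<dots> = 2 * (?s * ?yH) + (\<Sum>n. \<integral>\<^sup>+s. Tpow n ?R s \<partial>rho0 G)"
      by (simp only: suminf_add[symmetric, OF summableI summableI] ennreal_suminf_multc ennreal_suminf_cmult)
    finally show ?thesis by (simp only: mult.assoc)
  qed
  have "ennreal (J G \<pi> - J G (stationary (\<lambda>s. return_pmf (a s)))) \<le>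
    (\<Sum>n. \<integral>\<^sup>+s. Tpow n ?R s \<partial>rho0 G) + (\<Sum>n. \<integral>\<^sup>+s. Tpow n (\<lambda>s. (H s + H s) + ?R s) s \<partial>rho0 G)"
    by (rule J_gap[OF \<pi> a v Rm _ rb(1) h2]) measurable
  also have "\<dots> \<le> (\<Sum>n. \<integral>\<^sup>+s. Tpow n ?R s \<partial>rho0 G) + (2 * ?s * ?yH + (\<Sum>n. \<integral>\<^sup>+s. Tpow n ?R s \<partial>rho0 G))"
    by (intro add_left_mono sumH)
  also have "\<dots> \<le> (?s * ?A + ennreal (2 * V * \<gamma> ^ ?K / (1 - \<gamma>))) + (2 * ?s * ?yH + (?s * ?A + ennreal (2 * V * \<gamma> ^ ?K / (1 - \<gamma>))))"
    by (intro add_mono sumR order_refl)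
  also have "\<dots> = 2 * ?s * (?yH + ?A) + (ennreal (2 * V * \<gamma> ^ ?K / (1 - \<gamma>)) + ennreal (2 * V * \<gamma> ^ ?K / (1 - \<gamma>)))"
    by (simp only: distrib_left mult_2 distrib_right add_ac)
  also have "ennreal (2 * V * \<gamma> ^ ?K / (1 - \<gamma>)) + ennreal (2 * V * \<gamma> ^ ?K / (1 - \<gamma>)) = ennreal (4 * V * \<gamma> ^ ?K / (1 - \<gamma>))"
    using disc_nonneg disc_less V_nonneg by (subst ennreal_plus[symmetric]) (auto simp del: power_Suc simp: add_divide_distrib[symmetric])
  finally show ?thesis .
qed

end

section \<open>Square roots and the choice of the free parameter\<close>

lemma esqrt_ennreal: "0 \<le> x \<Longrightarrow> esqrt (ennreal x) = ennreal (sqrt x)"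
  by (simp add: esqrt_def)

lemma esqrt_top: "esqrt top = top"
  by (simp add: esqrt_def)

lemma esqrt_mult: "esqrt (a * b) = esqrt a * esqrt b"
  by (cases a; cases b)
     (auto simp: esqrt_ennreal[of 0, simplified] esqrt_ennreal esqrt_top ennreal_mult[symmetric] real_sqrt_mult ennreal_mult_top ennreal_top_mult)

lemma esqrt_mono: "a \<le> b \<Longrightarrow> esqrt a \<le> esqrt b"
  by (cases a; cases b) (auto simp: esqrt_ennreal esqrt_top ennreal_leI top_unique)

lemma esqrt_add_le: "esqrt (a + b) \<le> esqrt a + esqrt b"
proof (cases a; cases b)
  fix x y :: real assume "0 \<le> x" "a = ennreal x" "0 \<le> y" "b = ennreal y"
  then show ?thesis
    using sqrt_add_le_add_sqrt[of x y]
    by (simp add: esqrt_ennreal ennreal_plus[symmetric] ennreal_leI del: ennreal_plus)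
qed (auto simp: esqrt_top)

lemma esqrt_ge_1: "1 \<le> a \<Longrightarrow> 1 \<le> esqrt a"
  using esqrt_mono[of 1 a] esqrt_ennreal[of 1] by simp

text \<open>The infimum of \<delta> + Z / \<delta> is 2 sqrt Z, attained at \<delta> = sqrt Z. For Z
  = 0 it is only approached, hence the limiting argument; for infinite Z the claim is
  trivial.\<close>

lemma optimize_delta:
  assumes A: "0 < A" and le: "\<And>\<delta>. 0 < \<delta> \<Longrightarrow> x \<le> B + ennreal A * (ennreal \<delta> + Z * ennreal (1 / \<delta>))"
  shows "x \<le> B + ennreal (2 * A) * esqrt Z"
proof (cases Z)
  case top
  then show ?thesis using A by (simp add: esqrt_top ennreal_mult_top)
next
  case (real z)
  show ?thesis
  proof (cases "z = 0")
    case True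
    have "x \<le> B"
    proof (rule ennreal_le_epsilon)
      fix e :: real assume "0 < e"
      then have "x \<le> B + ennreal A * ennreal (e / A)" using le[of "e / A"] A real True by simp
      also have "ennreal A * ennreal (e / A) = ennreal e" using A \<open>0 < e\<close> by (simp add: ennreal_mult[symmetric])
      finally show "x \<le> B + ennreal e" .
    qed
    then show ?thesis by (rule order_trans) simp
  next
    case False
    then have z: "0 < z" using real by simp
    have "x \<le> B + ennreal A * (ennreal (sqrt z) + ennreal z * ennreal (1 / sqrt z))"
      using le[of "sqrt z"] z real by simp
    also have "ennreal z * ennreal (1 / sqrt z) = ennreal (sqrt z)"
      using z by (simp add: ennreal_mult[symmetric] real_div_sqrt)
    also have "ennreal A * (ennreal (sqrt z) + ennreal (sqrt z)) = ennreal (2 * A) * ennreal (sqrt z)"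
      using A z by (simp add: ennreal_mult[symmetric] ennreal_plus[symmetric] del: ennreal_plus)
    finally show ?thesis using real by (simp add: esqrt_ennreal)
  qed
qed

section \<open>Expected gap and the rate of the fits\<close>

context fd_m2dp_pos begin

lemma geometric_sqrt_suminf: "(\<Sum>n. ennreal (sqrt \<gamma> ^ n)) = ennreal (1 / (1 - sqrt \<gamma>))"
  using disc_nonneg disc_less by (simp add: suminf_ennreal2 suminf_geometric)

text \<open>With S = 1 / (1 - sqrt \<gamma>): summation over time gives S, and the accumulated fits
  add 2 S times the bound of a single error, so S (1 + 2 S) multiplies twice the common
  bound.\<close>

definition gap_const :: real where
  "gap_const = 1 / (1 - sqrt \<gamma>) + 2 * (1 / (1 - sqrt \<gamma>))\<^sup>2"

lemma gap_const_pos: "0 < gap_const"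
  using disc_nonneg disc_less by (simp add: gap_const_def add_pos_pos)

text \<open>For fixed \<delta> the bound on the gap is affine in the second moments, so it is
  integrated over the data before \<delta> is optimised. The square root then stands outside the
  expected divergences, and \<open>X\<close> dominates all second moments at once.\<close>

lemma expected_gap:
  fixes Qs :: "nat \<Rightarrow> ('s, 'a, 'm) dataset \<Rightarrow> 's \<Rightarrow> 'a \<Rightarrow> 'm \<Rightarrow> real"
  assumes st: "offline_stationary G" and N: "0 < card (data_idx L)" and c: "c1 G L < \<infinity>"
    and cls: "finite \<Q>" "finite \<B>" "finite \<M>" "q_class G \<Q>" "pb_class G \<B>" "pm_class G \<M>"
    and complete: "\<And>Q. Q \<in> \<Q> \<Longrightarrow> bellman_opt G Q \<in> \<Q>"
    and m: "\<And>j. j \<le> Suc k \<Longrightarrow> Qs j \<in> data_law G L \<rightarrow>\<^sub>M count_space \<Q>"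
      "bh \<in> data_law G L \<rightarrow>\<^sub>M count_space \<B>" "mh \<in> data_law G L \<rightarrow>\<^sub>M count_space \<M>"
    and ph: "(\<lambda>(d, s). ph d s) \<in> data_law G L \<Otimes>\<^sub>M St G \<rightarrow>\<^sub>M count_space UNIV"
    and greedy: "\<And>d s. d \<in> space (data_law G L) \<Longrightarrow> is_arg_max (mixQ_hat (bh d) (mh d) (Qs (Suc k) d) s) (\<lambda>_. True) (ph d s)"
    and \<pi>: "\<pi> \<in> policies G"
    and fit: "\<And>j. j \<le> k \<Longrightarrow> (\<integral>\<^sup>+d. ennreal (dist2 (Qs (Suc j) d) (bellman_opt G (Qs j d))) \<partial>data_law G L)
      \<le> 8 * (\<integral>\<^sup>+d. ennreal (plug2 (bh d) (mh d) (Qs j d)) \<partial>data_law G L) + ennreal \<tau>"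
  shows "(\<integral>\<^sup>+d. ennreal (J G \<pi> - J G (stationary (\<lambda>s. return_pmf (ph d s)))) \<partial>data_law G L) \<le>
    ennreal (4 * V * \<gamma> ^ Suc k / (1 - \<gamma>)) + ennreal (2 * gap_const) *
      esqrt (ennreal (1 / (1 - \<gamma>)) * c1 G L * (ennreal (1 / pmin G) *
        (ennreal (64 * V\<^sup>2) * (KL_b G L bh + c2 G * KL_m G L mh) + ennreal \<tau>)))"
proof -
  let ?P = "data_law G L"
  interpret P: prob_space ?P by (rule prob_data_law)
  have q: "qfun Q" if "Q \<in> \<Q>" for Q using cls(4) that by (auto simp: q_class_def qfun_def)
  have pb: "pb_class G {b}" if "b \<in> \<B>" for b using cls(5) that by (auto simp: pb_class_def)
  have pm: "pm_class G {b}" if "b \<in> \<M>" for b using cls(6) that by (auto simp: pm_class_def)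
  \<comment> \<open>The propagation lemmas quantify over all indices, the run only up to
    \<open>Suc k\<close>; the sequence is continued constantly.\<close>
  define Q where "Q j = Qs (min j (Suc k))" for j
  have Qm: "Q j \<in> ?P \<rightarrow>\<^sub>M count_space \<Q>" for j unfolding Q_def by (rule m) simp
  have Qin: "Q j d \<in> \<Q>" and bin: "bh d \<in> \<B>" and min: "mh d \<in> \<M>" if "d \<in> space ?P" for j d
    using Qm[THEN measurable_space, OF that] m(2,3)[THEN measurable_space, OF that] by auto
  define e where "e j d = (\<integral>\<^sup>+s. ennreal ((err (Q (Suc j) d) (bellman_opt G (Q j d)) s)\<^sup>2) \<partial>rho0 G)" for j d
  define p where "p d = (\<integral>\<^sup>+s. ennreal ((plug (bh d) (mh d) (Q (Suc k) d) s)\<^sup>2) \<partial>rho0 G)" for d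
  define Kl where "Kl = KL_b G L bh + c2 G * KL_m G L mh"
  define X where "X = ennreal (1 / pmin G) * (ennreal (64 * V\<^sup>2) * Kl + ennreal \<tau>)"
  have [measurable]: "e j \<in> borel_measurable ?P" for j
    unfolding e_def[abs_def]
    by (rule measurable_compose_countable'[OF _ Qm[of "Suc j"]], rule measurable_compose_countable'[OF _ Qm[of j]]) (auto simp: cls countable_finite)
  have [measurable]: "p \<in> borel_measurable ?P"
    unfolding p_def[abs_def]
    by (rule measurable_compose_countable'[OF _ m(2)], rule measurable_compose_countable'[OF _ m(3)], rule measurable_compose_countable'[OF _ Qm[of "Suc k"]])
       (auto simp: cls countable_finite)
  have [measurable]: "(\<lambda>d. klb (bh d)) \<in> borel_measurable ?P"
    by (rule measurable_compose_countable'[OF _ m(2)]) (auto simp: cls countable_finite)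
  have [measurable]: "(\<lambda>d. klm (mh d)) \<in> borel_measurable ?P"
    by (rule measurable_compose_countable'[OF _ m(3)]) (auto simp: cls countable_finite)
  have Kl_eq: "(\<integral>\<^sup>+d. klb (bh d) + c2 G * klm (mh d) \<partial>?P) = Kl"
    unfolding Kl_def KL_b_def KL_m_def rhoD_eq[OF st N] klb_def[symmetric] klm_def[symmetric]
    by (subst nn_integral_add, measurable) (simp add: nn_integral_cmult)
  have pin: "1 \<le> 1 / pmin G" using pmin_pos pmin_le_1 by simp
  have p_le: "(\<integral>\<^sup>+d. p d \<partial>?P) \<le> X"
  proof -
    have "(\<integral>\<^sup>+d. p d \<partial>?P) \<le> (\<integral>\<^sup>+d. ennreal (8 * V\<^sup>2) * (klb (bh d) + c2 G * klm (mh d)) \<partial>?P)"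
      unfolding p_def by (intro nn_integral_mono nn_plug q Qin pb bin pm min)
    also have "\<dots> = ennreal (8 * V\<^sup>2) * Kl" by (simp add: nn_integral_cmult Kl_eq)
    also have "\<dots> \<le> ennreal (64 * V\<^sup>2) * Kl" by (intro mult_right_mono ennreal_leI) auto
    also have "\<dots> \<le> 1 * (ennreal (64 * V\<^sup>2) * Kl + ennreal \<tau>)" by simp
    also have "\<dots> \<le> X" unfolding X_def using pin by (intro mult_right_mono) (auto simp: ennreal_1[symmetric] simp del: ennreal_1 intro: ennreal_leI)
    finally show ?thesis .
  qed
  have e_le: "(\<integral>\<^sup>+d. e j d \<partial>?P) \<le> X" if j: "j \<le> k" for j
  proof -
    have Qj: "Q j = Qs j" "Q (Suc j) = Qs (Suc j)" using j by (auto simp: Q_def min_def)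
    have [measurable]: "(\<lambda>d. dist2 (Q (Suc j) d) (bellman_opt G (Q j d))) \<in> borel_measurable ?P"
      by (rule measurable_compose_countable'[OF _ Qm[of "Suc j"]], rule measurable_compose_countable'[OF _ Qm[of j]]) (auto simp: cls countable_finite)
    have "(\<integral>\<^sup>+d. e j d \<partial>?P) \<le> (\<integral>\<^sup>+d. ennreal (1 / pmin G) * ennreal (dist2 (Q (Suc j) d) (bellman_opt G (Q j d))) \<partial>?P)"
      unfolding e_def by (intro nn_integral_mono nn_err q Qin complete)
    also have "\<dots> = ennreal (1 / pmin G) * (\<integral>\<^sup>+d. ennreal (dist2 (Q (Suc j) d) (bellman_opt G (Q j d))) \<partial>?P)"
      by (rule nn_integral_cmult) measurable
    also have "\<dots> \<le> ennreal (1 / pmin G) * (8 * (\<integral>\<^sup>+d. ennreal (plug2 (bh d) (mh d) (Q j d)) \<partial>?P) + ennreal \<tau>)"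
      unfolding Qj by (intro mult_left_mono fit j) auto
    also have "\<dots> \<le> ennreal (1 / pmin G) * (8 * (\<integral>\<^sup>+d. ennreal (8 * V\<^sup>2) * (klb (bh d) + c2 G * klm (mh d)) \<partial>?P) + ennreal \<tau>)"
      by (intro mult_left_mono add_right_mono nn_integral_mono nn_plug2 st q Qin pb bin pm min) auto
    also have "8 * (\<integral>\<^sup>+d. ennreal (8 * V\<^sup>2) * (klb (bh d) + c2 G * klm (mh d)) \<partial>?P) = ennreal (64 * V\<^sup>2) * Kl"
    proof -
      have "ennreal (64 * V\<^sup>2) = 8 * ennreal (8 * V\<^sup>2)" using ennreal_mult[of 8 "8 * V\<^sup>2"] by simp
      then show ?thesis by (simp add: nn_integral_cmult Kl_eq mult.assoc)
    qed
    finally show ?thesis by (simp add: X_def)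
  qed
  let ?S = "ennreal (1 / (1 - sqrt \<gamma>))"
  have s1: "sqrt \<gamma> < 1" "0 \<le> sqrt \<gamma>" using disc_less disc_nonneg by auto
  \<comment> \<open>The fixed-point equation of the sum makes the bound \<open>2 * ?S * y X\<close>
    invariant under the recursion of \<open>accum\<close>.\<close>
  have S: "1 + ennreal (sqrt \<gamma>) * ?S = ?S"
  proof -
    have "1 + sqrt \<gamma> * (1 / (1 - sqrt \<gamma>)) = 1 / (1 - sqrt \<gamma>)" using s1 by (simp add: field_simps)
    then show ?thesis using s1 by (simp add: ennreal_mult[symmetric] ennreal_1[symmetric] ennreal_plus[symmetric] del: ennreal_1 ennreal_plus)
  qed
  show ?thesis
    unfolding Kl_def[symmetric] X_def[symmetric]
  proof (rule optimize_delta[OF gap_const_pos])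
    fix \<delta> :: real assume \<delta>: "0 < \<delta>"
    define y where "y z = ennreal (\<delta> / 2) + ennreal (1 / (2 * \<delta> * (1 - \<gamma>))) * c1 G L * z" for z
    have ym: "(\<lambda>d. y (f d)) \<in> borel_measurable ?P" if [measurable]: "f \<in> borel_measurable ?P" for f
      unfolding y_def by measurable
    have yle: "(\<integral>\<^sup>+d. y (f d) \<partial>?P) \<le> y X" if [measurable]: "f \<in> borel_measurable ?P" and "(\<integral>\<^sup>+d. f d \<partial>?P) \<le> X" for f
    proof -
      have "(\<integral>\<^sup>+d. y (f d) \<partial>?P) = ennreal (\<delta> / 2) + ennreal (1 / (2 * \<delta> * (1 - \<gamma>))) * c1 G L * (\<integral>\<^sup>+d. f d \<partial>?P)"
        unfolding y_def by (subst nn_integral_add, measurable) (simp add: nn_integral_cmult P.emeasure_space_1)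
      also have "\<dots> \<le> y X" unfolding y_def by (intro add_left_mono mult_left_mono that) auto
      finally show ?thesis .
    qed
    have am: "(\<lambda>d. accum (\<lambda>j. y (e j d)) i) \<in> borel_measurable ?P" for i
    proof (induction i)
      case (Suc i)
      note [measurable] = Suc ym[of "e i"]
      show ?case unfolding accum.simps by measurable
    qed simp
    have acc: "(\<integral>\<^sup>+d. accum (\<lambda>j. y (e j d)) i \<partial>?P) \<le> 2 * ?S * y X" if "i \<le> Suc k" for i
      using that
    proof (induction i)
      case (Suc i)
      note [measurable] = am ym
      have "(\<integral>\<^sup>+d. accum (\<lambda>j. y (e j d)) (Suc i) \<partial>?P) = 2 * (\<integral>\<^sup>+d. y (e i d) \<partial>?P) + ennreal (sqrt \<gamma>) * (\<integral>\<^sup>+d. accum (\<lambda>j. y (e j d)) i \<partial>?P)"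
        unfolding accum.simps by (subst nn_integral_add, measurable) (simp add: nn_integral_cmult am ym)
      also have "\<dots> \<le> 2 * y X + ennreal (sqrt \<gamma>) * (2 * ?S * y X)"
        using Suc.prems by (intro add_mono mult_left_mono yle e_le Suc.IH) auto
      also have "\<dots> = 2 * (1 + ennreal (sqrt \<gamma>) * ?S) * y X"
        by (simp add: distrib_left distrib_right mult_ac)
      finally show ?case unfolding S .
    qed simp
    have "(\<integral>\<^sup>+d. ennreal (J G \<pi> - J G (stationary (\<lambda>s. return_pmf (ph d s)))) \<partial>?P) \<le>
      (\<integral>\<^sup>+d. 2 * ?S * (y (p d) + accum (\<lambda>j. y (e j d)) (Suc k)) + ennreal (4 * V * \<gamma> ^ Suc k / (1 - \<gamma>)) \<partial>?P)"
    proof (rule nn_integral_mono)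
      fix d assume d: "d \<in> space ?P"
      have a: "ph d \<in> St G \<rightarrow>\<^sub>M count_space UNIV"
        using measurable_compose[OF measurable_Pair1'[OF d] ph] by simp
      have "is_arg_max (mixQ_hat (bh d) (mh d) (Q (Suc k) d) s) (\<lambda>_. True) (ph d s)" for s
        using greedy[OF d] by (simp add: Q_def)
      from propagation[where Q="\<lambda>j. Q j d", OF st N c \<pi> a q[OF Qin[OF d]] q[OF complete[OF Qin[OF d]]] pb[OF bin[OF d]] pm[OF min[OF d]] this \<delta>]
      show "ennreal (J G \<pi> - J G (stationary (\<lambda>s. return_pmf (ph d s)))) \<le>
        2 * ?S * (y (p d) + accum (\<lambda>j. y (e j d)) (Suc k)) + ennreal (4 * V * \<gamma> ^ Suc k / (1 - \<gamma>))"
        unfolding geometric_sqrt_suminf y_def e_def p_def .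
    qed
    also have "\<dots> = 2 * ?S * ((\<integral>\<^sup>+d. y (p d) \<partial>?P) + (\<integral>\<^sup>+d. accum (\<lambda>j. y (e j d)) (Suc k) \<partial>?P)) + ennreal (4 * V * \<gamma> ^ Suc k / (1 - \<gamma>))"
    proof -
      note [measurable] = am ym
      show ?thesis
        by (subst nn_integral_add, measurable, subst nn_integral_cmult, measurable, subst nn_integral_add, measurable) (simp add: P.emeasure_space_1)
    qed
    also have "\<dots> \<le> 2 * ?S * (y X + 2 * ?S * y X) + ennreal (4 * V * \<gamma> ^ Suc k / (1 - \<gamma>))"
      by (intro add_right_mono mult_left_mono add_mono yle p_le acc) auto
    also have "2 * ?S * (y X + 2 * ?S * y X) = ennreal gap_const * (ennreal \<delta> + (ennreal (1 / (1 - \<gamma>)) * c1 G L * X) * ennreal (1 / \<delta>))"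
    proof -
      have yX: "2 * y X = ennreal \<delta> + (ennreal (1 / (1 - \<gamma>)) * c1 G L * X) * ennreal (1 / \<delta>)"
      proof -
        have "2 * ennreal (\<delta> / 2) = ennreal \<delta>" using \<delta> ennreal_mult[of 2 "\<delta> / 2"] by simp
        moreover have "2 * ennreal (1 / (2 * \<delta> * (1 - \<gamma>))) = ennreal (1 / (1 - \<gamma>)) * ennreal (1 / \<delta>)"
        proof -
          have "2 * ennreal (1 / (2 * \<delta> * (1 - \<gamma>))) = ennreal (2 * (1 / (2 * \<delta> * (1 - \<gamma>))))"
            using \<delta> disc_less ennreal_mult[of 2 "1 / (2 * \<delta> * (1 - \<gamma>))"] by simp
          also have "2 * (1 / (2 * \<delta> * (1 - \<gamma>))) = 1 / (1 - \<gamma>) * (1 / \<delta>)" by simp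
          also have "ennreal (1 / (1 - \<gamma>) * (1 / \<delta>)) = ennreal (1 / (1 - \<gamma>)) * ennreal (1 / \<delta>)"
            using \<delta> disc_less by (intro ennreal_mult) auto
          finally show ?thesis .
        qed
        ultimately show ?thesis unfolding y_def by (simp add: distrib_left mult.assoc[symmetric]) (simp add: mult_ac)
      qed
      have "ennreal gap_const = ?S + 2 * ?S * ?S"
      proof -
        have "2 * ?S * ?S = ennreal (2 * (1 / (1 - sqrt \<gamma>))\<^sup>2)"
        proof -
          have "2 * ennreal r * ennreal r = ennreal (2 * r\<^sup>2)" if "0 \<le> r" for r :: real
            using that by (simp add: ennreal_mult power2_eq_square mult.assoc)
          then show ?thesis using s1 by simp
        qed
        then show ?thesis using s1 by (simp add: gap_const_def ennreal_plus[symmetric] del: ennreal_plus)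
      qed
      then show ?thesis unfolding yX[symmetric] by (simp add: distrib_left distrib_right mult_ac)
    qed
    finally show "(\<integral>\<^sup>+d. ennreal (J G \<pi> - J G (stationary (\<lambda>s. return_pmf (ph d s)))) \<partial>?P) \<le>
      ennreal (4 * V * \<gamma> ^ Suc k / (1 - \<gamma>)) + ennreal gap_const * (ennreal \<delta> + (ennreal (1 / (1 - \<gamma>)) * c1 G L * X) * ennreal (1 / \<delta>))"
      by (simp only: add.commute)
  qed
qed

text \<open>The block length l is of order ln N / ln (1 / \<rho>), so that the mixing term falls to
  order 1 / N while the complexity term is l ln F / N. Both are then absorbed into the square of the
  stated rate.\<close>

lemma fitted_error:
  fixes Qs :: "nat \<Rightarrow> ('s, 'a, 'm) dataset \<Rightarrow> 's \<Rightarrow> 'a \<Rightarrow> 'm \<Rightarrow> real"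
  assumes st: "offline_stationary G" and V0: "0 < V" and N: "2 \<le> card (data_idx L)"
    and mix: "0 < \<rho>" "\<rho> < 1" "\<And>l. beta_coeff G l \<le> \<kappa> * \<rho> ^ l" and \<kappa>: "0 < \<kappa>"
    and cls: "finite \<Q>" "finite \<B>" "finite \<M>" "q_class G \<Q>" "pb_class G \<B>" "pm_class G \<M>"
    and complete: "\<And>Q. Q \<in> \<Q> \<Longrightarrow> bellman_opt G Q \<in> \<Q>"
    and m: "Qn \<in> data_law G L \<rightarrow>\<^sub>M count_space \<Q>" "Qo \<in> data_law G L \<rightarrow>\<^sub>M count_space \<Q>"
      "bh \<in> data_law G L \<rightarrow>\<^sub>M count_space \<B>" "mh \<in> data_law G L \<rightarrow>\<^sub>M count_space \<M>"
    and argmin: "\<And>d. d \<in> space (data_law G L) \<Longrightarrow> is_arg_min (cal_loss G L d (bh d) (mh d) (Qo d)) (\<lambda>Q. Q \<in> \<Q>) (Qn d)"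
  shows "(\<integral>\<^sup>+d. ennreal (dist2 (Qn d) (bellman_opt G (Qo d))) \<partial>data_law G L) \<le>
      8 * (\<integral>\<^sup>+d. ennreal (plug2 (bh d) (mh d) (Qo d)) \<partial>data_law G L) +
      ennreal (128 * ((1 / ln (1 / \<rho>) + 3 / ln 2) / ln 2 + 3 * \<kappa> / (ln 2)\<^sup>2) *
        (V * (real (card (data_idx L)) powr (- 1 / 2) * ln (real (card (data_idx L)))
              * sqrt (ln (real ((card \<Q>)\<^sup>2 * card \<B> * card \<M>)))))\<^sup>2)"
proof -
  let ?P = "data_law G L"
  let ?N = "real (card (data_idx L))"
  let ?F = "real ((card \<Q>)\<^sup>2 * card \<B> * card \<M>)"
  interpret P: prob_space ?P by (rule prob_data_law)
  have mem: "Qn d \<in> \<Q>" "Qo d \<in> \<Q>" "bh d \<in> \<B>" "mh d \<in> \<M>" if "d \<in> space ?P" for d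
    using m[THEN measurable_space, OF that] by auto
  obtain d0 where d0: "d0 \<in> space ?P" using P.not_empty by blast
  have card1: "1 \<le> card \<Q>" "1 \<le> card \<B>" "1 \<le> card \<M>"
    using mem[OF d0] cls by (auto simp: Suc_le_eq card_gt_0_iff)
  show ?thesis
  proof (cases "card \<Q> = 1")
    \<comment> \<open>A single function is its own Bellman image by completeness, so the error is
      zero. The case is separate because the logarithm in the rate may then be zero.\<close>
    case True
    then obtain q where q: "\<Q> = {q}" by (auto simp: card_1_singleton_iff)
    have "(\<integral>\<^sup>+d. ennreal (dist2 (Qn d) (bellman_opt G (Qo d))) \<partial>?P) = (\<integral>\<^sup>+d. 0 \<partial>?P)"
    proof (rule nn_integral_cong)
      fix d assume d: "d \<in> space ?P"
      have "Qn d = q" "bellman_opt G (Qo d) = q" using mem(1)[OF d] complete[OF mem(2)[OF d]] q by auto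
      then show "ennreal (dist2 (Qn d) (bellman_opt G (Qo d))) = 0" by (simp add: dist2_def)
    qed
    then show ?thesis by simp
  next
    case False
    \<comment> \<open>Two functions make the product of cardinalities at least 4, so its logarithm
      is at least one and the rate can absorb the mixing term, which carries no logarithm.\<close>
    then have "2 \<le> card \<Q>" using card1 by simp
    then have "2\<^sup>2 * 1 * 1 \<le> (card \<Q>)\<^sup>2 * card \<B> * card \<M>"
      using card1 by (intro mult_le_mono power_mono) auto
    then have "real 4 \<le> ?F" by (subst of_nat_le_iff) simp
    then have "ln 4 \<le> ln ?F" by simp
    moreover have "exp 1 \<le> (4::real)" using exp_le by simp
    then have "1 \<le> ln (4::real)" by (subst ln_ge_iff) auto
    ultimately have lnF: "1 \<le> ln ?F" by linarith
    have N2: "2 \<le> ?N" using N by simp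
    define mrate where "mrate = ln (1 / \<rho>)"
    have mrate0: "0 < mrate" using mix by (simp add: mrate_def)
    have l2: "0 < ln (2::real)" by simp
    have lnN: "ln 2 \<le> ln ?N" using N2 by simp
    \<comment> \<open>Ensures l - 1 \<ge> ln N / ln (1 / \<rho>), so that the mixing coefficient at
      l - 1 is at most \<kappa> / N.\<close>
    define l where "l = nat \<lceil>ln ?N / mrate\<rceil> + 2"
    have lnN0: "0 < ln ?N" using lnN l2 by linarith
    have c0: "0 \<le> ln ?N / mrate" using less_imp_le[OF lnN0] less_imp_le[OF mrate0] by (rule divide_nonneg_nonneg)
    have l_lower: "ln ?N / mrate \<le> real (l - 1)" unfolding l_def using c0 by linarith
    have l_upper: "real l \<le> ln ?N / mrate + 3" unfolding l_def using c0 by linarith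
    have l1: "1 \<le> l" by (simp add: l_def)
    have l_ln: "real l \<le> (1 / mrate + 3 / ln 2) * ln ?N"
    proof -
      have "1 \<le> ln ?N / ln 2" using lnN l2 by (simp only: le_divide_eq_1_pos)
      then have "real l \<le> ln ?N / mrate + 3 * (ln ?N / ln 2)" using l_upper by linarith
      then show ?thesis unfolding distrib_right by simp
    qed
    have beta: "beta_coeff G (l - 1) \<le> \<kappa> / ?N"
    proof -
      have "\<rho> ^ (l - 1) = exp (- (mrate * real (l - 1)))"
        using mix by (simp add: mrate_def ln_div exp_of_nat2_mult)
      also have "\<dots> \<le> exp (- ln ?N)"
        using l_lower mrate0 by (simp add: field_simps)
      also have "\<dots> = 1 / ?N" using N2 by (simp add: exp_minus inverse_eq_divide)
      finally have "\<kappa> * \<rho> ^ (l - 1) \<le> \<kappa> * (1 / ?N)" using \<kappa> by (intro mult_left_mono) auto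
      then show ?thesis using mix(3)[of "l - 1"] by simp
    qed
    let ?R = "?N powr (- 1 / 2) * ln ?N * sqrt (ln ?F)"
    have R2: "?R\<^sup>2 = (ln ?N)\<^sup>2 * ln ?F / ?N"
    proof -
      have "(?N powr (- 1 / 2))\<^sup>2 = 1 / ?N"
        using N2 by (simp add: power2_eq_square powr_add[symmetric] powr_minus inverse_eq_divide)
      then show ?thesis using lnF by (simp add: power_mult_distrib)
    qed
    let ?b = "1 / mrate + 3 / ln 2"
    have b0: "0 \<le> ?b" using less_imp_le[OF mrate0] by simp
    have i1: "real l * ln ?F / ?N \<le> ?b / ln 2 * ?R\<^sup>2"
    proof -
      \<comment> \<open>The block length contributes one factor ln N and the squared rate has two;
        as N \<ge> 2 the surplus is at least ln 2, hence this divisor in the constant.\<close>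
      have "ln ?N * ln 2 \<le> ln ?N * ln ?N" using lnN less_imp_le[OF lnN0] by (rule mult_left_mono)
      then have "ln ?N \<le> (ln ?N)\<^sup>2 / ln 2" using l2 by (simp add: field_simps power2_eq_square)
      then have "?b * ln ?N \<le> ?b * ((ln ?N)\<^sup>2 / ln 2)" using b0 by (rule mult_left_mono)
      with l_ln have "real l \<le> ?b * ((ln ?N)\<^sup>2 / ln 2)" by linarith
      then have "real l * (ln ?F / ?N) \<le> ?b * ((ln ?N)\<^sup>2 / ln 2) * (ln ?F / ?N)"
        using lnF by (intro mult_right_mono) auto
      then show ?thesis unfolding R2 by simp
    qed
    have i2: "3 * beta_coeff G (l - 1) \<le> 3 * \<kappa> / (ln 2)\<^sup>2 * ?R\<^sup>2"
    proof -
      have "(ln 2)\<^sup>2 * 1 \<le> (ln ?N)\<^sup>2 * ln ?F"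
        by (intro mult_mono power_mono lnN lnF) auto
      then have "1 \<le> (ln ?N)\<^sup>2 * ln ?F / (ln 2)\<^sup>2" using l2 by simp
      then have "\<kappa> / ?N * 1 \<le> \<kappa> / ?N * ((ln ?N)\<^sup>2 * ln ?F / (ln 2)\<^sup>2)" using \<kappa> by (intro mult_left_mono) auto
      then have "\<kappa> / ?N \<le> \<kappa> / (ln 2)\<^sup>2 * ?R\<^sup>2" unfolding R2 by (simp add: mult_ac)
      then show ?thesis using beta by simp
    qed
    have "128 * V\<^sup>2 * (real l * ln ?F / ?N + 3 * beta_coeff G (l - 1)) \<le> 128 * V\<^sup>2 * (?b / ln 2 * ?R\<^sup>2 + 3 * \<kappa> / (ln 2)\<^sup>2 * ?R\<^sup>2)"
      using i1 i2 by (intro mult_left_mono add_mono) auto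
    also have "\<dots> = 128 * (?b / ln 2 + 3 * \<kappa> / (ln 2)\<^sup>2) * (V * ?R)\<^sup>2"
      by (simp only: power_mult_distrib[of V] distrib_right distrib_left mult_ac)
    finally have "ennreal (128 * V\<^sup>2 * (real l * ln ?F / ?N + 3 * beta_coeff G (l - 1))) \<le> ennreal (128 * (?b / ln 2 + 3 * \<kappa> / (ln 2)\<^sup>2) * (V * ?R)\<^sup>2)"
      by (rule ennreal_leI)
    moreover have "0 < card (data_idx L)" using N by linarith
    ultimately show ?thesis
      using regression_error[OF st V0 _ l1 cls complete m argmin]
      unfolding mrate_def by (meson add_left_mono order_trans)
  qed
qed

end

section \<open>Assembly of the final bound\<close>

lemma (in fd_m2dp) p_b_pos_of_c2: "c2 G < \<infinity> \<Longrightarrow> 0 < p_b G s a"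
proof (rule ccontr)
  assume c: "c2 G < \<infinity>" and "\<not> 0 < p_b G s a"
  then have "1 / ennreal (p_b G s a) = top" by (simp add: ennreal_neg not_less)
  moreover have "1 / ennreal (p_b G s a) \<le> c2 G"
    unfolding c2_def by (meson SUP_upper2 UNIV_I order_refl)
  ultimately show False using c by (simp add: top_unique)
qed

theorem theorem2:
  fixes G :: "('s, 'c, 'a::finite, 'm::finite) m2dp" and \<kappa> \<rho> :: real
  assumes model: "confounded_m2dp G"
    and front_door: "front_door G"
    and coverage_actions: "c2 G < \<infinity>"
    and stationary_process: "offline_stationary G"
    and mixing_constants: "0 < \<kappa>" "0 < \<rho>" "\<rho> < 1"
    and mixing: "\<And>l. beta_coeff G l \<le> \<kappa> * \<rho> ^ l"
  shows "\<exists>C>0. \<forall>(T :: nat list) (N :: nat) (K :: nat)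
      (\<Q> :: ('s \<Rightarrow> 'a \<Rightarrow> 'm \<Rightarrow> real) set) (\<B> :: ('s \<Rightarrow> 'a pmf) set) (\<M> :: ('s \<Rightarrow> 'a \<Rightarrow> 'm pmf) set)
      bh mh Qh ph (\<pi>star :: ('s, 'a, 'm) policy).
    N = card (data_idx T) \<longrightarrow> 2 \<le> N \<longrightarrow>
    c1 G T < \<infinity> \<longrightarrow>
    q_class G \<Q> \<longrightarrow> pb_class G \<B> \<longrightarrow> pm_class G \<M> \<longrightarrow>
    finite \<Q> \<longrightarrow> finite \<B> \<longrightarrow> finite \<M> \<longrightarrow>
    (\<forall>Q\<in>\<Q>. bellman_opt G Q \<in> \<Q>) \<longrightarrow>
    cal_run G T K \<Q> \<B> \<M> bh mh Qh ph \<longrightarrow>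
    optimal_policy G \<pi>star \<longrightarrow>
    (\<integral>\<^sup>+d. ennreal (J G \<pi>star - J G (stationary (\<lambda>s. return_pmf (ph d s)))) \<partial>data_law G T)
      \<le> ennreal C * esqrt (c1 G T) * ennreal (disc G ^ K * Vmax G / (1 - disc G))
        + ennreal C * esqrt (c1 G T) / ennreal ((1 - disc G)\<^sup>2) *
          (ennreal (Vmax G * real N powr (- 1 / 2) * ln (real N)
              * sqrt (ln (real ((card \<Q>)\<^sup>2 * card \<B> * card \<M>))))
           + ennreal (Vmax G) * (esqrt (KL_b G T bh) + esqrt (c2 G * KL_m G T mh)))"
proof -
  have "0 < p_b G s a" for s a
    by (rule fd_m2dp.p_b_pos_of_c2[OF fd_m2dp.intro[OF model front_door] coverage_actions])
  then interpret fd_m2dp_pos G by unfold_locales (rule model, rule front_door)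
  note st = stationary_process
  define C3 where "C3 = 128 * ((1 / ln (1 / \<rho>) + 3 / ln 2) / ln 2 + 3 * \<kappa> / (ln 2)\<^sup>2)"
  \<comment> \<open>Everything under the square root besides \<open>c1\<close>: 1 / (1 - \<gamma>)
    from occupancies, 1 / \<open>pmin\<close> from mediators, 64 from the plug-in error and
    \<open>C3\<close> from the fits.\<close>
  define C4 where "C4 = (64 + C3) / ((1 - \<gamma>) * pmin G)"
  \<comment> \<open>The 4 is that of the trivial bound and of the initial residuals. A discarded
    iteration costs one power of \<gamma>, which the factor 1 / \<gamma> restores.\<close>
  define C0 where "C0 = (if \<gamma> = 0 then 4 else 4 / \<gamma>)"
  define C where "C = C0 + 2 * gap_const * sqrt C4"
  have C3: "0 \<le> C3" using mixing_constants by (simp add: C3_def)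
  have C4: "0 \<le> C4" using C3 disc_less pmin_pos by (simp add: C4_def)
  have C0: "4 \<le> C0" using disc_nonneg disc_less by (simp add: C0_def field_simps)
  have CC: "C0 \<le> C" "2 * gap_const * sqrt C4 \<le> C" "0 < C"
    using C0 C4 gap_const_pos by (auto simp: C_def intro: add_pos_nonneg)
  show ?thesis
  proof (intro exI[of _ C] conjI allI impI CC(3))
    fix L :: "nat list" and N K :: nat and \<Q> :: "('s \<Rightarrow> 'a \<Rightarrow> 'm \<Rightarrow> real) set"
      and \<B> :: "('s \<Rightarrow> 'a pmf) set" and \<M> :: "('s \<Rightarrow> 'a \<Rightarrow> 'm pmf) set"
      and bh mh Qh ph and \<pi>star :: "('s, 'a, 'm) policy"
    assume N: "N = card (data_idx L)" "2 \<le> N" and c: "c1 G L < \<infinity>"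
      and cl: "q_class G \<Q>" "pb_class G \<B>" "pm_class G \<M>" "finite \<Q>" "finite \<B>" "finite \<M>"
      and complete: "\<forall>Q\<in>\<Q>. bellman_opt G Q \<in> \<Q>"
      and run: "cal_run G L K \<Q> \<B> \<M> bh mh Qh ph" and opt: "optimal_policy G \<pi>star"
    let ?P = "data_law G L"
    let ?gap = "\<integral>\<^sup>+d. ennreal (J G \<pi>star - J G (stationary (\<lambda>s. return_pmf (ph d s)))) \<partial>?P"
    let ?S = "V * (real N powr (- 1 / 2) * ln (real N) * sqrt (ln (real ((card \<Q>)\<^sup>2 * card \<B> * card \<M>))))"
    let ?kl = "esqrt (KL_b G L bh) + esqrt (c2 G * KL_m G L mh)"
    let ?A = "ennreal C * esqrt (c1 G L) * ennreal (\<gamma> ^ K * V / (1 - \<gamma>))"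
    let ?B = "ennreal C * esqrt (c1 G L) / ennreal ((1 - \<gamma>)\<^sup>2) * (ennreal ?S + ennreal V * ?kl)"
    interpret P: prob_space ?P by (rule prob_data_law)
    have N0: "0 < card (data_idx L)" and N2: "2 \<le> card (data_idx L)" using N by auto
    have \<pi>: "\<pi>star \<in> policies G" using opt by (simp add: optimal_policy_def is_arg_max_def)
    have bm: "bh \<in> ?P \<rightarrow>\<^sub>M count_space \<B>" and mm: "mh \<in> ?P \<rightarrow>\<^sub>M count_space \<M>"
      and phm: "(\<lambda>(d, s). ph d s) \<in> ?P \<Otimes>\<^sub>M St G \<rightarrow>\<^sub>M count_space UNIV"
      and Q0: "\<And>d. Qh 0 d = (\<lambda>s a m. 0)"
      and Qm: "\<And>k. k < K \<Longrightarrow> Qh (Suc k) \<in> ?P \<rightarrow>\<^sub>M count_space \<Q>"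
      and argmin: "\<And>k d. k < K \<Longrightarrow> d \<in> space ?P \<Longrightarrow> is_arg_min (cal_loss G L d (bh d) (mh d) (Qh k d)) (\<lambda>Q. Q \<in> \<Q>) (Qh (Suc k) d)"
      and greedy: "\<And>d s. d \<in> space ?P \<Longrightarrow> is_arg_max (mixQ_hat (bh d) (mh d) (Qh K d) s) (\<lambda>_. True) (ph d s)"
      using run by (auto simp: cal_run_def)
    have sc1: "1 \<le> esqrt (c1 G L)" by (rule esqrt_ge_1[OF c1_ge_1[OF st N0 c]])
    have trivial: "?gap \<le> ennreal (4 * V / (1 - \<gamma>))"
    proof -
      have "?gap \<le> (\<integral>\<^sup>+d. ennreal (4 * V / (1 - \<gamma>)) \<partial>?P)"
      proof (intro nn_integral_mono ennreal_leI)
        fix d assume d: "d \<in> space ?P"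
        have "ph d \<in> St G \<rightarrow>\<^sub>M count_space UNIV"
          using measurable_compose[OF measurable_Pair1'[OF d] phm] by simp
        from J_bound[OF greedy_policy[OF this]] J_bound[OF \<pi>]
        show "J G \<pi>star - J G (stationary (\<lambda>s. return_pmf (ph d s))) \<le> 4 * V / (1 - \<gamma>)" by simp
      qed
      then show ?thesis by (simp add: P.emeasure_space_1)
    qed
    \<comment> \<open>Terms of geometric type fit into the first summand, since inserting
      \<open>esqrt (c1 G L)\<close>, which is at least one, only enlarges it.\<close>
    have first: "ennreal x \<le> ?A" if "0 \<le> x" "x \<le> C0 * (\<gamma> ^ K * V / (1 - \<gamma>))" for x
    proof -
      have nn: "0 \<le> \<gamma> ^ K * V / (1 - \<gamma>)" using disc_nonneg disc_less V_nonneg by simp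
      have "x \<le> C * (\<gamma> ^ K * V / (1 - \<gamma>))"
        using that(2) mult_right_mono[OF CC(1) nn] by linarith
      then have "ennreal x \<le> ennreal C * ennreal (\<gamma> ^ K * V / (1 - \<gamma>))"
        using CC(3) nn by (simp add: ennreal_mult[symmetric] ennreal_leI)
      also have "\<dots> \<le> ennreal C * (esqrt (c1 G L) * ennreal (\<gamma> ^ K * V / (1 - \<gamma>)))"
        using mult_right_mono[OF sc1, of "ennreal (\<gamma> ^ K * V / (1 - \<gamma>))"] by (intro mult_left_mono) auto
      finally show ?thesis by (simp only: mult.assoc)
    qed
    \<comment> \<open>Stated for any sequence that starts inside the class: \<open>last\<close> ties
      its end to the output of the run, \<open>pow\<close> compares the decay of the shortened
      sequence with K iterations.\<close>
    have main: "?gap \<le> ?A + ?B"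
      if Qs: "\<And>j. j \<le> Suc k \<Longrightarrow> Qs j \<in> ?P \<rightarrow>\<^sub>M count_space \<Q>"
        and am: "\<And>j d. j \<le> k \<Longrightarrow> d \<in> space ?P \<Longrightarrow> is_arg_min (cal_loss G L d (bh d) (mh d) (Qs j d)) (\<lambda>Q. Q \<in> \<Q>) (Qs (Suc j) d)"
        and last: "Qs (Suc k) = Qh K" and pow: "4 * V * \<gamma> ^ Suc k / (1 - \<gamma>) \<le> C0 * (\<gamma> ^ K * V / (1 - \<gamma>))"
        and V0: "0 < V" for Qs :: "nat \<Rightarrow> ('s, 'a, 'm) dataset \<Rightarrow> 's \<Rightarrow> 'a \<Rightarrow> 'm \<Rightarrow> real" and k
    proof -
      let ?Kl = "KL_b G L bh + c2 G * KL_m G L mh"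
      have comp: "\<And>Q. Q \<in> \<Q> \<Longrightarrow> bellman_opt G Q \<in> \<Q>" using complete by blast
      have fit: "(\<integral>\<^sup>+d. ennreal (dist2 (Qs (Suc j) d) (bellman_opt G (Qs j d))) \<partial>?P)
        \<le> 8 * (\<integral>\<^sup>+d. ennreal (plug2 (bh d) (mh d) (Qs j d)) \<partial>?P) + ennreal (C3 * ?S\<^sup>2)" if "j \<le> k" for j
        unfolding C3_def N(1)
        by (rule fitted_error[OF st V0 N2 mixing_constants(2,3) mixing mixing_constants(1) cl(4-6) cl(1-3) comp Qs Qs bm mm am])
           (use that in auto)
      have gr: "\<And>d s. d \<in> space ?P \<Longrightarrow> is_arg_max (mixQ_hat (bh d) (mh d) (Qs (Suc k) d) s) (\<lambda>_. True) (ph d s)"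
        unfolding last by (rule greedy)
      let ?Z = "ennreal (1 / (1 - \<gamma>)) * c1 G L * (ennreal (1 / pmin G) * (ennreal (64 * V\<^sup>2) * ?Kl + ennreal (C3 * ?S\<^sup>2)))"
      have ln0: "0 \<le> ln (real n)" for n by (cases n) auto
      have S0: "0 \<le> ?S"
        using V_nonneg by (intro mult_nonneg_nonneg real_sqrt_ge_zero ln0) auto
      have "?gap \<le> ennreal (4 * V * \<gamma> ^ Suc k / (1 - \<gamma>)) + ennreal (2 * gap_const) * esqrt ?Z"
        by (rule expected_gap[OF st N0 c cl(4-6) cl(1-3) comp Qs bm mm phm gr \<pi> fit])
      also have "\<dots> \<le> ?A + ennreal (2 * gap_const) * esqrt ?Z"
        using disc_nonneg disc_less V_nonneg by (intro add_right_mono first pow) auto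
      also have "ennreal (2 * gap_const) * esqrt ?Z \<le> ?B"
      proof -
        have "ennreal (64 * V\<^sup>2) * ?Kl + ennreal (C3 * ?S\<^sup>2) \<le> ennreal (64 + C3) * (ennreal (V\<^sup>2) * ?Kl + ennreal (?S\<^sup>2))"
        proof -
          have "ennreal (64 * V\<^sup>2) \<le> ennreal (64 + C3) * ennreal (V\<^sup>2)"
            using C3 by (subst ennreal_mult[symmetric]) (auto intro!: ennreal_leI mult_right_mono)
          moreover have "ennreal (C3 * ?S\<^sup>2) \<le> ennreal (64 + C3) * ennreal (?S\<^sup>2)"
            using C3 by (subst ennreal_mult[symmetric]) (auto intro!: ennreal_leI mult_right_mono)
          ultimately show ?thesis
            unfolding distrib_left mult.assoc[symmetric] by (intro add_mono mult_right_mono) auto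
        qed
        then have "?Z \<le> ennreal (1 / (1 - \<gamma>)) * c1 G L * (ennreal (1 / pmin G) * (ennreal (64 + C3) * (ennreal (V\<^sup>2) * ?Kl + ennreal (?S\<^sup>2))))"
          by (intro mult_left_mono) auto
        also have "\<dots> = ennreal C4 * (c1 G L * (ennreal (V\<^sup>2) * ?Kl + ennreal (?S\<^sup>2)))"
        proof -
          have "ennreal C4 = ennreal (1 / (1 - \<gamma>)) * ennreal (1 / pmin G) * ennreal (64 + C3)"
            using disc_less pmin_pos C3 by (simp add: C4_def ennreal_mult[symmetric] del: ennreal_plus)
          then show ?thesis by (simp add: mult_ac)
        qed
        finally have "esqrt ?Z \<le> esqrt (ennreal C4 * (c1 G L * (ennreal (V\<^sup>2) * ?Kl + ennreal (?S\<^sup>2))))"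
          by (rule esqrt_mono)
        also have "\<dots> = ennreal (sqrt C4) * (esqrt (c1 G L) * esqrt (ennreal (V\<^sup>2) * ?Kl + ennreal (?S\<^sup>2)))"
          by (simp add: esqrt_mult esqrt_ennreal C4)
        also have "\<dots> \<le> ennreal (sqrt C4) * (esqrt (c1 G L) * (ennreal ?S + ennreal V * ?kl))"
        proof (intro mult_left_mono)
          have "esqrt (ennreal (V\<^sup>2) * ?Kl + ennreal (?S\<^sup>2)) \<le> esqrt (ennreal (V\<^sup>2) * ?Kl) + esqrt (ennreal (?S\<^sup>2))"
            by (rule esqrt_add_le)
          also have "esqrt (ennreal (V\<^sup>2) * ?Kl) = ennreal V * esqrt ?Kl"
            using V_nonneg by (simp add: esqrt_mult esqrt_ennreal)
          also have "esqrt (ennreal (?S\<^sup>2)) = ennreal ?S"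
            using S0 by (subst esqrt_ennreal) (auto simp del: power_mult_distrib)
          also have "ennreal V * esqrt ?Kl + ennreal ?S \<le> ennreal V * ?kl + ennreal ?S"
            by (intro add_right_mono mult_left_mono esqrt_add_le) auto
          finally show "esqrt (ennreal (V\<^sup>2) * ?Kl + ennreal (?S\<^sup>2)) \<le> ennreal ?S + ennreal V * ?kl"
            by (simp only: add.commute)
        qed auto
        finally have "ennreal (2 * gap_const) * esqrt ?Z \<le> ennreal (2 * gap_const) * (ennreal (sqrt C4) * (esqrt (c1 G L) * (ennreal ?S + ennreal V * ?kl)))"
          by (intro mult_left_mono) auto
        also have "\<dots> = ennreal (2 * gap_const * sqrt C4) * (esqrt (c1 G L) * (ennreal ?S + ennreal V * ?kl))"
          using gap_const_pos C4 by (simp add: ennreal_mult mult.assoc)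
        also have "\<dots> \<le> ennreal C * (esqrt (c1 G L) * (ennreal ?S + ennreal V * ?kl))"
          by (intro mult_right_mono ennreal_leI CC) auto
        also have "\<dots> = ennreal C * esqrt (c1 G L) * (ennreal ?S + ennreal V * ?kl)"
          by (simp only: mult.assoc)
        \<comment> \<open>The powers of 1 / (1 - \<gamma>) produced above already sit in
          \<open>C\<close>; dividing by (1 - \<gamma>)^2, which is at most one, enlarges the
          bound.\<close>
        also have "\<dots> \<le> ?B"
        proof (rule mult_right_mono)
          have "(1 - \<gamma>)\<^sup>2 \<le> 1" "0 < (1 - \<gamma>)\<^sup>2" using disc_nonneg disc_less by (auto intro!: power_le_one)
          then have "1 \<le> inverse (ennreal ((1 - \<gamma>)\<^sup>2))"
            by (simp add: inverse_ennreal one_le_inverse ennreal_1[symmetric] ennreal_le_iff2 del: ennreal_1)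
          then show "ennreal C * esqrt (c1 G L) \<le> ennreal C * esqrt (c1 G L) / ennreal ((1 - \<gamma>)\<^sup>2)"
            unfolding divide_ennreal_def using mult_left_mono[of 1 _ "ennreal C * esqrt (c1 G L)"] by simp
        qed auto
        finally show ?thesis .
      qed
      finally show ?thesis by (simp add: add_left_mono)
    qed
    have "?gap \<le> ?A + ?B"
    \<comment> \<open>The scores are scaled by V^2; for V = 0 the gap is zero by the trivial
      bound.\<close>
    proof (cases "V = 0")
      case True
      then show ?thesis using trivial by simp
    next
      case False
      then have V0: "0 < V" using V_nonneg by simp
      have c0: "0 \<le> V / (1 - \<gamma>)" using V_nonneg disc_less by simp
      txt \<open>
        Completeness and the fast rate need \<open>Q\<^sub>k\<^sub>-\<^sub>1\<close> in the class, but \<open>Q\<^sub>0 = 0\<close> need not be.  So the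
        first step is discarded, and \<open>K \<le> 1\<close> is absorbed by the trivial bound, except that for
        \<open>\<gamma> = 0\<close> the loss ignores \<open>Q\<^sub>0\<close> and \<open>Q\<^sub>1\<close> can be taken in its place.
      \<close>
      consider "K = 0" | "K = 1" "\<gamma> \<noteq> 0" | "K = 1" "\<gamma> = 0" | k where "K = Suc (Suc k)"
        by (metis One_nat_def not0_implies_Suc)
      then show ?thesis
      proof cases
        case 1
        have "4 * V / (1 - \<gamma>) \<le> C0 * (\<gamma> ^ K * V / (1 - \<gamma>))"
          using 1 mult_right_mono[OF C0 c0] by simp
        then have "ennreal (4 * V / (1 - \<gamma>)) \<le> ?A" using c0 by (intro first) auto
        then show ?thesis using trivial by (meson add_increasing2 order_trans zero_le)
      next
        case 2
        have "4 * V / (1 - \<gamma>) \<le> C0 * (\<gamma> ^ K * V / (1 - \<gamma>))"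
          using 2 by (simp add: C0_def)
        then have "ennreal (4 * V / (1 - \<gamma>)) \<le> ?A" using c0 by (intro first) auto
        then show ?thesis using trivial by (meson add_increasing2 order_trans zero_le)
      next
        case 3
        show ?thesis
        proof (rule main[of 0 "\<lambda>_. Qh 1"])
          show "Qh 1 \<in> ?P \<rightarrow>\<^sub>M count_space \<Q>" using Qm[of 0] 3 by simp
          show "is_arg_min (cal_loss G L d (bh d) (mh d) (Qh 1 d)) (\<lambda>Q. Q \<in> \<Q>) (Qh 1 d)" if "d \<in> space ?P" for d
            using argmin[of 0 d] that 3 by (simp add: cal_loss_def[abs_def])
        qed (use 3 V0 in simp_all)
      next
        case 4
        \<comment> \<open>Shifting the sequence by one leaves \<open>Suc k\<close> = K - 1 fits,
          hence the decay \<gamma> ^ (K - 1).\<close>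
        show ?thesis
        proof (rule main[of k "\<lambda>j. Qh (Suc j)"])
          show "4 * V * \<gamma> ^ Suc k / (1 - \<gamma>) \<le> C0 * (\<gamma> ^ K * V / (1 - \<gamma>))"
            using 4 by (simp add: C0_def mult_ac)
        qed (use 4 V0 Qm argmin in auto)
      qed
    qed
    then show "?gap \<le> ?A + ennreal C * esqrt (c1 G L) / ennreal ((1 - disc G)\<^sup>2) *
          (ennreal (Vmax G * real N powr (- 1 / 2) * ln (real N)
              * sqrt (ln (real ((card \<Q>)\<^sup>2 * card \<B> * card \<M>))))
           + ennreal (Vmax G) * (esqrt (KL_b G L bh) + esqrt (c2 G * KL_m G L mh)))"
      by (simp only: mult.assoc)
  qed
qed

end
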